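(* Let $M^3$ be a positive definite affine hypersurface of $\mathbb{R}^4$ which admits a pointwise $SO(2)$-symmetry or a pointwise $Z_3$-symmetry, and with the globally defined function $b+\eta^2-\lambda^2$ not identically zero on $M^3$. Then $M^3$ is affine equivalent to $$F:I\times N^2\to\mathbb{R}^4:\ (t,u,v)\mapsto(\gamma_1(t),\gamma_2(t)\phi(u,v)),$$ where $\phi:N^2\to\mathbb{R}^3$ is an elliptic or hyperbolic affine sphere and $\gamma=(\gamma_1,\gamma_2):I\to\mathbb{R}^2$ is a curve. Moreover, if $M^3$ admits a pointwise $SO(2)$-symmetry, then $N^2$ is either an ellipsoid or a hyperboloid.
   Context: A nondegenerate affine hypersurface $F:M^3\to\mathbb{R}^4$ is an immersion with (equi)affine (Blaschke) normal field $\xi$, inducing $\nabla$, $h$, $S$ by $D_XY=\nabla_XY+h(X,Y)\xi$, $D_X\xi=-SX$ ($D$ the flat connection of $\mathbb{R}^4$), where $h$ (affine metric) is nondegenerate and $|\det(X_1,X_2,X_3,\xi)|=1$ for $h$-orthonormal $X_1,X_2,X_3$; $S$ is the affine shape operator. The difference tensor is $K(X,Y)=K_XY=\nabla_XY-\widehat\nabla_XY$ ($\widehat\nabla$ the Levi-Civita connection of $h$). Positive definite means $h$ is positive definite. For $p\in M$, $G_p$ is the group of orientation-preserving linear isometries of $(T_pM,h)$ preserving $K$ and $S$. $M$ admits a pointwise $SO(2)$-symmetry (resp. $Z_3$-symmetry) if for every $p$, $G_p$ is the group of all rotations about some axis $\mathbb{R}e_1\subset T_pM$ (resp. the order 3 group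 generated by the rotation by $2\pi/3$ about $\mathbb{R}e_1$). In this case, around each point there is a smooth $h$-orthonormal frame $\{e_1,e_2,e_3\}$ with $$K_{e_1}=\begin{pmatrix}2\lambda&0&0\\0&-\lambda&0\\0&0&-\lambda\end{pmatrix},\ K_{e_2}=\begin{pmatrix}0&-\lambda&0\\-\lambda&\mu&0\\0&0&-\mu\end{pmatrix},\ K_{e_3}=\begin{pmatrix}0&0&-\lambda\\0&0&-\mu\\-\lambda&-\mu&0\end{pmatrix},\ S=\begin{pmatrix}a&0&0\\0&b&0\\0&0&b\end{pmatrix},$$ $\lambda>0$, where for $SO(2)$ $\mu=0$, and for $Z_3$ $\mu>0$ and $a\neq b$ wherever $\mu=\sqrt2\lambda$. The unit vector field $e_1$ and the functions $\lambda,\mu,a,b$ are globally defined on $M^3$, and $\eta$ is the globally defined function $\eta=h(\widehat\nabla_{e_2}e_1,e_2)=h(\widehat\nabla_{e_3}e_1,e_3)$. $I\subset\mathbb{R}$ is an interval. An elliptic (resp. hyperbolic) affine sphere $\phi:N^2\to\mathbb{R}^3$ is a proper affine sphere, with centre at the origin, of positive (resp. negative) affine mean curvature with respect to a positive definite affine metric: its affine normal is $-c\phi$ with $c$ a constant, $c>0$ (resp. $c<0$).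
   Formalization: M is taken connected, and "affine equivalent to F on I×N" is proved locally: around every point M has this form, with one affine map and one alternative (elliptic or hyperbolic) for all points; globally it fails, e.g. for a non-product connected open subset of a model hypersurface. *)

theory Defs
  imports "HOL-Analysis.Analysis"
begin

section \<open>Smooth maps and smooth 3-manifolds\<close>

text \<open>
  All of the following derivatives are Frechet derivatives at points of open sets.  The predicate
  \<open>Ck_on k V f\<close> says that \<open>f\<close> is of class \<open>C\<^sup>k\<close> on the open set \<open>V\<close>.
\<close>

primrec Ck_on :: "nat \<Rightarrow> 'a::euclidean_space set \<Rightarrow> ('a \<Rightarrow> 'b::euclidean_space) \<Rightarrow> bool" where
  "Ck_on 0 V f \<longleftrightarrow> continuous_on V f"
| "Ck_on (Suc k) V f \<longleftrightarrow>
     (\<forall>w\<in>V. f differentiable (at w)) \<and> (\<forall>v. Ck_on k V (\<lambda>w. frechet_derivative f (at w) v))"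

definition smooth_on :: "'a::euclidean_space set \<Rightarrow> ('a \<Rightarrow> 'b::euclidean_space) \<Rightarrow> bool" where
  "smooth_on V f \<longleftrightarrow> open V \<and> (\<forall>k. Ck_on k V f)"

text \<open>
  A chart is a pair \<open>(U, x)\<close> of a domain and a coordinate map; only the restriction of \<open>x\<close> to \<open>U\<close>
  matters.  The manifold is the whole type \<open>'m\<close>.
\<close>

type_synonym 'm chart = "'m set \<times> ('m \<Rightarrow> real^3)"

definition is_chart :: "'m::topological_space set \<Rightarrow> ('m \<Rightarrow> real^3) \<Rightarrow> bool" where
  "is_chart U x \<longleftrightarrow> open U \<and> open (x ` U) \<and> homeomorphism U (x ` U) x (inv_into U x)"

definition smooth_atlas :: "'m::{t2_space, second_countable_topology} chart set \<Rightarrow> bool" where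
  "smooth_atlas \<A> \<longleftrightarrow>
     (\<forall>(U, x)\<in>\<A>. is_chart U x) \<and>
     (\<Union>(U, x)\<in>\<A>. U) = UNIV \<and>
     (\<forall>(U, x)\<in>\<A>. \<forall>(V, y)\<in>\<A>. smooth_on (x ` (U \<inter> V)) (y \<circ> inv_into U x))"

definition diffeomorphism_onto ::
  "'m::{t2_space, second_countable_topology} chart set \<Rightarrow> 'a::euclidean_space set \<Rightarrow> ('a \<Rightarrow> 'm) \<Rightarrow> 'm set \<Rightarrow> bool"
where
  "diffeomorphism_onto \<A> W \<Psi> U \<longleftrightarrow>
     open W \<and> open U \<and> bij_betw \<Psi> W U \<and>
     (\<forall>(V, x)\<in>\<A>. smooth_on (W \<inter> \<Psi> -` V) (x \<circ> \<Psi>) \<and>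
                smooth_on (x ` (U \<inter> V)) (inv_into W \<Psi> \<circ> inv_into V x))"


section \<open>Affine hypersurfaces in a local parametrization\<close>

text \<open>
  Here \<open>f\<close> is a parametrized hypersurface, \<open>\<xi>\<close> a transversal field along it, and tangent vectors are
  represented in the parameter domain (so that \<open>X\<close> stands for \<open>df(X)\<close>).  For a vector field \<open>Y\<close> and a
  tangent vector \<open>x\<close> at \<open>w\<close>, the vector \<open>flat_derivative f Y w x\<close> is \<open>D\<^sub>x (df Y)\<close>.
\<close>

definition flat_derivative ::
  "('a::euclidean_space \<Rightarrow> 'b::euclidean_space) \<Rightarrow> ('a \<Rightarrow> 'a) \<Rightarrow> 'a \<Rightarrow> 'a \<Rightarrow> 'b" where
  "flat_derivative f Y w x =
     frechet_derivative (\<lambda>q. frechet_derivative f (at q) (Y q)) (at w) x"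

text \<open>The Gauss formula \<open>D\<^sub>X Y = \<nabla>\<^sub>X Y + h(X,Y) \<xi>\<close> and the Weingarten formula \<open>D\<^sub>X \<xi> = - S X\<close>.\<close>

definition induced_connection ::
  "('a::euclidean_space \<Rightarrow> 'b::euclidean_space) \<Rightarrow> ('a \<Rightarrow> 'b) \<Rightarrow> ('a \<Rightarrow> 'a) \<Rightarrow> 'a \<Rightarrow> 'a \<Rightarrow> 'a" where
  "induced_connection f \<xi> Y w x =
     (THE z. \<exists>r. flat_derivative f Y w x = frechet_derivative f (at w) z + r *\<^sub>R \<xi> w)"

definition affine_metric ::
  "('a::euclidean_space \<Rightarrow> 'b::euclidean_space) \<Rightarrow> ('a \<Rightarrow> 'b) \<Rightarrow> 'a \<Rightarrow> 'a \<Rightarrow> 'a \<Rightarrow> real" where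
  "affine_metric f \<xi> w x y =
     (THE r. \<exists>z. flat_derivative f (\<lambda>_. y) w x = frechet_derivative f (at w) z + r *\<^sub>R \<xi> w)"

definition shape_operator ::
  "('a::euclidean_space \<Rightarrow> 'b::euclidean_space) \<Rightarrow> ('a \<Rightarrow> 'b) \<Rightarrow> 'a \<Rightarrow> 'a \<Rightarrow> 'a" where
  "shape_operator f \<xi> w x =
     (THE z. frechet_derivative \<xi> (at w) x = - frechet_derivative f (at w) z)"

text \<open>
  The Levi-Civita connection of a metric \<open>g\<close> on an open subset of a Euclidean space is
  \<open>D + \<Gamma>\<close>, where \<open>\<Gamma>\<close> is the unique tensor making it torsion free and metric.
\<close>

definition christoffel :: "('a::euclidean_space \<Rightarrow> 'a \<Rightarrow> 'a \<Rightarrow> real) \<Rightarrow> 'a \<Rightarrow> 'a \<Rightarrow> 'a \<Rightarrow> 'a" where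
  "christoffel g w = (THE \<Gamma>. (\<forall>x y. \<Gamma> x y = \<Gamma> y x) \<and>
     (\<forall>z x y. frechet_derivative (\<lambda>q. g q x y) (at w) z = g w (\<Gamma> z x) y + g w x (\<Gamma> z y)))"

definition levi_civita ::
  "('a::euclidean_space \<Rightarrow> 'a \<Rightarrow> 'a \<Rightarrow> real) \<Rightarrow> ('a \<Rightarrow> 'a) \<Rightarrow> 'a \<Rightarrow> 'a \<Rightarrow> 'a" where
  "levi_civita g Y w x = frechet_derivative Y (at w) x + christoffel g w x (Y w)"

text \<open>\<open>K\<close> is a tensor, so it can be evaluated on the constant extension of \<open>y\<close>.\<close>

definition difference_tensor ::
  "('a::euclidean_space \<Rightarrow> 'b::euclidean_space) \<Rightarrow> ('a \<Rightarrow> 'b) \<Rightarrow> 'a \<Rightarrow> 'a \<Rightarrow> 'a \<Rightarrow> 'a" where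
  "difference_tensor f \<xi> w x y =
     induced_connection f \<xi> (\<lambda>_. y) w x - levi_civita (affine_metric f \<xi>) (\<lambda>_. y) w x"

text \<open>
  A nondegenerate hypersurface with an equiaffine transversal field, i.e. one whose derivatives are
  tangential.
\<close>

definition equiaffine_hypersurface ::
  "'a::euclidean_space set \<Rightarrow> ('a \<Rightarrow> 'b::euclidean_space) \<Rightarrow> ('a \<Rightarrow> 'b) \<Rightarrow> bool" where
  "equiaffine_hypersurface V f \<xi> \<longleftrightarrow>
     smooth_on V f \<and> smooth_on V \<xi> \<and>
     (\<forall>w\<in>V. inj (frechet_derivative f (at w)) \<and>
            \<xi> w \<notin> range (frechet_derivative f (at w)) \<and>
            range (frechet_derivative \<xi> (at w)) \<subseteq> range (frechet_derivative f (at w)) \<and>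
            (\<forall>x. x \<noteq> 0 \<longrightarrow> (\<exists>y. affine_metric f \<xi> w x y \<noteq> 0)))"

text \<open>Orthonormality with respect to a possibly indefinite metric: \<open>g(X\<^sub>i, X\<^sub>i) = \<plusminus>1\<close>.\<close>

definition orthonormal :: "('a \<Rightarrow> 'a \<Rightarrow> real) \<Rightarrow> ('i \<Rightarrow> 'a) \<Rightarrow> bool" where
  "orthonormal g X \<longleftrightarrow> (\<forall>i j. \<bar>g (X i) (X j)\<bar> = (if i = j then 1 else 0))"

definition positive_definite :: "('a::zero \<Rightarrow> 'a \<Rightarrow> real) \<Rightarrow> bool" where
  "positive_definite g \<longleftrightarrow> (\<forall>x. x \<noteq> 0 \<longrightarrow> g x x > 0)"

text \<open>
  \<open>\<xi>\<close> is an affine (Blaschke) normal field of \<open>f\<close>, for hypersurfaces of \<open>\<real>\<^sup>4\<close> and for surfaces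
  in \<open>\<real>\<^sup>3\<close>.
\<close>

definition blaschke_hypersurface ::
  "(real^3) set \<Rightarrow> (real^3 \<Rightarrow> real^4) \<Rightarrow> (real^3 \<Rightarrow> real^4) \<Rightarrow> bool" where
  "blaschke_hypersurface V f \<xi> \<longleftrightarrow>
     equiaffine_hypersurface V f \<xi> \<and>
     (\<forall>w\<in>V. \<forall>X :: 3 \<Rightarrow> real^3. orthonormal (affine_metric f \<xi> w) X \<longrightarrow>
        \<bar>det (vector [frechet_derivative f (at w) (X 1), frechet_derivative f (at w) (X 2),
                     frechet_derivative f (at w) (X 3), \<xi> w] :: real^4^4)\<bar> = 1)"

definition blaschke_surface ::
  "(real^2) set \<Rightarrow> (real^2 \<Rightarrow> real^3) \<Rightarrow> (real^2 \<Rightarrow> real^3) \<Rightarrow> bool" where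
  "blaschke_surface V f \<xi> \<longleftrightarrow>
     equiaffine_hypersurface V f \<xi> \<and>
     (\<forall>w\<in>V. \<forall>X :: 2 \<Rightarrow> real^2. orthonormal (affine_metric f \<xi> w) X \<longrightarrow>
        \<bar>det (vector [frechet_derivative f (at w) (X 1), frechet_derivative f (at w) (X 2),
                     \<xi> w] :: real^3^3)\<bar> = 1)"

text \<open>
  A positive definite affine hypersurface \<open>F\<close> of \<open>\<real>\<^sup>4\<close> with affine normal field \<open>\<xi>\<close>; both are maps on
  the manifold and are examined in the charts of the atlas.
\<close>

definition positive_definite_affine_hypersurface ::
  "'m::{t2_space, second_countable_topology} chart set \<Rightarrow> ('m \<Rightarrow> real^4) \<Rightarrow> ('m \<Rightarrow> real^4) \<Rightarrow> bool" where
  "positive_definite_affine_hypersurface \<A> F \<xi> \<longleftrightarrow>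
     (\<forall>(U, x)\<in>\<A>.
        blaschke_hypersurface (x ` U) (F \<circ> inv_into U x) (\<xi> \<circ> inv_into U x) \<and>
        (\<forall>w\<in>x ` U. positive_definite (affine_metric (F \<circ> inv_into U x) (\<xi> \<circ> inv_into U x) w)))"


section \<open>Pointwise symmetries\<close>

text \<open>The columns of the matrix are the coordinates of the images of the basis vectors.\<close>

definition has_matrix :: "(3 \<Rightarrow> real^3) \<Rightarrow> (real^3 \<Rightarrow> real^3) \<Rightarrow> real^3^3 \<Rightarrow> bool" where
  "has_matrix e L B \<longleftrightarrow> (\<forall>j. L (e j) = (\<Sum>i\<in>UNIV. (B $ i $ j) *\<^sub>R e i))"

definition rotation_about_e1 :: "(3 \<Rightarrow> real^3) \<Rightarrow> real \<Rightarrow> (real^3 \<Rightarrow> real^3) \<Rightarrow> bool" where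
  "rotation_about_e1 e \<theta> R \<longleftrightarrow> linear R \<and>
     has_matrix e R (vector [vector [1, 0, 0],
                             vector [0, cos \<theta>, - sin \<theta>],
                             vector [0, sin \<theta>, cos \<theta>]])"

text \<open>The group \<open>G\<^sub>p\<close>.\<close>

definition symmetry_group ::
  "(real^3 \<Rightarrow> real^4) \<Rightarrow> (real^3 \<Rightarrow> real^4) \<Rightarrow> real^3 \<Rightarrow> (real^3 \<Rightarrow> real^3) set" where
  "symmetry_group f \<xi> w = {R. linear R \<and> det (matrix R) > 0 \<and>
     (\<forall>x y. affine_metric f \<xi> w (R x) (R y) = affine_metric f \<xi> w x y) \<and>
     (\<forall>x y. difference_tensor f \<xi> w (R x) (R y) = R (difference_tensor f \<xi> w x y)) \<and>
     (\<forall>x. shape_operator f \<xi> w (R x) = R (shape_operator f \<xi> w x))}"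

datatype symmetry_type = SO2 | Z3

fun rotation_angles :: "symmetry_type \<Rightarrow> real set" where
  "rotation_angles SO2 = UNIV"
| "rotation_angles Z3 = {0, 2 * pi / 3, 4 * pi / 3}"

definition pointwise_symmetry ::
  "'m::{t2_space, second_countable_topology} chart set \<Rightarrow> ('m \<Rightarrow> real^4) \<Rightarrow> ('m \<Rightarrow> real^4) \<Rightarrow>
     symmetry_type \<Rightarrow> bool" where
  "pointwise_symmetry \<A> F \<xi> G \<longleftrightarrow>
     (\<forall>(U, x)\<in>\<A>. \<forall>w\<in>x ` U. \<exists>e :: 3 \<Rightarrow> real^3.
        orthonormal (affine_metric (F \<circ> inv_into U x) (\<xi> \<circ> inv_into U x) w) e \<and>
        symmetry_group (F \<circ> inv_into U x) (\<xi> \<circ> inv_into U x) w =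
          {R. \<exists>\<theta>\<in>rotation_angles G. rotation_about_e1 e \<theta> R})"

text \<open>The smooth frames in which \<open>K\<close> and \<open>S\<close> have the normal form belonging to the symmetry.\<close>

definition adapted_frame ::
  "symmetry_type \<Rightarrow> (real^3) set \<Rightarrow> (real^3 \<Rightarrow> real^4) \<Rightarrow> (real^3 \<Rightarrow> real^4) \<Rightarrow> (3 \<Rightarrow> real^3 \<Rightarrow> real^3) \<Rightarrow>
     (real^3 \<Rightarrow> real) \<Rightarrow> (real^3 \<Rightarrow> real) \<Rightarrow> (real^3 \<Rightarrow> real) \<Rightarrow> (real^3 \<Rightarrow> real) \<Rightarrow> bool" where
  "adapted_frame G V f \<xi> e lam \<mu> a b \<longleftrightarrow>
     (\<forall>i. smooth_on V (e i)) \<and>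
     (\<forall>w\<in>V. let E = (\<lambda>i. e i w); K = difference_tensor f \<xi> w; l = lam w; m = \<mu> w in
        orthonormal (affine_metric f \<xi> w) E \<and>
        has_matrix E (K (E 1)) (vector [vector [2 * l, 0, 0],
                                        vector [0, - l, 0],
                                        vector [0, 0, - l]]) \<and>
        has_matrix E (K (E 2)) (vector [vector [0, - l, 0],
                                        vector [- l, m, 0],
                                        vector [0, 0, - m]]) \<and>
        has_matrix E (K (E 3)) (vector [vector [0, 0, - l],
                                        vector [0, 0, - m],
                                        vector [- l, - m, 0]]) \<and>
        has_matrix E (shape_operator f \<xi> w) (vector [vector [a w, 0, 0],
                                                     vector [0, b w, 0],
                                                     vector [0, 0, b w]]) \<and>
        l > 0 \<and>
        (case G of SO2 \<Rightarrow> m = 0 | Z3 \<Rightarrow> m > 0 \<and> (m = sqrt 2 * l \<longrightarrow> a w \<noteq> b w)))"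

definition eta_function ::
  "(real^3 \<Rightarrow> real^4) \<Rightarrow> (real^3 \<Rightarrow> real^4) \<Rightarrow> (3 \<Rightarrow> real^3 \<Rightarrow> real^3) \<Rightarrow> real^3 \<Rightarrow> real" where
  "eta_function f \<xi> e w =
     affine_metric f \<xi> w (levi_civita (affine_metric f \<xi>) (e 1) w (e 2 w)) (e 2 w)"

text \<open>
  The function \<open>b + \<eta>\<^sup>2 - \<lambda>\<^sup>2\<close> does not depend on the choice of adapted frames, so it is not
  identically zero iff it is nonzero at some point for some adapted frame around that point.
\<close>

definition nu_not_identically_zero ::
  "'m::{t2_space, second_countable_topology} chart set \<Rightarrow> ('m \<Rightarrow> real^4) \<Rightarrow> ('m \<Rightarrow> real^4) \<Rightarrow>
     symmetry_type \<Rightarrow> bool" where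
  "nu_not_identically_zero \<A> F \<xi> G \<longleftrightarrow>
     (\<exists>(U, x)\<in>\<A>. \<exists>V e lam \<mu> a b.
        V \<subseteq> x ` U \<and> adapted_frame G V (F \<circ> inv_into U x) (\<xi> \<circ> inv_into U x) e lam \<mu> a b \<and>
        (\<exists>w\<in>V. b w + (eta_function (F \<circ> inv_into U x) (\<xi> \<circ> inv_into U x) e w)\<^sup>2 - (lam w)\<^sup>2 \<noteq> 0))"


section \<open>Affine spheres, quadrics and the model hypersurfaces\<close>

text \<open>
  Proper affine spheres in \<open>\<real>\<^sup>3\<close> centred at the origin with affine normal \<open>- c \<phi>\<close>.  The sign of the
  affine normal is the one which makes the affine metric positive definite.
\<close>

definition elliptic_affine_sphere :: "(real^2) set \<Rightarrow> (real^2 \<Rightarrow> real^3) \<Rightarrow> bool" where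
  "elliptic_affine_sphere N \<phi> \<longleftrightarrow> (\<exists>c>0.
     blaschke_surface N \<phi> (\<lambda>y. (- c) *\<^sub>R \<phi> y) \<and>
     (\<forall>y\<in>N. positive_definite (affine_metric \<phi> (\<lambda>y. (- c) *\<^sub>R \<phi> y) y)))"

definition hyperbolic_affine_sphere :: "(real^2) set \<Rightarrow> (real^2 \<Rightarrow> real^3) \<Rightarrow> bool" where
  "hyperbolic_affine_sphere N \<phi> \<longleftrightarrow> (\<exists>c<0.
     blaschke_surface N \<phi> (\<lambda>y. (- c) *\<^sub>R \<phi> y) \<and>
     (\<forall>y\<in>N. positive_definite (affine_metric \<phi> (\<lambda>y. (- c) *\<^sub>R \<phi> y) y)))"

definition is_ellipsoid :: "(real^3) set \<Rightarrow> bool" where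
  "is_ellipsoid Q \<longleftrightarrow> (\<exists>(B::real^3^3) d. invertible B \<and> Q = (\<lambda>x. B *v x + d) ` sphere 0 1)"

text \<open>
  Only the hyperboloid of two sheets is needed: the affine metric of the one of one sheet is
  indefinite.
\<close>

definition is_hyperboloid :: "(real^3) set \<Rightarrow> bool" where
  "is_hyperboloid Q \<longleftrightarrow> (\<exists>(B::real^3^3) d. invertible B \<and>
     Q = (\<lambda>x. B *v x + d) ` {x. (x $ 1)\<^sup>2 + (x $ 2)\<^sup>2 - (x $ 3)\<^sup>2 = - 1})"

text \<open>
  Around \<open>p\<close> the hypersurface is the image under the affine map \<open>v \<mapsto> L v + d\<close> of
  \<open>(t, y) \<mapsto> (\<gamma>\<^sub>1(t), \<gamma>\<^sub>2(t) \<phi>(y))\<close>, where \<open>\<phi>\<close> on \<open>N\<close> satisfies \<open>P\<close>.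
\<close>

definition locally_warped ::
  "'m::{t2_space, second_countable_topology} chart set \<Rightarrow> ('m \<Rightarrow> real^4) \<Rightarrow> real^4^4 \<Rightarrow> real^4 \<Rightarrow>
     ((real^2) set \<Rightarrow> (real^2 \<Rightarrow> real^3) \<Rightarrow> bool) \<Rightarrow> 'm \<Rightarrow> bool" where
  "locally_warped \<A> F L d P p \<longleftrightarrow>
     (\<exists>(I :: real set) (N :: (real^2) set) U \<Psi> \<gamma>1 \<gamma>2 \<phi>.
        p \<in> U \<and> open I \<and> is_interval I \<and> open N \<and> connected N \<and>
        diffeomorphism_onto \<A> (I \<times> N) \<Psi> U \<and>
        smooth_on I \<gamma>1 \<and> smooth_on I \<gamma>2 \<and> P N \<phi> \<and>
        (\<forall>t\<in>I. \<forall>y\<in>N. F (\<Psi> (t, y)) =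
           L *v vector [\<gamma>1 t, \<gamma>2 t * \<phi> y $ 1, \<gamma>2 t * \<phi> y $ 2, \<gamma>2 t * \<phi> y $ 3] + d))"

end

theory Submission
  imports Defs
begin

text \<open>Take a local orthonormal frame with \<open>e\<^sub>1\<close> on the symmetry axis, put \<open>\<alpha> = \<eta> + \<lambda>\<close>, \<open>\<beta> = \<eta> - \<lambda>\<close>,
  \<open>\<nu> = b + \<eta>\<^sup>2 - \<lambda>\<^sup>2 = b + \<alpha> \<beta>\<close>, and \<open>\<theta> = h(e\<^sub>1, -)\<close>. By the equations of Gauss and Codazzi
  the differentials of all invariants are multiples of \<open>\<theta>\<close>. The covector \<open>\<omega>\<close> with \<open>\<omega>(e\<^sub>1) = 1\<close>,
  \<open>\<omega>(e\<^sub>2) = \<omega>(e\<^sub>3) = 0\<close>, \<open>\<omega>(\<xi>) = \<alpha>\<close> and the vector \<open>W = b e\<^sub>1 + \<beta> \<xi>\<close> satisfy linear equations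
  \<open>d\<omega> = (\<dots>) \<theta> \<omega>\<close> and \<open>dW = (\<dots>) \<theta> W\<close>, so on the connected manifold their directions are constant, and
  \<open>\<nu> = \<omega>(W)\<close>, which vanishes nowhere as soon as it is nonzero at one point, has constant sign.

  The leaves of \<open>\<theta> = 0\<close> lie in hyperplanes parallel to the kernel of \<open>\<omega>\<close>. Along them
  \<open>\<zeta> = \<xi> - \<alpha> e\<^sub>1\<close> satisfies \<open>d\<zeta> = - \<nu> dF\<close>, so that a leaf is a proper affine sphere with centre
  \<open>F + \<zeta> / \<nu>\<close>, and this centre moves on a line of direction \<open>W\<close>. Along \<open>e\<^sub>1\<close> the leaves change by
  homotheties, which gives the warped form; the sign of \<open>\<nu>\<close> decides between elliptic and
  hyperbolic. If \<open>\<mu> = 0\<close>, the quadratic tensor \<open>e\<^sub>2\<^sup>2 + e\<^sub>3\<^sup>2 + \<zeta>\<^sup>2 / \<nu>\<close> is constant along a leaf, and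
  the position vector \<open>- \<zeta> / \<nu>\<close> of the leaf is thereby confined to a quadric.\<close>

section \<open>Smooth calculus\<close>

text \<open>The symmetry is given point by point, so nothing says that the axis varies continuously,
  while the structure equations need a differentiable frame. The axis is therefore read off from a
  smooth symmetric tensor \<open>p I + q e\<^sub>1 \<otimes> e\<^sub>1\<close>: from
  \<open>S\<close> if \<open>a \<noteq> b\<close>, otherwise from the trace form of
  \<open>K\<close>, where \<open>q = 4 l\<^sup>2 - 2 (m\<^sup>2 + n\<^sup>2)\<close>. Both fail at a
  point only if \<open>a = b\<close> and \<open>m\<^sup>2 + n\<^sup>2 = 2 l\<^sup>2\<close>, and
  then the symmetry group is larger than allowed. The vectors \<open>e\<^sub>2\<close>,
  \<open>e\<^sub>3\<close> are not normalised: a second cubic component \<open>n\<close> is kept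
  next to \<open>m\<close>, which avoids a smooth choice of angle and treats both symmetries at
  once. That the invariants vary along \<open>e\<^sub>1\<close> only comes from a linear system
  governed by \<open>m\<^sup>2 + n\<^sup>2 + 4 l\<^sup>2 > 0\<close>. The covector,
  \<open>W\<close>, \<nu> and the centre depend on no frame vector but \<open>e\<^sub>1\<close>,
  hence not on the chart. Homotheties preserve ratios of coordinates relative to the line of
  centres; with the height, these ratios are the coordinates in which \<open>F\<close> is a
  product.\<close>

abbreviation fd :: "('a::euclidean_space \<Rightarrow> 'b::euclidean_space) \<Rightarrow> 'a \<Rightarrow> 'a \<Rightarrow> 'b" where
  "fd f w \<equiv> frechet_derivative f (at w)"

lemma fd_eq: "(f has_derivative f') (at w) \<Longrightarrow> fd f w = f'"
  by (metis frechet_derivative_at)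

lemma fd_has: "f differentiable (at w) \<Longrightarrow> (f has_derivative fd f w) (at w)"
  by (simp add: frechet_derivative_works)

lemma fd_cong:
  assumes "open V" "w \<in> V" "\<And>q. q \<in> V \<Longrightarrow> f q = g q" "f differentiable (at w)"
  shows "fd g w = fd f w" "g differentiable (at w)"
proof -
  have "(g has_derivative fd f w) (at w)"
    using has_derivative_transform_within_open[OF fd_has[OF assms(4)] assms(1,2)] assms(3) by auto
  then show "fd g w = fd f w" "g differentiable (at w)"
    by (auto simp: fd_eq differentiable_def)
qed

text \<open>On an open set the derivative depends only on values in that set. This is what allows a
  formula valid on \<open>V\<close> alone to be substituted under \<open>fd\<close>.\<close>

lemma Ck_on_cong_imp:
  assumes "open V" "\<And>w. w \<in> V \<Longrightarrow> f w = g w" "Ck_on k V f"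
  shows "Ck_on k V g"
  using assms(2,3)
proof (induction k arbitrary: f g)
  case 0
  then show ?case by (auto cong: continuous_on_cong)
next
  case (Suc k)
  have "fd f w = fd g w" "g differentiable (at w)" if "w \<in> V" for w
    using fd_cong[OF assms(1) that, of f g] Suc.prems that by auto
  moreover have "Ck_on k V (\<lambda>w. fd g w v)" for v
    by (rule Suc.IH[of "\<lambda>w. fd f w v"]) (use Suc.prems calculation in auto)
  ultimately show ?case by auto
qed

lemma Ck_on_cong:
  assumes "open V" "\<And>w. w \<in> V \<Longrightarrow> f w = g w"
  shows "Ck_on k V f = Ck_on k V g"
  using Ck_on_cong_imp[of V f g] Ck_on_cong_imp[of V g f] assms by auto

lemma Ck_on_SucD: "Ck_on (Suc k) V f \<Longrightarrow> Ck_on k V f"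
proof (induction k arbitrary: f)
  case 0
  then show ?case
    by (auto intro!: continuous_at_imp_continuous_on differentiable_imp_continuous_within)
next
  case (Suc k)
  then show ?case by auto
qed

lemma Ck_on_subset: "Ck_on k V f \<Longrightarrow> U \<subseteq> V \<Longrightarrow> Ck_on k U f"
  by (induction k arbitrary: f) (auto intro: continuous_on_subset)

lemma Ck_on_const: "Ck_on k V (\<lambda>_. c)"
proof (induction k arbitrary: c)
  case (Suc k)
  then show ?case by auto
qed auto

lemma Ck_on_linear:
  assumes "bounded_linear L"
  shows "Ck_on k V L"
proof (cases k)
  case (Suc j)
  have "fd L w = L" for w
    using assms by (intro fd_eq bounded_linear_imp_has_derivative)
  then show ?thesis
    using Suc assms by (auto intro: bounded_linear_imp_differentiable Ck_on_const)
qed (use assms in \<open>auto intro: linear_continuous_on\<close>)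

lemma Ck_on_add:
  assumes "open V"
  shows "Ck_on k V f \<Longrightarrow> Ck_on k V g \<Longrightarrow> Ck_on k V (\<lambda>w. f w + g w)"
proof (induction k arbitrary: f g)
  case (Suc k)
  have "fd (\<lambda>w. f w + g w) w v = fd f w v + fd g w v" if "w \<in> V" for w v
    using Suc.prems that by (subst fd_eq[OF has_derivative_add[OF fd_has fd_has]]) auto
  moreover have "Ck_on k V (\<lambda>w. fd f w v + fd g w v)" for v
    using Suc by auto
  ultimately have "Ck_on k V (\<lambda>w. fd (\<lambda>w. f w + g w) w v)" for v
    using Ck_on_cong_imp[OF assms] by (metis (no_types, lifting))
  then show ?case using Suc.prems by auto
qed (auto intro: continuous_on_add)

lemma Ck_on_bilinear:
  assumes "open V" "bounded_bilinear p"
  shows "Ck_on k V f \<Longrightarrow> Ck_on k V g \<Longrightarrow> Ck_on k V (\<lambda>w. p (f w) (g w))"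
proof (induction k arbitrary: f g)
  case 0
  then show ?case using assms by (auto intro: bounded_bilinear.continuous_on)
next
  case (Suc k)
  have d: "((\<lambda>w. p (f w) (g w)) has_derivative (\<lambda>v. p (f w) (fd g w v) + p (fd f w v) (g w))) (at w)"
    if "w \<in> V" for w
    using Suc.prems that by (intro bounded_bilinear.FDERIV[OF assms(2)] fd_has) auto
  have "Ck_on k V (\<lambda>w. p (f w) (fd g w v) + p (fd f w v) (g w))" for v
    using Suc.prems Suc.prems[THEN Ck_on_SucD] by (intro Ck_on_add[OF assms(1)] Suc.IH) auto
  then have "Ck_on k V (\<lambda>w. fd (\<lambda>w. p (f w) (g w)) w v)" for v
    by (rule Ck_on_cong_imp[OF assms(1), rotated]) (simp add: fd_eq[OF d])
  then show ?case using d by (auto simp: differentiable_def)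
qed

lemma Ck_on_sum:
  assumes "open V" "finite I" "\<And>i. i \<in> I \<Longrightarrow> Ck_on k V (f i)"
  shows "Ck_on k V (\<lambda>w. \<Sum>i\<in>I. f i w)"
  using assms(2,3) by (induction I) (auto intro!: Ck_on_add[OF assms(1)] Ck_on_const)

text \<open>\<open>Ck_on\<close> differentiates in fixed directions only. A direction that moves
  with the point is expanded in the standard basis, whose vectors are fixed.\<close>

lemma fd_basis_expand:
  assumes "f differentiable (at w)"
  shows "fd f w v = (\<Sum>b\<in>Basis. (v \<bullet> b) *\<^sub>R fd f w b)"
proof -
  have l: "linear (fd f w)" using assms by (rule linear_frechet_derivative)
  have "fd f w v = fd f w (\<Sum>b\<in>Basis. (v \<bullet> b) *\<^sub>R b)" by (simp add: euclidean_representation)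
  then show ?thesis using l by (simp add: linear_sum linear_scale)
qed

lemma Ck_on_compose:
  assumes "open V" "open W" "f ` V \<subseteq> W"
  shows "Ck_on k V f \<Longrightarrow> Ck_on k W g \<Longrightarrow> Ck_on k V (\<lambda>w. g (f w))"
proof (induction k arbitrary: g)
  case 0
  then show ?case using assms(3) by (auto intro: continuous_on_compose2)
next
  case (Suc k)
  have d: "((\<lambda>w. g (f w)) has_derivative (\<lambda>v. fd g (f w) (fd f w v))) (at w)" if "w \<in> V" for w
    using diff_chain_at[of f "fd f w" w g "fd g (f w)"] Suc.prems that assms(3)
    by (auto intro!: fd_has simp: o_def)
  \<comment> \<open>The chain rule produces the moving direction \<open>fd f w v\<close>; its
    expansion leaves products of functions to which the induction hypothesis applies.\<close>
  have "Ck_on k V (\<lambda>w. \<Sum>b\<in>Basis. (fd f w v \<bullet> b) *\<^sub>R fd g (f w) b)" for v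
  proof (intro Ck_on_sum[OF assms(1)] Ck_on_bilinear[OF assms(1) bounded_bilinear_scaleR])
    fix b :: 'b
    show "Ck_on k V (\<lambda>w. fd f w v \<bullet> b)"
      using Suc.prems by (intro Ck_on_bilinear[OF assms(1) bounded_bilinear_inner] Ck_on_const) auto
    show "Ck_on k V (\<lambda>w. fd g (f w) b)"
      using Suc.prems Suc.prems(1)[THEN Ck_on_SucD] by (intro Suc.IH) auto
  qed auto
  then have "Ck_on k V (\<lambda>w. fd (\<lambda>w. g (f w)) w v)" for v
  proof (rule Ck_on_cong_imp[OF assms(1), rotated])
    fix w assume "w \<in> V"
    moreover have "g differentiable (at (f w))" using Suc.prems \<open>w \<in> V\<close> assms(3) by auto
    ultimately show "(\<Sum>b\<in>Basis. (fd f w v \<bullet> b) *\<^sub>R fd g (f w) b) = fd (\<lambda>w. g (f w)) w v"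
      by (simp add: fd_eq[OF d] fd_basis_expand[of g _ "fd f w v"])
  qed
  then show ?case using d by (auto simp: differentiable_def)
qed

text \<open>The derivative of \<open>inverse\<close> is a polynomial in \<open>inverse\<close>, so
  the class climbs by one at each induction step.\<close>

lemma Ck_on_inverse: "Ck_on k (- {0}) (inverse :: real \<Rightarrow> real)"
proof (induction k)
  case 0
  then show ?case by (auto intro!: continuous_intros)
next
  case (Suc k)
  have d: "((inverse :: real \<Rightarrow> real) has_derivative (\<lambda>v. - (inverse w * v * inverse w))) (at w)"
    if "w \<in> - {0}" for w
    using has_derivative_inverse'[of w UNIV] that by auto
  have o: "open (- {0 :: real})" by (auto intro: open_Compl)
  have "Ck_on k (- {0}) (\<lambda>w :: real. ((- v) * inverse w) * inverse w)" for v
    by (intro Ck_on_bilinear[OF o bounded_bilinear_mult] Ck_on_const Suc)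
  then have "Ck_on k (- {0}) (\<lambda>w :: real. fd inverse w v)" for v
    by (rule Ck_on_cong_imp[OF o, rotated]) (simp add: fd_eq[OF d])
  then show ?case using d by (auto simp: differentiable_def)
qed

lemma Ck_on_inverse_compose:
  assumes "open V" "Ck_on k V f" "\<And>w. w \<in> V \<Longrightarrow> f w \<noteq> 0"
  shows "Ck_on k V (\<lambda>w. inverse (f w) :: real)"
  by (rule Ck_on_compose[where W = "- {0}" and g = inverse])
    (use assms in \<open>auto intro: Ck_on_inverse open_Compl\<close>)

lemma smooth_on_open: "smooth_on V f \<Longrightarrow> open V"
  by (simp add: smooth_on_def)

lemma smooth_on_Ck: "smooth_on V f \<Longrightarrow> Ck_on k V f"
  by (simp add: smooth_on_def)

lemma smooth_on_differentiable: "smooth_on V f \<Longrightarrow> w \<in> V \<Longrightarrow> f differentiable (at w)"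
  using smooth_on_Ck[of V f "Suc 0"] by auto

lemma smooth_on_has: "smooth_on V f \<Longrightarrow> w \<in> V \<Longrightarrow> (f has_derivative fd f w) (at w)"
  by (simp add: fd_has smooth_on_differentiable)

lemma smooth_on_linear_fd: "smooth_on V f \<Longrightarrow> w \<in> V \<Longrightarrow> linear (fd f w)"
  by (simp add: linear_frechet_derivative smooth_on_differentiable)

lemma smooth_on_continuous: "smooth_on V f \<Longrightarrow> continuous_on V f"
  using smooth_on_Ck[of V f 0] by simp

lemma smooth_on_fd_const: "smooth_on V f \<Longrightarrow> smooth_on V (\<lambda>w. fd f w v)"
  unfolding smooth_on_def by (metis Ck_on.simps(2))

lemma smooth_on_subset: "smooth_on V f \<Longrightarrow> open U \<Longrightarrow> U \<subseteq> V \<Longrightarrow> smooth_on U f"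
  by (auto simp: smooth_on_def intro: Ck_on_subset)

lemma smooth_on_cong: "(\<And>w. w \<in> V \<Longrightarrow> f w = g w) \<Longrightarrow> smooth_on V f = smooth_on V g"
  unfolding smooth_on_def using Ck_on_cong[of V f g] by auto

lemma smooth_on_const: "open V \<Longrightarrow> smooth_on V (\<lambda>_. c)"
  by (simp add: smooth_on_def Ck_on_const)

lemma smooth_on_linear: "open V \<Longrightarrow> linear L \<Longrightarrow> smooth_on V L"
  by (simp add: smooth_on_def Ck_on_linear linear_linear)

lemma smooth_on_ident: "open V \<Longrightarrow> smooth_on V (\<lambda>w. w)"
  by (simp add: smooth_on_linear linear_id[unfolded id_def])

lemma smooth_on_compose:
  "smooth_on V f \<Longrightarrow> smooth_on W g \<Longrightarrow> f ` V \<subseteq> W \<Longrightarrow> smooth_on V (\<lambda>w. g (f w))"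
  by (auto simp: smooth_on_def intro: Ck_on_compose)

lemma smooth_on_linear_compose: "smooth_on V f \<Longrightarrow> linear L \<Longrightarrow> smooth_on V (\<lambda>w. L (f w))"
  by (rule smooth_on_compose[where W = UNIV]) (auto intro: smooth_on_linear)

lemma smooth_on_bilinear:
  "smooth_on V f \<Longrightarrow> smooth_on V g \<Longrightarrow> bounded_bilinear p \<Longrightarrow> smooth_on V (\<lambda>w. p (f w) (g w))"
  by (auto simp: smooth_on_def intro: Ck_on_bilinear)

lemma smooth_on_add: "smooth_on V f \<Longrightarrow> smooth_on V g \<Longrightarrow> smooth_on V (\<lambda>w. f w + g w)"
  by (auto simp: smooth_on_def intro: Ck_on_add)

lemma smooth_on_scaleR: "smooth_on V f \<Longrightarrow> smooth_on V g \<Longrightarrow> smooth_on V (\<lambda>w. f w *\<^sub>R g w)"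
  by (rule smooth_on_bilinear[OF _ _ bounded_bilinear_scaleR])

lemma smooth_on_mult:
  "smooth_on V f \<Longrightarrow> smooth_on V g \<Longrightarrow> smooth_on V (\<lambda>w. f w * g w :: real)"
  by (rule smooth_on_bilinear[OF _ _ bounded_bilinear_mult])

lemma smooth_on_inner: "smooth_on V f \<Longrightarrow> smooth_on V g \<Longrightarrow> smooth_on V (\<lambda>w. f w \<bullet> g w)"
  by (rule smooth_on_bilinear[OF _ _ bounded_bilinear_inner])

lemma smooth_on_minus: "smooth_on V f \<Longrightarrow> smooth_on V (\<lambda>w. - f w)"
  by (rule smooth_on_linear_compose) (auto intro: linearI)

lemma smooth_on_diff: "smooth_on V f \<Longrightarrow> smooth_on V g \<Longrightarrow> smooth_on V (\<lambda>w. f w - g w)"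
  using smooth_on_add[of V f "\<lambda>w. - g w"] by (simp add: smooth_on_minus)

lemma smooth_on_sum:
  "open V \<Longrightarrow> finite I \<Longrightarrow> (\<And>i. i \<in> I \<Longrightarrow> smooth_on V (f i)) \<Longrightarrow> smooth_on V (\<lambda>w. \<Sum>i\<in>I. f i w)"
  by (auto simp: smooth_on_def intro: Ck_on_sum)

lemma smooth_on_prod:
  fixes f :: "'i \<Rightarrow> 'a::euclidean_space \<Rightarrow> real"
  assumes "open V" "finite I" "\<And>i. i \<in> I \<Longrightarrow> smooth_on V (f i)"
  shows "smooth_on V (\<lambda>w. \<Prod>i\<in>I. f i w)"
  using assms(2,3) by (induction I) (auto intro!: smooth_on_mult smooth_on_const assms(1))

lemma smooth_on_inverse:
  "smooth_on V f \<Longrightarrow> (\<And>w. w \<in> V \<Longrightarrow> f w \<noteq> 0) \<Longrightarrow> smooth_on V (\<lambda>w. inverse (f w) :: real)"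
  by (rule smooth_on_compose[where W = "- {0}"]) (auto simp: smooth_on_def Ck_on_inverse)

lemma smooth_on_divide:
  "smooth_on V f \<Longrightarrow> smooth_on V g \<Longrightarrow> (\<And>w. w \<in> V \<Longrightarrow> g w \<noteq> 0) \<Longrightarrow> smooth_on V (\<lambda>w. f w / g w :: real)"
  unfolding divide_inverse by (intro smooth_on_mult smooth_on_inverse)

text \<open>The induction closes because the derivative \<open>v / 2 * inverse (sqrt w)\<close> is
  again built from \<open>sqrt\<close> and from \<open>inverse\<close>, which is smooth off
  0.\<close>

lemma Ck_on_sqrt: "Ck_on k {0<..} sqrt"
proof (induction k)
  case 0
  then show ?case by (auto intro!: continuous_intros)
next
  case (Suc k)
  have d: "(sqrt has_derivative (\<lambda>v. (v / 2) * inverse (sqrt w))) (at w)" if "w \<in> {0<..}" for w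
  proof -
    have "(\<lambda>v. (v / 2) * inverse (sqrt w)) = (*) (inverse (sqrt w) / 2)" by (auto simp: fun_eq_iff)
    then show ?thesis using DERIV_real_sqrt[of w] that by (simp add: has_field_derivative_def)
  qed
  have o: "open {0 :: real<..}" by simp
  have "Ck_on k {0<..} (\<lambda>w. (v / 2) * inverse (sqrt w))" for v
    by (intro Ck_on_bilinear[OF o bounded_bilinear_mult] Ck_on_const
        Ck_on_inverse_compose o Suc) auto
  then have "Ck_on k {0<..} (\<lambda>w :: real. fd sqrt w v)" for v
    by (rule Ck_on_cong_imp[OF o, rotated]) (simp add: fd_eq[OF d])
  then show ?case using d by (auto simp: differentiable_def)
qed

lemma smooth_on_sqrt:
  "smooth_on V f \<Longrightarrow> (\<And>w. w \<in> V \<Longrightarrow> f w > 0) \<Longrightarrow> smooth_on V (\<lambda>w. sqrt (f w))"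
  by (rule smooth_on_compose[where W = "{0<..}"]) (auto simp: smooth_on_def Ck_on_sqrt)

lemma smooth_on_vec_lambda:
  fixes f :: "'n::finite \<Rightarrow> 'a::euclidean_space \<Rightarrow> real"
  assumes "open V" "\<And>i. smooth_on V (f i)"
  shows "smooth_on V (\<lambda>w. \<chi> i. f i w)"
proof -
  have "smooth_on V (\<lambda>w. \<Sum>i\<in>UNIV. f i w *\<^sub>R (axis i 1 :: real^'n))"
    by (intro smooth_on_sum smooth_on_scaleR smooth_on_const assms) auto
  moreover have "(\<Sum>i\<in>UNIV. f i w *\<^sub>R (axis i 1 :: real^'n)) = (\<chi> i. f i w)" for w
    by (simp add: vec_eq_iff axis_def if_distrib[of "(*) _"] cong: if_cong)
  ultimately show ?thesis by simp
qed

lemma smooth_on_vec_nth: "smooth_on V f \<Longrightarrow> smooth_on V (\<lambda>w. f w $ i :: real)"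
  by (rule smooth_on_linear_compose) (auto intro: linearI)

lemma smooth_on_det:
  fixes M :: "'a::euclidean_space \<Rightarrow> real^'n^'n"
  assumes "open V" "\<And>i j. smooth_on V (\<lambda>w. M w $ i $ j)"
  shows "smooth_on V (\<lambda>w. det (M w))"
  unfolding det_def
  by (intro smooth_on_sum smooth_on_mult smooth_on_const smooth_on_prod assms)
     (auto simp: finite_permutations)

text \<open>Cramer's rule writes the solution as a quotient of polynomials in the coefficients. So
  \<open>u\<close> may be chosen point by point, even by a choice operator; its smoothness is a
  conclusion.\<close>

lemma smooth_on_linear_solution:
  fixes M :: "'a::euclidean_space \<Rightarrow> real^'n^'n"
  assumes "open V" "\<And>i j. smooth_on V (\<lambda>w. M w $ i $ j)" "\<And>i. smooth_on V (\<lambda>w. b w $ i)"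
    and "\<And>w. w \<in> V \<Longrightarrow> det (M w) \<noteq> 0" "\<And>w. w \<in> V \<Longrightarrow> M w *v u w = b w"
  shows "smooth_on V u"
proof -
  have "smooth_on V (\<lambda>w. \<chi> k. det (\<chi> i j. if j = k then b w $ i else M w $ i $ j) / det (M w))"
  proof (intro smooth_on_vec_lambda smooth_on_divide smooth_on_det assms(1,4))
    show "smooth_on V (\<lambda>w. (\<chi> i j. if j = k then b w $ i else M w $ i $ j) $ i $ j)" for i j k
      using assms(2,3) by (cases "j = k") auto
  qed (use assms in auto)
  moreover have "u w = (\<chi> k. det (\<chi> i j. if j = k then b w $ i else M w $ i $ j) / det (M w))"
    if "w \<in> V" for w
    using cramer[OF assms(4)[OF that]] assms(5)[OF that] by blast
  ultimately show ?thesis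
    using smooth_on_cong[of V u] by simp
qed

section \<open>Derivatives along vector fields\<close>

lemma smooth_on_fd:
  assumes "smooth_on V f" "smooth_on V X"
  shows "smooth_on V (\<lambda>w. fd f w (X w))"
proof -
  have "smooth_on V (\<lambda>w. \<Sum>b\<in>Basis. (X w \<bullet> b) *\<^sub>R fd f w b)"
    using assms smooth_on_open by (intro smooth_on_sum smooth_on_scaleR smooth_on_inner
        smooth_on_fd_const smooth_on_const) auto
  moreover have "(\<Sum>b\<in>Basis. (X w \<bullet> b) *\<^sub>R fd f w b) = fd f w (X w)" if "w \<in> V" for w
    using fd_basis_expand smooth_on_differentiable[OF assms(1) that] by metis
  ultimately show ?thesis
    using smooth_on_cong by (metis (no_types, lifting))
qed

lemma fd_add: "f differentiable (at w) \<Longrightarrow> g differentiable (at w) \<Longrightarrow>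
    fd (\<lambda>q. f q + g q) w x = fd f w x + fd g w x"
  by (subst fd_eq[OF has_derivative_add[OF fd_has fd_has]]) auto

lemma fd_diff: "f differentiable (at w) \<Longrightarrow> g differentiable (at w) \<Longrightarrow>
    fd (\<lambda>q. f q - g q) w x = fd f w x - fd g w x"
  by (subst fd_eq[OF has_derivative_diff[OF fd_has fd_has]]) auto

lemma fd_minus: "f differentiable (at w) \<Longrightarrow> fd (\<lambda>q. - f q) w x = - fd f w x"
  by (subst fd_eq[OF has_derivative_minus[OF fd_has]]) auto

lemma fd_scaleR: "f differentiable (at w) \<Longrightarrow> g differentiable (at w) \<Longrightarrow>
    fd (\<lambda>q. f q *\<^sub>R g q) w x = fd f w x *\<^sub>R g w + f w *\<^sub>R fd g w x"
  by (subst fd_eq[OF has_derivative_scaleR[OF fd_has fd_has]]) auto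

lemma fd_mult: "f differentiable (at w) \<Longrightarrow> g differentiable (at w) \<Longrightarrow>
    fd (\<lambda>q. f q * g q :: real) w x = fd f w x * g w + f w * fd g w x"
  by (subst fd_eq[OF has_derivative_mult[OF fd_has fd_has]]) auto

lemma fd_inner: "f differentiable (at w) \<Longrightarrow> g differentiable (at w) \<Longrightarrow>
    fd (\<lambda>q. f q \<bullet> g q) w x = fd f w x \<bullet> g w + f w \<bullet> fd g w x"
  by (subst fd_eq[OF has_derivative_inner[OF fd_has fd_has]]) auto

lemma fd_linear_compose:
  assumes "linear L" "f differentiable (at w)"
  shows "fd (\<lambda>q. L (f q)) w x = L (fd f w x)"
proof -
  have "((\<lambda>q. L (f q)) has_derivative (\<lambda>x. L (fd f w x))) (at w)"
    using bounded_linear.has_derivative[OF _ fd_has[OF assms(2)], of L] assms(1)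
    by (simp add: linear_conv_bounded_linear)
  then show ?thesis by (simp add: fd_eq)
qed

lemma fd_sum: "finite I \<Longrightarrow> (\<And>i. i \<in> I \<Longrightarrow> f i differentiable (at w)) \<Longrightarrow>
    fd (\<lambda>q. \<Sum>i\<in>I. f i q) w x = (\<Sum>i\<in>I. fd (f i) w x)"
  by (subst fd_eq[OF has_derivative_sum[where f' = "\<lambda>i. fd (f i) w"]]) (auto intro: fd_has)

lemma fd_compose:
  assumes "f differentiable (at w)" "g differentiable (at (f w))"
  shows "fd (\<lambda>q. g (f q)) w x = fd g (f w) (fd f w x)"
  using diff_chain_at[OF fd_has[OF assms(1)] fd_has[OF assms(2)]]
  by (subst fd_eq) (auto simp: o_def)

text \<open>Product rule for the pairing of the differential with the field: the first summand
  freezes the field at \<open>w\<close>, the second differentiates the field only.\<close>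

lemma fd_fd_apply:
  assumes "smooth_on V u" "smooth_on V Y" "w \<in> V"
  shows "fd (\<lambda>q. fd u q (Y q)) w x = fd (\<lambda>q. fd u q (Y w)) w x + fd u w (fd Y w x)"
proof -
  have dY: "(\<lambda>q. Y q \<bullet> b) differentiable (at w)" for b
    using smooth_on_differentiable[OF assms(2,3)] by auto
  have du: "(\<lambda>q. fd u q b) differentiable (at w)" for b
    using smooth_on_differentiable[OF smooth_on_fd_const[OF assms(1)] assms(3)] .
  have o: "open V" using assms(1) by (rule smooth_on_open)
  have lin: "fd u w v = (\<Sum>b\<in>Basis. (v \<bullet> b) *\<^sub>R fd u w b)" if "w \<in> V" for w v
    using fd_basis_expand smooth_on_differentiable[OF assms(1) that] by metis
  have 1: "fd (\<lambda>q. \<Sum>b\<in>Basis. (Z q \<bullet> b) *\<^sub>R fd u q b) w x =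
    (\<Sum>b\<in>Basis. (fd Z w x \<bullet> b) *\<^sub>R fd u w b + (Z w \<bullet> b) *\<^sub>R fd (\<lambda>q. fd u q b) w x)"
    and 2: "fd (\<lambda>q. fd u q (Z q)) w x = fd (\<lambda>q. \<Sum>b\<in>Basis. (Z q \<bullet> b) *\<^sub>R fd u q b) w x"
    if dZ: "Z differentiable (at w)" for Z
  proof -
    have dZ': "(\<lambda>q. Z q \<bullet> b) differentiable (at w)" for b using dZ by auto
    have d: "(\<lambda>q. (Z q \<bullet> b) *\<^sub>R fd u q b) differentiable (at w)" for b
      using dZ' du by auto
    show "fd (\<lambda>q. \<Sum>b\<in>Basis. (Z q \<bullet> b) *\<^sub>R fd u q b) w x =
      (\<Sum>b\<in>Basis. (fd Z w x \<bullet> b) *\<^sub>R fd u w b + (Z w \<bullet> b) *\<^sub>R fd (\<lambda>q. fd u q b) w x)"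
      using d du dZ' dZ by (subst fd_sum) (auto simp: fd_scaleR fd_inner)
    show "fd (\<lambda>q. fd u q (Z q)) w x = fd (\<lambda>q. \<Sum>b\<in>Basis. (Z q \<bullet> b) *\<^sub>R fd u q b) w x"
      using d by (subst fd_cong(1)[OF o assms(3), of "\<lambda>q. \<Sum>b\<in>Basis. (Z q \<bullet> b) *\<^sub>R fd u q b"])
        (auto intro: lin[symmetric])
  qed
  have "fd (\<lambda>q. fd u q (Y w)) w x = (\<Sum>b\<in>Basis. (Y w \<bullet> b) *\<^sub>R fd (\<lambda>q. fd u q b) w x)"
    using 1[of "\<lambda>_. Y w"] 2[of "\<lambda>_. Y w"] by simp
  moreover have "fd (\<lambda>q. fd u q (Y q)) w x =
     (\<Sum>b\<in>Basis. (fd Y w x \<bullet> b) *\<^sub>R fd u w b) + (\<Sum>b\<in>Basis. (Y w \<bullet> b) *\<^sub>R fd (\<lambda>q. fd u q b) w x)"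
    using 1[of Y] 2[of Y] smooth_on_differentiable[OF assms(2,3)] by (simp add: sum.distrib)
  ultimately show ?thesis using lin[OF assms(3), of "fd Y w x"] by simp
qed

section \<open>Symmetry of second derivatives and the Lie bracket\<close>

lemma second_difference_mean_value:
  fixes f :: "'a::euclidean_space \<Rightarrow> real"
  assumes sm: "smooth_on V f" and s: "s > 0"
    and V: "\<And>\<sigma> \<tau>. 0 \<le> \<sigma> \<Longrightarrow> \<sigma> \<le> s \<Longrightarrow> 0 \<le> \<tau> \<Longrightarrow> \<tau> \<le> s \<Longrightarrow> w + \<sigma> *\<^sub>R x + \<tau> *\<^sub>R y \<in> V"
  obtains \<sigma> \<tau> where "0 \<le> \<sigma>" "\<sigma> \<le> s" "0 \<le> \<tau>" "\<tau> \<le> s"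
    "f (w + s *\<^sub>R x + s *\<^sub>R y) - f (w + s *\<^sub>R x) - f (w + s *\<^sub>R y) + f w =
     s * s * fd (\<lambda>q. fd f q x) (w + \<sigma> *\<^sub>R x + \<tau> *\<^sub>R y) y"
proof -
  have chain: "((\<lambda>t. g (p + t *\<^sub>R v)) has_real_derivative fd g (p + t *\<^sub>R v) v) (at t)"
    if "smooth_on V g" "p + t *\<^sub>R v \<in> V" for g :: "'a \<Rightarrow> real" and p v t
  proof -
    have "((\<lambda>t. p + t *\<^sub>R v) has_derivative (\<lambda>h. h *\<^sub>R v)) (at t)"
      by (auto intro!: derivative_eq_intros)
    from diff_chain_at[OF this smooth_on_has[OF that]]
    have "((\<lambda>t. g (p + t *\<^sub>R v)) has_derivative (\<lambda>h. fd g (p + t *\<^sub>R v) (h *\<^sub>R v))) (at t)"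
      by (simp add: o_def)
    moreover have "fd g (p + t *\<^sub>R v) (h *\<^sub>R v) = fd g (p + t *\<^sub>R v) v * h" for h
      using linear_scale[OF smooth_on_linear_fd[OF that]] by simp
    ultimately show ?thesis by (simp add: has_field_derivative_def)
  qed
  define u where "u \<sigma> = f ((w + s *\<^sub>R y) + \<sigma> *\<^sub>R x) - f (w + \<sigma> *\<^sub>R x)" for \<sigma>
  have "(u has_real_derivative (fd f ((w + s *\<^sub>R y) + \<sigma> *\<^sub>R x) x - fd f (w + \<sigma> *\<^sub>R x) x)) (at \<sigma>)"
    if "0 \<le> \<sigma>" "\<sigma> \<le> s" for \<sigma>
    unfolding u_def using V[of \<sigma> s] V[of \<sigma> 0] that s
    by (intro derivative_intros chain[OF sm]) (auto simp: algebra_simps)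
  from MVT2[OF s, of u, OF this] obtain \<sigma> where \<sigma>: "0 < \<sigma>" "\<sigma> < s"
    "u s - u 0 = (s - 0) * (fd f ((w + s *\<^sub>R y) + \<sigma> *\<^sub>R x) x - fd f (w + \<sigma> *\<^sub>R x) x)" by blast
  define v where "v \<tau> = fd f ((w + \<sigma> *\<^sub>R x) + \<tau> *\<^sub>R y) x" for \<tau>
  have "(v has_real_derivative fd (\<lambda>q. fd f q x) ((w + \<sigma> *\<^sub>R x) + \<tau> *\<^sub>R y) y) (at \<tau>)"
    if "0 \<le> \<tau>" "\<tau> \<le> s" for \<tau>
    unfolding v_def using V[of \<sigma> \<tau>] that \<sigma> by (intro chain[OF smooth_on_fd_const[OF sm]]) auto
  from MVT2[OF s, of v, OF this] obtain \<tau> where \<tau>: "0 < \<tau>" "\<tau> < s"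
    "v s - v 0 = (s - 0) * fd (\<lambda>q. fd f q x) ((w + \<sigma> *\<^sub>R x) + \<tau> *\<^sub>R y) y" by blast
  have "f (w + s *\<^sub>R x + s *\<^sub>R y) - f (w + s *\<^sub>R x) - f (w + s *\<^sub>R y) + f w =
     s * s * fd (\<lambda>q. fd f q x) (w + \<sigma> *\<^sub>R x + \<tau> *\<^sub>R y) y"
    using \<sigma>(3) \<tau>(3) by (simp add: u_def v_def algebra_simps)
  then show ?thesis using that[of \<sigma> \<tau>] \<sigma> \<tau> by simp
qed

text \<open>The second difference over a small parallelogram does not see the order of
  \<open>x\<close> and \<open>y\<close>. By the mean value theorem it equals \<open>s * s\<close>
  times either mixed derivative at some nearby point, so two distinct values at \<open>w\<close>
  contradict continuity.\<close>

lemma second_derivative_symmetric_real: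
  fixes f :: "'a::euclidean_space \<Rightarrow> real"
  assumes sm: "smooth_on V f" and w: "w \<in> V"
  shows "fd (\<lambda>q. fd f q x) w y = fd (\<lambda>q. fd f q y) w x"
proof (rule ccontr)
  let ?g = "\<lambda>q. fd (\<lambda>q. fd f q x) q y" and ?h = "\<lambda>q. fd (\<lambda>q. fd f q y) q x"
  assume ne: "?g w \<noteq> ?h w"
  have o: "open V" using sm by (rule smooth_on_open)
  have c: "continuous_on V ?g" "continuous_on V ?h"
    by (intro smooth_on_continuous smooth_on_fd_const sm)+
  define \<epsilon> where "\<epsilon> = \<bar>?g w - ?h w\<bar> / 2"
  have \<epsilon>: "\<epsilon> > 0" using ne by (simp add: \<epsilon>_def)
  have "isCont ?g w" "isCont ?h w" using c o w by (auto simp: continuous_on_eq_continuous_at)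
  then obtain d1 d2 where d: "d1 > 0" "d2 > 0"
    "\<And>q. dist q w < d1 \<Longrightarrow> dist (?g q) (?g w) < \<epsilon>" "\<And>q. dist q w < d2 \<Longrightarrow> dist (?h q) (?h w) < \<epsilon>"
    using \<epsilon> unfolding continuous_at_eps_delta by metis
  obtain r where r: "r > 0" "ball w r \<subseteq> V" using o w openE by blast
  define R where "R = min r (min d1 d2)"
  \<comment> \<open>With this \<open>s\<close> the parallelogram with sides
    \<open>s *\<^sub>R x\<close> and \<open>s *\<^sub>R y\<close> stays within distance
    \<open>R\<close> of \<open>w\<close>; the summand 1 keeps the denominator positive.\<close>
  define s where "s = R / (norm x + norm y + 1)"
  have R: "R > 0" using r d by (simp add: R_def)
  have np: "norm x + norm y + 1 > 0" by (simp add: add_nonneg_pos)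
  have s: "s > 0" using R np by (simp add: s_def)
  have near: "dist (w + \<sigma> *\<^sub>R x + \<tau> *\<^sub>R y) w < R" if "0 \<le> \<sigma>" "\<sigma> \<le> s" "0 \<le> \<tau>" "\<tau> \<le> s" for \<sigma> \<tau>
  proof -
    have "dist (w + \<sigma> *\<^sub>R x + \<tau> *\<^sub>R y) w = norm (\<sigma> *\<^sub>R x + \<tau> *\<^sub>R y)"
      by (simp add: dist_norm algebra_simps)
    also have "\<dots> \<le> \<sigma> * norm x + \<tau> * norm y"
      using norm_triangle_ineq[of "\<sigma> *\<^sub>R x" "\<tau> *\<^sub>R y"] that by simp
    also have "\<dots> \<le> s * norm x + s * norm y"
      using that by (intro add_mono mult_right_mono) auto
    also have "\<dots> < s * (norm x + norm y + 1)" using s by (simp add: algebra_simps)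
    also have "\<dots> = R" using np by (simp add: s_def)
    finally show ?thesis .
  qed
  have V: "w + \<sigma> *\<^sub>R x + \<tau> *\<^sub>R y \<in> V" if "0 \<le> \<sigma>" "\<sigma> \<le> s" "0 \<le> \<tau>" "\<tau> \<le> s" for \<sigma> \<tau>
    using near[OF that] r by (auto simp: R_def dist_commute)
  obtain \<sigma> \<tau> where 1: "0 \<le> \<sigma>" "\<sigma> \<le> s" "0 \<le> \<tau>" "\<tau> \<le> s"
    "f (w + s *\<^sub>R x + s *\<^sub>R y) - f (w + s *\<^sub>R x) - f (w + s *\<^sub>R y) + f w =
     s * s * ?g (w + \<sigma> *\<^sub>R x + \<tau> *\<^sub>R y)"
    by (rule second_difference_mean_value[OF sm s V])
  have V': "w + \<tau> *\<^sub>R y + \<sigma> *\<^sub>R x \<in> V" if "0 \<le> \<tau>" "\<tau> \<le> s" "0 \<le> \<sigma>" "\<sigma> \<le> s" for \<sigma> \<tau>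
    using V[OF that(3,4,1,2)] by (simp add: add.commute add.left_commute)
  obtain \<tau>' \<sigma>' where 2: "0 \<le> \<tau>'" "\<tau>' \<le> s" "0 \<le> \<sigma>'" "\<sigma>' \<le> s"
    "f (w + s *\<^sub>R y + s *\<^sub>R x) - f (w + s *\<^sub>R y) - f (w + s *\<^sub>R x) + f w =
     s * s * ?h (w + \<tau>' *\<^sub>R y + \<sigma>' *\<^sub>R x)"
    by (rule second_difference_mean_value[OF sm s V'])
  have sw: "w + s *\<^sub>R y + s *\<^sub>R x = w + s *\<^sub>R x + s *\<^sub>R y"
    "w + \<tau>' *\<^sub>R y + \<sigma>' *\<^sub>R x = w + \<sigma>' *\<^sub>R x + \<tau>' *\<^sub>R y" by (simp_all add: algebra_simps)
  have "s * s * ?g (w + \<sigma> *\<^sub>R x + \<tau> *\<^sub>R y) = s * s * ?h (w + \<sigma>' *\<^sub>R x + \<tau>' *\<^sub>R y)"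
    using 1(5) 2(5) unfolding sw by linarith
  then have "?g (w + \<sigma> *\<^sub>R x + \<tau> *\<^sub>R y) = ?h (w + \<sigma>' *\<^sub>R x + \<tau>' *\<^sub>R y)" using s by simp
  moreover have "dist (?g (w + \<sigma> *\<^sub>R x + \<tau> *\<^sub>R y)) (?g w) < \<epsilon>"
    using near[OF 1(1-4)] d(3) by (simp add: R_def)
  moreover have "dist (?h (w + \<sigma>' *\<^sub>R x + \<tau>' *\<^sub>R y)) (?h w) < \<epsilon>"
    using near[OF 2(3,4,1,2)] d(4) by (simp add: R_def)
  moreover have False if "a = b" "\<bar>a - c\<bar> < \<bar>c - d\<bar> / 2" "\<bar>b - d\<bar> < \<bar>c - d\<bar> / 2" for a b c d :: real
    using that by (auto simp: abs_if split: if_splits)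
  ultimately show False unfolding \<epsilon>_def dist_real_def by blast
qed

lemma second_derivative_symmetric:
  assumes sm: "smooth_on V f" and w: "w \<in> V"
  shows "fd (\<lambda>q. fd f q x) w y = fd (\<lambda>q. fd f q y) w x"
proof (rule euclidean_eqI)
  fix b :: 'b
  have l: "linear (\<lambda>z. z \<bullet> b)" by (auto intro: linearI simp: inner_add_left)
  have sb: "smooth_on V (\<lambda>q. f q \<bullet> b)" using sm l by (rule smooth_on_linear_compose)
  have 1: "fd (\<lambda>q. f q \<bullet> b) q v = fd f q v \<bullet> b" if "q \<in> V" for q v
    using fd_linear_compose[OF l smooth_on_differentiable[OF sm that]] .
  have 2: "fd (\<lambda>q. fd (\<lambda>q. f q \<bullet> b) q v) w u = fd (\<lambda>q. fd f q v) w u \<bullet> b" for u v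
    using fd_cong(1)[OF smooth_on_open[OF sm] w, of "\<lambda>q. fd f q v \<bullet> b" "\<lambda>q. fd (\<lambda>q. f q \<bullet> b) q v"]
      fd_linear_compose[OF l smooth_on_differentiable[OF smooth_on_fd_const[OF sm] w]]
      smooth_on_differentiable[OF smooth_on_linear_compose[OF smooth_on_fd_const[OF sm] l] w]
    by (simp add: 1)
  show "fd (\<lambda>q. fd f q x) w y \<bullet> b = fd (\<lambda>q. fd f q y) w x \<bullet> b"
    using second_derivative_symmetric_real[OF sb w] unfolding 2 .
qed

text \<open>The second derivatives of \<open>u\<close> cancel by symmetry and leave the differential
  applied to the Lie bracket. For the frame vectors and for \<xi> this is the flatness of the
  ambient space, from which all equations of Gauss and Codazzi follow.\<close>

lemma fd_Lie_bracket:
  assumes "smooth_on V u" "smooth_on V X" "smooth_on V Y" "w \<in> V"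
  shows "fd (\<lambda>q. fd u q (Y q)) w (X w) - fd (\<lambda>q. fd u q (X q)) w (Y w) =
     fd u w (fd Y w (X w) - fd X w (Y w))"
  using fd_fd_apply[OF assms(1,3,4), of "X w"] fd_fd_apply[OF assms(1,2,4), of "Y w"]
    second_derivative_symmetric[OF assms(1,4), of "X w" "Y w"]
    linear_diff[OF smooth_on_linear_fd[OF assms(1,4)]]
  by simp

text \<open>Along the segment from \<open>w0\<close> to \<open>w\<close> this is a linear equation
  with a scalar coefficient, solved by an integrating factor. The constant is an exponential, hence
  positive: besides directions it preserves signs, on which the distinction of elliptic and
  hyperbolic rests.\<close>

lemma linear_ode_proportional:
  fixes u :: "'a::euclidean_space \<Rightarrow> 'b::euclidean_space"
  assumes "convex V" "open V" "w0 \<in> V" "w \<in> V"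
    and d: "\<And>w. w \<in> V \<Longrightarrow> u differentiable (at w)"
    and eq: "\<And>w x. w \<in> V \<Longrightarrow> fd u w x = s w x *\<^sub>R u w"
    and c: "\<And>x. continuous_on V (\<lambda>w. s w x)"
  obtains c where "c > 0" "u w = c *\<^sub>R u w0"
proof -
  define x where "x = w - w0"
  define p where "p t = w0 + t *\<^sub>R x" for t
  define g where "g t = s (p t) x" for t
  have pV: "p t \<in> V" if "t \<in> {0..1}" for t
    using convexD_alt[OF assms(1,3,4), of t] that by (simp add: p_def x_def algebra_simps)
  have cg: "continuous_on {0..1} g"
    unfolding g_def
    by (rule continuous_on_compose2[OF c[of x], of _ p]) (use pV in \<open>auto simp: p_def intro!: continuous_intros\<close>)
  define G where "G t = integral {0..t} g" for t
  have dG: "(G has_real_derivative g t) (at t within {0..1})" if "t \<in> {0..1}" for t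
    using integral_has_real_derivative[OF cg] that unfolding G_def by auto
  have dp: "((\<lambda>t. u (p t)) has_vector_derivative g t *\<^sub>R u (p t)) (at t within {0..1})"
    if "t \<in> {0..1}" for t
  proof -
    have "(p has_derivative (\<lambda>h. h *\<^sub>R x)) (at t within {0..1})"
      unfolding p_def by (auto intro!: derivative_eq_intros)
    from has_derivative_compose[OF this fd_has[OF d[OF pV[OF that]]]]
    have "((\<lambda>t. u (p t)) has_derivative (\<lambda>h. fd u (p t) (h *\<^sub>R x))) (at t within {0..1})" .
    moreover have "fd u (p t) (h *\<^sub>R x) = h *\<^sub>R (g t *\<^sub>R u (p t))" for h
      using linear_scale[OF linear_frechet_derivative[OF d[OF pV[OF that]]]] eq[OF pV[OF that]]
      by (simp add: g_def)
    ultimately show ?thesis by (simp add: has_vector_derivative_def)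
  qed
  have "((\<lambda>t. exp (- G t) *\<^sub>R u (p t)) has_vector_derivative 0) (at t within {0..1})"
    if "t \<in> {0..1}" for t
  proof -
    have "((\<lambda>t. exp (- G t)) has_vector_derivative - g t * exp (- G t)) (at t within {0..1})"
      unfolding has_real_derivative_iff_has_vector_derivative[symmetric]
      using dG[OF that] by (auto intro!: derivative_eq_intros)
    from has_vector_derivative_scaleR[OF this[folded has_real_derivative_iff_has_vector_derivative] dp[OF that]]
    show ?thesis by (simp add: algebra_simps)
  qed
  then have "\<exists>c. \<forall>t\<in>{0..1}. exp (- G t) *\<^sub>R u (p t) = c"
    unfolding has_vector_derivative_def
    by (intro has_derivative_zero_constant) auto
  then have "exp (- G 1) *\<^sub>R u (p 1) = exp (- G 0) *\<^sub>R u (p 0)" by force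
  then have "exp (- G 1) *\<^sub>R u w = u w0" by (simp add: G_def p_def x_def)
  then have "u w = exp (G 1) *\<^sub>R u w0"
    by (metis exp_minus_inverse scaleR_one scaleR_scaleR)
  then show ?thesis using that[of "exp (G 1)"] by simp
qed

lemma matrix_works_real: "linear f \<Longrightarrow> matrix f *v x = f x" for f :: "real^'n \<Rightarrow> real^'m"
  by simp

text \<open>The inverse function theorem gives a differentiable local inverse \<open>g\<close> with
  \<open>fd g y\<close> inverse to \<open>fd f (g y)\<close>. Smoothness is bootstrapped: Cramer's
  rule expresses \<open>fd g\<close> through the entries of \<open>fd f (g y)\<close>, so if
  \<open>g\<close> is of class \<open>k\<close> then so is its derivative.\<close>

lemma smooth_inverse_function:
  fixes f :: "real^'n \<Rightarrow> real^'n"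
  assumes sm: "smooth_on V f" and w: "w \<in> V" and inj: "inj (fd f w)"
  obtains U W g where "open U" "U \<subseteq> V" "w \<in> U" "open W" "homeomorphism U W f g" "smooth_on W g"
    "\<And>y. y \<in> W \<Longrightarrow> inj (fd f (g y))"
proof -
  have o: "open V" using sm by (rule smooth_on_open)
  have bl: "bounded_linear (fd f q)" if "q \<in> V" for q
    using smooth_on_linear_fd[OF sm that] by (simp add: linear_linear)
  define f' where "f' q = Blinfun (fd f q)" for q
  have f': "blinfun_apply (f' q) = fd f q" if "q \<in> V" for q
    unfolding f'_def using bl[OF that] by (simp add: bounded_linear_Blinfun_apply)
  have cf': "continuous_on V f'"
  proof (rule continuous_on_blinfun_componentwise)
    fix b :: "real^'n"
    show "continuous_on V (\<lambda>q. blinfun_apply (f' q) b)"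
      using smooth_on_continuous[OF smooth_on_fd_const[OF sm, of b]] f'
      by (auto cong: continuous_on_cong)
  qed
  obtain h where h: "linear h" "h \<circ> fd f w = id"
    using linear_injective_left_inverse[OF smooth_on_linear_fd[OF sm w] inj] by blast
  have hinv: "Blinfun h o\<^sub>L f' w = id_blinfun"
  proof (rule blinfun_eqI)
    fix v
    have "h (fd f w v) = v" using h(2) by (metis comp_apply id_apply)
    then show "blinfun_apply (Blinfun h o\<^sub>L f' w) v = blinfun_apply id_blinfun v"
      using h(1) f'[OF w] by (simp add: bounded_linear_Blinfun_apply linear_linear)
  qed
  obtain U W g g' where *: "open U" "U \<subseteq> V" "w \<in> U" "open W" "homeomorphism U W f g"
    "\<And>y. y \<in> W \<Longrightarrow> (g has_derivative (g' y)) (at y)"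
    "\<And>y. y \<in> W \<Longrightarrow> g' y = inv (blinfun_apply (f' (g y)))"
    "\<And>y. y \<in> W \<Longrightarrow> bij (blinfun_apply (f' (g y)))"
    using inverse_function_theorem[OF o _ cf' w hinv] smooth_on_has[OF sm] f' by metis
  have gV: "g y \<in> V" if "y \<in> W" for y using *(2,5) that by (auto simp: homeomorphism_def)
  have bij: "bij (fd f (g y))" if "y \<in> W" for y using *(8)[OF that] f'[OF gV[OF that]] by simp
  have dg: "fd f (g y) (fd g y v) = v" if "y \<in> W" for y v
    using fd_eq[OF *(6)[OF that]] *(7)[OF that] f'[OF gV[OF that]] bij[OF that]
    by (simp add: bij_is_surj surj_f_inv_f)
  have "Ck_on k W g" for k
  proof (induction k)
    case 0
    then show ?case using *(5) by (simp add: homeomorphism_def)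
  next
    case (Suc k)
    have mat: "matrix (fd f (g y)) *v fd g y v = v" if "y \<in> W" for y v
      using dg[OF that] matrix_works_real[OF smooth_on_linear_fd[OF sm gV[OF that]]] by simp
    have det: "det (matrix (fd f (g y))) \<noteq> 0" if "y \<in> W" for y
    proof -
      have "matrix (fd f (g y)) ** matrix (fd g y) = mat 1"
        using mat[OF that] matrix_works_real[OF linear_frechet_derivative[OF differentiableI[OF *(6)[OF that]]]]
        by (auto simp: matrix_eq matrix_vector_mul_assoc[symmetric])
      then show ?thesis by (metis invertible_det_nz invertible_right_inverse)
    qed
    have entry: "Ck_on k W (\<lambda>y. matrix (fd f (g y)) $ i $ j)" for i j
    proof -
      have "Ck_on k W (\<lambda>y. fd f (g y) (axis j 1))"
        by (rule Ck_on_compose[OF *(4) o _ Suc smooth_on_Ck[OF smooth_on_fd_const[OF sm]]])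
          (use gV in auto)
      from Ck_on_bilinear[OF *(4) bounded_bilinear_inner this Ck_on_const[of k W "axis i 1"]]
      show ?thesis by (simp add: matrix_def inner_axis)
    qed
    have sol: "fd g y v = (\<Sum>k\<in>UNIV. (det (\<chi> i j. if j = k then v $ i else matrix (fd f (g y)) $ i $ j)
         * inverse (det (matrix (fd f (g y))))) *\<^sub>R axis k 1)" if "y \<in> W" for y v
    proof -
      have "fd g y v = (\<chi> k. det (\<chi> i j. if j = k then v $ i else matrix (fd f (g y)) $ i $ j)
         / det (matrix (fd f (g y))))"
        using cramer[OF det[OF that]] mat[OF that] by blast
      then show ?thesis
        by (simp add: vec_eq_iff axis_def divide_inverse if_distrib[of "(*) _"] cong: if_cong)
    qed
    have detC: "Ck_on k W (\<lambda>y. det (M y))" if "\<And>i j. Ck_on k W (\<lambda>y. M y $ i $ j)"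
      for M :: "real^'n \<Rightarrow> real^'n^'n"
    proof -
      have "Ck_on k W (\<lambda>y. \<Prod>i\<in>I. M y $ i $ p i)" if "finite I" for p and I :: "'n set"
        using that \<open>\<And>i j. Ck_on k W (\<lambda>y. M y $ i $ j)\<close>
        by (induction I) (auto intro!: Ck_on_const Ck_on_bilinear[OF *(4) bounded_bilinear_mult])
      then show ?thesis unfolding det_def
        by (intro Ck_on_sum *(4) Ck_on_bilinear[OF *(4) bounded_bilinear_mult] Ck_on_const)
          (auto simp: finite_permutations)
    qed
    have "Ck_on k W (\<lambda>y. \<Sum>k\<in>UNIV. (det (\<chi> i j. if j = k then v $ i else matrix (fd f (g y)) $ i $ j)
         * inverse (det (matrix (fd f (g y))))) *\<^sub>R (axis k 1 :: real^'n))" for v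
    proof (intro Ck_on_sum *(4) Ck_on_bilinear[OF *(4) bounded_bilinear_scaleR]
        Ck_on_bilinear[OF *(4) bounded_bilinear_mult] Ck_on_const detC)
      show "Ck_on k W (\<lambda>y. (\<chi> i j. if j = l then v $ i else matrix (fd f (g y)) $ i $ j) $ i $ j)" for i j l
        using entry by (cases "j = l") (auto intro: Ck_on_const)
      show "Ck_on k W (\<lambda>y. inverse (det (matrix (fd f (g y)))))"
        using det by (intro Ck_on_inverse_compose *(4) detC entry) auto
    qed auto
    then have "Ck_on k W (\<lambda>y. fd g y v)" for v
      by (rule Ck_on_cong_imp[OF *(4), rotated]) (simp add: sol)
    then show ?case using *(6) by (auto simp: differentiable_def)
  qed
  then have "smooth_on W g" using *(4) by (simp add: smooth_on_def)
  then show ?thesis using that[OF *(1-5)] bij by (auto simp: bij_is_inj)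
qed

section \<open>Linear algebra\<close>

text \<open>Independence of a list, stated with scalars: in a set, repeated vectors would go
  unnoticed.\<close>

definition indep4 :: "'a::real_vector \<Rightarrow> 'a \<Rightarrow> 'a \<Rightarrow> 'a \<Rightarrow> bool" where
  "indep4 a b c d \<longleftrightarrow> (\<forall>x y z t. x *\<^sub>R a + y *\<^sub>R b + z *\<^sub>R c + t *\<^sub>R d = 0 \<longrightarrow> x = 0 \<and> y = 0 \<and> z = 0 \<and> t = 0)"

definition indep3 :: "'a::real_vector \<Rightarrow> 'a \<Rightarrow> 'a \<Rightarrow> bool" where
  "indep3 a b c \<longleftrightarrow> (\<forall>x y z. x *\<^sub>R a + y *\<^sub>R b + z *\<^sub>R c = 0 \<longrightarrow> x = 0 \<and> y = 0 \<and> z = 0)"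

lemma independent_columns_solution:
  fixes a b c d v :: "real^4"
  assumes ind: "indep4 a b c d"
  defines "M \<equiv> \<chi> i j. if j = 1 then a $ i else if j = 2 then b $ i else if j = 3 then c $ i else d $ i"
  shows "det M \<noteq> 0"
    and "M *v u = (u $ 1) *\<^sub>R a + (u $ 2) *\<^sub>R b + (u $ 3) *\<^sub>R c + (u $ 4) *\<^sub>R d"
proof -
  show eq: "M *v u = (u $ 1) *\<^sub>R a + (u $ 2) *\<^sub>R b + (u $ 3) *\<^sub>R c + (u $ 4) *\<^sub>R d" for u
    by (simp add: vec_eq_iff M_def matrix_vector_mult_def sum_4)
  have "u = 0" if "M *v u = 0" for u
    using ind[unfolded indep4_def, rule_format, of "u $ 1" "u $ 2" "u $ 3" "u $ 4"] that
    unfolding eq by (simp add: vec_eq_iff[of u] forall_4)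
  then show "det M \<noteq> 0"
    unfolding invertible_det_nz[symmetric]
    by (simp add: invertible_left_inverse matrix_left_invertible_ker)
qed

lemma independent_columns_expand:
  fixes a b c d v :: "real^4"
  assumes ind: "indep4 a b c d"
  obtains x y z t where "v = x *\<^sub>R a + y *\<^sub>R b + z *\<^sub>R c + t *\<^sub>R d"
proof -
  define M :: "real^4^4" where "M = (\<chi> i j. if j = 1 then a $ i else if j = 2 then b $ i else if j = 3 then c $ i else d $ i)"
  have "det M \<noteq> 0" unfolding M_def by (rule independent_columns_solution(1)[OF ind])
  then obtain u where "M *v u = v" using cramer by blast
  then have "v = (u $ 1) *\<^sub>R a + (u $ 2) *\<^sub>R b + (u $ 3) *\<^sub>R c + (u $ 4) *\<^sub>R d"
    unfolding M_def using independent_columns_solution(2)[OF ind] by metis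
  then show ?thesis by (rule that)
qed

lemma smooth_independent_expand:
  fixes a b c d v :: "'a::euclidean_space \<Rightarrow> real^4"
  assumes sm: "smooth_on V a" "smooth_on V b" "smooth_on V c" "smooth_on V d" "smooth_on V v"
    and ind: "\<And>w. w \<in> V \<Longrightarrow> indep4 (a w) (b w) (c w) (d w)"
  obtains x y z t where "smooth_on V x" "smooth_on V y" "smooth_on V z" "smooth_on V t"
    "\<And>w. w \<in> V \<Longrightarrow> v w = x w *\<^sub>R a w + y w *\<^sub>R b w + z w *\<^sub>R c w + t w *\<^sub>R d w"
proof -
  define M :: "'a \<Rightarrow> real^4^4" where "M w = (\<chi> i j. if j = 1 then a w $ i else if j = 2 then b w $ i
      else if j = 3 then c w $ i else d w $ i)" for w
  have det: "det (M w) \<noteq> 0" if "w \<in> V" for w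
    unfolding M_def by (rule independent_columns_solution(1)[OF ind[OF that]])
  define u where "u w = (SOME u. M w *v u = v w)" for w
  have u: "M w *v u w = v w" if "w \<in> V" for w
    unfolding u_def using someI_ex[of "\<lambda>u. M w *v u = v w"] cramer[OF det[OF that]] by blast
  have "smooth_on V u"
  proof (rule smooth_on_linear_solution[where M = M and b = v])
    show "smooth_on V (\<lambda>w. M w $ i $ j)" for i j
      using sm(1-4)[THEN smooth_on_vec_nth] by (cases "j = 1"; cases "j = 2"; cases "j = 3") (auto simp: M_def)
  qed (use sm det u in \<open>auto intro: smooth_on_vec_nth smooth_on_open\<close>)
  moreover have "v w = (u w $ 1) *\<^sub>R a w + (u w $ 2) *\<^sub>R b w + (u w $ 3) *\<^sub>R c w + (u w $ 4) *\<^sub>R d w"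
    if "w \<in> V" for w
    unfolding u[OF that, symmetric] M_def by (rule independent_columns_solution(2)[OF ind[OF that]])
  ultimately show ?thesis
    by (intro that[of "\<lambda>w. u w $ 1" "\<lambda>w. u w $ 2" "\<lambda>w. u w $ 3" "\<lambda>w. u w $ 4"] smooth_on_vec_nth)
qed

text \<open>The terms of the expanded row with \<open>m \<noteq> k\<close> produce determinants with
  two equal rows.\<close>

lemma det_row_combination:
  fixes a :: "'n::finite \<Rightarrow> real^'n"
  shows "det (\<chi> i. if i = k then (\<Sum>m\<in>UNIV. c m *\<^sub>R a m) else a i) = c k * det (\<chi> i. a i)"
  unfolding scalar_mult_eq_scaleR[symmetric]
proof -
  have "det (\<chi> i. if i = k then (\<Sum>m\<in>UNIV. c m *s a m) else a i) =
      (\<Sum>m\<in>UNIV. det (\<chi> i. if i = k then c m *s a m else a i))"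
    by (rule det_linear_row_sum) simp
  also have "\<dots> = (\<Sum>m\<in>UNIV. c m * det (\<chi> i. if i = k then a m else a i))"
    by (simp add: det_row_mul)
  also have "\<dots> = (\<Sum>m\<in>UNIV. if m = k then c k * det (\<chi> i. a i) else 0)"
  proof (rule sum.cong)
    fix m
    show "c m * det (\<chi> i. if i = k then a m else a i) = (if m = k then c k * det (\<chi> i. a i) else 0)"
    proof (cases "m = k")
      case True
      have "(\<chi> i. if i = k then a k else a i) = (\<chi> i. a i)" by (simp add: vec_eq_iff)
      then show ?thesis unfolding True by simp
    next
      case False
      then have "det (\<chi> i. if i = k then a m else a i) = 0"
        by (intro det_identical_rows[of k m]) (auto simp: row_def)
      then show ?thesis using False by simp
    qed
  qed simp
  finally show "det (\<chi> i. if i = k then (\<Sum>m\<in>UNIV. c m *s a m) else a i) = c k * det (\<chi> i. a i)" by simp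
qed

lemma has_derivative_det_rows:
  fixes a :: "'n::finite \<Rightarrow> 'a::euclidean_space \<Rightarrow> real^'n"
  assumes "\<And>i. (a i has_derivative a' i) (at w)"
  shows "((\<lambda>q. det (\<chi> i. a i q)) has_derivative
      (\<lambda>v. \<Sum>k\<in>UNIV. det (\<chi> i. if i = k then a' k v else a i w))) (at w)"
proof -
  let ?P = "{p. p permutes (UNIV :: 'n set)}"
  have comp: "((\<lambda>q. a i q $ j) has_derivative (\<lambda>v. a' i v $ j)) (at w)" for i j
    by (rule bounded_linear.has_derivative[OF bounded_linear_vec_nth assms])
  have "((\<lambda>q. \<Sum>p\<in>?P. of_int (sign p) * (\<Prod>i\<in>UNIV. a i q $ p i)) has_derivative
     (\<lambda>v. \<Sum>p\<in>?P. of_int (sign p) * (\<Sum>i\<in>UNIV. a' i v $ p i * (\<Prod>j\<in>UNIV - {i}. a j w $ p j)))) (at w)"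
    by (intro has_derivative_sum has_derivative_mult_right has_derivative_prod comp)
  moreover have "(\<Sum>p\<in>?P. of_int (sign p) * (\<Sum>i\<in>UNIV. a' i v $ p i * (\<Prod>j\<in>UNIV - {i}. a j w $ p j)))
      = (\<Sum>k\<in>UNIV. det (\<chi> i. if i = k then a' k v else a i w))" for v
  proof -
    have "(\<Prod>i\<in>UNIV. (\<chi> i. if i = k then a' k v else a i w) $ i $ p i) =
        a' k v $ p k * (\<Prod>j\<in>UNIV - {k}. a j w $ p j)" for k p
      by (subst prod.remove[of _ k]) (auto intro!: prod.cong)
    then show ?thesis
      unfolding det_def by (subst sum.swap) (simp add: sum_distrib_left)
  qed
  ultimately show ?thesis by (simp add: det_def)
qed

lemma vector4_rows: "(vector [a, b, c, d] :: real^4^4) =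
   (\<chi> i. if i = 1 then a else if i = 2 then b else if i = 3 then c else d)"
proof -
  have "(vector [a, b, c, d] :: real^4^4) $ 1 = a" "(vector [a, b, c, d] :: real^4^4) $ 2 = b"
    "(vector [a, b, c, d] :: real^4^4) $ 3 = c" "(vector [a, b, c, d] :: real^4^4) $ 4 = d"
    unfolding vector_def by simp_all
  then show ?thesis by (simp add: vec_eq_iff forall_4)
qed

definition delta :: "3 \<Rightarrow> 3 \<Rightarrow> real" where "delta i j = (if i = j then 1 else 0)"

lemma delta_same [simp]: "delta i i = 1" by (simp add: delta_def)

lemma delta_commute: "delta i j = delta j i" by (simp add: delta_def eq_commute)

lemma delta_3 [simp]: "delta 1 2 = 0" "delta 1 3 = 0" "delta 2 1 = 0" "delta 2 3 = 0" "delta 3 1 = 0" "delta 3 2 = 0"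
  by (simp_all add: delta_def)

lemma delta_sum [simp]: "(\<Sum>k\<in>UNIV. delta i k * g k) = g i" "(\<Sum>k\<in>UNIV. g k * delta k i) = g i"
  "(\<Sum>k\<in>UNIV. g k * delta i k) = g i"
  "(\<Sum>k\<in>UNIV. delta k i *\<^sub>R G k) = (G i :: 'a::real_vector)" "(\<Sum>k\<in>UNIV. delta i k *\<^sub>R G k) = G i"
  by (simp_all add: delta_def if_distrib[of "\<lambda>x. x * _"] if_distrib[of "\<lambda>x. _ * x"]
      if_distrib[of "\<lambda>x. x *\<^sub>R _"] cong: if_cong)

text \<open>Collects coefficients after \<open>dE\<close> has been substituted for the derivatives
  of the frame, with \<xi> in the role of \<open>y\<close>.\<close>

lemma frame_combination:
  fixes X :: "3 \<Rightarrow> 'a::real_vector"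
  shows "(\<Sum>k\<in>UNIV. c k *\<^sub>R ((\<Sum>m\<in>UNIV. a k m *\<^sub>R X m) + delta i k *\<^sub>R y)) =
    (\<Sum>m\<in>UNIV. (\<Sum>k\<in>UNIV. c k * a k m) *\<^sub>R X m) + c i *\<^sub>R y"
proof -
  have "(\<Sum>k\<in>UNIV. c k *\<^sub>R (\<Sum>m\<in>UNIV. a k m *\<^sub>R X m)) = (\<Sum>m\<in>UNIV. (\<Sum>k\<in>UNIV. c k * a k m) *\<^sub>R X m)"
    unfolding scaleR_sum_right scaleR_sum_left scaleR_scaleR by (rule sum.swap)
  moreover have "(\<Sum>k\<in>UNIV. c k *\<^sub>R (delta i k *\<^sub>R y)) = c i *\<^sub>R y"
    unfolding scaleR_scaleR scaleR_sum_left[symmetric] by simp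
  ultimately show ?thesis by (simp add: scaleR_add_right sum.distrib)
qed

section \<open>Definite bilinear forms and orthonormal bases\<close>

definition spd :: "(real^3 \<Rightarrow> real^3 \<Rightarrow> real) \<Rightarrow> bool" where
  "spd g \<longleftrightarrow> bilinear g \<and> (\<forall>x y. g x y = g y x) \<and> positive_definite g"

text \<open>Unlike \<open>orthonormal\<close>, which takes absolute values so as to cover indefinite
  metrics, this fixes the signs; for positive definite forms the two agree.\<close>

definition onb :: "(real^3 \<Rightarrow> real^3 \<Rightarrow> real) \<Rightarrow> (3 \<Rightarrow> real^3) \<Rightarrow> bool" where
  "onb g e \<longleftrightarrow> (\<forall>i j. g (e i) (e j) = delta i j)"

lemma orthonormal_iff_onb:
  assumes "spd g"
  shows "orthonormal g e \<longleftrightarrow> onb g e"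
proof -
  have "g x x \<ge> 0" for x
    using assms bilinear_lzero[of g] by (cases "x = 0") (auto simp: spd_def positive_definite_def less_imp_le)
  then have "\<bar>g x x\<bar> = 1 \<longleftrightarrow> g x x = 1" for x
    by (metis abs_of_nonneg)
  then show ?thesis unfolding orthonormal_def onb_def delta_def by (metis abs_eq_0)
qed

lemma spd_linear: assumes "spd g" shows "linear (g x)" "linear (\<lambda>x. g x y)"
  using assms by (auto simp: spd_def bilinear_def)

lemma spd_simps:
  assumes "spd g"
  shows "g (x + y) z = g x z + g y z" "g z (x + y) = g z x + g z y"
    "g (c *\<^sub>R x) z = c * g x z" "g z (c *\<^sub>R x) = c * g z x"
    "g (x - y) z = g x z - g y z" "g z (x - y) = g z x - g z y"
    "g (- x) z = - g x z" "g z (- x) = - g z x"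
    "g 0 z = 0" "g z 0 = 0"
    "g (\<Sum>i\<in>I. F i) z = (\<Sum>i\<in>I. g (F i) z)" "g z (\<Sum>i\<in>I. F i) = (\<Sum>i\<in>I. g z (F i))"
  using linear_add[OF spd_linear(1)[OF assms]] linear_add[OF spd_linear(2)[OF assms]]
    linear_scale[OF spd_linear(1)[OF assms]] linear_scale[OF spd_linear(2)[OF assms]]
    linear_diff[OF spd_linear(1)[OF assms]] linear_diff[OF spd_linear(2)[OF assms]]
    linear_neg[OF spd_linear(1)[OF assms]] linear_neg[OF spd_linear(2)[OF assms]]
    linear_0[OF spd_linear(1)[OF assms]] linear_0[OF spd_linear(2)[OF assms]]
    linear_sum[OF spd_linear(1)[OF assms]] linear_sum[OF spd_linear(2)[OF assms]]
  by auto

lemma spd_sym: "spd g \<Longrightarrow> g x y = g y x" by (simp add: spd_def)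

lemma spd_pos: "spd g \<Longrightarrow> x \<noteq> 0 \<Longrightarrow> g x x > 0"
  by (simp add: spd_def positive_definite_def)

lemma spd_zeroI: "spd g \<Longrightarrow> g x x = 0 \<Longrightarrow> x = 0"
  using spd_pos by fastforce

text \<open>The combination map \<open>L\<close> has the coordinates as a left inverse, so it is
  injective and, in dimension three, surjective.\<close>

lemma onb_expand:
  assumes "spd g" "onb g e"
  shows "x = (\<Sum>k\<in>UNIV. g x (e k) *\<^sub>R e k)"
proof -
  define L where "L c = (\<Sum>k\<in>UNIV. (c $ k) *\<^sub>R e k)" for c :: "real^3"
  have l: "linear L" unfolding L_def
    by (rule linearI) (simp_all add: algebra_simps sum.distrib scaleR_sum_right)
  have co: "g (L c) (e k) = c $ k" for c k
    using assms(2) by (simp add: L_def spd_simps[OF assms(1)] onb_def)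
  have "inj L"
    using co by (metis injI vec_eq_iff)
  then have "surj L" using l by (simp add: linear_injective_imp_surjective)
  then obtain c where "x = L c" by blast
  then show ?thesis using co by (simp add: L_def)
qed

lemma onb_inner:
  assumes "spd g" "onb g e"
  shows "g x y = (\<Sum>k\<in>UNIV. g x (e k) * g y (e k))"
  by (subst onb_expand[OF assms, of y]) (simp add: spd_simps[OF assms(1)] mult.commute)

lemma onb_linear_eqI:
  assumes "spd g" "onb g e" "linear F" "linear H" "\<And>k. F (e k) = H (e k)"
  shows "F x = H x"
proof -
  have "F x = F (\<Sum>k\<in>UNIV. g x (e k) *\<^sub>R e k)" using onb_expand[OF assms(1,2)] by metis
  also have "\<dots> = H (\<Sum>k\<in>UNIV. g x (e k) *\<^sub>R e k)"
    using assms(5) by (simp add: linear_sum[OF assms(3)] linear_sum[OF assms(4)]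
        linear_scale[OF assms(3)] linear_scale[OF assms(4)])
  also have "\<dots> = H x" using onb_expand[OF assms(1,2)] by metis
  finally show ?thesis .
qed

text \<open>Lets a trace be formed in a smooth auxiliary frame and evaluated in the pointwise normal
  form.\<close>

lemma onb_trace_independent:
  assumes "spd g" "onb g e" "onb g b" "bilinear \<beta>"
  shows "(\<Sum>k\<in>UNIV. \<beta> (b k) (b k)) = (\<Sum>k\<in>UNIV. (\<beta> (e k) (e k) :: real))"
proof -
  have "\<beta> (b k) (b k) = (\<Sum>i\<in>UNIV. \<Sum>j\<in>UNIV. g (b k) (e i) * g (b k) (e j) * \<beta> (e i) (e j))" for k
  proof -
    have "\<beta> (b k) (b k) = \<beta> (\<Sum>i\<in>UNIV. g (b k) (e i) *\<^sub>R e i) (\<Sum>i\<in>UNIV. g (b k) (e i) *\<^sub>R e i)"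
      using onb_expand[OF assms(1,2), of "b k"] by simp
    then show ?thesis
      by (simp add: bilinear_sum[OF assms(4)] sum.cartesian_product bilinear_lmul[OF assms(4)]
          bilinear_rmul[OF assms(4)] mult_ac case_prod_beta)
  qed
  then have "(\<Sum>k\<in>UNIV. \<beta> (b k) (b k)) =
      (\<Sum>k\<in>UNIV. \<Sum>i\<in>UNIV. \<Sum>j\<in>UNIV. g (b k) (e i) * g (b k) (e j) * \<beta> (e i) (e j))" by simp
  also have "\<dots> = (\<Sum>i\<in>UNIV. \<Sum>j\<in>UNIV. \<Sum>k\<in>UNIV. g (b k) (e i) * g (b k) (e j) * \<beta> (e i) (e j))"
    by (subst sum.swap, rule sum.cong[OF refl], rule sum.swap)
  also have "\<dots> = (\<Sum>i\<in>UNIV. \<Sum>j\<in>UNIV. g (e i) (e j) * \<beta> (e i) (e j))"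
    by (simp add: onb_inner[OF assms(1,3), of "e _" "e _"] sum_distrib_right spd_sym[OF assms(1), of "b _"])
  also have "\<dots> = (\<Sum>k\<in>UNIV. \<beta> (e k) (e k))"
    using assms(2) by (simp add: onb_def)
  finally show ?thesis .
qed

lemma bilinear_family_derivative:
  fixes g :: "'a::euclidean_space \<Rightarrow> 'b::euclidean_space \<Rightarrow> 'b \<Rightarrow> real"
  assumes bil: "\<And>q. q \<in> V \<Longrightarrow> bilinear (g q)" and sm: "\<And>x y. smooth_on V (\<lambda>q. g q x y)"
    and YZ: "smooth_on V Y" "smooth_on V Z"
  shows "smooth_on V (\<lambda>q. g q (Y q) (Z q))"
    and "w \<in> V \<Longrightarrow> fd (\<lambda>q. g q (Y q) (Z q)) w x =
      fd (\<lambda>q. g q (Y w) (Z w)) w x + g w (fd Y w x) (Z w) + g w (Y w) (fd Z w x)"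
proof -
  have o: "open V" using YZ(1) by (rule smooth_on_open)
  have ex: "g q y z = (\<Sum>b\<in>Basis. \<Sum>c\<in>Basis. (y \<bullet> b) * (z \<bullet> c) * g q b c)" if "q \<in> V" for q y z
  proof -
    have "g q y z = g q (\<Sum>b\<in>Basis. (y \<bullet> b) *\<^sub>R b) (\<Sum>b\<in>Basis. (z \<bullet> b) *\<^sub>R b)"
      by (simp add: euclidean_representation)
    then show ?thesis
      by (simp add: bilinear_sum[OF bil[OF that]] sum.cartesian_product bilinear_lmul[OF bil[OF that]]
          bilinear_rmul[OF bil[OF that]] mult_ac case_prod_beta)
  qed
  have sm2: "smooth_on V (\<lambda>q. \<Sum>b\<in>Basis. \<Sum>c\<in>Basis. (Y q \<bullet> b) * (Z q \<bullet> c) * g q b c)"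
    if "smooth_on V Y" "smooth_on V Z" for Y Z
    using that by (intro smooth_on_sum o smooth_on_mult smooth_on_inner smooth_on_const sm) auto
  show s: "smooth_on V (\<lambda>q. g q (Y q) (Z q))"
    by (rule smooth_on_cong[THEN iffD2, OF ex sm2[OF YZ]])
  assume w: "w \<in> V"
  have d: "fd (\<lambda>q. g q (Y q) (Z q)) w x = (\<Sum>b\<in>Basis. \<Sum>c\<in>Basis.
      ((fd Y w x \<bullet> b) * (Z w \<bullet> c) + (Y w \<bullet> b) * (fd Z w x \<bullet> c)) * g w b c
      + (Y w \<bullet> b) * (Z w \<bullet> c) * fd (\<lambda>q. g q b c) w x)" if YZ: "smooth_on V Y" "smooth_on V Z" for Y Z
  proof -
    have dY: "Y differentiable (at w)" "Z differentiable (at w)" "(\<lambda>q. g q b c) differentiable (at w)"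
      "(\<lambda>q. Y q \<bullet> b) differentiable (at w)" "(\<lambda>q. Z q \<bullet> c) differentiable (at w)" for b c
      using smooth_on_differentiable[OF YZ(1) w] smooth_on_differentiable[OF YZ(2) w]
        smooth_on_differentiable[OF sm w] by auto
    have "fd (\<lambda>q. g q (Y q) (Z q)) w x = fd (\<lambda>q. \<Sum>b\<in>Basis. \<Sum>c\<in>Basis. (Y q \<bullet> b) * (Z q \<bullet> c) * g q b c) w x"
      using fd_cong(1)[OF o w ex[symmetric] smooth_on_differentiable[OF sm2[OF YZ] w]] by simp
    also have "\<dots> = (\<Sum>b\<in>Basis. fd (\<lambda>q. \<Sum>c\<in>Basis. (Y q \<bullet> b) * (Z q \<bullet> c) * g q b c) w x)"
      using dY by (intro fd_sum) auto
    also have "\<dots> = (\<Sum>b\<in>Basis. \<Sum>c\<in>Basis. fd (\<lambda>q. (Y q \<bullet> b) * (Z q \<bullet> c) * g q b c) w x)"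
      using dY by (intro sum.cong refl fd_sum) auto
    finally show ?thesis
      using dY by (simp add: fd_mult fd_inner algebra_simps)
  qed
  have "fd (\<lambda>q. g q (Y w) (Z w)) w x = (\<Sum>b\<in>Basis. \<Sum>c\<in>Basis. (Y w \<bullet> b) * (Z w \<bullet> c) * fd (\<lambda>q. g q b c) w x)"
    using d[OF smooth_on_const[OF o] smooth_on_const[OF o], of "Y w" "Z w"] by simp
  then show "fd (\<lambda>q. g q (Y q) (Z q)) w x =
      fd (\<lambda>q. g q (Y w) (Z w)) w x + g w (fd Y w x) (Z w) + g w (Y w) (fd Z w x)"
    unfolding d[OF YZ] ex[OF w, of "fd Y w x"] ex[OF w, of "Y w" "fd Z w x"]
    by (simp add: sum.distrib algebra_simps)
qed

section \<open>The structure equations of an affine hypersurface\<close>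

locale hypersurface =
  fixes V :: "(real^3) set" and f \<xi> :: "real^3 \<Rightarrow> real^4"
  assumes blaschke: "blaschke_hypersurface V f \<xi>"
    and posdef: "\<And>w. w \<in> V \<Longrightarrow> positive_definite (affine_metric f \<xi> w)"
begin

abbreviation "h \<equiv> affine_metric f \<xi>"
abbreviation "S \<equiv> shape_operator f \<xi>"
abbreviation "K \<equiv> difference_tensor f \<xi>"
abbreviation "conn \<equiv> induced_connection f \<xi>"

lemma smooth_f: "smooth_on V f" and smooth_xi: "smooth_on V \<xi>"
  using blaschke by (auto simp: blaschke_hypersurface_def equiaffine_hypersurface_def)

lemma open_V: "open V" using smooth_f by (rule smooth_on_open)

lemma linear_df: "w \<in> V \<Longrightarrow> linear (fd f w)" using smooth_f by (rule smooth_on_linear_fd)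

lemma df_xi_independent:
  assumes "w \<in> V" "fd f w z + r *\<^sub>R \<xi> w = 0"
  shows "z = 0" "r = 0"
proof -
  have i: "inj (fd f w)" "\<xi> w \<notin> range (fd f w)"
    using blaschke assms(1) by (auto simp: blaschke_hypersurface_def equiaffine_hypersurface_def)
  note l = linear_df[OF assms(1)]
  show r: "r = 0"
  proof (rule ccontr)
    assume r: "r \<noteq> 0"
    have "fd f w z = - (r *\<^sub>R \<xi> w)" using assms(2) by (simp add: eq_neg_iff_add_eq_0)
    then have "fd f w ((- 1 / r) *\<^sub>R z) = \<xi> w" using r unfolding linear_scale[OF l] by simp
    then show False using i(2) by (metis rangeI)
  qed
  show "z = 0" using assms(2) r linear_injective_0[OF l] i(1) by simp
qed

lemma df_xi_unique:
  assumes "w \<in> V" "fd f w z + r *\<^sub>R \<xi> w = fd f w z' + r' *\<^sub>R \<xi> w"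
  shows "z = z'" "r = r'"
proof -
  have "fd f w (z - z') + (r - r') *\<^sub>R \<xi> w = 0"
    using assms(2) by (simp add: linear_diff[OF linear_df[OF assms(1)]] algebra_simps)
  from df_xi_independent[OF assms(1) this] show "z = z'" "r = r'" by auto
qed

lemma frame_independent:
  assumes "w \<in> V" "indep3 a b c"
  shows "indep4 (fd f w a) (fd f w b) (fd f w c) (\<xi> w)"
  unfolding indep4_def
proof (intro allI impI)
  fix x y z t assume 3: "x *\<^sub>R fd f w a + y *\<^sub>R fd f w b + z *\<^sub>R fd f w c + t *\<^sub>R \<xi> w = 0"
  note l = linear_df[OF assms(1)]
  have "fd f w (x *\<^sub>R a + y *\<^sub>R b + z *\<^sub>R c) + t *\<^sub>R \<xi> w = 0"
    using 3 by (simp add: linear_add[OF l] linear_scale[OF l])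
  from df_xi_independent[OF assms(1) this] show "x = 0 \<and> y = 0 \<and> z = 0 \<and> t = 0"
    using assms(2) unfolding indep3_def by blast
qed

lemma axis_independent:
  "indep3 (axis 1 1 :: real^3) (axis 2 1) (axis 3 1)"
  by (simp add: indep3_def vec_eq_iff forall_3 axis_def)

lemma decompose:
  assumes "w \<in> V"
  obtains z r where "v = fd f w z + r *\<^sub>R \<xi> w"
proof -
  note l = linear_df[OF assms]
  obtain x y z t where "v = x *\<^sub>R fd f w (axis 1 1) + y *\<^sub>R fd f w (axis 2 1) + z *\<^sub>R fd f w (axis 3 1) + t *\<^sub>R \<xi> w"
    using independent_columns_expand[OF frame_independent[OF assms axis_independent]] by blast
  then have "v = fd f w (x *\<^sub>R axis 1 1 + y *\<^sub>R axis 2 1 + z *\<^sub>R axis 3 1) + t *\<^sub>R \<xi> w"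
    by (simp add: linear_add[OF l] linear_scale[OF l])
  then show ?thesis by (rule that)
qed

text \<open>Here the definite descriptions of connection and metric become usable: the decomposition
  into a tangential part and a multiple of \<xi> exists by dimension and is unique by
  transversality.\<close>

lemma Gauss_constant:
  assumes "w \<in> V"
  shows "fd (\<lambda>q. fd f q y) w x = fd f w (conn (\<lambda>_. y) w x) + h w x y *\<^sub>R \<xi> w"
proof -
  obtain z r where zr: "fd (\<lambda>q. fd f q y) w x = fd f w z + r *\<^sub>R \<xi> w" using decompose[OF assms] .
  have "conn (\<lambda>_. y) w x = z" "h w x y = r"
    unfolding induced_connection_def affine_metric_def flat_derivative_def zr
    using df_xi_unique[OF assms] by blast+
  then show ?thesis using zr by simp
qed

lemma Gauss_constant_unique:
  assumes "w \<in> V" "fd (\<lambda>q. fd f q y) w x = fd f w z + r *\<^sub>R \<xi> w"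
  shows "conn (\<lambda>_. y) w x = z" "h w x y = r"
  using df_xi_unique[OF assms(1)] Gauss_constant[OF assms(1), of y x] assms(2) by metis+

text \<open>Replacing a field by its value at \<open>w\<close> changes the second derivative only by
  the tangential vector \<open>fd Y w x\<close>; so the connection sees the derivative of
  \<open>Y\<close>, the metric only its value.\<close>

lemma Gauss_formula:
  assumes "smooth_on U Y" "U \<subseteq> V" "w \<in> U"
  shows "fd (\<lambda>q. fd f q (Y q)) w x = fd f w (conn Y w x) + h w x (Y w) *\<^sub>R \<xi> w"
    and "conn Y w x = conn (\<lambda>_. Y w) w x + fd Y w x"
proof -
  have w: "w \<in> V" using assms by auto
  have sf: "smooth_on U f" using smooth_on_subset[OF smooth_f smooth_on_open[OF assms(1)] assms(2)] .
  have eq: "fd (\<lambda>q. fd f q (Y q)) w x = fd f w (conn (\<lambda>_. Y w) w x + fd Y w x) + h w x (Y w) *\<^sub>R \<xi> w"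
    using fd_fd_apply[OF sf assms(1,3), of x] Gauss_constant[OF w, of "Y w" x]
    by (simp add: linear_add[OF linear_df[OF w]])
  show *: "conn Y w x = conn (\<lambda>_. Y w) w x + fd Y w x"
    unfolding induced_connection_def[of f \<xi> Y] flat_derivative_def eq
    using df_xi_unique[OF w] by blast
  show "fd (\<lambda>q. fd f q (Y q)) w x = fd f w (conn Y w x) + h w x (Y w) *\<^sub>R \<xi> w"
    using eq * by simp
qed

lemma second_derivative_linear:
  assumes "w \<in> V"
  shows "linear (fd (\<lambda>q. fd f q y) w)" "linear (\<lambda>y. fd (\<lambda>q. fd f q y) w x)"
proof -
  show 1: "linear (fd (\<lambda>q. fd f q y) w)" for y
    using smooth_on_linear_fd[OF smooth_on_fd_const[OF smooth_f] assms] .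
  have "(\<lambda>y. fd (\<lambda>q. fd f q y) w x) = fd (\<lambda>q. fd f q x) w"
    using second_derivative_symmetric[OF smooth_f assms] by auto
  then show "linear (\<lambda>y. fd (\<lambda>q. fd f q y) w x)" using 1 by simp
qed

lemma metric_conn_symmetric:
  assumes "w \<in> V"
  shows "h w x y = h w y x" "conn (\<lambda>_. y) w x = conn (\<lambda>_. x) w y"
  using Gauss_constant_unique[OF assms, of y x] Gauss_constant[OF assms, of x y]
    second_derivative_symmetric[OF smooth_f assms, of x y] by auto

lemma metric_linear:
  assumes "w \<in> V"
  shows "linear (\<lambda>x. h w x y)" "linear (\<lambda>x. conn (\<lambda>_. y) w x)"
proof -
  note l = linear_df[OF assms]
  have a: "fd (\<lambda>q. fd f q y) w (x + x') = fd f w (conn (\<lambda>_. y) w x + conn (\<lambda>_. y) w x') + (h w x y + h w x' y) *\<^sub>R \<xi> w" for x x'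
    unfolding linear_add[OF second_derivative_linear(1)[OF assms]] unfolding Gauss_constant[OF assms]
    by (simp add: linear_add[OF l] algebra_simps)
  have s: "fd (\<lambda>q. fd f q y) w (c *\<^sub>R x) = fd f w (c *\<^sub>R conn (\<lambda>_. y) w x) + (c * h w x y) *\<^sub>R \<xi> w" for x c
    unfolding linear_scale[OF second_derivative_linear(1)[OF assms]] unfolding Gauss_constant[OF assms]
    by (simp add: linear_scale[OF l] algebra_simps)
  show "linear (\<lambda>x. h w x y)" "linear (\<lambda>x. conn (\<lambda>_. y) w x)"
    using Gauss_constant_unique[OF assms a] Gauss_constant_unique[OF assms s] by (auto intro!: linearI)
qed

lemma spd_h:
  assumes "w \<in> V"
  shows "spd (h w)"
  unfolding spd_def bilinear_def
proof (intro conjI allI posdef assms)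
  show "linear (\<lambda>x. h w x y)" for y by (rule metric_linear[OF assms])
  show "linear (h w x)" for x
  proof -
    have "(\<lambda>y. h w y x) = h w x" using metric_conn_symmetric(1)[OF assms] by auto
    then show ?thesis using metric_linear(1)[OF assms, of x] by simp
  qed
  show "h w x y = h w y x" for x y by (rule metric_conn_symmetric[OF assms])
qed

text \<open>The metric is defined point by point; smoothness comes from Cramer's rule for the
  coefficient of \<xi> in the smooth frame of coordinate vectors and \<xi>.\<close>

lemma smooth_h: "smooth_on V (\<lambda>w. h w x y)"
proof -
  have s: "smooth_on V (\<lambda>w. fd (\<lambda>q. fd f q y) w x)" "smooth_on V (\<lambda>w. fd f w v)" for v
    by (intro smooth_on_fd_const smooth_f)+
  obtain a b c d where "smooth_on V a" "smooth_on V b" "smooth_on V c" and r: "smooth_on V d" "\<And>w. w \<in> V \<Longrightarrow> fd (\<lambda>q. fd f q y) w x =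
     a w *\<^sub>R fd f w (axis 1 1) + b w *\<^sub>R fd f w (axis 2 1) + c w *\<^sub>R fd f w (axis 3 1) + d w *\<^sub>R \<xi> w"
    by (rule smooth_independent_expand[OF s(2) s(2) s(2) smooth_xi s(1) frame_independent[OF _ axis_independent]], assumption)
      (rule that; assumption)
  have "h w x y = d w" if "w \<in> V" for w
  proof -
    note l = linear_df[OF that]
    have "fd (\<lambda>q. fd f q y) w x = fd f w (a w *\<^sub>R axis 1 1 + b w *\<^sub>R axis 2 1 + c w *\<^sub>R axis 3 1) + d w *\<^sub>R \<xi> w"
      using r(2)[OF that] by (simp add: linear_add[OF l] linear_scale[OF l])
    from Gauss_constant_unique(2)[OF that this] show ?thesis .
  qed
  then show ?thesis using r(1) smooth_on_cong[of V d "\<lambda>w. h w x y"] by simp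
qed

lemma Weingarten:
  assumes "w \<in> V"
  shows "fd \<xi> w x = - fd f w (S w x)"
proof -
  have "fd \<xi> w x \<in> range (fd f w)"
    using blaschke assms unfolding blaschke_hypersurface_def equiaffine_hypersurface_def by blast
  then obtain z where z: "fd \<xi> w x = - fd f w z"
    by (metis (no_types, lifting) imageE linear_df[OF assms] linear_neg minus_minus)
  have "S w x = z" unfolding shape_operator_def z
  proof (rule the_equality)
    fix z' assume "- fd f w z = - fd f w z'"
    then show "z' = z" using df_xi_unique(1)[OF assms, of z 0 z' 0] by simp
  qed simp
  then show ?thesis using z by simp
qed

lemma Weingarten_unique: "w \<in> V \<Longrightarrow> fd \<xi> w x = - fd f w z \<Longrightarrow> S w x = z"
  using Weingarten[of w x] df_xi_unique(1)[of w "S w x" 0 z 0] by simp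

lemma linear_S:
  assumes "w \<in> V"
  shows "linear (S w)"
proof (rule linearI)
  note l = linear_df[OF assms] smooth_on_linear_fd[OF smooth_xi assms]
  show "S w (x + y) = S w x + S w y" for x y
    by (rule Weingarten_unique[OF assms], unfold linear_add[OF l(2)], unfold Weingarten[OF assms])
      (simp add: linear_add[OF l(1)])
  show "S w (c *\<^sub>R x) = c *\<^sub>R S w x" for c x
    by (rule Weingarten_unique[OF assms], unfold linear_scale[OF l(2)], unfold Weingarten[OF assms])
      (simp add: linear_scale[OF l(1)])
qed

lemma hypersurface_subset: "open U \<Longrightarrow> U \<subseteq> V \<Longrightarrow> hypersurface U f \<xi>"
  using blaschke posdef unfolding hypersurface_def blaschke_hypersurface_def equiaffine_hypersurface_def
  by (blast intro: smooth_on_subset)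

lemma smooth_h_fields:
  assumes "smooth_on U Y" "smooth_on U Z" "U \<subseteq> V"
  shows "smooth_on U (\<lambda>w. h w (Y w) (Z w))"
    and "w \<in> U \<Longrightarrow> fd (\<lambda>q. h q (Y q) (Z q)) w x =
      fd (\<lambda>q. h q (Y w) (Z w)) w x + h w (fd Y w x) (Z w) + h w (Y w) (fd Z w x)"
proof -
  have o: "open U" using assms(1) by (rule smooth_on_open)
  have 1: "bilinear (h q)" if "q \<in> U" for q using spd_h that assms(3) by (auto simp: spd_def)
  have 2: "smooth_on U (\<lambda>q. h q x y)" for x y using smooth_on_subset[OF smooth_h o assms(3)] .
  show "smooth_on U (\<lambda>w. h w (Y w) (Z w))"
    by (rule bilinear_family_derivative(1)[OF 1 2 assms(1,2)])
  show "w \<in> U \<Longrightarrow> fd (\<lambda>q. h q (Y q) (Z q)) w x =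
      fd (\<lambda>q. h q (Y w) (Z w)) w x + h w (fd Y w x) (Z w) + h w (Y w) (fd Z w x)"
    by (rule bilinear_family_derivative(2)[OF 1 2 assms(1,2)])
qed

text \<open>Gram-Schmidt, with roots taken of positive smooth functions. That the first vector is
  only rescaled is what later keeps the symmetry axis as first frame vector.\<close>

lemma smooth_orthonormalization:
  assumes "open U" "U \<subseteq> V" "\<And>i. smooth_on U (u i)"
    and indep: "\<And>w. w \<in> U \<Longrightarrow> indep3 (u 1 w) (u 2 w) (u 3 w)"
  obtains e where "\<And>i. smooth_on U (e i)" "\<And>w. w \<in> U \<Longrightarrow> onb (h w) (\<lambda>i. e i w)"
    "\<And>w. w \<in> U \<Longrightarrow> e 1 w = (1 / sqrt (h w (u 1 w) (u 1 w))) *\<^sub>R u (1::3) w"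
proof -
  have ind: "x = 0 \<and> y = 0 \<and> z = 0" if "w \<in> U" "x *\<^sub>R u 1 w + y *\<^sub>R u 2 w + z *\<^sub>R u 3 w = 0" for w x y z
    using indep[OF that(1)] that(2) unfolding indep3_def by blast
  define N where "N Y w = (1 / sqrt (h w (Y w) (Y w))) *\<^sub>R Y w" for Y w
  have pos: "h w x x > 0" if "w \<in> U" "x \<noteq> 0" for w x using spd_pos[OF spd_h] that assms(2) by auto
  have sN: "smooth_on U (N Y)" if "smooth_on U Y" and nz: "\<And>w. w \<in> U \<Longrightarrow> Y w \<noteq> 0" for Y
  proof -
    have p: "h w (Y w) (Y w) > 0" "sqrt (h w (Y w) (Y w)) \<noteq> 0" if "w \<in> U" for w
      using pos[OF that nz[OF that]] by auto
    show ?thesis unfolding N_def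
      by (intro smooth_on_scaleR smooth_on_divide smooth_on_const smooth_on_sqrt smooth_h_fields assms that p)
  qed
  have unit: "h w (N Y w) (N Y w) = 1" if "w \<in> U" "Y w \<noteq> 0" for Y w
    using spd_h[of w] that assms(2) pos[OF that]
    by (auto simp: N_def spd_simps[of "h w"] power2_eq_square[symmetric])
  define e1 where "e1 = N (u 1)"
  define v2 where "v2 w = u 2 w - h w (u 2 w) (e1 w) *\<^sub>R e1 w" for w
  define e2 where "e2 = N v2"
  define v3 where "v3 w = u 3 w - h w (u 3 w) (e1 w) *\<^sub>R e1 w - h w (u 3 w) (e2 w) *\<^sub>R e2 w" for w
  define e3 where "e3 = N v3"
  have n1: "u 1 w \<noteq> 0" if "w \<in> U" for w using ind[OF that, of 1 0 0] by auto
  have s1: "smooth_on U e1" unfolding e1_def using n1 by (intro sN assms) auto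
  have n2: "v2 w \<noteq> 0" if "w \<in> U" for w
  proof
    assume "v2 w = 0"
    then have "(- h w (u 2 w) (e1 w) / sqrt (h w (u 1 w) (u 1 w))) *\<^sub>R u 1 w + 1 *\<^sub>R u 2 w + 0 *\<^sub>R u 3 w = 0"
      by (simp add: v2_def e1_def N_def)
    then show False using ind[OF that] by fastforce
  qed
  have sv2: "smooth_on U v2" unfolding v2_def by (intro smooth_on_diff smooth_on_scaleR smooth_h_fields assms s1)
  have s2: "smooth_on U e2" unfolding e2_def using n2 sv2 by (intro sN) auto
  have n3: "v3 w \<noteq> 0" if "w \<in> U" for w
  proof
    assume "v3 w = 0"
    moreover define p where "p = h w (u 3 w) (e1 w)"
    moreover define q where "q = h w (u 3 w) (e2 w) / sqrt (h w (v2 w) (v2 w))"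
    ultimately have "u 3 w - p *\<^sub>R e1 w - q *\<^sub>R v2 w = 0"
      by (simp add: v3_def e2_def N_def)
    then have "((- p + q * h w (u 2 w) (e1 w)) / sqrt (h w (u 1 w) (u 1 w))) *\<^sub>R u 1 w + (- q) *\<^sub>R u 2 w + 1 *\<^sub>R u 3 w = 0"
      by (simp add: v2_def e1_def N_def algebra_simps add_divide_distrib diff_divide_distrib)
    then show False using ind[OF that] by fastforce
  qed
  have sv3: "smooth_on U v3" unfolding v3_def by (intro smooth_on_diff smooth_on_scaleR smooth_h_fields assms s1 s2)
  have s3: "smooth_on U e3" unfolding e3_def using n3 sv3 by (intro sN) auto
  define e where "e i = (if i = 1 then e1 else if i = 2 then e2 else e3)" for i :: 3
  have "onb (h w) (\<lambda>i. e i w)" if "w \<in> U" for w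
  proof -
    have g: "spd (h w)" using spd_h that assms(2) by auto
    have u: "h w (e1 w) (e1 w) = 1" "h w (e2 w) (e2 w) = 1" "h w (e3 w) (e3 w) = 1"
      using unit[OF that] n1[OF that] n2[OF that] n3[OF that] by (auto simp: e1_def e2_def e3_def)
    have "h w (v2 w) (e1 w) = 0" by (simp add: v2_def spd_simps[OF g] u)
    then have 12: "h w (e2 w) (e1 w) = 0" by (simp add: e2_def N_def spd_simps[OF g])
    have "h w (v3 w) (e1 w) = 0" "h w (v3 w) (e2 w) = 0"
      by (simp_all add: v3_def spd_simps[OF g] u 12 spd_sym[OF g, of "e1 w" "e2 w"])
    then have 13: "h w (e3 w) (e1 w) = 0" "h w (e3 w) (e2 w) = 0" by (simp_all add: e3_def N_def spd_simps[OF g])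
    show ?thesis unfolding onb_def e_def delta_def
      using u 12 13 spd_sym[OF g, of "e1 w" "e2 w"] spd_sym[OF g, of "e1 w" "e3 w"] spd_sym[OF g, of "e2 w" "e3 w"]
      by (simp add: forall_3)
  qed
  moreover have "smooth_on U (e i)" for i using s1 s2 s3 by (simp add: e_def)
  ultimately show ?thesis by (intro that[of e]) (auto simp: e_def e1_def N_def)
qed

end

section \<open>Structure equations in a moving orthonormal frame\<close>

locale framed_hypersurface = hypersurface +
  fixes e :: "3 \<Rightarrow> real^3 \<Rightarrow> real^3"
  assumes smooth_e: "\<And>i. smooth_on V (e i)"
    and onb_e: "\<And>w. w \<in> V \<Longrightarrow> onb (h w) (\<lambda>i. e i w)"
begin

definition E :: "3 \<Rightarrow> real^3 \<Rightarrow> real^4" where "E i w = fd f w (e i w)"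
definition A :: "3 \<Rightarrow> 3 \<Rightarrow> 3 \<Rightarrow> real^3 \<Rightarrow> real" where
  "A i j k w = h w (conn (e j) w (e i w)) (e k w)"
definition Sm :: "3 \<Rightarrow> 3 \<Rightarrow> real^3 \<Rightarrow> real" where "Sm i k w = h w (S w (e i w)) (e k w)"

lemma smooth_E: "smooth_on V (E i)"
  unfolding E_def by (intro smooth_on_fd smooth_f smooth_e)

lemma e_expand: "w \<in> V \<Longrightarrow> x = (\<Sum>k\<in>UNIV. h w x (e k w) *\<^sub>R e k w)"
  using onb_expand[OF spd_h onb_e] by simp

lemma df_expand: "w \<in> V \<Longrightarrow> fd f w x = (\<Sum>k\<in>UNIV. h w x (e k w) *\<^sub>R E k w)"
  by (subst e_expand[of w x]) (auto simp: E_def linear_sum[OF linear_df] linear_scale[OF linear_df])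

lemma h_e: "w \<in> V \<Longrightarrow> h w (e i w) (e j w) = delta i j"
  using onb_e by (simp add: onb_def)

lemma E_xi_independent:
  assumes "w \<in> V" "(\<Sum>k\<in>UNIV. c k *\<^sub>R E k w) + r *\<^sub>R \<xi> w = 0"
  shows "c k = 0" "r = 0"
proof -
  have "fd f w (\<Sum>k\<in>UNIV. c k *\<^sub>R e k w) + r *\<^sub>R \<xi> w = 0"
    using assms by (simp add: E_def linear_sum[OF linear_df] linear_scale[OF linear_df])
  from df_xi_independent[OF assms(1) this] have *: "(\<Sum>k\<in>UNIV. c k *\<^sub>R e k w) = 0" "r = 0" by auto
  have "h w (\<Sum>k\<in>UNIV. c k *\<^sub>R e k w) (e k w) = c k"
    by (simp add: spd_simps[OF spd_h[OF assms(1)]] h_e[OF assms(1)])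
  then show "c k = 0" using * by (simp add: spd_simps[OF spd_h[OF assms(1)]])
  show "r = 0" by fact
qed

lemma E_xi_unique:
  assumes "w \<in> V" "(\<Sum>k\<in>UNIV. c k *\<^sub>R E k w) + r *\<^sub>R \<xi> w = (\<Sum>k\<in>UNIV. c' k *\<^sub>R E k w) + r' *\<^sub>R \<xi> w"
  shows "c k = c' k" "r = r'"
proof -
  have "(\<Sum>k\<in>UNIV. (c k - c' k) *\<^sub>R E k w) + (r - r') *\<^sub>R \<xi> w = 0"
    using assms(2) by (simp add: sum_subtractf algebra_simps)
  from E_xi_independent[OF assms(1) this] show "c k = c' k" "r = r'" by auto
qed

lemma dE:
  assumes "w \<in> V"
  shows "fd (E j) w (e i w) = (\<Sum>k\<in>UNIV. A i j k w *\<^sub>R E k w) + delta i j *\<^sub>R \<xi> w"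
proof -
  have "fd (E j) w (e i w) = fd f w (conn (e j) w (e i w)) + h w (e i w) (e j w) *\<^sub>R \<xi> w"
    unfolding E_def by (rule Gauss_formula(1)[OF smooth_e order_refl assms])
  then show ?thesis
    using df_expand[OF assms, of "conn (e j) w (e i w)"] h_e[OF assms] by (simp add: A_def)
qed

lemma dxi:
  assumes "w \<in> V"
  shows "fd \<xi> w (e i w) = - (\<Sum>k\<in>UNIV. Sm i k w *\<^sub>R E k w)"
  using Weingarten[OF assms] df_expand[OF assms, of "S w (e i w)"] by (simp add: Sm_def)

lemma A_unique:
  assumes "w \<in> V" "fd (E j) w (e i w) = (\<Sum>k\<in>UNIV. c k *\<^sub>R E k w) + r *\<^sub>R \<xi> w"
  shows "A i j k w = c k"
  using E_xi_unique(1)[OF assms(1), of "\<lambda>k. A i j k w" "delta i j" c r] dE[OF assms(1), of j i] assms(2) by simp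

lemma smooth_coefficients:
  assumes "smooth_on V v"
  obtains c r where "\<And>k. smooth_on V (c k)" "smooth_on V r"
    "\<And>w. w \<in> V \<Longrightarrow> v w = (\<Sum>k\<in>UNIV. c k w *\<^sub>R E k w) + r w *\<^sub>R \<xi> w"
proof -
  have ind: "indep4 (E 1 w) (E 2 w) (E 3 w) (\<xi> w)" if "w \<in> V" for w
    unfolding indep4_def
  proof (intro allI impI)
    fix x y z t assume *: "x *\<^sub>R E 1 w + y *\<^sub>R E 2 w + z *\<^sub>R E 3 w + t *\<^sub>R \<xi> w = 0"
    define c where "c k = (if k = 1 then x else if k = 2 then y else z)" for k :: 3
    have "(\<Sum>k\<in>UNIV. c k *\<^sub>R E k w) + t *\<^sub>R \<xi> w = 0" using * by (simp add: sum_3 c_def)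
    note z = E_xi_independent[OF that this]
    show "x = 0 \<and> y = 0 \<and> z = 0 \<and> t = 0" using z(1)[of 1] z(1)[of 2] z(1)[of 3] z(2) by (simp add: c_def)
  qed
  obtain x y z t where *: "smooth_on V x" "smooth_on V y" "smooth_on V z" "smooth_on V t"
    "\<And>w. w \<in> V \<Longrightarrow> v w = x w *\<^sub>R E 1 w + y w *\<^sub>R E 2 w + z w *\<^sub>R E 3 w + t w *\<^sub>R \<xi> w"
    by (rule smooth_independent_expand[OF smooth_E smooth_E smooth_E smooth_xi assms ind], assumption)
      (rule that; assumption)
  show ?thesis
    by (rule that[of "\<lambda>k. if k = 1 then x else if k = 2 then y else z" t]) (use * in \<open>auto simp: sum_3\<close>)
qed

lemma smooth_A: "smooth_on V (A i j k)"
proof -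
  have "smooth_on V (\<lambda>w. fd (E j) w (e i w))" by (intro smooth_on_fd smooth_E smooth_e)
  then obtain c r where c: "\<And>k. smooth_on V (c k)" "smooth_on V r"
    "\<And>w. w \<in> V \<Longrightarrow> fd (E j) w (e i w) = (\<Sum>k\<in>UNIV. c k w *\<^sub>R E k w) + r w *\<^sub>R \<xi> w"
    by (rule smooth_coefficients) (rule that; assumption)
  have "A i j k w = c k w" if "w \<in> V" for w using A_unique[OF that c(3)[OF that]] .
  then show ?thesis using c(1)[of k] smooth_on_cong by metis
qed

lemma smooth_Sm: "smooth_on V (Sm i k)"
proof -
  have "smooth_on V (\<lambda>w. fd \<xi> w (e i w))" by (intro smooth_on_fd smooth_xi smooth_e)
  then obtain c r where c: "\<And>k. smooth_on V (c k)" "smooth_on V r"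
    "\<And>w. w \<in> V \<Longrightarrow> fd \<xi> w (e i w) = (\<Sum>k\<in>UNIV. c k w *\<^sub>R E k w) + r w *\<^sub>R \<xi> w"
    by (rule smooth_coefficients) (rule that; assumption)
  have "Sm i k w = - c k w" if "w \<in> V" for w
    using E_xi_unique(1)[OF that, of "\<lambda>k. - Sm i k w" 0 "\<lambda>k. c k w" "r w" k] dxi[OF that, of i] c(3)[OF that]
    by (simp add: sum_negf)
  then show ?thesis using smooth_on_minus[OF c(1)[of k]] smooth_on_cong by metis
qed

text \<open>The induced connection is torsion-free because second derivatives of \<open>f\<close>
  commute, so its skew part in the frame is the Lie bracket.\<close>

lemma bracket:
  assumes "w \<in> V"
  shows "fd (e j) w (e i w) - fd (e i) w (e j w) = (\<Sum>k\<in>UNIV. (A i j k w - A j i k w) *\<^sub>R e k w)"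
proof -
  have "fd (e j) w (e i w) - fd (e i) w (e j w) = conn (e j) w (e i w) - conn (e i) w (e j w)"
    using Gauss_formula(2)[OF smooth_e order_refl assms] metric_conn_symmetric(2)[OF assms, of "e i w" "e j w"] by simp
  also have "\<dots> = (\<Sum>k\<in>UNIV. h w (conn (e j) w (e i w) - conn (e i) w (e j w)) (e k w) *\<^sub>R e k w)"
    by (rule e_expand[OF assms])
  finally show ?thesis by (simp add: A_def spd_simps[OF spd_h[OF assms]])
qed

lemma second_derivative_commute:
  assumes "smooth_on V u" "w \<in> V"
  shows "fd (\<lambda>q. fd u q (e j q)) w (e i w) - fd (\<lambda>q. fd u q (e i q)) w (e j w) =
    (\<Sum>k\<in>UNIV. (A i j k w - A j i k w) *\<^sub>R fd u w (e k w))"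
  using fd_Lie_bracket[OF assms(1) smooth_e smooth_e assms(2), of j i] bracket[OF assms(2), of j i]
    smooth_on_linear_fd[OF assms]
  by (simp add: linear_sum linear_scale)

lemma second_derivative_E:
  assumes "w \<in> V"
  shows "fd (\<lambda>q. fd (E l) q (e j q)) w (e i w) =
     (\<Sum>k\<in>UNIV. (fd (A j l k) w (e i w) + (\<Sum>m\<in>UNIV. A j l m w * A i m k w) - delta j l * Sm i k w) *\<^sub>R E k w)
     + A j l i w *\<^sub>R \<xi> w"
proof -
  have d: "A j l k differentiable (at w)" "E k differentiable (at w)" "\<xi> differentiable (at w)" for k
    using smooth_on_differentiable assms smooth_A smooth_E smooth_xi by blast+
  have "fd (\<lambda>q. fd (E l) q (e j q)) w (e i w) =
     fd (\<lambda>q. (\<Sum>k\<in>UNIV. A j l k q *\<^sub>R E k q) + delta j l *\<^sub>R \<xi> q) w (e i w)"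
    using d by (subst fd_cong(1)[OF open_V assms, of "\<lambda>q. (\<Sum>k\<in>UNIV. A j l k q *\<^sub>R E k q) + delta j l *\<^sub>R \<xi> q"])
      (auto simp: dE)
  also have "\<dots> = (\<Sum>k\<in>UNIV. fd (A j l k) w (e i w) *\<^sub>R E k w + A j l k w *\<^sub>R fd (E k) w (e i w)) +
     delta j l *\<^sub>R fd \<xi> w (e i w)"
    using d by (simp add: fd_add fd_sum fd_scaleR)
  also have "\<dots> = (\<Sum>k\<in>UNIV. (fd (A j l k) w (e i w) + (\<Sum>m\<in>UNIV. A j l m w * A i m k w) - delta j l * Sm i k w) *\<^sub>R E k w)
     + A j l i w *\<^sub>R \<xi> w"
    unfolding sum.distrib dE[OF assms] dxi[OF assms] frame_combination
    by (simp add: sum.distrib sum_subtractf scaleR_sum_right scaleR_add_left scaleR_diff_left)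
  finally show ?thesis .
qed

text \<open>Flat derivatives of \<open>E l\<close> commute up to the Lie bracket. The components
  along the frame give the curvature equation of the induced connection, the component along \<xi>
  gives the total symmetry of the cubic form.\<close>

lemma Gauss_Codazzi:
  assumes "w \<in> V"
  shows "fd (A j l k) w (e i w) - fd (A i l k) w (e j w) =
      (\<Sum>m\<in>UNIV. (A i j m w - A j i m w) * A m l k w) + (\<Sum>m\<in>UNIV. A i l m w * A j m k w - A j l m w * A i m k w)
      + delta j l * Sm i k w - delta i l * Sm j k w"
    and "A j l i w - A i l j w = A i j l w - A j i l w"
proof -
  let ?L = "\<lambda>k i j. fd (A j l k) w (e i w) + (\<Sum>m\<in>UNIV. A j l m w * A i m k w) - delta j l * Sm i k w"
  have "(\<Sum>k\<in>UNIV. (?L k i j - ?L k j i) *\<^sub>R E k w) + (A j l i w - A i l j w) *\<^sub>R \<xi> w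
     = (\<Sum>k\<in>UNIV. (A i j k w - A j i k w) *\<^sub>R fd (E l) w (e k w))"
    using second_derivative_commute[OF smooth_E assms, of l j i]
    by (simp add: second_derivative_E[OF assms] sum_subtractf sum.distrib algebra_simps)
  also have "\<dots> = (\<Sum>k\<in>UNIV. (\<Sum>m\<in>UNIV. (A i j m w - A j i m w) * A m l k w) *\<^sub>R E k w) + (A i j l w - A j i l w) *\<^sub>R \<xi> w"
    unfolding dE[OF assms] delta_commute[of _ l] frame_combination ..
  finally have eq: "(\<Sum>k\<in>UNIV. (?L k i j - ?L k j i) *\<^sub>R E k w) + (A j l i w - A i l j w) *\<^sub>R \<xi> w = \<dots>" .
  from E_xi_unique(1)[OF assms eq, of k] E_xi_unique(2)[OF assms eq] show "fd (A j l k) w (e i w) - fd (A i l k) w (e j w) =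
      (\<Sum>m\<in>UNIV. (A i j m w - A j i m w) * A m l k w) + (\<Sum>m\<in>UNIV. A i l m w * A j m k w - A j l m w * A i m k w)
      + delta j l * Sm i k w - delta i l * Sm j k w"
    "A j l i w - A i l j w = A i j l w - A j i l w"
    by (auto simp: sum_subtractf algebra_simps)
qed

text \<open>The same commutation for \<xi>: its component along \<xi> is the symmetry of
  \<open>S\<close>, its tangential part the Codazzi equation of \<open>S\<close>.\<close>

lemma Sm_symmetric_Codazzi:
  assumes "w \<in> V"
  shows "Sm i j w = Sm j i w"
    and "fd (Sm j k) w (e i w) - fd (Sm i k) w (e j w) =
      (\<Sum>m\<in>UNIV. (A i j m w - A j i m w) * Sm m k w) + (\<Sum>m\<in>UNIV. Sm i m w * A j m k w - Sm j m w * A i m k w)"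
proof -
  have d: "Sm j k differentiable (at w)" "E k differentiable (at w)" for j k
    using smooth_on_differentiable assms smooth_Sm smooth_E by blast+
  have 1: "fd (\<lambda>q. fd \<xi> q (e j q)) w (e i w) =
     (\<Sum>k\<in>UNIV. - (fd (Sm j k) w (e i w) + (\<Sum>m\<in>UNIV. Sm j m w * A i m k w)) *\<^sub>R E k w) - Sm j i w *\<^sub>R \<xi> w" for i j
  proof -
    have "fd (\<lambda>q. fd \<xi> q (e j q)) w (e i w) = fd (\<lambda>q. - (\<Sum>k\<in>UNIV. Sm j k q *\<^sub>R E k q)) w (e i w)"
      using d by (subst fd_cong(1)[OF open_V assms, of "\<lambda>q. - (\<Sum>k\<in>UNIV. Sm j k q *\<^sub>R E k q)"])
        (auto simp: dxi)
    also have "\<dots> = - (\<Sum>k\<in>UNIV. fd (Sm j k) w (e i w) *\<^sub>R E k w + Sm j k w *\<^sub>R fd (E k) w (e i w))"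
      using d by (simp add: fd_minus fd_sum fd_scaleR)
    also have "\<dots> = (\<Sum>k\<in>UNIV. - (fd (Sm j k) w (e i w) + (\<Sum>m\<in>UNIV. Sm j m w * A i m k w)) *\<^sub>R E k w) - Sm j i w *\<^sub>R \<xi> w"
      unfolding sum.distrib dE[OF assms] frame_combination
      by (simp add: sum.distrib sum_subtractf sum_negf scaleR_add_left scaleR_diff_left)
    finally show ?thesis .
  qed
  let ?L = "\<lambda>k i j. fd (Sm j k) w (e i w) + (\<Sum>m\<in>UNIV. Sm j m w * A i m k w)"
  have "(\<Sum>k\<in>UNIV. (?L k j i - ?L k i j) *\<^sub>R E k w) + (Sm i j w - Sm j i w) *\<^sub>R \<xi> w
     = (\<Sum>k\<in>UNIV. (A i j k w - A j i k w) *\<^sub>R fd \<xi> w (e k w))"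
    using second_derivative_commute[OF smooth_xi assms, of j i]
    by (simp add: 1 sum_subtractf sum_negf algebra_simps sum.distrib)
  also have "\<dots> = (\<Sum>k\<in>UNIV. - (\<Sum>m\<in>UNIV. (A i j m w - A j i m w) * Sm m k w) *\<^sub>R E k w) + 0 *\<^sub>R \<xi> w"
    unfolding dxi[OF assms] by (simp add: sum_3 algebra_simps)
  finally have eq: "(\<Sum>k\<in>UNIV. (?L k j i - ?L k i j) *\<^sub>R E k w) + (Sm i j w - Sm j i w) *\<^sub>R \<xi> w = \<dots>" .
  from E_xi_unique(1)[OF assms eq, of k] E_xi_unique(2)[OF assms eq] show "Sm i j w = Sm j i w"
    "fd (Sm j k) w (e i w) - fd (Sm i k) w (e j w) =
      (\<Sum>m\<in>UNIV. (A i j m w - A j i m w) * Sm m k w) + (\<Sum>m\<in>UNIV. Sm i m w * A j m k w - Sm j m w * A i m k w)"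
    by (auto simp: sum_subtractf algebra_simps)
qed

text \<open>These are the components \<open>h(K(e\<^sub>i, e\<^sub>j), e\<^sub>k)\<close>: in an
  orthonormal frame the Levi-Civita coefficients are skew in \<open>j\<close> and \<open>k\<close>,
  so symmetrising \<open>A\<close> removes them. The difference tensor is thus reached without
  computing Christoffel symbols.\<close>

definition C :: "3 \<Rightarrow> 3 \<Rightarrow> 3 \<Rightarrow> real^3 \<Rightarrow> real" where "C i j k w = (A i j k w + A i k j w) / 2"

lemma smooth_C: "smooth_on V (C i j k)"
  unfolding C_def by (intro smooth_on_divide smooth_on_add smooth_A smooth_on_const open_V) auto

lemma C_symmetric:
  assumes "w \<in> V"
  shows "C i j k w = C i k j w" "C i j k w = C j i k w"
  using Gauss_Codazzi(2)[OF assms, of j k i] by (auto simp: C_def)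

text \<open>The trace of the connection is the logarithmic derivative of the volume spanned by the
  frame and \<xi>, and the Blaschke normalisation fixes this volume up to sign.\<close>

lemma C_apolar:
  assumes "w \<in> V"
  shows "(\<Sum>k\<in>UNIV. C i k k w) = 0"
proof -
  define R where "R k = (if k = 1 then E 1 else if k = 2 then E 2 else if k = 3 then E 3 else \<xi>)" for k :: 4
  define \<Delta> where "\<Delta> q = det (\<chi> k. R k q)" for q
  have R: "R 1 = E 1" "R 2 = E 2" "R 3 = E 3" "R 4 = \<xi>" by (simp_all add: R_def)
  have sR: "smooth_on V (R k)" for k using smooth_E smooth_xi by (auto simp: R_def)
  have "((\<lambda>q. det (\<chi> i. R i q)) has_derivative
      (\<lambda>v. \<Sum>k\<in>UNIV. det (\<chi> i. if i = k then fd (R k) w v else R i w))) (at w)"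
    using smooth_on_has[OF sR assms] by (rule has_derivative_det_rows)
  then have d: "(\<Delta> has_derivative (\<lambda>v. \<Sum>k\<in>UNIV. det (\<chi> i. if i = k then fd (R k) w v else R i w))) (at w)"
    by (simp add: \<Delta>_def[abs_def])
  have row: "det (\<chi> i. if i = k then (\<Sum>m\<in>UNIV. c m *\<^sub>R R m w) else R i w) = c k * \<Delta> w" for k c
    unfolding \<Delta>_def by (rule det_row_combination)
  \<comment> \<open>Row \<open>k\<close> holds the derivative of the \<open>k\<close>-th vector in
    terms of all four. Only the diagonal enters, and \<xi> contributes 0 there since its derivative
    is tangential.\<close>
  define c :: "4 \<Rightarrow> 4 \<Rightarrow> real" where "c k m = (if k = 1 then (if m = 1 then A i 1 1 w else if m = 2 then A i 1 2 w else if m = 3 then A i 1 3 w else delta i 1)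
    else if k = 2 then (if m = 1 then A i 2 1 w else if m = 2 then A i 2 2 w else if m = 3 then A i 2 3 w else delta i 2)
    else if k = 3 then (if m = 1 then A i 3 1 w else if m = 2 then A i 3 2 w else if m = 3 then A i 3 3 w else delta i 3)
    else (if m = 1 then - Sm i 1 w else if m = 2 then - Sm i 2 w else if m = 3 then - Sm i 3 w else 0))" for k m
  have "\<forall>k. fd (R k) w (e i w) = (\<Sum>m\<in>UNIV. c k m *\<^sub>R R m w)"
    unfolding forall_4 R dE[OF assms] dxi[OF assms] by (simp add: sum_4 sum_3 c_def R)
  then have Rk: "fd (R k) w (e i w) = (\<Sum>m\<in>UNIV. c k m *\<^sub>R R m w)" for k by blast
  have "fd \<Delta> w (e i w) = (\<Sum>k\<in>UNIV. c k k * \<Delta> w)"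
    unfolding fd_eq[OF d] Rk row ..
  also have "\<dots> = (\<Sum>k\<in>UNIV. A i k k w) * \<Delta> w"
    by (simp add: sum_4 sum_3 c_def algebra_simps)
  finally have 1: "fd \<Delta> w (e i w) = (\<Sum>k\<in>UNIV. A i k k w) * \<Delta> w" .
  \<comment> \<open>The sign of the determinant is unknown, so its square is differentiated
    instead.\<close>
  have one: "\<Delta> q * \<Delta> q = 1" if "q \<in> V" for q
  proof -
    have "orthonormal (h q) (\<lambda>i. e i q)"
      using orthonormal_iff_onb[OF spd_h[OF that]] onb_e[OF that] by simp
    then have "\<bar>det (vector [E 1 q, E 2 q, E 3 q, \<xi> q] :: real^4^4)\<bar> = 1"
      using blaschke that unfolding blaschke_hypersurface_def E_def by blast
    moreover have "(vector [E 1 q, E 2 q, E 3 q, \<xi> q] :: real^4^4) = (\<chi> k. R k q)"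
      unfolding vector4_rows by (simp add: vec_eq_iff R_def)
    ultimately have "\<bar>\<Delta> q\<bar> = 1" by (simp add: \<Delta>_def)
    then show ?thesis by (metis abs_mult_self_eq mult_1)
  qed
  have dd: "\<Delta> differentiable (at w)" using d by (auto simp: differentiable_def)
  have "fd (\<lambda>q. \<Delta> q * \<Delta> q) w (e i w) = fd (\<lambda>q. 1 :: real) w (e i w)"
    using one by (subst fd_cong(1)[OF open_V assms, of "\<lambda>q. 1"]) auto
  then have "fd \<Delta> w (e i w) * \<Delta> w = 0" by (auto simp: fd_mult[OF dd dd])
  moreover have "\<Delta> w \<noteq> 0" using one[OF assms] by auto
  ultimately show ?thesis using 1 by (simp add: C_def)
qed

lemma metric_derivative:
  assumes w: "w \<in> V"
  shows "linear (fd (\<lambda>q. h q x y) w)" "linear (\<lambda>x. fd (\<lambda>q. h q x y) w z)" "linear (\<lambda>y. fd (\<lambda>q. h q x y) w z)"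
proof -
  have d: "(\<lambda>q. h q x y) differentiable (at w)" for x y
    using smooth_on_differentiable[OF smooth_h w] .
  show "linear (fd (\<lambda>q. h q x y) w)" using smooth_on_linear_fd[OF smooth_h w] .
  have c: "fd (\<lambda>q. h q x y) w z = fd g w z" if "\<And>q. q \<in> V \<Longrightarrow> g q = h q x y" "g differentiable (at w)" for g x y
    using fd_cong(1)[OF open_V w that] by simp
  show "linear (\<lambda>x. fd (\<lambda>q. h q x y) w z)"
  proof (rule linearI)
    show "fd (\<lambda>q. h q (x + x') y) w z = fd (\<lambda>q. h q x y) w z + fd (\<lambda>q. h q x' y) w z" for x x'
      using d by (subst c[of "\<lambda>q. h q x y + h q x' y"]) (auto simp: fd_add spd_simps[OF spd_h])
    show "fd (\<lambda>q. h q (r *\<^sub>R x) y) w z = r *\<^sub>R fd (\<lambda>q. h q x y) w z" for x r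
      using d by (subst c[of "\<lambda>q. r * h q x y"]) (auto simp: fd_mult spd_simps[OF spd_h])
  qed
  show "linear (\<lambda>y. fd (\<lambda>q. h q x y) w z)"
  proof (rule linearI)
    show "fd (\<lambda>q. h q x (y + y')) w z = fd (\<lambda>q. h q x y) w z + fd (\<lambda>q. h q x y') w z" for y y'
      using d by (subst c[of "\<lambda>q. h q x y + h q x y'"]) (auto simp: fd_add spd_simps[OF spd_h])
    show "fd (\<lambda>q. h q x (r *\<^sub>R y)) w z = r *\<^sub>R fd (\<lambda>q. h q x y) w z" for y r
      using d by (subst c[of "\<lambda>q. r * h q x y"]) (auto simp: fd_mult spd_simps[OF spd_h])
  qed
qed

text \<open>By uniqueness of the Levi-Civita connection, whose defining properties hold for \<open>\<nabla> - C\<close>.\<close>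

lemma K_eq:
  assumes w: "w \<in> V"
  shows "K w x y = (\<Sum>k\<in>UNIV. (\<Sum>i\<in>UNIV. \<Sum>j\<in>UNIV. C i j k w * h w x (e i w) * h w y (e j w)) *\<^sub>R e k w)"
proof -
  note g = spd_h[OF w] and he = h_e[OF w]
  define Kt where "Kt x y = (\<Sum>k\<in>UNIV. (\<Sum>i\<in>UNIV. \<Sum>j\<in>UNIV. C i j k w * h w x (e i w) * h w y (e j w)) *\<^sub>R e k w)" for x y
  define \<Gamma> where "\<Gamma> x y = conn (\<lambda>_. y) w x - Kt x y" for x y
  have lin: "linear (\<lambda>x. Kt x y)" "linear (Kt x)" for x y
    unfolding Kt_def by (auto intro!: linearI simp: spd_simps[OF g] algebra_simps sum.distrib scaleR_sum_left
        scaleR_sum_right sum_distrib_left)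
  have lG: "linear (\<lambda>x. \<Gamma> x y)" "linear (\<Gamma> x)" for x y
  proof -
    have "(\<lambda>y. conn (\<lambda>_. y) w x) = (\<lambda>y. conn (\<lambda>_. x) w y)" using metric_conn_symmetric(2)[OF w] by auto
    then show "linear (\<lambda>x. \<Gamma> x y)" "linear (\<Gamma> x)"
      unfolding \<Gamma>_def using metric_linear(2)[OF w] lin by (auto intro: linear_compose_sub)
  qed
  have Kt_e: "h w (Kt (e i w) (e j w)) (e k w) = C i j k w" for i j k
    unfolding Kt_def by (simp add: spd_simps[OF g] he)
  have sym: "Kt x y = Kt y x" for x y
  proof -
    have "(\<Sum>i\<in>UNIV. \<Sum>j\<in>UNIV. C i j k w * h w x (e i w) * h w y (e j w)) =
      (\<Sum>i\<in>UNIV. \<Sum>j\<in>UNIV. C i j k w * h w y (e i w) * h w x (e j w))" for k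
      by (subst sum.swap) (simp add: C_symmetric(2)[OF w] mult_ac)
    then show ?thesis by (simp add: Kt_def)
  qed
  have met: "fd (\<lambda>q. h q x y) w z = h w (\<Gamma> z x) y + h w x (\<Gamma> z y)" for x y z
  proof -
    have 3: "fd (\<lambda>q. h q (e j w) (e k w)) w (e i w) = h w (\<Gamma> (e i w) (e j w)) (e k w) + h w (e j w) (\<Gamma> (e i w) (e k w))" for i j k
    proof -
      have "fd (\<lambda>q. h q (e j q) (e k q)) w (e i w) = fd (\<lambda>q. delta j k) w (e i w)"
        using h_e by (subst fd_cong(1)[OF open_V w, of "\<lambda>q. delta j k"]) auto
      then have 0: "fd (\<lambda>q. h q (e j w) (e k w)) w (e i w) = - h w (fd (e j) w (e i w)) (e k w) - h w (e j w) (fd (e k) w (e i w))"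
        using smooth_h_fields(2)[OF smooth_e smooth_e order_refl w, of j k "e i w"] by simp
      have "A i j k w = h w (conn (\<lambda>_. e j w) w (e i w)) (e k w) + h w (fd (e j) w (e i w)) (e k w)" for i j k
        unfolding A_def Gauss_formula(2)[OF smooth_e order_refl w] by (simp add: spd_simps[OF g])
      from this[of i j k] this[of i k j] show ?thesis
        unfolding 0 \<Gamma>_def spd_sym[OF g, of "e j w" "fd (e k) w (e i w)"]
          spd_sym[OF g, of "e j w" "conn (\<lambda>_. e k w) w (e i w) - Kt (e i w) (e k w)"]
        using Kt_e[of i j k] Kt_e[of i k j]
        by (simp add: spd_simps[OF g] C_def)
    qed
    have l: "linear (\<lambda>z. h w (\<Gamma> z x) y + h w x (\<Gamma> z y))" "linear (\<lambda>x. h w (\<Gamma> z x) y + h w x (\<Gamma> z y))"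
      "linear (\<lambda>y. h w (\<Gamma> z x) y + h w x (\<Gamma> z y))" for x y z
      by (auto intro!: linearI simp: spd_simps[OF g] linear_add[OF lG(1)] linear_add[OF lG(2)]
          linear_scale[OF lG(1)] linear_scale[OF lG(2)] algebra_simps)
    note o = onb_linear_eqI[OF g onb_e[OF w]]
    have 2: "fd (\<lambda>q. h q (e j w) (e k w)) w z = h w (\<Gamma> z (e j w)) (e k w) + h w (e j w) (\<Gamma> z (e k w))" for j k z
      by (rule o[OF metric_derivative(1)[OF w] l(1) 3])
    have 1: "fd (\<lambda>q. h q x (e k w)) w z = h w (\<Gamma> z x) (e k w) + h w x (\<Gamma> z (e k w))" for x k z
      by (rule o[OF metric_derivative(2)[OF w] l(2) 2])
    show ?thesis by (rule o[OF metric_derivative(3)[OF w] l(3) 1])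
  qed
  have "christoffel h w = \<Gamma>"
    unfolding christoffel_def
  proof (rule the_equality)
    show "(\<forall>x y. \<Gamma> x y = \<Gamma> y x) \<and> (\<forall>z x y. fd (\<lambda>q. h q x y) w z = h w (\<Gamma> z x) y + h w x (\<Gamma> z y))"
      using met sym metric_conn_symmetric(2)[OF w] by (auto simp: \<Gamma>_def)
  next
    fix \<Gamma>' assume a: "(\<forall>x y. \<Gamma>' x y = \<Gamma>' y x) \<and> (\<forall>z x y. fd (\<lambda>q. h q x y) w z = h w (\<Gamma>' z x) y + h w x (\<Gamma>' z y))"
    define d where "d x y = \<Gamma>' x y - \<Gamma> x y" for x y
    have ds: "d x y = d y x" for x y
      using a sym metric_conn_symmetric(2)[OF w] by (auto simp: d_def \<Gamma>_def)
    have da: "h w (d z x) y = - h w (d z y) x" for x y z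
      using a met[where x = x and y = y and z = z] spd_sym[OF g, of x "d z y"]
      by (auto simp: d_def spd_simps[OF g])
    \<comment> \<open>An expression symmetric in its first two arguments and skew in its last two
      vanishes, by going around the permutations.\<close>
    have "h w (d x y) z = 0" for x y z
      using da[of x y z] da[of z x y] da[of y z x] unfolding ds[of x z] ds[of z y] ds[of y x] by linarith
    then have "d x y = 0" for x y using spd_zeroI[OF g] by blast
    then show "\<Gamma>' = \<Gamma>" by (auto simp: d_def fun_eq_iff)
  qed
  then show ?thesis
    by (simp add: difference_tensor_def levi_civita_def \<Gamma>_def Kt_def)
qed

lemma K_e: "w \<in> V \<Longrightarrow> K w (e i w) (e j w) = (\<Sum>k\<in>UNIV. C i j k w *\<^sub>R e k w)"
  by (simp add: K_eq h_e)

lemma h_K_e: "w \<in> V \<Longrightarrow> h w (K w (e i w) (e j w)) (e k w) = C i j k w"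
  by (simp add: K_e spd_simps[OF spd_h] h_e)

end

section \<open>Cubic forms with a rotational symmetry\<close>

lemma delta_sum' [simp]: "(\<Sum>k\<in>UNIV. delta k i * g k) = g i"
  by (simp add: delta_def if_distrib[of "\<lambda>x. x * _"] cong: if_cong)

text \<open>A single tangent space with its metric, difference tensor and shape operator: the
  discussion of symmetry groups is linear algebra at a point.\<close>

locale cubic_data =
  fixes g :: "real^3 \<Rightarrow> real^3 \<Rightarrow> real" and K :: "real^3 \<Rightarrow> real^3 \<Rightarrow> real^3" and S :: "real^3 \<Rightarrow> real^3"
  assumes g: "spd g" and K: "bilinear K" and K_sym: "K x y = K y x" and C_sym: "g (K x y) z = g (K x z) y"
    and apolar: "onb g e \<Longrightarrow> (\<Sum>k\<in>UNIV. g (K x (e k)) (e k)) = 0"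
    and S: "linear S" and S_sym: "g (S x) y = g x (S y)"
begin

definition sym_group :: "(real^3 \<Rightarrow> real^3) set" where
  "sym_group = {R. linear R \<and> det (matrix R) > 0 \<and> (\<forall>x y. g (R x) (R y) = g x y) \<and>
     (\<forall>x y. K (R x) (R y) = R (K x y)) \<and> (\<forall>x. S (R x) = R (S x))}"

text \<open>The normal form before \<open>e 2\<close>, \<open>e 3\<close> are turned into the
  position \<open>n = 0\<close>; in this generality it survives every change of \<open>e 2\<close>,
  \<open>e 3\<close>. The number \<open>l\<close> may still have either sign.\<close>

definition adapted :: "(3 \<Rightarrow> real^3) \<Rightarrow> real \<Rightarrow> real \<Rightarrow> real \<Rightarrow> real \<Rightarrow> real \<Rightarrow> bool" where
  "adapted e l m n a b \<longleftrightarrow> onb g e \<and>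
     K (e 1) (e 1) = (2 * l) *\<^sub>R e 1 \<and> K (e 1) (e 2) = (- l) *\<^sub>R e 2 \<and> K (e 1) (e 3) = (- l) *\<^sub>R e 3 \<and>
     K (e 2) (e 2) = (- l) *\<^sub>R e 1 + m *\<^sub>R e 2 + n *\<^sub>R e 3 \<and> K (e 2) (e 3) = n *\<^sub>R e 2 - m *\<^sub>R e 3 \<and>
     K (e 3) (e 3) = (- l) *\<^sub>R e 1 - m *\<^sub>R e 2 - n *\<^sub>R e 3 \<and>
     S (e 1) = a *\<^sub>R e 1 \<and> S (e 2) = b *\<^sub>R e 2 \<and> S (e 3) = b *\<^sub>R e 3"

lemma adaptedD:
  assumes "adapted e l m n a b"
  shows "onb g e" "K (e 1) (e 1) = (2 * l) *\<^sub>R e 1" "K (e 1) (e 2) = (- l) *\<^sub>R e 2" "K (e 1) (e 3) = (- l) *\<^sub>R e 3"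
    "K (e 2) (e 2) = (- l) *\<^sub>R e 1 + m *\<^sub>R e 2 + n *\<^sub>R e 3" "K (e 2) (e 3) = n *\<^sub>R e 2 - m *\<^sub>R e 3"
    "K (e 3) (e 3) = (- l) *\<^sub>R e 1 - m *\<^sub>R e 2 - n *\<^sub>R e 3"
    "S (e 1) = a *\<^sub>R e 1" "S (e 2) = b *\<^sub>R e 2" "S (e 3) = b *\<^sub>R e 3"
  using assms by (auto simp: adapted_def)

lemmas K_simps = bilinear_ladd[OF K] bilinear_radd[OF K] bilinear_lmul[OF K] bilinear_rmul[OF K]
  bilinear_lneg[OF K] bilinear_rneg[OF K] bilinear_lsub[OF K] bilinear_rsub[OF K] bilinear_lzero[OF K] bilinear_rzero[OF K]

lemmas S_simps = linear_add[OF S] linear_scale[OF S] linear_neg[OF S] linear_diff[OF S]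

lemma onb_vectorI:
  assumes "onb g e" "g v (e 1) = x" "g v (e 2) = y" "g v (e 3) = z"
  shows "v = x *\<^sub>R e 1 + y *\<^sub>R e 2 + z *\<^sub>R e 3"
  by (subst onb_expand[OF g assms(1), of v]) (simp add: sum_3 assms(2-4))

lemma onb_bilinear_equivariant:
  assumes e: "onb g e" and R: "linear R"
    and "K (R (e 1)) (R (e 1)) = R (K (e 1) (e 1))" "K (R (e 1)) (R (e 2)) = R (K (e 1) (e 2))"
    "K (R (e 1)) (R (e 3)) = R (K (e 1) (e 3))" "K (R (e 2)) (R (e 2)) = R (K (e 2) (e 2))"
    "K (R (e 2)) (R (e 3)) = R (K (e 2) (e 3))" "K (R (e 3)) (R (e 3)) = R (K (e 3) (e 3))"
  shows "K (R x) (R y) = R (K x y)"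
proof -
  have 0: "\<forall>i j. K (R (e i)) (R (e j)) = R (K (e i) (e j))"
    using assms(3-8) by (simp add: forall_3 K_sym[of "R (e 2)" "R (e 1)"] K_sym[of "R (e 3)" "R (e 1)"]
        K_sym[of "R (e 3)" "R (e 2)"] K_sym[of "e 2" "e 1"] K_sym[of "e 3" "e 1"] K_sym[of "e 3" "e 2"])
  have 1: "K (R (e i)) (R y) = R (K (e i) y)" for i y
    by (rule onb_linear_eqI[OF g e]) (use 0 in \<open>auto intro!: linearI simp: K_simps linear_add[OF R] linear_scale[OF R]\<close>)
  show ?thesis
    by (rule onb_linear_eqI[OF g e]) (use 1 in \<open>auto intro!: linearI simp: K_simps linear_add[OF R] linear_scale[OF R]\<close>)
qed

text \<open>The right-hand side is the determinant of \<open>R\<close> in the basis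
  \<open>e\<close>; the change of basis \<open>P\<close> cancels. So orientation can be checked in
  the frame.\<close>

lemma det_matrix_onb:
  assumes e: "onb g e" and R: "linear R"
  shows "det (matrix R) = det (\<chi> i j. g (R (e j)) (e i) :: real^3^3)"
proof -
  define P :: "real^3^3" where "P = (\<chi> i j. e j $ i)"
  define M :: "real^3^3" where "M = (\<chi> i j. g (R (e j)) (e i))"
  have Pv: "P *v v = (\<Sum>k\<in>UNIV. v $ k *\<^sub>R e k)" for v
    by (simp add: P_def vec_eq_iff matrix_vector_mult_def mult.commute)
  have "v = 0" if "P *v v = 0" for v
  proof -
    have "g (P *v v) (e k) = v $ k" for k
      unfolding Pv using e by (simp add: spd_simps[OF g] onb_def)
    then show ?thesis using that by (simp add: vec_eq_iff spd_simps[OF g])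
  qed
  then have "det P \<noteq> 0"
    unfolding invertible_det_nz[symmetric] by (simp add: invertible_left_inverse matrix_left_invertible_ker)
  moreover have "matrix R ** P = P ** M"
  proof -
    have Rv: "R (e j) $ i = (\<Sum>k\<in>UNIV. g (R (e j)) (e k) * e k $ i)" for i j
      using arg_cong[OF onb_expand[OF g e, of "R (e j)"], of "\<lambda>x. x $ i"] by simp
    have "matrix R *v e j = R (e j)" for j using R by (rule matrix_works_real)
    then have "(\<Sum>k\<in>UNIV. matrix R $ i $ k * e j $ k) = R (e j) $ i" for i j
      by (simp add: matrix_vector_mult_def vec_eq_iff)
    then show ?thesis using Rv
      by (simp add: matrix_matrix_mult_def vec_eq_iff P_def M_def mult.commute)
  qed
  then have "det (matrix R) * det P = det P * det M" by (metis det_mul)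
  ultimately show ?thesis by (simp add: M_def)
qed

lemma frame_map:
  assumes e: "onb g e" and o: "onb g u"
  obtains R where "linear R" "\<And>k. R (e k) = u k" "\<And>x y. g (R x) (R y) = g x y"
proof
  define R where "R x = (\<Sum>k\<in>UNIV. g x (e k) *\<^sub>R u k)" for x
  show "linear R" unfolding R_def
    by (rule linearI) (simp_all add: spd_simps[OF g] sum.distrib scaleR_add_left scaleR_sum_right)
  show "R (e k) = u k" for k using e by (simp add: R_def onb_def)
  show "g (R x) (R y) = g x y" for x y
    using o unfolding R_def by (simp add: spd_simps[OF g] onb_def onb_inner[OF g e, of x y] mult.commute)
qed

lemma onb_det_pos_sym_groupI:
  assumes e: "onb g e" and o: "onb g u" and d: "det (\<chi> i j. g (u j) (e i) :: real^3^3) > 0"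
    and kk: "\<And>R. linear R \<Longrightarrow> (\<And>k. R (e k) = u k) \<Longrightarrow> \<forall>x y. K (R x) (R y) = R (K x y)"
    and ss: "\<And>R k. linear R \<Longrightarrow> (\<And>k. R (e k) = u k) \<Longrightarrow> S (R (e k)) = R (S (e k))"
  obtains R where "R \<in> sym_group" "\<And>k. R (e k) = u k"
proof -
  obtain R where R: "linear R" "\<And>k. R (e k) = u k" "\<And>x y. g (R x) (R y) = g x y"
    by (rule frame_map[OF e o]) (rule that; assumption)
  have "S (R x) = R (S x)" for x
    by (rule onb_linear_eqI[OF g e, where F = "\<lambda>x. S (R x)" and H = "\<lambda>x. R (S x)"])
      (use ss[OF R(1,2)] in \<open>auto intro!: linearI simp: S_simps linear_add[OF R(1)] linear_scale[OF R(1)]\<close>)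
  moreover have "det (matrix R) > 0" using det_matrix_onb[OF e R(1)] R(2) d by simp
  ultimately have "R \<in> sym_group" using R kk[OF R(1,2)] by (simp add: sym_group_def)
  then show ?thesis using R(2) that by blast
qed

text \<open>In the plane orthogonal to the axis a turn by a third fixes no nonzero vector, and its
  invariant quadratic forms are multiples of the metric. This removes the mixed components of
  \<open>K\<close> and \<open>S\<close>; apolarity ties the remaining ones to \<open>l\<close>,
  \<open>m\<close>, \<open>n\<close>.\<close>

lemma third_rotation_normal_form:
  assumes e: "onb g e" and R: "R \<in> sym_group" and R1: "R (e 1) = e 1"
    and R2: "R (e 2) = (- 1 / 2) *\<^sub>R e 2 + (sqrt 3 / 2) *\<^sub>R e 3"
    and R3: "R (e 3) = (- sqrt 3 / 2) *\<^sub>R e 2 + (- 1 / 2) *\<^sub>R e 3"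
  obtains l m n a b where "adapted e l m n a b"
proof -
  define c where "c i j k = g (K (e i) (e j)) (e k)" for i j k
  have sy: "c i j k = c j i k" "c i j k = c i k j" for i j k
    unfolding c_def using K_sym C_sym by metis+
  have inv: "g (K (R x) (R y)) (R z) = g (K x y) z" for x y z
    using R by (simp add: sym_group_def)
  note ex = K_simps spd_simps[OF g] c_def[symmetric]
  have s3: "sqrt 3 * sqrt 3 = (3 :: real)" "sqrt 3 * (sqrt 3 * z) = 3 * z" for z :: real
    by (simp_all flip: mult.assoc)
  have a1: "c 1 1 2 = - c 1 1 2 / 2 + sqrt 3 / 2 * c 1 1 3"
    using inv[of "e 1" "e 1" "e 2"] unfolding R1 R2 by (simp add: ex)
  have a2: "c 1 1 3 = - sqrt 3 / 2 * c 1 1 2 - c 1 1 3 / 2"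
    using inv[of "e 1" "e 1" "e 3"] unfolding R1 R3 by (simp add: ex)
  \<comment> \<open>Multiplied by \<open>sqrt 3\<close>, the second equation has the same atoms as
    the first, and the pair becomes a linear system with rational coefficients. The same device
    returns below.\<close>
  have "sqrt 3 * c 1 1 3 = - 3 / 2 * c 1 1 2 - sqrt 3 * c 1 1 3 / 2"
    using arg_cong[OF a2, of "\<lambda>x. sqrt 3 * x"] by (simp add: algebra_simps s3)
  with a1 have z112: "c 1 1 2 = 0" by linarith
  with a2 have z113: "c 1 1 3 = 0" by simp
  have b1: "c 1 2 2 = c 1 2 2 / 4 - sqrt 3 / 2 * c 1 2 3 + 3 / 4 * c 1 3 3"
    using inv[of "e 1" "e 2" "e 2"] unfolding R1 R2
    by (simp add: ex sy(2)[of 1 3 2] algebra_simps s3)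
  have b2: "c 1 2 3 = sqrt 3 / 4 * c 1 2 2 - c 1 2 3 / 2 - sqrt 3 / 4 * c 1 3 3"
    using inv[of "e 1" "e 2" "e 3"] unfolding R1 R2 R3
    by (simp add: ex sy(2)[of 1 3 2] algebra_simps s3)
  have "sqrt 3 * c 1 2 3 = 3 / 4 * c 1 2 2 - sqrt 3 * c 1 2 3 / 2 - 3 / 4 * c 1 3 3"
    using arg_cong[OF b2, of "\<lambda>x. sqrt 3 * x"] by (simp add: algebra_simps s3)
  with b1 have "c 1 2 2 = c 1 3 3" by argo
  with b2 have z123: "c 1 2 3 = 0" by simp
  have tr: "c i 1 1 + c i 2 2 + c i 3 3 = 0" for i
    using apolar[OF e, of "e i"] by (simp add: sum_3 c_def)
  define l where "l = - c 1 2 2"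
  have l: "c 1 2 2 = - l" "c 1 3 3 = - l" "c 1 1 1 = 2 * l"
    using tr[of 1] \<open>c 1 2 2 = c 1 3 3\<close> by (auto simp: l_def)
  define m where "m = c 2 2 2"
  define n where "n = c 2 2 3"
  have mn: "c 2 3 3 = - m" "c 3 3 3 = - n"
    using tr[of 2] tr[of 3] z112 z113 sy(1)[of 2 1 1] sy(1)[of 3 1 1] sy(2)[of 1 2 1] sy(2)[of 1 3 1] sy(1)[of 3 2 2] sy(2)[of 2 3 2]
    by (auto simp: m_def n_def)
  have Rs: "g (S (R x)) (R y) = g (S x) y" for x y using R by (simp add: sym_group_def)
  define s where "s i j = g (S (e i)) (e j)" for i j
  have ssy: "s i j = s j i" for i j unfolding s_def using S_sym spd_sym[OF g] by metis
  note exs = S_simps spd_simps[OF g] s_def[symmetric]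
  have d1: "s 1 2 = - s 1 2 / 2 + sqrt 3 / 2 * s 1 3"
    using Rs[of "e 1" "e 2"] unfolding R1 R2 by (simp add: exs)
  have d2: "s 1 3 = - sqrt 3 / 2 * s 1 2 - s 1 3 / 2"
    using Rs[of "e 1" "e 3"] unfolding R1 R3 by (simp add: exs)
  have "sqrt 3 * s 1 3 = - 3 / 2 * s 1 2 - sqrt 3 * s 1 3 / 2"
    using arg_cong[OF d2, of "\<lambda>x. sqrt 3 * x"] by (simp add: algebra_simps s3)
  with d1 have z12: "s 1 2 = 0" by linarith
  with d2 have z13: "s 1 3 = 0" by simp
  have f1: "s 2 2 = s 2 2 / 4 - sqrt 3 / 2 * s 2 3 + 3 / 4 * s 3 3"
    using Rs[of "e 2" "e 2"] unfolding R2 by (simp add: exs ssy[of 3 2] algebra_simps s3)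
  have f2: "s 2 3 = sqrt 3 / 4 * s 2 2 - s 2 3 / 2 - sqrt 3 / 4 * s 3 3"
    using Rs[of "e 2" "e 3"] unfolding R2 R3 by (simp add: exs ssy[of 3 2] algebra_simps s3)
  have "sqrt 3 * s 2 3 = 3 / 4 * s 2 2 - sqrt 3 * s 2 3 / 2 - 3 / 4 * s 3 3"
    using arg_cong[OF f2, of "\<lambda>x. sqrt 3 * x"] by (simp add: algebra_simps s3)
  with f1 have "s 2 2 = s 3 3" by argo
  with f2 have z23: "s 2 3 = 0" by simp
  have "adapted e l m n (s 1 1) (s 2 2)"
    unfolding adapted_def
  proof (intro conjI e)
    note V = onb_vectorI[OF e, folded c_def s_def]
    show "K (e 1) (e 1) = (2 * l) *\<^sub>R e 1" using onb_vectorI[OF e, of "K (e 1) (e 1)" "2 * l" 0 0] l z112 z113 by (simp add: c_def)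
    show "K (e 1) (e 2) = (- l) *\<^sub>R e 2"
      using onb_vectorI[OF e, of "K (e 1) (e 2)" 0 "- l" 0] l z112 z123 sy(2)[of 1 2 1] by (simp add: c_def)
    show "K (e 1) (e 3) = (- l) *\<^sub>R e 3"
      using onb_vectorI[OF e, of "K (e 1) (e 3)" 0 0 "- l"] l z113 z123 sy(2)[of 1 3 1] sy(2)[of 1 3 2] by (simp add: c_def)
    show "K (e 2) (e 2) = (- l) *\<^sub>R e 1 + m *\<^sub>R e 2 + n *\<^sub>R e 3"
      using onb_vectorI[OF e, of "K (e 2) (e 2)" "- l" m n] l sy(2)[of 2 2 1] sy(1)[of 2 1 2] by (simp add: c_def m_def n_def)
    show "K (e 2) (e 3) = n *\<^sub>R e 2 - m *\<^sub>R e 3"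
      using onb_vectorI[OF e, of "K (e 2) (e 3)" 0 n "- m"] mn z123 sy(2)[of 2 3 1] sy(1)[of 2 1 3] sy(2)[of 2 3 2] by (simp add: c_def n_def)
    show "K (e 3) (e 3) = (- l) *\<^sub>R e 1 - m *\<^sub>R e 2 - n *\<^sub>R e 3"
      using onb_vectorI[OF e, of "K (e 3) (e 3)" "- l" "- m" "- n"] mn l sy(2)[of 3 3 1] sy(1)[of 3 1 3] sy(2)[of 3 3 2] sy(1)[of 3 2 3] by (simp add: c_def)
    show "S (e 1) = s 1 1 *\<^sub>R e 1"
      using onb_vectorI[OF e, of "S (e 1)" "s 1 1" 0 0] z12 z13 by (simp add: s_def)
    show "S (e 2) = s 2 2 *\<^sub>R e 2"
      using onb_vectorI[OF e, of "S (e 2)" 0 "s 2 2" 0] z12 z23 ssy[of 2 1] by (simp add: s_def)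
    show "S (e 3) = s 2 2 *\<^sub>R e 3"
      using onb_vectorI[OF e, of "S (e 3)" 0 0 "s 2 2"] z13 z23 ssy[of 3 1] ssy[of 3 2] \<open>s 2 2 = s 3 3\<close> by (simp add: s_def)
  qed
  then show ?thesis by (rule that)
qed

lemma onb_simps:
  assumes "onb g e"
  shows "g (e 1) (e 1) = 1" "g (e 2) (e 2) = 1" "g (e 3) (e 3) = 1" "g (e 1) (e 2) = 0" "g (e 1) (e 3) = 0"
    "g (e 2) (e 3) = 0" "g (e 2) (e 1) = 0" "g (e 3) (e 1) = 0" "g (e 3) (e 2) = 0"
  using assms by (simp_all add: onb_def)

text \<open>On the plane orthogonal to \<open>e 1\<close> both \<open>K (e 1)\<close> and
  \<open>S\<close> are scalar, so \<open>l\<close>, \<open>a\<close>, \<open>b\<close> do not depend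
  on \<open>e 2\<close>, \<open>e 3\<close>; total symmetry and apolarity give the rest of the form.
  The last clause transports the rotationally symmetric case to the new frame.\<close>

lemma adapted_change:
  assumes A: "adapted e l m n a b" and e': "onb g e'" and e'1: "e' 1 = e 1"
  obtains m' n' where "adapted e' l m' n' a b" "m = 0 \<Longrightarrow> n = 0 \<Longrightarrow> m' = 0 \<and> n' = 0"
proof -
  note B = adaptedD[OF A]
  have ex: "x = g x (e 2) *\<^sub>R e 2 + g x (e 3) *\<^sub>R e 3" if "g x (e 1) = 0" for x
    using onb_vectorI[OF B(1), of x 0] that by simp
  have K1: "K (e 1) x = (- l) *\<^sub>R x" if "g x (e 1) = 0" for x
    by (subst (1 2) ex[OF that]) (simp add: K_simps B vec_eq_iff algebra_simps)
  have S1: "S x = b *\<^sub>R x" if "g x (e 1) = 0" for x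
    by (subst (1 2) ex[OF that]) (simp add: S_simps B vec_eq_iff algebra_simps)
  have p: "g (e' 2) (e 1) = 0" "g (e' 3) (e 1) = 0" using onb_simps[OF e'] e'1 by metis+
  have K1': "K (e' 1) (e' 2) = (- l) *\<^sub>R e' 2" "K (e' 1) (e' 3) = (- l) *\<^sub>R e' 3" using K1 p e'1 by auto
  have K1'': "K (e' 2) (e' 1) = (- l) *\<^sub>R e' 2" "K (e' 3) (e' 1) = (- l) *\<^sub>R e' 3" using K1' K_sym by metis+
  define m' where "m' = g (K (e' 2) (e' 2)) (e' 2)"
  define n' where "n' = g (K (e' 2) (e' 2)) (e' 3)"
  have q: "g (K (e' 2) (e' 2)) (e' 1) = - l" "g (K (e' 2) (e' 3)) (e' 1) = 0" "g (K (e' 3) (e' 3)) (e' 1) = - l"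
    by (simp_all add: C_sym[of _ _ "e' 1"] K1'' spd_simps[OF g] onb_simps[OF e'])
  have r: "g (K (e' 2) (e' 3)) (e' 2) = n'" using C_sym by (simp add: n'_def)
  have t: "g (K (e' i) (e' 1)) (e' 1) + g (K (e' i) (e' 2)) (e' 2) + g (K (e' i) (e' 3)) (e' 3) = 0" for i
    using apolar[OF e', of "e' i"] by (simp add: sum_3)
  have u: "g (K (e' 2) (e' 3)) (e' 3) = - m'" using t[of 2] by (simp add: K1'' spd_simps[OF g] onb_simps[OF e'] m'_def)
  have v: "g (K (e' 3) (e' 3)) (e' 2) = - m'" using u C_sym K_sym by metis
  have "g (K (e' 3) (e' 2)) (e' 2) = n'" using r K_sym by metis
  then have x: "g (K (e' 3) (e' 3)) (e' 3) = - n'" using t[of 3] by (simp add: K1'' spd_simps[OF g] onb_simps[OF e'])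
  have "adapted e' l m' n' a b"
    unfolding adapted_def
  proof (intro conjI e' K1')
    show "K (e' 1) (e' 1) = (2 * l) *\<^sub>R e' 1" "S (e' 1) = a *\<^sub>R e' 1" using B e'1 by simp_all
    show "S (e' 2) = b *\<^sub>R e' 2" "S (e' 3) = b *\<^sub>R e' 3" using S1 p by auto
    show "K (e' 2) (e' 2) = (- l) *\<^sub>R e' 1 + m' *\<^sub>R e' 2 + n' *\<^sub>R e' 3"
      by (rule onb_vectorI[OF e' q(1)]) (simp_all add: m'_def n'_def)
    show "K (e' 2) (e' 3) = n' *\<^sub>R e' 2 - m' *\<^sub>R e' 3"
      using onb_vectorI[OF e' q(2) r u] by simp
    show "K (e' 3) (e' 3) = (- l) *\<^sub>R e' 1 - m' *\<^sub>R e' 2 - n' *\<^sub>R e' 3"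
      using onb_vectorI[OF e' q(3) v x] by simp
  qed
  moreover have "m' = 0 \<and> n' = 0" if "m = 0" "n = 0"
  proof -
    have "K (e' 2) (e' 2) = (c * c * - l + d * d * - l) *\<^sub>R e 1"
      if "e' 2 = c *\<^sub>R e 2 + d *\<^sub>R e 3" for c d
      using B(5-7) \<open>m = 0\<close> \<open>n = 0\<close> K_sym[of "e 3" "e 2"]
      by (simp add: that K_simps vec_eq_iff algebra_simps)
    then obtain t where "K (e' 2) (e' 2) = t *\<^sub>R e' 1" using ex[OF p(1)] e'1 by metis
    then show ?thesis by (simp add: m'_def n'_def spd_simps[OF g] onb_simps[OF e'])
  qed
  ultimately show ?thesis by (rule that)
qed

lemma onbI3:
  assumes "g u1 u1 = 1" "g u2 u2 = 1" "g u3 u3 = 1" "g u1 u2 = 0" "g u1 u3 = 0" "g u2 u3 = 0"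
  shows "onb g (\<lambda>k. if k = 1 then u1 else if k = 2 then u2 else u3)"
  using assms spd_sym[OF g, of u1 u2] spd_sym[OF g, of u1 u3] spd_sym[OF g, of u2 u3]
  by (simp add: onb_def forall_3)

lemma adapted_flip:
  assumes "adapted e l m n a b"
  shows "adapted (\<lambda>k. if k = 1 then - e 1 else if k = 2 then e 2 else e 3) (- l) m n a b"
proof -
  have e: "onb g e" using assms by (simp add: adapted_def)
  have "onb g (\<lambda>k. if k = 1 then - e 1 else if k = 2 then e 2 else e 3)"
    by (rule onbI3) (simp_all add: spd_simps[OF g] onb_simps[OF e])
  then show ?thesis using assms by (simp add: adapted_def K_simps S_simps)
qed

text \<open>When \<open>e 2\<close>, \<open>e 3\<close> are rotated by an angle, the pair
  \<open>(m, n)\<close> turns by three times that angle, since these components form a cubic in the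
  plane.\<close>

lemma adapted_rotate:
  assumes "adapted e l m n a b"
  obtains e' where "e' 1 = e 1" "adapted e' l (sqrt (m\<^sup>2 + n\<^sup>2)) 0 a b"
proof -
  have e: "onb g e" using assms by (simp add: adapted_def)
  define \<rho> where "\<rho> = sqrt (m\<^sup>2 + n\<^sup>2)"
  obtain \<psi> where \<psi>: "m = \<rho> * cos \<psi>" "n = \<rho> * sin \<psi>"
  proof (cases "\<rho> = 0")
    case True
    then have "m = 0" "n = 0" by (auto simp: \<rho>_def sum_power2_eq_zero_iff)
    then show ?thesis using that[of 0] True by simp
  next
    case False
    have r2: "m\<^sup>2 + n\<^sup>2 = \<rho>\<^sup>2" by (simp add: \<rho>_def)
    then have "(m / \<rho>)\<^sup>2 + (n / \<rho>)\<^sup>2 = 1" using False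
      unfolding power_divide add_divide_distrib[symmetric] r2 by simp
    then obtain t where "m / \<rho> = cos t" "n / \<rho> = sin t" using sincos_total_2pi by metis
    then show ?thesis using that[of t] False by (simp add: field_simps)
  qed
  \<comment> \<open>A third of the argument of \<open>(m, n)\<close>, so that the turn cancels
    it.\<close>
  define \<phi> where "\<phi> = \<psi> / 3"
  define c where "c = cos \<phi>"
  define s where "s = sin \<phi>"
  have cs: "c * c + s * s = 1" by (simp add: c_def s_def power2_eq_square[symmetric])
  have ps: "\<psi> = \<phi> + (\<phi> + \<phi>)" by (simp add: \<phi>_def)
  have m: "m = \<rho> * (c * (c * c - s * s) - s * (2 * s * c))"
    unfolding \<psi>(1) ps cos_add sin_add c_def s_def by (simp add: algebra_simps)
  have n: "n = \<rho> * (s * (c * c - s * s) + c * (2 * s * c))"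
    unfolding \<psi>(2) ps cos_add sin_add c_def s_def by (simp add: algebra_simps)
  define e' where "e' k = (if k = 1 then e 1 else if k = 2 then c *\<^sub>R e 2 + s *\<^sub>R e 3 else (- s) *\<^sub>R e 2 + c *\<^sub>R e 3)" for k :: 3
  have e'_simps: "e' 1 = e 1" "e' 2 = c *\<^sub>R e 2 + s *\<^sub>R e 3" "e' 3 = (- s) *\<^sub>R e 2 + c *\<^sub>R e 3"
    by (simp_all add: e'_def)
  have "onb g e'"
    unfolding e'_def[abs_def] by (rule onbI3) (use cs in \<open>simp_all add: spd_simps[OF g] onb_simps[OF e]\<close>)
  note A = adaptedD[OF assms]
  have k32: "K (e 3) (e 2) = K (e 2) (e 3)" by (rule K_sym)
  have k22: "K (e' 2) (e' 2) = (c * c) *\<^sub>R K (e 2) (e 2) + (2 * (c * s)) *\<^sub>R K (e 2) (e 3) + (s * s) *\<^sub>R K (e 3) (e 3)"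
    unfolding e'_simps by (simp add: K_simps k32 vec_eq_iff algebra_simps)
  have k23: "K (e' 2) (e' 3) = (- (c * s)) *\<^sub>R K (e 2) (e 2) + (c * c - s * s) *\<^sub>R K (e 2) (e 3) + (c * s) *\<^sub>R K (e 3) (e 3)"
    unfolding e'_simps by (simp add: K_simps k32 algebra_simps)
  have k33: "K (e' 3) (e' 3) = (s * s) *\<^sub>R K (e 2) (e 2) - (2 * (c * s)) *\<^sub>R K (e 2) (e 3) + (c * c) *\<^sub>R K (e 3) (e 3)"
    unfolding e'_simps by (simp add: K_simps k32 vec_eq_iff algebra_simps)
  \<comment> \<open>Subtraction of the double angle from the triple angle; as polynomial identities
    both need the factor \<open>(c * c + s * s)\<^sup>2 = 1\<close>.\<close>
  have mc: "m * (c * c - s * s) + n * (2 * (c * s)) = \<rho> * c"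
    "n * (c * c - s * s) - m * (2 * (c * s)) = \<rho> * s"
  proof -
    have "m * (c * c - s * s) + n * (2 * (c * s)) = \<rho> * c * ((c * c + s * s) * (c * c + s * s))"
      unfolding m n by algebra
    then show "m * (c * c - s * s) + n * (2 * (c * s)) = \<rho> * c" by (simp add: cs)
    have "n * (c * c - s * s) - m * (2 * (c * s)) = \<rho> * s * ((c * c + s * s) * (c * c + s * s))"
      unfolding m n by algebra
    then show "n * (c * c - s * s) - m * (2 * (c * s)) = \<rho> * s" by (simp add: cs)
  qed
  have "K (e' 2) (e' 2) = (- l) *\<^sub>R e' 1 + \<rho> *\<^sub>R e' 2"
  proof -
    have "K (e' 2) (e' 2) = ((c * c + s * s) * - l) *\<^sub>R e 1 + (m * (c * c - s * s) + n * (2 * (c * s))) *\<^sub>R e 2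
        + (n * (c * c - s * s) - m * (2 * (c * s))) *\<^sub>R e 3"
      unfolding k22 by (simp add: A vec_eq_iff algebra_simps)
    then show ?thesis unfolding mc cs e'_simps by (simp add: vec_eq_iff algebra_simps)
  qed
  moreover have "K (e' 3) (e' 3) = (- l) *\<^sub>R e' 1 - \<rho> *\<^sub>R e' 2"
  proof -
    have "K (e' 3) (e' 3) = ((c * c + s * s) * - l) *\<^sub>R e 1 - (m * (c * c - s * s) + n * (2 * (c * s))) *\<^sub>R e 2
        - (n * (c * c - s * s) - m * (2 * (c * s))) *\<^sub>R e 3"
      unfolding k33 by (simp add: A vec_eq_iff algebra_simps)
    then show ?thesis unfolding mc cs e'_simps by (simp add: vec_eq_iff algebra_simps)
  qed
  moreover have "K (e' 2) (e' 3) = - \<rho> *\<^sub>R e' 3"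
  proof -
    have "K (e' 2) (e' 3) = (n * (c * c - s * s) - m * (2 * (c * s))) *\<^sub>R e 2 - (m * (c * c - s * s) + n * (2 * (c * s))) *\<^sub>R e 3"
      unfolding k23 by (simp add: A vec_eq_iff algebra_simps)
    then show ?thesis unfolding mc e'_simps by (simp add: algebra_simps)
  qed
  moreover have "K (e' 1) (e' 2) = (- l) *\<^sub>R e' 2" "K (e' 1) (e' 3) = (- l) *\<^sub>R e' 3"
    "S (e' 2) = b *\<^sub>R e' 2" "S (e' 3) = b *\<^sub>R e' 3"
    unfolding e'_simps by (simp_all add: A K_simps S_simps algebra_simps)
  ultimately have "adapted e' l \<rho> 0 a b"
    using A \<open>onb g e'\<close> by (simp add: adapted_def e'_simps(1))
  then show ?thesis using that[of e'] e'_simps(1) by (simp add: \<rho>_def)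
qed

lemma det3_entries: "det (\<chi> i j. M i j :: real^3^3) =
    M 1 1 * M 2 2 * M 3 3 + M 1 2 * M 2 3 * M 3 1 + M 1 3 * M 2 1 * M 3 2 -
    M 1 1 * M 2 3 * M 3 2 - M 1 2 * M 2 1 * M 3 3 - M 1 3 * M 2 2 * M 3 1"
  by (simp add: det_3)

text \<open>A vanishing \<open>\<lambda>\<close> produces a half turn exchanging the two directions of the axis, and the
  tetrahedral cubic form produces a half turn about another of its four axes.\<close>

lemma adapted_nondegenerate:
  assumes A: "adapted e l m n a b" and fix1: "\<And>R. R \<in> sym_group \<Longrightarrow> R (e 1) = e 1"
  shows "l \<noteq> 0" and "\<not> (m\<^sup>2 + n\<^sup>2 = 2 * l\<^sup>2 \<and> a = b)"
proof -
  obtain e' where e'1: "e' 1 = e 1" and A': "adapted e' l (sqrt (m\<^sup>2 + n\<^sup>2)) 0 a b"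
    by (rule adapted_rotate[OF A]) (rule that; assumption)
  have e: "onb g e'" using A' by (simp add: adapted_def)
  have k32: "K (e' 3) (e' 2) = K (e' 2) (e' 3)" "K (e' 3) (e' 1) = K (e' 1) (e' 3)" "K (e' 2) (e' 1) = K (e' 1) (e' 2)"
    by (rule K_sym)+
  show "l \<noteq> 0"
  proof
    assume l: "l = 0"
    \<comment> \<open>The half turn about \<open>e' 2\<close>. With \<open>l = 0\<close> only the
      component in the plane is left, and it is even in \<open>e' 3\<close>.\<close>
    define u where "u k = (if k = 1 then - e' 1 else if k = 2 then e' 2 else - e' 3)" for k :: 3
    have u: "u 1 = - e' 1" "u 2 = e' 2" "u 3 = - e' 3" by (simp_all add: u_def)
    have o: "onb g u" unfolding u_def[abs_def]
      by (rule onbI3) (simp_all add: spd_simps[OF g] onb_simps[OF e])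
    have d: "det (\<chi> i j. g (u j) (e' i) :: real^3^3) > 0"
      by (simp add: det3_entries u spd_simps[OF g] onb_simps[OF e])
    have k: "\<forall>x y. K (R x) (R y) = R (K x y)" if R: "linear R" "\<And>k. R (e' k) = u k" for R
      by (intro allI, rule onb_bilinear_equivariant[OF e R(1)])
        (simp_all add: adaptedD[OF A'] l R(2) u K_simps k32 linear_add[OF R(1)] linear_scale[OF R(1)] linear_neg[OF R(1)] linear_diff[OF R(1)] linear_0[OF R(1)])
    have s: "S (R (e' k)) = R (S (e' k))" if R: "linear R" "\<And>k. R (e' k) = u k" for R k
      using exhaust_3[of k] A' by (auto simp: adapted_def R(2) u S_simps linear_scale[OF R(1)])
    obtain R where "R \<in> sym_group" "\<And>k. R (e' k) = u k"
      by (rule onb_det_pos_sym_groupI[OF e o d k s]) (assumption | rule that)+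
    then have "u 1 = e' 1" using fix1 e'1 by metis
    then have "g (u 1) (e' 1) = 1" using onb_simps[OF e] by simp
    then show False by (simp add: u spd_simps[OF g] onb_simps[OF e])
  qed
  show "\<not> (m\<^sup>2 + n\<^sup>2 = 2 * l\<^sup>2 \<and> a = b)"
  proof
    assume mn: "m\<^sup>2 + n\<^sup>2 = 2 * l\<^sup>2 \<and> a = b"
    \<comment> \<open>The sign follows that of \<open>l\<close>, so that the nonnegative root equals
      \<open>r * l\<close>.\<close>
    define r where "r = (if l > 0 then sqrt 2 else - sqrt 2)"
    have l: "l \<noteq> 0" by fact
    have "sqrt (m\<^sup>2 + n\<^sup>2) = r * l" using mn l by (simp add: r_def real_sqrt_mult)
    then have A2: "adapted e' l (r * l) 0 a a" using A' mn by simp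
    have rr: "r * r = 2" "r * (r * z) = 2 * z" for z
      by (simp_all add: r_def flip: mult.assoc)
    \<comment> \<open>The half turn about the direction of \<open>e' 1 + r *\<^sub>R e' 2\<close>;
      it exchanges \<open>e' 1\<close> with another vertex direction of the tetrahedral form. The
      number \<open>- 1 / 3\<close> is the cosine of the angle between two vertices of a regular
      tetrahedron seen from its centre.\<close>
    define u where "u k = (if k = 1 then (- 1 / 3) *\<^sub>R e' 1 + (2 * r / 3) *\<^sub>R e' 2
      else if k = 2 then (2 * r / 3) *\<^sub>R e' 1 + (1 / 3) *\<^sub>R e' 2 else - e' 3)" for k :: 3
    have u: "u 1 = (- 1 / 3) *\<^sub>R e' 1 + (2 * r / 3) *\<^sub>R e' 2" "u 2 = (2 * r / 3) *\<^sub>R e' 1 + (1 / 3) *\<^sub>R e' 2" "u 3 = - e' 3"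
      by (simp_all add: u_def)
    have o: "onb g u" unfolding u_def[abs_def]
      by (rule onbI3) (simp_all add: spd_simps[OF g] onb_simps[OF e] rr)
    have d: "det (\<chi> i j. g (u j) (e' i) :: real^3^3) > 0"
      by (simp add: det3_entries u spd_simps[OF g] onb_simps[OF e] rr)
    have k: "\<forall>x y. K (R x) (R y) = R (K x y)" if R: "linear R" "\<And>k. R (e' k) = u k" for R
    proof -
      note B = adaptedD[OF A2]
      note Rl = linear_add[OF R(1)] linear_scale[OF R(1)] linear_neg[OF R(1)] linear_diff[OF R(1)]
      have *: "x = y" if "x - y = (0::real^3)" for x y using that by simp
      have co: "x *\<^sub>R e' 1 + y *\<^sub>R e' 2 + z *\<^sub>R e' 3 = x' *\<^sub>R e' 1 + y' *\<^sub>R e' 2 + z' *\<^sub>R e' 3"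
        if "x = x'" "y = y'" "z = z'" for x y z x' y' z' using that by simp
      have 11: "K (u 1) (u 1) = (- 2 * l / 3) *\<^sub>R e' 1 + (4 * r * l / 3) *\<^sub>R e' 2 + 0 *\<^sub>R e' 3"
      proof -
        have "K (u 1) (u 1) = (1 / 9) *\<^sub>R K (e' 1) (e' 1) + (- 4 * r / 9) *\<^sub>R K (e' 1) (e' 2) + (4 * (r * r) / 9) *\<^sub>R K (e' 2) (e' 2)"
          unfolding u by (simp add: K_simps k32 vec_eq_iff algebra_simps)
        also have "\<dots> = (2 * l / 9 - 4 * (r * r) * l / 9) *\<^sub>R e' 1 + (4 * r * l / 9 + 4 * (r * r) * (r * l) / 9) *\<^sub>R e' 2 + 0 *\<^sub>R e' 3"
          by (simp add: B vec_eq_iff algebra_simps)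
        finally show ?thesis unfolding rr(1) by (auto intro: co)
      qed
      have 12: "K (u 1) (u 2) = (- 2 * r * l / 3) *\<^sub>R e' 1 + (- l / 3) *\<^sub>R e' 2 + 0 *\<^sub>R e' 3"
      proof -
        have "K (u 1) (u 2) = (- 2 * r / 9) *\<^sub>R K (e' 1) (e' 1) + (4 * (r * r) / 9 - 1 / 9) *\<^sub>R K (e' 1) (e' 2) + (2 * r / 9) *\<^sub>R K (e' 2) (e' 2)"
          unfolding u by (simp add: K_simps k32 algebra_simps)
        also have "\<dots> = (- 4 * r * l / 9 - 2 * r * l / 9) *\<^sub>R e' 1 + (- (4 * (r * r) / 9 - 1 / 9) * l + 2 * (r * r) * l / 9) *\<^sub>R e' 2 + 0 *\<^sub>R e' 3"
          by (simp add: B vec_eq_iff algebra_simps)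
        finally show ?thesis unfolding rr(1) by (auto intro: co)
      qed
      have 22: "K (u 2) (u 2) = (5 * l / 3) *\<^sub>R e' 1 + (- r * l / 3) *\<^sub>R e' 2 + 0 *\<^sub>R e' 3"
      proof -
        have "K (u 2) (u 2) = (4 * (r * r) / 9) *\<^sub>R K (e' 1) (e' 1) + (4 * r / 9) *\<^sub>R K (e' 1) (e' 2) + (1 / 9) *\<^sub>R K (e' 2) (e' 2)"
          unfolding u by (simp add: K_simps k32 vec_eq_iff algebra_simps)
        also have "\<dots> = (8 * (r * r) * l / 9 - l / 9) *\<^sub>R e' 1 + (- 4 * r * l / 9 + r * l / 9) *\<^sub>R e' 2 + 0 *\<^sub>R e' 3"
          by (simp add: B vec_eq_iff algebra_simps)
        finally show ?thesis unfolding rr(1) by (auto intro: co)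
      qed
      have 13: "K (u 1) (u 3) = 0 *\<^sub>R e' 1 + 0 *\<^sub>R e' 2 + l *\<^sub>R e' 3"
      proof -
        have "K (u 1) (u 3) = (1 / 3) *\<^sub>R K (e' 1) (e' 3) + (- 2 * r / 3) *\<^sub>R K (e' 2) (e' 3)"
          unfolding u by (simp add: K_simps k32 algebra_simps)
        also have "\<dots> = 0 *\<^sub>R e' 1 + 0 *\<^sub>R e' 2 + (- l / 3 + 2 * (r * r) * l / 3) *\<^sub>R e' 3"
          by (simp add: B vec_eq_iff algebra_simps)
        finally show ?thesis unfolding rr(1) by (auto intro: co)
      qed
      have 23: "K (u 2) (u 3) = 0 *\<^sub>R e' 1 + 0 *\<^sub>R e' 2 + (r * l) *\<^sub>R e' 3"
      proof -
        have "K (u 2) (u 3) = (- 2 * r / 3) *\<^sub>R K (e' 1) (e' 3) + (- 1 / 3) *\<^sub>R K (e' 2) (e' 3)"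
          unfolding u by (simp add: K_simps k32 algebra_simps)
        also have "\<dots> = 0 *\<^sub>R e' 1 + 0 *\<^sub>R e' 2 + (2 * r * l / 3 + r * l / 3) *\<^sub>R e' 3"
          by (simp add: B vec_eq_iff algebra_simps)
        finally show ?thesis by (auto intro: co)
      qed
      have R11: "R (K (e' 1) (e' 1)) = (- 2 * l / 3) *\<^sub>R e' 1 + (4 * r * l / 3) *\<^sub>R e' 2 + 0 *\<^sub>R e' 3"
        and R12: "R (K (e' 1) (e' 2)) = (- 2 * r * l / 3) *\<^sub>R e' 1 + (- l / 3) *\<^sub>R e' 2 + 0 *\<^sub>R e' 3"
        and R13: "R (K (e' 1) (e' 3)) = 0 *\<^sub>R e' 1 + 0 *\<^sub>R e' 2 + l *\<^sub>R e' 3"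
        and R23: "R (K (e' 2) (e' 3)) = 0 *\<^sub>R e' 1 + 0 *\<^sub>R e' 2 + (r * l) *\<^sub>R e' 3"
        by (simp_all add: B Rl R(2) u vec_eq_iff algebra_simps)
      have "R (K (e' 2) (e' 2)) = (l / 3 + 2 * (r * r) * l / 3) *\<^sub>R e' 1 + (- 2 * r * l / 3 + r * l / 3) *\<^sub>R e' 2 + 0 *\<^sub>R e' 3"
        by (simp add: B Rl R(2) u vec_eq_iff algebra_simps)
      then have R22: "R (K (e' 2) (e' 2)) = (5 * l / 3) *\<^sub>R e' 1 + (- r * l / 3) *\<^sub>R e' 2 + 0 *\<^sub>R e' 3"
        unfolding rr(1) by (auto intro: co)
      have "K (e' 3) (e' 3) = (- 2 * l) *\<^sub>R e' 1 - K (e' 2) (e' 2)" by (simp add: B vec_eq_iff algebra_simps)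
      then have "R (K (e' 3) (e' 3)) = (- 2 * l) *\<^sub>R u 1 - R (K (e' 2) (e' 2))" by (simp add: Rl R(2))
      also have "\<dots> = (2 * l / 3 - 5 * l / 3) *\<^sub>R e' 1 + (- 4 * r * l / 3 + r * l / 3) *\<^sub>R e' 2 + 0 *\<^sub>R e' 3"
        unfolding R22 u by (simp add: vec_eq_iff algebra_simps)
      finally have R33: "R (K (e' 3) (e' 3)) = (- l) *\<^sub>R e' 1 + (- r * l) *\<^sub>R e' 2 + 0 *\<^sub>R e' 3"
        by (auto intro: co)
      have 33: "K (u 3) (u 3) = (- l) *\<^sub>R e' 1 + (- r * l) *\<^sub>R e' 2 + 0 *\<^sub>R e' 3"
        by (simp add: B u K_simps vec_eq_iff algebra_simps)
      show ?thesis
        by (intro allI, rule onb_bilinear_equivariant[OF e R(1)])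
          (simp_all only: R(2) 11 12 13 22 23 33 R11 R12 R13 R22 R23 R33)
    qed
    have s: "S (R (e' k)) = R (S (e' k))" if R: "linear R" "\<And>k. R (e' k) = u k" for R k
    proof -
      have eq: "S (e' k) = a *\<^sub>R e' k" for k
        using exhaust_3[of k] adaptedD(8-10)[OF A2] by auto
      have "S x = a *\<^sub>R x" for x
        by (rule onb_linear_eqI[OF g e S, where H = "\<lambda>x. a *\<^sub>R x"]) (auto intro: linearI simp: eq algebra_simps)
      then show ?thesis by (simp add: linear_scale[OF R(1)])
    qed
    obtain R where "R \<in> sym_group" "\<And>k. R (e' k) = u k"
      by (rule onb_det_pos_sym_groupI[OF e o d k s]) (assumption | rule that)+
    then have "u 1 = e' 1" using fix1 e'1 by metis
    then have "g (u 1) (e' 1) = 1" using onb_simps[OF e] by simp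
    then show False by (simp add: u spd_simps[OF g] onb_simps[OF e])
  qed
qed

text \<open>Every adapted frame has this symmetry, whichever symmetry type is assumed. It makes the
  axis recognisable from any adapted frame.\<close>

lemma adapted_third_rotation:
  assumes A: "adapted e l m n a b"
  obtains R where "R \<in> sym_group" "R (e 1) = e 1" "R (e 2) = (- 1 / 2) *\<^sub>R e 2 + (sqrt 3 / 2) *\<^sub>R e 3"
    "R (e 3) = (- sqrt 3 / 2) *\<^sub>R e 2 + (- 1 / 2) *\<^sub>R e 3"
proof -
  have e: "onb g e" by (rule adaptedD(1)[OF A])
  define r where "r = sqrt (3 :: real)"
  have rr: "r * r = 3" "r * (r * z) = 3 * z" for z by (simp_all add: r_def flip: mult.assoc)
  define u where "u k = (if k = 1 then e 1 else if k = 2 then (- 1 / 2) *\<^sub>R e 2 + (r / 2) *\<^sub>R e 3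
    else (- r / 2) *\<^sub>R e 2 + (- 1 / 2) *\<^sub>R e 3)" for k :: 3
  have u: "u 1 = e 1" "u 2 = (- 1 / 2) *\<^sub>R e 2 + (r / 2) *\<^sub>R e 3" "u 3 = (- r / 2) *\<^sub>R e 2 + (- 1 / 2) *\<^sub>R e 3"
    by (simp_all add: u_def)
  have o: "onb g u" unfolding u_def[abs_def]
    by (rule onbI3) (simp_all add: spd_simps[OF g] onb_simps[OF e] rr)
  have d: "det (\<chi> i j. g (u j) (e i) :: real^3^3) > 0"
    by (simp add: det3_entries u spd_simps[OF g] onb_simps[OF e] rr)
  have k32: "K (e 3) (e 2) = K (e 2) (e 3)" by (rule K_sym)
  note B = adaptedD[OF A]
  have k: "\<forall>x y. K (R x) (R y) = R (K x y)" if R: "linear R" "\<And>k. R (e k) = u k" for R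
  proof -
    note Rl = linear_add[OF R(1)] linear_scale[OF R(1)] linear_neg[OF R(1)] linear_diff[OF R(1)]
    have co: "x *\<^sub>R e 1 + y *\<^sub>R e 2 + z *\<^sub>R e 3 = x' *\<^sub>R e 1 + y' *\<^sub>R e 2 + z' *\<^sub>R e 3"
      if "x = x'" "y = y'" "z = z'" for x y z x' y' z' using that by simp
    have 22: "K (u 2) (u 2) = (- l) *\<^sub>R e 1 + (- m / 2 - r * n / 2) *\<^sub>R e 2 + (r * m / 2 - n / 2) *\<^sub>R e 3"
    proof -
      have "K (u 2) (u 2) = (1 / 4) *\<^sub>R K (e 2) (e 2) + (- r / 2) *\<^sub>R K (e 2) (e 3) + (r * r / 4) *\<^sub>R K (e 3) (e 3)"
        unfolding u by (simp add: K_simps k32 vec_eq_iff algebra_simps)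
      also have "\<dots> = (- l / 4 - r * r * l / 4) *\<^sub>R e 1 + (m / 4 - r * n / 2 - r * r * m / 4) *\<^sub>R e 2 + (n / 4 + r * m / 2 - r * r * n / 4) *\<^sub>R e 3"
        by (simp add: B vec_eq_iff algebra_simps)
      finally show ?thesis unfolding rr(1) by (auto intro!: co)
    qed
    have 23: "K (u 2) (u 3) = 0 *\<^sub>R e 1 + (r * m / 2 - n / 2) *\<^sub>R e 2 + (r * n / 2 + m / 2) *\<^sub>R e 3"
    proof -
      have "K (u 2) (u 3) = (r / 4) *\<^sub>R K (e 2) (e 2) + (1 / 4 - r * r / 4) *\<^sub>R K (e 2) (e 3) + (- r / 4) *\<^sub>R K (e 3) (e 3)"
        unfolding u by (simp add: K_simps k32 algebra_simps)
      also have "\<dots> = 0 *\<^sub>R e 1 + (r * m / 4 + (1 / 4 - r * r / 4) * n + r * m / 4) *\<^sub>R e 2 + (r * n / 4 - (1 / 4 - r * r / 4) * m + r * n / 4) *\<^sub>R e 3"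
        by (simp add: B vec_eq_iff algebra_simps)
      finally show ?thesis unfolding rr(1) by (simp add: mult.commute)
    qed
    have 33: "K (u 3) (u 3) = (- l) *\<^sub>R e 1 + (m / 2 + r * n / 2) *\<^sub>R e 2 + (- r * m / 2 + n / 2) *\<^sub>R e 3"
    proof -
      have "K (u 3) (u 3) = (r * r / 4) *\<^sub>R K (e 2) (e 2) + (r / 2) *\<^sub>R K (e 2) (e 3) + (1 / 4) *\<^sub>R K (e 3) (e 3)"
        unfolding u by (simp add: K_simps k32 vec_eq_iff algebra_simps)
      also have "\<dots> = (- l / 4 - r * r * l / 4) *\<^sub>R e 1 + (- m / 4 + r * n / 2 + r * r * m / 4) *\<^sub>R e 2 + (- n / 4 - r * m / 2 + r * r * n / 4) *\<^sub>R e 3"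
        by (simp add: B vec_eq_iff algebra_simps)
      finally show ?thesis unfolding rr(1) by (auto intro!: co)
    qed
    have R22: "R (K (e 2) (e 2)) = (- l) *\<^sub>R e 1 + (- m / 2 - r * n / 2) *\<^sub>R e 2 + (r * m / 2 - n / 2) *\<^sub>R e 3"
      and R33: "R (K (e 3) (e 3)) = (- l) *\<^sub>R e 1 + (m / 2 + r * n / 2) *\<^sub>R e 2 + (- r * m / 2 + n / 2) *\<^sub>R e 3"
      and R23: "R (K (e 2) (e 3)) = 0 *\<^sub>R e 1 + (r * m / 2 - n / 2) *\<^sub>R e 2 + (r * n / 2 + m / 2) *\<^sub>R e 3"
      by (simp_all add: B Rl R(2) u vec_eq_iff algebra_simps)
    show ?thesis
    proof (intro allI, rule onb_bilinear_equivariant[OF e R(1)])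
      show "K (R (e 1)) (R (e 1)) = R (K (e 1) (e 1))" by (simp add: B Rl R(2) u)
      show "K (R (e 1)) (R (e 2)) = R (K (e 1) (e 2))" by (simp add: B Rl R(2) u K_simps vec_eq_iff algebra_simps)
      show "K (R (e 1)) (R (e 3)) = R (K (e 1) (e 3))" by (simp add: B Rl R(2) u K_simps vec_eq_iff algebra_simps)
    qed (simp_all only: R(2) 22 23 33 R22 R23 R33)
  qed
  have s: "S (R (e k)) = R (S (e k))" if R: "linear R" "\<And>k. R (e k) = u k" for R k
    using exhaust_3[of k] by (auto simp: B R(2) u S_simps linear_scale[OF R(1)] vec_eq_iff algebra_simps)
  obtain R where "R \<in> sym_group" "\<And>k. R (e k) = u k"
    by (rule onb_det_pos_sym_groupI[OF e o d k s]) (assumption | rule that)+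
  then show ?thesis using that[of R] u by (simp add: r_def)
qed

lemma third_rotation_fixes:
  assumes e: "onb g e" and R: "linear R" "R (e 1) = e 1" "R (e 2) = (- 1 / 2) *\<^sub>R e 2 + (sqrt 3 / 2) *\<^sub>R e 3"
    "R (e 3) = (- sqrt 3 / 2) *\<^sub>R e 2 + (- 1 / 2) *\<^sub>R e 3" and v: "R v = v"
  shows "v = g v (e 1) *\<^sub>R e 1"
proof -
  define y where "y = g v (e 2)"
  define z where "z = g v (e 3)"
  have ve: "v = g v (e 1) *\<^sub>R e 1 + y *\<^sub>R e 2 + z *\<^sub>R e 3"
    unfolding y_def z_def by (rule onb_vectorI[OF e]) auto
  have Rv: "R v = g v (e 1) *\<^sub>R e 1 + y *\<^sub>R R (e 2) + z *\<^sub>R R (e 3)"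
    by (subst ve) (simp add: linear_add[OF R(1)] linear_scale[OF R(1)] R(2))
  have "g (R v) (e 2) = - y / 2 - z * sqrt 3 / 2" "g (R v) (e 3) = y * sqrt 3 / 2 - z / 2"
    unfolding Rv R(3,4) by (simp_all add: spd_simps[OF g] onb_simps[OF e])
  then have 1: "3 * y = - z * sqrt 3" "3 * z = y * sqrt 3" using v by (simp_all add: y_def z_def)
  have "3 * (3 * z) = sqrt 3 * (3 * y)" unfolding 1(2) by simp
  also have "\<dots> = - 3 * z" unfolding 1(1) by simp
  finally have "z = 0" by simp
  then have "y = 0" using 1 by simp
  then show ?thesis using ve \<open>z = 0\<close> by simp
qed

text \<open>A vector fixed by the turn by a third is a multiple \<open>t\<close> of
  \<open>e 1\<close>. Unit length leaves two signs, and the cubic form, which takes the value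
  \<open>2 * l * t ^ 3\<close>, decides between them.\<close>

lemma axis_unique:
  assumes A: "adapted e l m n a b" and l: "l > 0" and v: "g v v = 1" "g (K v v) v > 0"
    and f: "\<And>R. R \<in> sym_group \<Longrightarrow> R v = v"
  shows "v = e 1"
proof -
  have e: "onb g e" by (rule adaptedD(1)[OF A])
  obtain R where R: "R \<in> sym_group" "R (e 1) = e 1" "R (e 2) = (- 1 / 2) *\<^sub>R e 2 + (sqrt 3 / 2) *\<^sub>R e 3"
    "R (e 3) = (- sqrt 3 / 2) *\<^sub>R e 2 + (- 1 / 2) *\<^sub>R e 3"
    by (rule adapted_third_rotation[OF A]) (rule that; assumption)
  define t where "t = g v (e 1)"
  have ve: "v = t *\<^sub>R e 1"
    unfolding t_def using R f[OF R(1)] by (intro third_rotation_fixes[OF e, of R]) (auto simp: sym_group_def)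
  have "t * t = 1" using v(1) by (simp add: ve spd_simps[OF g] onb_simps[OF e])
  moreover have "t * (t * (t * (2 * l))) > 0"
    using v(2) A by (simp add: ve K_simps adapted_def spd_simps[OF g] onb_simps[OF e])
  ultimately have "t * (2 * l) > 0" by (simp flip: mult.assoc)
  then have "t > 0" using l by (simp add: zero_less_mult_iff)
  with \<open>t * t = 1\<close> have "t = 1" by (metis abs_of_pos abs_mult_self_eq mult_cancel_right1 real_sqrt_abs2 real_sqrt_one)
  then show ?thesis using ve by simp
qed

text \<open>Apart from a multiple of the metric only the square of \<open>e 1\<close> remains, so
  where \<open>a \<noteq> b\<close> the tensor \<open>S\<close> determines the axis up to
  sign.\<close>

lemma adapted_S_form:
  assumes A: "adapted e l m n a b"
  shows "g (S x) y = b * g x y + (a - b) * (g x (e 1) * g y (e 1))"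
proof -
  note e = adaptedD(1)[OF A]
  have "g (S x) (e 1) = a * g x (e 1)" "g (S x) (e 2) = b * g x (e 2)" "g (S x) (e 3) = b * g x (e 3)"
    by (simp_all add: S_sym adaptedD[OF A] spd_simps[OF g])
  then show ?thesis
    unfolding onb_inner[OF g e, of "S x" y] onb_inner[OF g e, of x y] by (simp add: sum_3 algebra_simps)
qed

text \<open>The substitute for \<open>S\<close> at points with \<open>a = b\<close>. The sum may be
  formed in any orthonormal frame \<open>u\<close>, hence in a smooth one; the coefficient
  \<open>4 * l\<^sup>2 - 2 * (m\<^sup>2 + n\<^sup>2)\<close> vanishes exactly in the tetrahedral
  case.\<close>

lemma adapted_K_form:
  assumes A: "adapted e l m n a b" and o: "onb g u"
  shows "(\<Sum>k\<in>UNIV. \<Sum>j\<in>UNIV. g (K x (u k)) (u j) * g (K y (u k)) (u j)) =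
    (2 * l\<^sup>2 + 2 * (m\<^sup>2 + n\<^sup>2)) * g x y + (4 * l\<^sup>2 - 2 * (m\<^sup>2 + n\<^sup>2)) * (g x (e 1) * g y (e 1))"
proof -
  note B = adaptedD[OF A]
  note e = B(1)
  have c: "g (K x (e k)) (e j) = g (K (e j) (e k)) x" for x k j
    using C_sym K_sym by metis
  have k: "K (e 2) (e 1) = K (e 1) (e 2)" "K (e 3) (e 1) = K (e 1) (e 3)" "K (e 3) (e 2) = K (e 2) (e 3)"
    by (rule K_sym)+
  have "(\<Sum>k\<in>UNIV. \<Sum>j\<in>UNIV. g (K x (u k)) (u j) * g (K y (u k)) (u j)) = (\<Sum>k\<in>UNIV. g (K x (u k)) (K y (u k)))"
    by (simp add: onb_inner[OF g o, symmetric])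
  also have "\<dots> = (\<Sum>k\<in>UNIV. g (K x (e k)) (K y (e k)))"
    by (rule onb_trace_independent[OF g e o]) (auto intro!: linearI simp: bilinear_def K_simps spd_simps[OF g])
  also have "\<dots> = (\<Sum>k\<in>UNIV. \<Sum>j\<in>UNIV. g (K (e j) (e k)) x * g (K (e j) (e k)) y)"
    unfolding onb_inner[OF g e, of "K x _"] c ..
  also have "\<dots> = (2 * l\<^sup>2 + 2 * (m\<^sup>2 + n\<^sup>2)) * (g x (e 1) * g y (e 1) + g x (e 2) * g y (e 2) + g x (e 3) * g y (e 3))
      + (4 * l\<^sup>2 - 2 * (m\<^sup>2 + n\<^sup>2)) * (g x (e 1) * g y (e 1))"
    unfolding sum_3 k B(2-7) by (simp add: spd_simps[OF g] spd_sym[OF g, of "e 1"] spd_sym[OF g, of "e 2"] spd_sym[OF g, of "e 3"])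
      (simp add: power2_eq_square algebra_simps)
  finally show ?thesis unfolding onb_inner[OF g e, of x y] by (simp add: sum_3)
qed

end

section \<open>Smoothness of the symmetry axis\<close>

context hypersurface
begin

lemma framed_exists:
  obtains b where "framed_hypersurface V f \<xi> b"
proof -
  obtain b where "\<And>i. smooth_on V (b i)" "\<And>w. w \<in> V \<Longrightarrow> onb (h w) (\<lambda>i. b i w)"
    "\<And>w. w \<in> V \<Longrightarrow> b 1 w = (1 / sqrt (h w (axis 1 1) (axis 1 1))) *\<^sub>R axis 1 1"
    by (rule smooth_orthonormalization[OF open_V order_refl, of "\<lambda>i _. axis i 1"])
      (auto intro: smooth_on_const open_V axis_independent that)
  then have "framed_hypersurface V f \<xi> b"
    by (intro framed_hypersurface.intro hypersurface_axioms framed_hypersurface_axioms.intro)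
  then show ?thesis by (rule that)
qed

lemma bilinear_K:
  assumes w: "w \<in> V"
  shows "bilinear (K w)"
proof -
  obtain b where "framed_hypersurface V f \<xi> b" by (rule framed_exists)
  then interpret F: framed_hypersurface V f \<xi> b .
  show ?thesis
    unfolding bilinear_def F.K_eq[OF w]
    by (auto intro!: linearI simp: spd_simps[OF spd_h[OF w]] algebra_simps sum.distrib scaleR_sum_left
        scaleR_sum_right sum_distrib_left)
qed

text \<open>Each identity is known for the components in a smooth frame and is carried over to
  arbitrary vectors one argument at a time.\<close>

lemma cubic: 
  assumes w: "w \<in> V"
  shows "cubic_data (h w) (K w) (S w)"
proof -
  obtain b where "framed_hypersurface V f \<xi> b" by (rule framed_exists)
  then interpret F: framed_hypersurface V f \<xi> b .
  note g = spd_h[OF w] and K = bilinear_K[OF w] and S = linear_S[OF w]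
  note o = onb_linear_eqI[OF g F.onb_e[OF w]]
  note K_simps = bilinear_ladd[OF K] bilinear_radd[OF K] bilinear_lmul[OF K] bilinear_rmul[OF K]
  note Ks = K_simps spd_simps[OF g] algebra_simps
  have 1: "K w (b i w) (b j w) = K w (b j w) (b i w)" for i j
    unfolding F.K_e[OF w] using F.C_symmetric(2)[OF w] by simp
  have 2: "K w x (b j w) = K w (b j w) x" for x j
    by (rule o[where F = "\<lambda>x. K w x (b j w)" and H = "\<lambda>x. K w (b j w) x"]) (auto intro!: linearI simp: K_simps 1)
  have 3: "K w x y = K w y x" for x y
    by (rule o[where F = "\<lambda>y. K w x y" and H = "\<lambda>y. K w y x"]) (auto intro!: linearI simp: K_simps 2)
  have 4: "h w (K w (b i w) (b j w)) (b k w) = h w (K w (b i w) (b k w)) (b j w)" for i j k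
    unfolding F.h_K_e[OF w] using F.C_symmetric(1)[OF w] .
  have 5: "h w (K w x (b j w)) (b k w) = h w (K w x (b k w)) (b j w)" for x j k
    by (rule o[where F = "\<lambda>x. h w (K w x (b j w)) (b k w)" and H = "\<lambda>x. h w (K w x (b k w)) (b j w)"])
      (auto intro!: linearI simp: Ks 4)
  have 6: "h w (K w x y) (b k w) = h w (K w x (b k w)) y" for x y k
    by (rule o[where F = "\<lambda>y. h w (K w x y) (b k w)" and H = "\<lambda>y. h w (K w x (b k w)) y"])
      (auto intro!: linearI simp: Ks 5)
  have 7: "h w (K w x y) z = h w (K w x z) y" for x y z
    by (rule o[where F = "\<lambda>z. h w (K w x y) z" and H = "\<lambda>z. h w (K w x z) y"])
      (auto intro!: linearI simp: Ks 6)
  have 8: "(\<Sum>k\<in>UNIV. h w (K w x (b k w)) (b k w)) = 0" for x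
    by (rule o[where F = "\<lambda>x. \<Sum>k\<in>UNIV. h w (K w x (b k w)) (b k w)" and H = "\<lambda>x. 0"])
      (auto intro!: linearI simp: K_simps spd_simps[OF g] sum.distrib sum_distrib_left F.h_K_e[OF w] F.C_apolar[OF w])
  have 9: "(\<Sum>k\<in>UNIV. h w (K w x (e k)) (e k)) = 0" if "onb (h w) e" for x e
  proof -
    have "bilinear (\<lambda>y z. h w (K w x y) z)"
      unfolding bilinear_def by (auto intro!: linearI simp: K_simps spd_simps[OF g])
    from onb_trace_independent[OF g that F.onb_e[OF w] this] show ?thesis using 8 by simp
  qed
  have 10: "h w (S w (b i w)) (b j w) = h w (b i w) (S w (b j w))" for i j
    using F.Sm_symmetric_Codazzi(1)[OF w, of i j] spd_sym[OF g, of "b i w"] by (simp add: F.Sm_def)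
  have 11: "h w (S w x) (b j w) = h w x (S w (b j w))" for x j
    by (rule o[where F = "\<lambda>x. h w (S w x) (b j w)" and H = "\<lambda>x. h w x (S w (b j w))"])
      (auto intro!: linearI simp: spd_simps[OF g] linear_add[OF S] linear_scale[OF S] 10)
  have 12: "h w (S w x) y = h w x (S w y)" for x y
    by (rule o[where F = "\<lambda>y. h w (S w x) y" and H = "\<lambda>y. h w x (S w y)"])
      (auto intro!: linearI simp: spd_simps[OF g] linear_add[OF S] linear_scale[OF S] 11)
  show ?thesis by (rule cubic_data.intro) (fact g K 3 7 9 S 12)+
qed

abbreviation "adapted w \<equiv> cubic_data.adapted (h w) (K w) (S w)"

lemma symmetry_group_eq: "w \<in> V \<Longrightarrow> symmetry_group f \<xi> w = cubic_data.sym_group (h w) (K w) (S w)"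
  unfolding symmetry_group_def cubic_data.sym_group_def[OF cubic] ..

end

lemma rotation_about_e1_iff:
  "rotation_about_e1 e \<theta> R \<longleftrightarrow> linear R \<and> R (e 1) = e 1 \<and> R (e 2) = cos \<theta> *\<^sub>R e 2 + sin \<theta> *\<^sub>R e 3 \<and>
     R (e 3) = (- sin \<theta>) *\<^sub>R e 2 + cos \<theta> *\<^sub>R e 3"
  by (auto simp: rotation_about_e1_def has_matrix_def forall_3 sum_3)

text \<open>A description of \<open>e\<^sub>1\<close> that mentions no frame and can therefore be
  compared between charts. Positivity of the cubic form orients the axis; it corresponds to
  \<open>\<lambda> > 0\<close>.\<close>

definition is_axis :: "(real^3 \<Rightarrow> real^4) \<Rightarrow> (real^3 \<Rightarrow> real^4) \<Rightarrow> real^3 \<Rightarrow> real^3 \<Rightarrow> bool" where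
  "is_axis f \<xi> w v \<longleftrightarrow> affine_metric f \<xi> w v v = 1 \<and> (\<forall>R\<in>symmetry_group f \<xi> w. R v = v) \<and>
     affine_metric f \<xi> w (difference_tensor f \<xi> w v v) v > 0"

definition sym_axis :: "(real^3 \<Rightarrow> real^4) \<Rightarrow> (real^3 \<Rightarrow> real^4) \<Rightarrow> real^3 \<Rightarrow> real^3" where
  "sym_axis f \<xi> w = (THE v. is_axis f \<xi> w v)"

locale symmetric_hypersurface = hypersurface +
  fixes G :: symmetry_type
  assumes symmetry: "\<And>w. w \<in> V \<Longrightarrow> \<exists>e. orthonormal (h w) e \<and>
    symmetry_group f \<xi> w = {R. \<exists>\<theta>\<in>rotation_angles G. rotation_about_e1 e \<theta> R}"
begin

abbreviation "ax \<equiv> sym_axis f \<xi>"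

text \<open>The angle \<open>2 * pi / 3\<close> occurs for both symmetry types, so the turn by a
  third serves both. The half turn, available for \<open>SO2\<close>, reverses \<open>e 2\<close>
  and \<open>e 3\<close> and so kills \<open>m\<close> and \<open>n\<close>. A negative
  \<open>l\<close> is repaired by reversing the axis.\<close>

lemma pointwise_normal_form:
  assumes w: "w \<in> V"
  obtains e l m n a b where "adapted w e l m n a b" "l > 0" "m\<^sup>2 + n\<^sup>2 \<noteq> 2 * l\<^sup>2 \<or> a \<noteq> b"
    "G = SO2 \<Longrightarrow> m = 0 \<and> n = 0" "\<And>R. R \<in> symmetry_group f \<xi> w \<Longrightarrow> R (e 1) = e 1"
proof -
  interpret P: cubic_data "h w" "K w" "S w" by (rule cubic[OF w])
  note g = spd_h[OF w]
  obtain e where "orthonormal (h w) e"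
    and grp: "symmetry_group f \<xi> w = {R. \<exists>\<theta>\<in>rotation_angles G. rotation_about_e1 e \<theta> R}"
    using symmetry[OF w] by blast
  then have e: "onb (h w) e" using orthonormal_iff_onb[OF g] by simp
  \<comment> \<open>The group is given as a set of maps; that every allowed angle really occurs
    needs the construction of a rotation.\<close>
  have ex: "\<exists>R\<in>P.sym_group. rotation_about_e1 e \<theta> R" if "\<theta> \<in> rotation_angles G" for \<theta>
  proof -
    define u where "u k = (if k = 1 then e 1 else if k = 2 then cos \<theta> *\<^sub>R e 2 + sin \<theta> *\<^sub>R e 3
      else (- sin \<theta>) *\<^sub>R e 2 + cos \<theta> *\<^sub>R e 3)" for k :: 3
    have "onb (h w) u" unfolding u_def[abs_def]
      by (rule P.onbI3) (simp_all add: spd_simps[OF g] P.onb_simps[OF e] flip: power2_eq_square)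
    then obtain R where R: "linear R" "\<And>k. R (e k) = u k" "\<And>x y. h w (R x) (R y) = h w x y"
      by (rule P.frame_map[OF e]) (rule that; assumption)
    have "rotation_about_e1 e \<theta> R" unfolding rotation_about_e1_iff using R by (simp add: u_def)
    then have "R \<in> symmetry_group f \<xi> w" using grp that by blast
    then show ?thesis using \<open>rotation_about_e1 e \<theta> R\<close> symmetry_group_eq[OF w] by auto
  qed
  have fix1: "R (e 1) = e 1" if "R \<in> P.sym_group" for R
    using that grp symmetry_group_eq[OF w] rotation_about_e1_iff by auto
  have "2 * pi / 3 \<in> rotation_angles G" by (cases G) auto
  from ex[OF this] obtain R where R: "R \<in> P.sym_group" "rotation_about_e1 e (2 * pi / 3) R" by blast
  then have R': "R (e 1) = e 1" "R (e 2) = (- 1 / 2) *\<^sub>R e 2 + (sqrt 3 / 2) *\<^sub>R e 3"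
    "R (e 3) = (- sqrt 3 / 2) *\<^sub>R e 2 + (- 1 / 2) *\<^sub>R e 3"
    unfolding rotation_about_e1_iff by (auto simp: cos_120 sin_120)
  obtain l m n a b where A: "P.adapted e l m n a b"
    by (rule P.third_rotation_normal_form[OF e R(1) R']) (rule that; assumption)
  have so2: "m = 0 \<and> n = 0" if "G = SO2"
  proof -
    obtain Q where Q: "Q \<in> P.sym_group" "rotation_about_e1 e pi Q" using ex[of pi] \<open>G = SO2\<close> by auto
    then have l: "linear Q" "Q (e 1) = e 1" "Q (e 2) = - e 2" "Q (e 3) = - e 3"
      unfolding rotation_about_e1_iff by auto
    have "K w (Q (e 2)) (Q (e 2)) = Q (K w (e 2) (e 2))" using Q(1) by (simp add: P.sym_group_def)
    then have "K w (e 2) (e 2) = Q (K w (e 2) (e 2))" by (simp add: l P.K_simps)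
    then have "(- l) *\<^sub>R e 1 + m *\<^sub>R e 2 + n *\<^sub>R e 3 = (- l) *\<^sub>R e 1 - m *\<^sub>R e 2 - n *\<^sub>R e 3"
      unfolding P.adaptedD(5)[OF A] by (simp add: l(2-4) linear_add[OF l(1)] linear_diff[OF l(1)] linear_neg[OF l(1)] linear_scale[OF l(1)])
    from arg_cong[OF this, of "\<lambda>x. h w x (e 2)"] arg_cong[OF this, of "\<lambda>x. h w x (e 3)"]
    show ?thesis by (simp add: spd_simps[OF g] P.onb_simps[OF e])
  qed
  have nd: "l \<noteq> 0" "\<not> (m\<^sup>2 + n\<^sup>2 = 2 * l\<^sup>2 \<and> a = b)"
    by (rule P.adapted_nondegenerate[OF A]; rule fix1; assumption)+
  show ?thesis
  proof (cases "l > 0")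
    case True
    then show ?thesis using that[OF A True] nd so2 fix1 symmetry_group_eq[OF w] by auto
  next
    case False
    define e' where "e' k = (if k = 1 then - e 1 else if k = 2 then e 2 else e 3)" for k :: 3
    have A': "P.adapted e' (- l) m n a b" unfolding e'_def[abs_def] by (rule P.adapted_flip[OF A])
    have f: "R (e' 1) = e' 1" if "R \<in> symmetry_group f \<xi> w" for R
      using that fix1[of R] symmetry_group_eq[OF w] linear_neg[of R "e 1"] by (auto simp: e'_def P.sym_group_def)
    show ?thesis by (rule that[OF A']) (use False nd so2 f in auto)
  qed
qed

lemma axis_eq:
  assumes w: "w \<in> V" and A: "adapted w e l m n a b" and l: "l > 0"
    and f: "\<And>R. R \<in> symmetry_group f \<xi> w \<Longrightarrow> R (e 1) = e 1"
  shows "ax w = e 1" "is_axis f \<xi> w (e 1)"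
proof -
  interpret P: cubic_data "h w" "K w" "S w" by (rule cubic[OF w])
  note g = spd_h[OF w]
  have e: "onb (h w) e" using P.adaptedD(1)[OF A] .
  show *: "is_axis f \<xi> w (e 1)"
    unfolding is_axis_def using f l P.adaptedD(2)[OF A] P.onb_simps[OF e] by (auto simp: spd_simps[OF g])
  show "ax w = e 1"
    unfolding sym_axis_def
  proof (rule the_equality[where P = "is_axis f \<xi> w", OF *])
    fix v assume "is_axis f \<xi> w v"
    then show "v = e 1" using symmetry_group_eq[OF w] unfolding is_axis_def
      by (intro P.axis_unique[OF A l]) auto
  qed
qed

lemma adapted_at_axis:
  assumes w: "w \<in> V"
  obtains e l m n a b where "adapted w e l m n a b" "l > 0" "m\<^sup>2 + n\<^sup>2 \<noteq> 2 * l\<^sup>2 \<or> a \<noteq> b"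
    "G = SO2 \<Longrightarrow> m = 0 \<and> n = 0" "e 1 = ax w"
proof -
  obtain e l m n a b where *: "adapted w e l m n a b" "l > 0" "m\<^sup>2 + n\<^sup>2 \<noteq> 2 * l\<^sup>2 \<or> a \<noteq> b"
    "G = SO2 \<Longrightarrow> m = 0 \<and> n = 0" "\<And>R. R \<in> symmetry_group f \<xi> w \<Longrightarrow> R (e 1) = e 1"
    by (rule pointwise_normal_form[OF w]) (rule that; assumption)
  have "ax w = e 1" by (rule axis_eq(1)[OF w *(1,2)]) (rule *(5))
  then show ?thesis using that[OF *(1-4)] by simp
qed

lemma is_axis_ax: "w \<in> V \<Longrightarrow> is_axis f \<xi> w (ax w)"
  by (rule pointwise_normal_form[of w]) (simp_all add: axis_eq)

lemma is_axis_unique: "w \<in> V \<Longrightarrow> is_axis f \<xi> w v \<Longrightarrow> v = ax w"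
proof -
  assume w: "w \<in> V" and v: "is_axis f \<xi> w v"
  interpret P: cubic_data "h w" "K w" "S w" by (rule cubic[OF w])
  obtain e l m n a b where *: "adapted w e l m n a b" "l > 0" "e 1 = ax w"
    by (rule adapted_at_axis[OF w]) (rule that; assumption)
  show "v = ax w" using v symmetry_group_eq[OF w] unfolding is_axis_def *(3)[symmetric]
    by (intro P.axis_unique[OF *(1,2)]) auto
qed

end

text \<open>If \<open>T = p I + q v v\<^sup>t\<close> with a unit vector \<open>v\<close>, then \<open>v v\<^sup>t\<close> is a rational function of \<open>T\<close>: for the
  traceless part \<open>T\<^sub>0\<close> one has \<open>v v\<^sup>t = 2 T\<^sub>0\<^sup>2 / tr T\<^sub>0\<^sup>2 - I / 3\<close>.\<close>

lemma smooth_rank_one_projection: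
  fixes T :: "3 \<Rightarrow> 3 \<Rightarrow> 'a::euclidean_space \<Rightarrow> real"
  assumes sm: "\<And>i j. smooth_on V (T i j)"
    and T: "\<And>w i j. w \<in> V \<Longrightarrow> T i j w = p w * delta i j + q w * (v w i * v w j)"
    and v: "\<And>w. w \<in> V \<Longrightarrow> v w 1 * v w 1 + v w 2 * v w 2 + v w 3 * v w 3 = 1"
    and w0: "w0 \<in> V" "q w0 \<noteq> 0"
  obtains U where "open U" "w0 \<in> U" "U \<subseteq> V" "\<And>i j. smooth_on U (\<lambda>w. v w i * v w j)"
proof -
  have o: "open V" using sm by (rule smooth_on_open)
  define T0 where "T0 i j w = T i j w - (T 1 1 w + T 2 2 w + T 3 3 w) / 3 * delta i j" for i j w
  define N where "N w = (\<Sum>i\<in>UNIV. \<Sum>j\<in>UNIV. T0 i j w * T0 i j w)" for w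
  define P where "P i j w = 2 * (\<Sum>k\<in>UNIV. T0 i k w * T0 k j w) / N w - delta i j / 3" for i j w
  have sT0: "smooth_on V (T0 i j)" for i j
    unfolding T0_def by (intro smooth_on_diff smooth_on_mult smooth_on_divide smooth_on_add smooth_on_const sm o) auto
  have sN: "smooth_on V N" unfolding N_def by (intro smooth_on_sum smooth_on_mult sT0 o) auto
  have T0: "T0 i j w = q w * (v w i * v w j - delta i j / 3)" if "w \<in> V" for i j w
  proof -
    have "T 1 1 w + T 2 2 w + T 3 3 w = 3 * p w + q w * (v w 1 * v w 1 + v w 2 * v w 2 + v w 3 * v w 3)"
      unfolding T[OF that] by (simp add: algebra_simps)
    then show ?thesis unfolding T0_def v[OF that] T[OF that] by (simp add: algebra_simps)
  qed
  have sq: "(\<Sum>k\<in>UNIV. T0 i k w * T0 k j w) = q w * q w * (v w i * v w j / 3 + delta i j / 9)" if "w \<in> V" for i j w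
  proof -
    have "(\<Sum>k\<in>UNIV. T0 i k w * T0 k j w) = q w * q w * (\<Sum>k\<in>UNIV. (v w i * v w k - delta i k / 3) * (v w k * v w j - delta k j / 3))"
      unfolding T0[OF that] by (simp add: sum_distrib_left mult_ac)
    also have "(\<Sum>k\<in>UNIV. (v w i * v w k - delta i k / 3) * (v w k * v w j - delta k j / 3)) =
      (\<Sum>k\<in>UNIV. v w i * v w j * (v w k * v w k) - v w j / 3 * (v w k * delta i k) - v w i / 3 * (v w k * delta k j) + delta k j / 9 * delta i k)"
      by (rule sum.cong) (simp_all add: algebra_simps)
    also have "\<dots> = v w i * v w j * (\<Sum>k\<in>UNIV. v w k * v w k) - v w j / 3 * v w i - v w i / 3 * v w j + delta i j / 9"
      by (simp add: sum.distrib sum_subtractf sum_divide_distrib[symmetric] sum_distrib_left[symmetric])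
    also have "\<dots> = v w i * v w j / 3 + delta i j / 9"
      using v[OF that] by (simp add: sum_3)
    finally show ?thesis .
  qed
  have symT0: "T0 j i w = T0 i j w" if "w \<in> V" for i j w
    unfolding T0[OF that] by (simp add: delta_commute[of j i])
  have N: "N w = 2 / 3 * (q w * q w)" if "w \<in> V" for w
  proof -
    have "N w = (\<Sum>i\<in>UNIV. \<Sum>j\<in>UNIV. T0 i j w * T0 j i w)"
      unfolding N_def symT0[OF that] ..
    also have "\<dots> = (\<Sum>i\<in>UNIV. q w * q w * (v w i * v w i / 3 + 1 / 9))"
      unfolding sq[OF that] by simp
    also have "\<dots> = q w * q w * ((v w 1 * v w 1 + v w 2 * v w 2 + v w 3 * v w 3) / 3 + 1 / 3)"
      by (simp add: sum_3 algebra_simps)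
    finally show ?thesis unfolding v[OF that] by simp
  qed
  define U where "U = {w \<in> V. N w \<noteq> 0}"
  have "open U" using continuous_open_preimage[OF smooth_on_continuous[OF sN] o, of "- {0}"]
    by (simp add: U_def vimage_def Int_def open_Compl)
  moreover have "N w0 \<noteq> 0" unfolding N[OF w0(1)] using w0(2) by simp
  then have "w0 \<in> U" using w0(1) by (simp add: U_def)
  moreover have "U \<subseteq> V" by (auto simp: U_def)
  moreover have "smooth_on U (\<lambda>w. v w i * v w j)" for i j
  proof -
    have s: "smooth_on U (T0 i j)" "smooth_on U N" for i j
      using smooth_on_subset[OF sT0 \<open>open U\<close> \<open>U \<subseteq> V\<close>] smooth_on_subset[OF sN \<open>open U\<close> \<open>U \<subseteq> V\<close>] .
    have "smooth_on U (P i j)" unfolding P_def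
      by (intro smooth_on_diff smooth_on_divide smooth_on_mult smooth_on_sum smooth_on_const s \<open>open U\<close>)
        (auto simp: U_def)
    moreover have "P i j w = v w i * v w j" if "w \<in> U" for w
    proof -
      have wV: "w \<in> V" and "q w * q w \<noteq> 0" using that N[of w] by (auto simp: U_def)
      then show ?thesis unfolding P_def sq[OF wV] N[OF wV] by (simp add: field_simps)
    qed
    ultimately show ?thesis using smooth_on_cong by (metis (no_types, lifting))
  qed
  ultimately show ?thesis by (rule that)
qed

context symmetric_hypersurface
begin

text \<open>The tensor is selected at \<open>w0\<close> alone: \<open>S\<close> if its two
  eigenvalues differ there, otherwise the trace form of \<open>K\<close>. Its form holds on all of
  \<open>V\<close>, but \<open>q\<close> is known to be nonzero only at \<open>w0\<close>.\<close>

lemma axis_matrix: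
  assumes F: "framed_hypersurface V f \<xi> b" and w0: "w0 \<in> V"
  obtains T p q where "\<And>i j. smooth_on V (T i j)"
    "\<And>w i j. w \<in> V \<Longrightarrow> T i j w = p w * delta i j + q w * (h w (ax w) (b i w) * h w (ax w) (b j w))"
    "q w0 \<noteq> (0 :: real)"
proof -
  interpret F: framed_hypersurface V f \<xi> b by (rule F)
  have "\<forall>w. \<exists>e l m n a c. w \<in> V \<longrightarrow> adapted w e l m n a c \<and> (m\<^sup>2 + n\<^sup>2 \<noteq> 2 * l\<^sup>2 \<or> a \<noteq> c) \<and> e 1 = ax w"
    using adapted_at_axis by metis
  then obtain e l m n a c where D: "\<And>w. w \<in> V \<Longrightarrow> adapted w (e w) (l w) (m w) (n w) (a w) (c w)"
    "\<And>w. w \<in> V \<Longrightarrow> (m w)\<^sup>2 + (n w)\<^sup>2 \<noteq> 2 * (l w)\<^sup>2 \<or> a w \<noteq> c w" "\<And>w. w \<in> V \<Longrightarrow> e w 1 = ax w"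
    by metis
  show ?thesis
  proof (cases "a w0 = c w0")
    case False
    have "F.Sm i j w = c w * delta i j + (a w - c w) * (h w (ax w) (b i w) * h w (ax w) (b j w))" if w: "w \<in> V" for w i j
    proof -
      interpret P: cubic_data "h w" "K w" "S w" by (rule cubic[OF w])
      note sy = spd_sym[OF spd_h[OF w], of "ax w"]
      show ?thesis unfolding F.Sm_def P.adapted_S_form[OF D(1)[OF w]] D(3)[OF w] sy[of "b i w"] sy[of "b j w"]
        by (simp add: F.h_e[OF w])
    qed
    then show ?thesis using that[of F.Sm c "\<lambda>w. a w - c w"] F.smooth_Sm False by simp
  next
    case True
    define L where "L i j w = (\<Sum>k\<in>UNIV. \<Sum>l\<in>UNIV. F.C i k l w * F.C j k l w)" for i j w
    have sL: "smooth_on V (L i j)" for i j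
      unfolding L_def by (intro smooth_on_sum smooth_on_mult F.smooth_C open_V) auto
    have "L i j w = (2 * (l w)\<^sup>2 + 2 * ((m w)\<^sup>2 + (n w)\<^sup>2)) * delta i j +
        (4 * (l w)\<^sup>2 - 2 * ((m w)\<^sup>2 + (n w)\<^sup>2)) * (h w (ax w) (b i w) * h w (ax w) (b j w))" if w: "w \<in> V" for w i j
    proof -
      interpret P: cubic_data "h w" "K w" "S w" by (rule cubic[OF w])
      note sy = spd_sym[OF spd_h[OF w], of "ax w"]
      show ?thesis unfolding L_def F.h_K_e[OF w, symmetric] P.adapted_K_form[OF D(1)[OF w] F.onb_e[OF w]] D(3)[OF w]
          sy[of "b i w"] sy[of "b j w"] by (simp add: F.h_e[OF w])
    qed
    then show ?thesis
      using that[of L "\<lambda>w. 2 * (l w)\<^sup>2 + 2 * ((m w)\<^sup>2 + (n w)\<^sup>2)" "\<lambda>w. 4 * (l w)\<^sup>2 - 2 * ((m w)\<^sup>2 + (n w)\<^sup>2)"]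
        sL True D(2)[OF w0] by simp
  qed
qed

text \<open>The tensor yields only the products \<open>v w i * v w j\<close>, that is the axis up to
  a sign that might jump from point to point. Dividing by the root of one square gives a smooth
  field \<open>X\<close> that is the axis up to sign, and the cubic form on \<open>X\<close> reveals
  the sign.\<close>

lemma smooth_axis:
  assumes w0: "w0 \<in> V"
  obtains U where "open U" "w0 \<in> U" "U \<subseteq> V" "smooth_on U ax"
proof -
  obtain b where F: "framed_hypersurface V f \<xi> b" by (rule framed_exists)
  interpret F: framed_hypersurface V f \<xi> b by (rule F)
  define v where "v w i = h w (ax w) (b i w)" for w i
  have unit: "h w (ax w) (ax w) = 1" and pos: "h w (K w (ax w) (ax w)) (ax w) > 0" if "w \<in> V" for w
    using is_axis_ax[OF that] by (auto simp: is_axis_def)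
  obtain T p q where T': "\<And>i j. smooth_on V (T i j)"
    "\<And>w i j. w \<in> V \<Longrightarrow> T i j w = p w * delta i j + q w * (h w (ax w) (b i w) * h w (ax w) (b j w))" "q w0 \<noteq> (0 :: real)"
    by (rule axis_matrix[OF F w0]) (rule that; assumption)
  note T = T'[folded v_def]
  have v1: "v w 1 * v w 1 + v w 2 * v w 2 + v w 3 * v w 3 = 1" if "w \<in> V" for w
    using onb_inner[OF spd_h[OF that] F.onb_e[OF that], of "ax w" "ax w"] unit[OF that] by (simp add: sum_3 v_def)
  obtain U1 where U1: "open U1" "w0 \<in> U1" "U1 \<subseteq> V" "\<And>i j. smooth_on U1 (\<lambda>w. v w i * v w j)"
    by (rule smooth_rank_one_projection[OF T(1,2) v1 w0 T(3)]) (assumption | rule that)+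
  have "\<exists>k. v w0 k \<noteq> 0" using v1[OF w0] by (metis mult_zero_left add_0 zero_neq_one)
  then obtain k where k: "v w0 k \<noteq> 0" by blast
  define U2 where "U2 = {w \<in> U1. v w k * v w k > 0}"
  have "U2 = U1 \<inter> (\<lambda>w. v w k * v w k) -` {0<..}" by (auto simp: U2_def)
  then have oU2: "open U2"
    using continuous_open_preimage[OF smooth_on_continuous[OF U1(4)] U1(1), of "{0<..}" k k] by simp
  have U2: "U2 \<subseteq> U1" "w0 \<in> U2" using U1(2) k by (auto simp: U2_def zero_less_mult_iff)
  have sU2: "smooth_on U2 (\<lambda>w. v w i * v w j)" for i j using smooth_on_subset[OF U1(4) oU2 U2(1)] .
  define u where "u i w = (v w i * v w k) / sqrt (v w k * v w k)" for i w
  have su: "smooth_on U2 (u i)" for i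
    unfolding u_def by (intro smooth_on_divide smooth_on_sqrt sU2) (auto simp: U2_def)
  have uv: "u i w = sgn (v w k) * v w i" if "w \<in> U2" for i w
    using that by (auto simp: u_def U2_def sgn_if real_sqrt_mult_self abs_if)
  define X where "X w = (\<Sum>i\<in>UNIV. u i w *\<^sub>R b i w)" for w
  have sX: "smooth_on U2 X"
    unfolding X_def using smooth_on_subset[OF F.smooth_e oU2] U1(3) U2(1)
    by (intro smooth_on_sum smooth_on_scaleR su oU2) auto
  have Xv: "X w = sgn (v w k) *\<^sub>R ax w" if "w \<in> U2" for w
  proof -
    have "w \<in> V" using that U1(3) U2(1) by auto
    then have "ax w = (\<Sum>i\<in>UNIV. v w i *\<^sub>R b i w)" unfolding v_def by (rule F.e_expand)
    then show ?thesis by (simp add: X_def uv[OF that] scaleR_sum_right)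
  qed
  \<comment> \<open>The cubic form on \<open>X\<close>: smooth by construction, and of the sign of
    \<open>v w k\<close> because it is odd.\<close>
  define c where "c w = (\<Sum>i\<in>UNIV. \<Sum>j\<in>UNIV. \<Sum>r\<in>UNIV. F.C i j r w * u i w * u j w * u r w)" for w
  have "smooth_on U2 (F.C i j r)" for i j r using smooth_on_subset[OF F.smooth_C oU2] U1(3) U2(1) by auto
  then have sc: "smooth_on U2 c"
    unfolding c_def by (intro smooth_on_sum smooth_on_mult su oU2) auto
  have cK: "c w = sgn (v w k) * h w (K w (ax w) (ax w)) (ax w)" if "w \<in> U2" for w
  proof -
    have w: "w \<in> V" using that U1(3) U2(1) by auto
    note g = spd_h[OF w]
    have hX: "h w (X w) (b i w) = u i w" for i
      unfolding X_def by (simp add: spd_simps[OF g] F.h_e[OF w])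
    have "c w = h w (K w (X w) (X w)) (X w)"
    proof -
      have "h w (K w (X w) (X w)) (X w) = (\<Sum>r\<in>UNIV. (\<Sum>i\<in>UNIV. \<Sum>j\<in>UNIV. F.C i j r w * u i w * u j w) * u r w)"
        unfolding F.K_eq[OF w] hX by (simp add: spd_simps[OF g] spd_sym[OF g, of "b _ w" "X w"] hX)
      also have "\<dots> = c w" unfolding c_def sum_3 by (simp add: algebra_simps)
      finally show ?thesis ..
    qed
    also have "\<dots> = sgn (v w k) * sgn (v w k) * sgn (v w k) * h w (K w (ax w) (ax w)) (ax w)"
      unfolding Xv[OF that] using bilinear_K[OF w] by (simp add: bilinear_lmul bilinear_rmul spd_simps[OF g])
    finally show ?thesis by (simp add: sgn_if)
  qed
  have c0: "c w0 \<noteq> 0" using cK[OF U2(2)] pos[OF w0] k by (simp add: sgn_if)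
  \<comment> \<open>Here the sign is that at \<open>w0\<close>, so a constant sign times
    \<open>X\<close> is the axis.\<close>
  define U where "U = {w \<in> U2. c w * c w0 > 0}"
  have "smooth_on U2 (\<lambda>w. c w * c w0)" by (intro smooth_on_mult sc smooth_on_const oU2)
  from continuous_open_preimage[OF smooth_on_continuous[OF this] oU2, of "{0<..}"]
  have oU: "open U" by (simp add: U_def vimage_def Int_def)
  have "w0 \<in> U" using U2(2) c0 by (auto simp: U_def zero_less_mult_iff)
  moreover have UV: "U \<subseteq> V" "U \<subseteq> U2" using U1(3) U2(1) by (auto simp: U_def)
  moreover have "smooth_on U ax"
  proof -
    have "ax w = sgn (v w0 k) *\<^sub>R X w" if "w \<in> U" for w
    proof -
      have w: "w \<in> U2" "w \<in> V" using that UV by auto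
      have "c w * c w0 > 0" using that by (simp add: U_def)
      then have "sgn (v w0 k) * sgn (v w k) > 0"
        unfolding cK[OF w(1)] cK[OF U2(2)] using pos[OF w(2)] pos[OF w0]
        by (auto simp: zero_less_mult_iff mult_less_0_iff)
      then have "sgn (v w0 k) * sgn (v w k) = 1" by (auto simp: sgn_if split: if_splits)
      then show ?thesis unfolding Xv[OF w(1)] by simp
    qed
    moreover have "smooth_on U (\<lambda>w. sgn (v w0 k) *\<^sub>R X w)"
      by (intro smooth_on_scaleR smooth_on_const oU smooth_on_subset[OF sX oU UV(2)])
    ultimately show ?thesis using smooth_on_cong[of U ax] by simp
  qed
  ultimately show ?thesis using that oU by blast
qed

text \<open>The axis is completed by two vectors frozen at \<open>w0\<close>, independent of it
  nearby, and the result is orthonormalised. A ball is taken for its convexity, needed to integrate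
  the equations of \<open>om\<close> and \<open>W\<close>.\<close>

lemma axis_frame:
  assumes w0: "w0 \<in> V"
  obtains r e where "r > 0" "ball w0 r \<subseteq> V" "framed_hypersurface (ball w0 r) f \<xi> e"
    "\<And>w. w \<in> ball w0 r \<Longrightarrow> e 1 w = ax w"
proof -
  obtain U where U: "open U" "w0 \<in> U" "U \<subseteq> V" "smooth_on U ax" by (rule smooth_axis[OF w0])
  obtain b where "framed_hypersurface V f \<xi> b" by (rule framed_exists)
  obtain e0 l m n a c where A0: "adapted w0 e0 l m n a c" "e0 1 = ax w0"
    by (rule adapted_at_axis[OF w0]) (rule that; assumption)
  have o0: "onb (h w0) e0" by (rule cubic_data.adaptedD(1)[OF cubic[OF w0] A0(1)])
  define M :: "real^3 \<Rightarrow> real^3^3" where "M w = (\<chi> i j. if j = 1 then ax w $ i else e0 j $ i)" for w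
  have Mv: "M w *v x = (x $ 1) *\<^sub>R ax w + (x $ 2) *\<^sub>R e0 2 + (x $ 3) *\<^sub>R e0 (3::3)" for w x
    by (simp add: M_def vec_eq_iff matrix_vector_mult_def sum_3 mult.commute)
  have sM: "smooth_on U (\<lambda>w. det (M w :: real^3^3))"
  proof (rule smooth_on_det[OF U(1)])
    show "smooth_on U (\<lambda>w. M w $ i $ (j::3))" for i j
      using smooth_on_vec_nth[OF U(4)] U(1) by (cases "j = 1") (auto simp: M_def intro: smooth_on_const)
  qed
  have "x = 0" if "M w0 *v x = 0" for x :: "real^3"
  proof -
    note g = spd_h[OF w0]
    have "h w0 (M w0 *v x) (e0 i) = x $ i" for i
      unfolding Mv A0(2)[symmetric] using exhaust_3[of i] o0 by (auto simp: spd_simps[OF g] onb_def)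
    then show ?thesis using that by (simp add: vec_eq_iff spd_simps[OF g])
  qed
  then have d0: "det (M w0 :: real^3^3) \<noteq> 0"
    unfolding invertible_det_nz[symmetric] by (simp add: invertible_left_inverse matrix_left_invertible_ker)
  define U' where "U' = {w \<in> U. det (M w :: real^3^3) \<noteq> 0}"
  have "open U'" using continuous_open_preimage[OF smooth_on_continuous[OF sM] U(1), of "- {0}"]
    by (simp add: U'_def vimage_def Int_def open_Compl)
  moreover have "w0 \<in> U'" using U(2) d0 by (simp add: U'_def)
  ultimately obtain r where r: "r > 0" "ball w0 r \<subseteq> U'" using openE by blast
  let ?B = "ball w0 r"
  have BU: "?B \<subseteq> U" "?B \<subseteq> V" using r U(3) by (auto simp: U'_def)
  define u where "u i w = (if i = 1 then ax w else e0 i)" for i :: 3 and w :: "real^3"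
  have su: "smooth_on ?B (u i)" for i
    using smooth_on_subset[OF U(4) open_ball BU(1)] by (cases "i = 1") (auto simp: u_def[abs_def] intro: smooth_on_const)
  have ind: "indep3 (u 1 w) (u 2 w) (u 3 w)" if "w \<in> ?B" for w
    unfolding indep3_def
  proof (intro allI impI)
    fix x y z assume *: "x *\<^sub>R u 1 w + y *\<^sub>R u 2 w + z *\<^sub>R u 3 w = 0"
    define X :: "real^3" where "X = vector [x, y, z]"
    have "M w *v X = 0" using * by (simp add: Mv X_def u_def vector_3)
    moreover have "invertible (M w :: real^3^3)" using that r(2) by (auto simp: U'_def invertible_det_nz)
    ultimately have "X = 0" by (metis invertible_def matrix_left_invertible_ker)
    then have "X $ 1 = 0" "X $ 2 = 0" "X $ 3 = 0" by simp_all
    then show "x = 0 \<and> y = 0 \<and> z = 0" by (simp add: X_def vector_3)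
  qed
  obtain e where e: "\<And>i. smooth_on ?B (e i)" "\<And>w. w \<in> ?B \<Longrightarrow> onb (h w) (\<lambda>i. e i w)"
    "\<And>w. w \<in> ?B \<Longrightarrow> e 1 w = (1 / sqrt (h w (u 1 w) (u 1 w))) *\<^sub>R u 1 w"
    by (rule smooth_orthonormalization[OF open_ball BU(2) su ind]) (assumption | rule that)+
  have "e 1 w = ax w" if "w \<in> ?B" for w
  proof -
    have "h w (ax w) (ax w) = 1" using is_axis_ax that BU by (auto simp: is_axis_def)
    then show ?thesis using e(3)[OF that] by (simp add: u_def)
  qed
  moreover have "framed_hypersurface ?B f \<xi> e"
    by (intro framed_hypersurface.intro hypersurface_subset open_ball BU framed_hypersurface_axioms.intro e)
  ultimately show ?thesis using that r(1) BU by blast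
qed

end

section \<open>The structure equations in a symmetric frame\<close>

text \<open>The numbers of the normal form are only asserted to exist at each point; their
  smoothness comes from reading them off as components of \<open>C\<close> and
  \<open>Sm\<close>.\<close>

locale adapted_hypersurface = framed_hypersurface +
  assumes adapted_frame: "\<And>w. w \<in> V \<Longrightarrow> \<exists>l m n a b. adapted w (\<lambda>i. e i w) l m n a b \<and> l > 0"
    and convex_V: "convex V"
begin

text \<open>In terms of \<open>\<eta> = h(\<nabla>'\<^sub>e\<^sub>2 e\<^sub>1, e\<^sub>2)\<close>, with \<open>\<nabla>'\<close> the Levi-Civita connection, \<open>be = \<eta> - \<lambda>\<close>,
  \<open>al = \<eta> + \<lambda>\<close> and \<open>nu = b + \<eta>\<^sup>2 - \<lambda>\<^sup>2\<close>.\<close>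

definition l :: "real^3 \<Rightarrow> real" where "l w = C 1 1 1 w / 2"
definition a :: "real^3 \<Rightarrow> real" where "a w = Sm 1 1 w"
definition b :: "real^3 \<Rightarrow> real" where "b w = Sm 2 2 w"
definition be :: "real^3 \<Rightarrow> real" where "be w = A 2 1 2 w"
definition al :: "real^3 \<Rightarrow> real" where "al w = be w + 2 * l w"
definition nu :: "real^3 \<Rightarrow> real" where "nu w = b w + al w * be w"
definition th :: "real^3 \<Rightarrow> real^3 \<Rightarrow> real" where "th w x = h w (e 1 w) x"

lemma adapted_l:
  assumes w: "w \<in> V"
  shows "adapted w (\<lambda>i. e i w) (l w) (C 2 2 2 w) (C 2 2 3 w) (a w) (b w)" and "l w > 0"
proof -
  interpret P: cubic_data "h w" "K w" "S w" by (rule cubic[OF w])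
  obtain l' m n a' b' where A: "adapted w (\<lambda>i. e i w) l' m n a' b'" "l' > 0" using adapted_frame[OF w] by blast
  note B = P.adaptedD[OF A(1)] and g = spd_h[OF w]
  have "l w = l'" "C 2 2 2 w = m" "C 2 2 3 w = n" "a w = a'" "b w = b'"
    unfolding l_def a_def b_def Sm_def h_K_e[OF w, symmetric] B(2,5,8,9) by (simp_all add: spd_simps[OF g] h_e[OF w])
  then show "adapted w (\<lambda>i. e i w) (l w) (C 2 2 2 w) (C 2 2 3 w) (a w) (b w)" "l w > 0" using A by auto
qed

text \<open>The matrix of \<open>K\<^sub>e\<^sub>1\<close> divided by \<lambda>, that is
  \<open>diag (2, - 1, - 1)\<close>.\<close>

definition cv :: "3 \<Rightarrow> 3 \<Rightarrow> real" where "cv j k = (if j = 1 \<and> k = 1 then 2 else if j = k then - 1 else 0)"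

lemma C_values:
  assumes w: "w \<in> V"
  shows "C j 1 k w = cv j k * l w" "C j k 1 w = cv j k * l w" "C 1 j k w = cv j k * l w"
    "C 2 3 3 w = - C 2 2 2 w" "C 3 3 3 w = - C 2 2 3 w" "C 2 3 2 w = C 2 2 3 w" "C 3 2 2 w = C 2 2 3 w"
    "C 3 2 3 w = - C 2 2 2 w" "C 3 3 2 w = - C 2 2 2 w"
proof -
  interpret P: cubic_data "h w" "K w" "S w" by (rule cubic[OF w])
  note B = P.adaptedD[OF adapted_l(1)[OF w]] and g = spd_h[OF w]
  note s = C_symmetric[OF w]
  have "\<forall>j k. C 1 j k w = cv j k * l w"
    unfolding forall_3 h_K_e[OF w, symmetric] using B(2-4) P.K_sym
    by (simp add: spd_simps[OF g] h_e[OF w] cv_def)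
  then show 1: "C 1 j k w = cv j k * l w" for j k by blast
  show "C j 1 k w = cv j k * l w" "C j k 1 w = cv j k * l w" using 1 s by metis+
  have "C 2 3 3 w = - C 2 2 2 w" "C 3 3 3 w = - C 2 2 3 w"
    unfolding h_K_e[OF w, symmetric] using B(5-7) by (simp_all add: spd_simps[OF g] h_e[OF w])
  then show "C 2 3 3 w = - C 2 2 2 w" "C 3 3 3 w = - C 2 2 3 w" "C 2 3 2 w = C 2 2 3 w" "C 3 2 2 w = C 2 2 3 w"
    "C 3 2 3 w = - C 2 2 2 w" "C 3 3 2 w = - C 2 2 2 w" using s by metis+
qed

lemma Sm_values:
  assumes w: "w \<in> V"
  shows "Sm 1 1 w = a w" "Sm 2 2 w = b w" "Sm 3 3 w = b w" "Sm 1 2 w = 0" "Sm 1 3 w = 0" "Sm 2 1 w = 0"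
    "Sm 2 3 w = 0" "Sm 3 1 w = 0" "Sm 3 2 w = 0"
proof -
  interpret P: cubic_data "h w" "K w" "S w" by (rule cubic[OF w])
  note B = P.adaptedD[OF adapted_l(1)[OF w]] and g = spd_h[OF w]
  show "Sm 1 1 w = a w" "Sm 2 2 w = b w" "Sm 3 3 w = b w" "Sm 1 2 w = 0" "Sm 1 3 w = 0" "Sm 2 1 w = 0"
    "Sm 2 3 w = 0" "Sm 3 1 w = 0" "Sm 3 2 w = 0"
    unfolding Sm_def B(8-10) by (simp_all add: spd_simps[OF g] h_e[OF w])
qed

lemma smooth_invariants:
  "smooth_on V l" "smooth_on V a" "smooth_on V b" "smooth_on V be" "smooth_on V al" "smooth_on V nu" "smooth_on V (\<lambda>w. th w x)"
proof -
  show 1: "smooth_on V l" unfolding l_def by (intro smooth_on_divide smooth_C smooth_on_const open_V) auto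
  show 2: "smooth_on V a" "smooth_on V b" "smooth_on V be"
    unfolding a_def b_def be_def by (rule smooth_Sm smooth_A)+
  show 3: "smooth_on V al" unfolding al_def by (intro smooth_on_add smooth_on_mult smooth_on_const open_V 1 2)
  show "smooth_on V nu" unfolding nu_def by (intro smooth_on_add smooth_on_mult 2 3)
  show "smooth_on V (\<lambda>w. th w x)" unfolding th_def
    by (rule smooth_h_fields(1)[OF smooth_e smooth_on_const[OF open_V] order_refl])
qed

lemma invariants_differentiable:
  assumes "w \<in> V"
  shows "l differentiable (at w)" "a differentiable (at w)" "b differentiable (at w)" "be differentiable (at w)"
    "al differentiable (at w)" "nu differentiable (at w)" "E i differentiable (at w)" "\<xi> differentiable (at w)"
    "f differentiable (at w)"
  using smooth_on_differentiable[OF _ assms] smooth_invariants smooth_E smooth_xi smooth_f by blast+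

text \<open>Each coefficient is a skew Levi-Civita part plus a known cubic part, so of two mirrored
  coefficients one determines the other.\<close>

lemma A_values:
  assumes w: "w \<in> V"
  shows "A j 1 1 w = cv j 1 * l w" "A 1 2 1 w = - A 1 1 2 w" "A 1 3 1 w = - A 1 1 3 w" "A 1 3 2 w = - A 1 2 3 w"
    "A 1 2 2 w = - l w" "A 1 3 3 w = - l w" "A 2 2 1 w = - 2 * l w - A 2 1 2 w" "A 2 3 1 w = - A 2 1 3 w"
    "A 2 2 2 w = C 2 2 2 w" "A 2 3 2 w = 2 * C 2 2 3 w - A 2 2 3 w" "A 2 3 3 w = - C 2 2 2 w"
    "A 3 2 1 w = - A 3 1 2 w" "A 3 3 1 w = - 2 * l w - A 3 1 3 w" "A 3 2 2 w = C 2 2 3 w"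
    "A 3 3 2 w = - 2 * C 2 2 2 w - A 3 2 3 w" "A 3 3 3 w = - C 2 2 3 w"
proof -
  have c: "A i j k w + A i k j w = 2 * C i j k w" for i j k by (simp add: C_def)
  note v = C_values[OF w]
  show "A j 1 1 w = cv j 1 * l w" using c[of j 1 1] v(1)[of j 1] by simp
  show "A 1 2 1 w = - A 1 1 2 w" "A 1 3 1 w = - A 1 1 3 w" "A 1 3 2 w = - A 1 2 3 w"
    "A 1 2 2 w = - l w" "A 1 3 3 w = - l w" "A 2 2 1 w = - 2 * l w - A 2 1 2 w" "A 2 3 1 w = - A 2 1 3 w"
    "A 3 2 1 w = - A 3 1 2 w" "A 3 3 1 w = - 2 * l w - A 3 1 3 w"
    using c[of 1 2 1] c[of 1 3 1] c[of 1 3 2] c[of 1 2 2] c[of 1 3 3] c[of 2 2 1] c[of 2 3 1] c[of 3 2 1] c[of 3 3 1]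
    unfolding v(1-3) cv_def by simp_all
  show "A 2 2 2 w = C 2 2 2 w" "A 2 3 2 w = 2 * C 2 2 3 w - A 2 2 3 w" "A 2 3 3 w = - C 2 2 2 w"
    "A 3 2 2 w = C 2 2 3 w" "A 3 3 2 w = - 2 * C 2 2 2 w - A 3 2 3 w" "A 3 3 3 w = - C 2 2 3 w"
    using c[of 2 2 2] c[of 2 3 2] c[of 2 3 3] c[of 3 2 2] c[of 3 3 2] c[of 3 3 3] unfolding v(4-9) by simp_all
qed

text \<open>In this combination of the Gauss equations the derivatives of the connection coefficients cancel.\<close>

lemma Codazzi_axis:
  assumes w: "w \<in> V"
  shows "2 * cv j k * fd l w (e i w) - 2 * cv i k * fd l w (e j w) =
     (\<Sum>m\<in>UNIV. (A i j m w - A j i m w) * (A m 1 k w + A m k 1 w))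
     + (\<Sum>m\<in>UNIV. A i 1 m w * A j m k w - A j 1 m w * A i m k w)
     + (\<Sum>m\<in>UNIV. A i k m w * A j m 1 w - A j k m w * A i m 1 w)
     + delta j 1 * Sm i k w - delta i 1 * Sm j k w + delta j k * Sm i 1 w - delta i k * Sm j 1 w"
proof -
  have d: "fd (A j 1 k) w x + fd (A j k 1) w x = 2 * cv j k * fd l w x" for j x
  proof -
    have dA: "A i j k differentiable (at w)" for i j k by (rule smooth_on_differentiable[OF smooth_A w])
    have "fd (A j 1 k) w x + fd (A j k 1) w x = fd (\<lambda>q. A j 1 k q + A j k 1 q) w x" by (simp add: fd_add dA)
    also have "\<dots> = fd (\<lambda>q. (2 * cv j k) * l q) w x"
    proof -
      have "(2 * cv j k) * l q = A j 1 k q + A j k 1 q" if "q \<in> V" for q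
        using C_values(1)[OF that, of j k] by (simp add: C_def)
      then show ?thesis using invariants_differentiable[OF w]
        by (subst fd_cong(1)[OF open_V w, of "\<lambda>q. (2 * cv j k) * l q"]) auto
    qed
    also have "\<dots> = 2 * cv j k * fd l w x" using invariants_differentiable[OF w] by (simp add: fd_mult)
    finally show ?thesis .
  qed
  show ?thesis
    using Gauss_Codazzi(1)[OF w, where i = i and j = j and l = 1 and k = k]
      Gauss_Codazzi(1)[OF w, where i = i and j = j and l = k and k = 1] d[of j "e i w"] d[of i "e j w"]
    by (simp add: distrib_left sum.distrib)
qed

text \<open>The Codazzi equation for the components of \<open>K\<close> that involve
  \<open>e 1\<close> is a system for the connection coefficients of the axis. Its solution says that
  the axis curves are geodesics (\<open>p = q = 0\<close>), that the orthogonal planes are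
  integrable (\<open>r = r'\<close>), and that their leaves are umbilic (\<open>x = y\<close>,
  \<open>r = 0\<close>).\<close>

lemma axis_connection:
  assumes w: "w \<in> V"
  shows "A 1 1 2 w = 0" "A 1 1 3 w = 0" "A 2 1 3 w = 0" "A 3 1 2 w = 0" "A 3 1 3 w = be w" "A 2 1 2 w = be w"
    and "fd l w (e 2 w) = 0" "fd l w (e 3 w) = 0"
    "fd l w (e 1 w) = (b w - a w) / 2 - 4 * l w * (be w + l w)"
proof -
  note v = A_values[OF w] Sm_values[OF w]
  note cod = Codazzi_axis[OF w, unfolded sum_3]
  define p where "p = A 1 1 2 w"
  define q where "q = A 1 1 3 w"
  define r where "r = A 2 1 3 w"
  define r' where "r' = A 3 1 2 w"
  define x where "x = A 2 1 2 w"
  define y where "y = A 3 1 3 w"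
  define s1 where "s1 = A 1 2 3 w"
  define s2 where "s2 = A 2 2 3 w"
  define s3 where "s3 = A 3 2 3 w"
  define L where "L = l w"
  define m where "m = C 2 2 2 w"
  define n where "n = C 2 2 3 w"
  define d1 where "d1 = fd l w (e 1 w)"
  define d2 where "d2 = fd l w (e 2 w)"
  define d3 where "d3 = fd l w (e 3 w)"
  note defs = p_def[symmetric] q_def[symmetric] r_def[symmetric] r'_def[symmetric] x_def[symmetric] y_def[symmetric]
    s1_def[symmetric] s2_def[symmetric] s3_def[symmetric] L_def[symmetric] m_def[symmetric] n_def[symmetric]
    d1_def[symmetric] d2_def[symmetric] d3_def[symmetric]
  have L: "L > 0" using adapted_l(2)[OF w] by (simp add: L_def)
  have 1: "d2 = 2 * (L * p)"
    using cod[of 2 1 1] unfolding v defs by (simp add: cv_def algebra_simps)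
  have 2: "d3 = 2 * (L * q)"
    using cod[of 3 1 1] unfolding v defs by (simp add: cv_def algebra_simps)
  have 3: "L * r = L * r'"
    using cod[of 3 1 2] unfolding v defs by (simp add: cv_def algebra_simps)
  then have r: "r' = r" using L by simp
  have 4: "- d1 - (m * p + n * q) - 4 * (L * (x + L)) = (a w - b w) / 2"
    using cod[of 2 2 1] unfolding v defs r by (simp add: cv_def algebra_simps)
  have 5: "- d1 + (m * p + n * q) - 4 * (L * (y + L)) = (a w - b w) / 2"
    using cod[of 3 3 1] unfolding v defs r by (simp add: cv_def algebra_simps)
  have 6: "q * m - p * n = 4 * (L * r)"
    using cod[of 2 3 1] unfolding v defs r by (simp add: cv_def algebra_simps)
  have 7: "d3 = n * (x - y) - 2 * (m * r)"
    using cod[of 3 2 2] unfolding v defs r by (simp add: cv_def algebra_simps)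
  have 8: "d2 = m * (x - y) + 2 * (n * r)"
    using cod[of 3 3 2] unfolding v defs r by (simp add: cv_def algebra_simps)
  have 9: "m * p + n * q = - 2 * (L * (x - y))" using 4 5 by (simp add: algebra_simps)
  \<comment> \<open>The sum \<open>m * d2 + n * d3\<close> is
    \<open>(m\<^sup>2 + n\<^sup>2) * (x - y)\<close> by 7 and 8, while through \<open>p\<close> and
    \<open>q\<close> it becomes \<open>- 4 * L\<^sup>2 * (x - y)\<close> by 9.\<close>
  have "(m\<^sup>2 + n\<^sup>2 + 4 * L\<^sup>2) * (x - y) = (m * (2 * (L * p)) + n * (2 * (L * q))) - 2 * L * (m * p + n * q)"
    using 1 2 7 8 9 by algebra
  then have "(m\<^sup>2 + n\<^sup>2 + 4 * L\<^sup>2) * (x - y) = 0" by (simp add: algebra_simps)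
  moreover have pos: "m\<^sup>2 + n\<^sup>2 + 4 * L\<^sup>2 > 0" using L by (simp add: add_nonneg_pos)
  ultimately have xy: "x = y" by simp
  \<comment> \<open>The same comparison for \<open>m * d3 - n * d2\<close>, with 6 in the place of
    9.\<close>
  have "(m\<^sup>2 + n\<^sup>2 + 4 * L\<^sup>2) * (2 * r) = - (m * (2 * (L * q)) - n * (2 * (L * p))) + 2 * L * (q * m - p * n)"
    using 1 2 6 7 8 xy by algebra
  then have "(m\<^sup>2 + n\<^sup>2 + 4 * L\<^sup>2) * (2 * r) = 0" by (simp add: algebra_simps)
  then have r0: "r = 0" using pos by simp
  have p0: "p = 0" "q = 0" using 1 2 7 8 xy r0 L by auto
  show "A 1 1 2 w = 0" "A 1 1 3 w = 0" "A 2 1 3 w = 0" "A 3 1 2 w = 0" "A 3 1 3 w = be w" "A 2 1 2 w = be w"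
    using p0 r0 r xy by (simp_all add: p_def q_def r_def r'_def x_def y_def be_def)
  show "fd l w (e 2 w) = 0" "fd l w (e 3 w) = 0" using 1 2 p0 by (simp_all add: d2_def d3_def)
  show "fd l w (e 1 w) = (b w - a w) / 2 - 4 * l w * (be w + l w)"
    using 4 p0 by (simp add: d1_def L_def be_def x_def algebra_simps)
qed

lemma fd_vanishing:
  assumes "w \<in> V" "\<And>q. q \<in> V \<Longrightarrow> g q = (0::real)"
  shows "fd g w x = 0"
  using fd_cong(1)[OF open_V assms(1), of "\<lambda>_. 0" g] assms(2) by simp

text \<open>In these Gauss equations the other differentiated coefficient is identically zero or the
  quantity is \<open>A 3 1 3\<close>, which equals \<open>be\<close>; so a single derivative of
  \<open>be\<close> is isolated.\<close>

lemma be_derivatives: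
  assumes w: "w \<in> V"
  shows "fd be w (e 1 w) = 2 * l w * be w - be w * be w - b w" "fd be w (e 2 w) = 0" "fd be w (e 3 w) = 0"
proof -
  note v = A_values[OF w] Sm_values[OF w] axis_connection[OF w]
  note G = Gauss_Codazzi(1)[OF w, unfolded sum_3]
  have be: "A 2 1 2 = be" by (simp add: fun_eq_iff be_def)
  have z: "fd (A 1 1 2) w x = 0" "fd (A 2 1 3) w x = 0" "fd (A 3 1 2) w x = 0" for x
    using axis_connection by (auto intro!: fd_vanishing[OF w])
  have b3: "fd (A 3 1 3) w x = fd be w x" for x
    using fd_cong(1)[OF open_V w, of be "A 3 1 3"] axis_connection(5) invariants_differentiable[OF w] by simp
  show "fd be w (e 1 w) = 2 * l w * be w - be w * be w - b w"
    using G[where i = 1 and j = 2 and l = 1 and k = 2] unfolding be z v by (simp add: cv_def algebra_simps)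
  show "fd be w (e 3 w) = 0"
    using G[where i = 2 and j = 3 and l = 1 and k = 2] unfolding be z v by (simp add: cv_def algebra_simps)
  show "fd be w (e 2 w) = 0"
    using G[where i = 2 and j = 3 and l = 1 and k = 3] unfolding b3 z v by (simp add: cv_def algebra_simps)
qed

lemma b_derivatives:
  assumes w: "w \<in> V"
  shows "fd b w (e 1 w) = (a w - b w) * be w" "fd b w (e 2 w) = 0" "fd b w (e 3 w) = 0"
proof -
  note v = A_values[OF w] Sm_values[OF w] axis_connection[OF w]
  note G = Sm_symmetric_Codazzi(2)[OF w, unfolded sum_3]
  have b2: "Sm 2 2 = b" by (simp add: fun_eq_iff b_def)
  have z: "fd (Sm 1 2) w x = 0" "fd (Sm 2 3) w x = 0" "fd (Sm 3 2) w x = 0" for x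
    using Sm_values by (auto intro!: fd_vanishing[OF w])
  have b3: "fd (Sm 3 3) w x = fd b w x" for x
    using fd_cong(1)[OF open_V w, of b "Sm 3 3"] Sm_values(3) invariants_differentiable[OF w] by simp
  show "fd b w (e 1 w) = (a w - b w) * be w"
    using G[where i = 1 and j = 2 and k = 2] unfolding b2 z v by (simp add: cv_def algebra_simps)
  show "fd b w (e 3 w) = 0"
    using G[where i = 2 and j = 3 and k = 2] unfolding b2 z v by (simp add: cv_def algebra_simps)
  show "fd b w (e 2 w) = 0"
    using G[where i = 2 and j = 3 and k = 3] unfolding b3 z v by (simp add: cv_def algebra_simps)
qed

lemma fd_frame_expand:
  assumes w: "w \<in> V" and u: "u differentiable (at w)"
  shows "fd u w x = h w x (e 1 w) *\<^sub>R fd u w (e 1 w) + h w x (e 2 w) *\<^sub>R fd u w (e 2 w) + h w x (e 3 w) *\<^sub>R fd u w (e 3 w)"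
proof -
  have li: "linear (fd u w)" using u by (rule linear_frechet_derivative)
  have "fd u w x = fd u w (h w x (e 1 w) *\<^sub>R e 1 w + h w x (e 2 w) *\<^sub>R e 2 w + h w x (e 3 w) *\<^sub>R e 3 w)"
    using e_expand[OF w, of x] by (simp add: sum_3)
  then show ?thesis by (simp add: linear_add[OF li] linear_scale[OF li])
qed

lemma th_e [simp]: "w \<in> V \<Longrightarrow> th w (e 1 w) = 1" "w \<in> V \<Longrightarrow> th w (e 2 w) = 0" "w \<in> V \<Longrightarrow> th w (e 3 w) = 0"
  by (simp_all add: th_def h_e)

lemma fd_along_axis:
  assumes w: "w \<in> V" and u: "u differentiable (at w)" and z: "fd u w (e 2 w) = 0" "fd u w (e 3 w) = 0"
  shows "fd u w x = th w x *\<^sub>R fd u w (e 1 w)"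
  using fd_frame_expand[OF w u, of x] z spd_sym[OF spd_h[OF w], of x "e 1 w"] by (simp add: th_def)

lemma invariant_derivatives:
  assumes w: "w \<in> V"
  shows "fd l w x = th w x * ((b w - a w) / 2 - 4 * l w * (be w + l w))"
    "fd be w x = th w x * (2 * l w * be w - be w * be w - b w)"
    "fd b w x = th w x * ((a w - b w) * be w)"
    "fd al w x = th w x * (- a w - al w * (be w + 4 * l w))"
    "fd nu w x = th w x * (- 2 * (be w + l w) * nu w)"
proof -
  note d = invariants_differentiable[OF w]
  show 1: "fd l w x = th w x * ((b w - a w) / 2 - 4 * l w * (be w + l w))"
    using fd_along_axis[OF w d(1)] axis_connection(7-9)[OF w] by simp
  show 2: "fd be w x = th w x * (2 * l w * be w - be w * be w - b w)"
    using fd_along_axis[OF w d(4)] be_derivatives[OF w] by simp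
  show 3: "fd b w x = th w x * ((a w - b w) * be w)"
    using fd_along_axis[OF w d(3)] b_derivatives[OF w] by simp
  have "fd al w x = fd be w x + 2 * fd l w x" unfolding al_def[abs_def] using d by (simp add: fd_add fd_mult)
  then show 4: "fd al w x = th w x * (- a w - al w * (be w + 4 * l w))" unfolding 1 2 al_def
    by (simp add: field_simps)
  have "fd nu w x = fd b w x + fd al w x * be w + al w * fd be w x"
    unfolding nu_def[abs_def] using d by (simp add: fd_add fd_mult)
  then show "fd nu w x = th w x * (- 2 * (be w + l w) * nu w)" unfolding 2 3 4 nu_def al_def by algebra
qed

section \<open>The vectors \<open>zeta\<close> and \<open>W\<close>, the covector \<open>om\<close>
  and the line of centres\<close>

lemma dE1:
  assumes w: "w \<in> V"
  shows "fd (E 1) w x = th w x *\<^sub>R ((2 * l w) *\<^sub>R E 1 w + \<xi> w) + be w *\<^sub>R (fd f w x - th w x *\<^sub>R E 1 w)"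
proof -
  have 1: "fd (E 1) w (e 1 w) = (2 * l w) *\<^sub>R E 1 w + \<xi> w" "fd (E 1) w (e 2 w) = be w *\<^sub>R E 2 w"
    "fd (E 1) w (e 3 w) = be w *\<^sub>R E 3 w"
    unfolding dE[OF w] sum_3 A_values[OF w] axis_connection[OF w] by (simp_all add: cv_def)
  have "fd f w x = h w x (e 1 w) *\<^sub>R E 1 w + h w x (e 2 w) *\<^sub>R E 2 w + h w x (e 3 w) *\<^sub>R E 3 w"
    using df_expand[OF w, of x] by (simp add: sum_3)
  then show ?thesis
    unfolding fd_frame_expand[OF w invariants_differentiable(7)[OF w], of 1 x] 1 th_def spd_sym[OF spd_h[OF w], of "e 1 w" x]
    by (simp add: algebra_simps)
qed

lemma dxi_axis:
  assumes w: "w \<in> V"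
  shows "fd \<xi> w x = - (a w * th w x) *\<^sub>R E 1 w - b w *\<^sub>R (fd f w x - th w x *\<^sub>R E 1 w)"
proof -
  have 1: "fd \<xi> w (e 1 w) = - (a w *\<^sub>R E 1 w)" "fd \<xi> w (e 2 w) = - (b w *\<^sub>R E 2 w)" "fd \<xi> w (e 3 w) = - (b w *\<^sub>R E 3 w)"
    unfolding dxi[OF w] sum_3 Sm_values[OF w] by simp_all
  have "fd f w x = h w x (e 1 w) *\<^sub>R E 1 w + h w x (e 2 w) *\<^sub>R E 2 w + h w x (e 3 w) *\<^sub>R E 3 w"
    using df_expand[OF w, of x] by (simp add: sum_3)
  then show ?thesis
    unfolding fd_frame_expand[OF w invariants_differentiable(8)[OF w], of x] 1 th_def spd_sym[OF spd_h[OF w], of "e 1 w" x]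
    by (simp add: algebra_simps)
qed

definition zeta :: "real^3 \<Rightarrow> real^4" where "zeta w = \<xi> w - al w *\<^sub>R E 1 w"
definition W :: "real^3 \<Rightarrow> real^4" where "W w = b w *\<^sub>R E 1 w + be w *\<^sub>R \<xi> w"
definition Cen :: "real^3 \<Rightarrow> real^4" where "Cen w = f w + (1 / nu w) *\<^sub>R zeta w"

lemma smooth_zeta: "smooth_on V zeta" and smooth_W: "smooth_on V W"
  unfolding zeta_def W_def
  by (intro smooth_on_add smooth_on_diff smooth_on_scaleR smooth_invariants smooth_E smooth_xi)+

lemma dzeta:
  assumes w: "w \<in> V"
  shows "fd zeta w x = - nu w *\<^sub>R (fd f w x - th w x *\<^sub>R E 1 w) - (al w * th w x) *\<^sub>R zeta w"
proof -
  note d = invariants_differentiable[OF w]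
  have "fd zeta w x = fd \<xi> w x - (fd al w x *\<^sub>R E 1 w + al w *\<^sub>R fd (E 1) w x)"
    unfolding zeta_def[abs_def] using d by (simp add: fd_diff fd_scaleR)
  then show ?thesis
    unfolding dE1[OF w] dxi_axis[OF w] invariant_derivatives[OF w] zeta_def nu_def al_def
    by (simp add: vec_eq_iff algebra_simps)
qed

lemma dW:
  assumes w: "w \<in> V"
  shows "fd W w x = (- (be w - 2 * l w) * th w x) *\<^sub>R W w"
proof -
  note d = invariants_differentiable[OF w]
  have "fd W w x = fd b w x *\<^sub>R E 1 w + b w *\<^sub>R fd (E 1) w x + (fd be w x *\<^sub>R \<xi> w + be w *\<^sub>R fd \<xi> w x)"
    unfolding W_def[abs_def] using d by (simp add: fd_add fd_scaleR)
  then show ?thesis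
    unfolding dE1[OF w] dxi_axis[OF w] invariant_derivatives[OF w] W_def
    by (simp add: vec_eq_iff algebra_simps)
qed

text \<open>The four conditions have exactly one solution, since the frame and \<xi> form a basis of
  \<open>real^4\<close>.\<close>

definition om :: "real^3 \<Rightarrow> real^4" where
  "om w = (SOME v. v \<bullet> E 1 w = 1 \<and> v \<bullet> E 2 w = 0 \<and> v \<bullet> E 3 w = 0 \<and> v \<bullet> \<xi> w = al w)"

lemma E_indep4: "w \<in> V \<Longrightarrow> indep4 (E 1 w) (E 2 w) (E 3 w) (\<xi> w)"
proof -
  assume w: "w \<in> V"
  have "indep3 (e 1 w) (e 2 w) (e 3 w)"
    unfolding indep3_def
  proof (intro allI impI)
    fix x y z assume 0: "x *\<^sub>R e 1 w + y *\<^sub>R e 2 w + z *\<^sub>R e 3 w = 0"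
    from arg_cong[OF 0, of "\<lambda>v. h w v (e 1 w)"] arg_cong[OF 0, of "\<lambda>v. h w v (e 2 w)"] arg_cong[OF 0, of "\<lambda>v. h w v (e 3 w)"]
    show "x = 0 \<and> y = 0 \<and> z = 0" by (simp add: spd_simps[OF spd_h[OF w]] h_e[OF w])
  qed
  from frame_independent[OF w this] show ?thesis by (simp add: E_def)
qed

lemma E_dual_eqI:
  assumes w: "w \<in> V" and "\<And>i. u \<bullet> E i w = v \<bullet> E i w" "u \<bullet> \<xi> w = v \<bullet> \<xi> w"
  shows "u = v"
proof -
  obtain x y z t where "u - v = x *\<^sub>R E 1 w + y *\<^sub>R E 2 w + z *\<^sub>R E 3 w + t *\<^sub>R \<xi> w"
    by (rule independent_columns_expand[OF E_indep4[OF w]])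
  then have "(u - v) \<bullet> (u - v) = (u - v) \<bullet> (x *\<^sub>R E 1 w + y *\<^sub>R E 2 w + z *\<^sub>R E 3 w + t *\<^sub>R \<xi> w)" by simp
  also have "\<dots> = 0" using assms(2,3) by (simp add: inner_add_right inner_diff_left)
  finally show ?thesis by simp
qed

lemma smooth_om: "smooth_on V om"
  and om_E: "w \<in> V \<Longrightarrow> om w \<bullet> E 1 w = 1" "w \<in> V \<Longrightarrow> om w \<bullet> E 2 w = 0" "w \<in> V \<Longrightarrow> om w \<bullet> E 3 w = 0"
    "w \<in> V \<Longrightarrow> om w \<bullet> \<xi> w = al w"
proof -
  define M :: "real^3 \<Rightarrow> real^4^4" where "M w = (\<chi> i j. if i = 1 then E 1 w $ j else if i = 2 then E 2 w $ j
      else if i = 3 then E 3 w $ j else \<xi> w $ j)" for w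
  define r :: "real^3 \<Rightarrow> real^4" where "r w = (\<chi> i. if i = 1 then 1 else if i = 2 then 0 else if i = 3 then 0 else al w)" for w
  have M: "M w *v v = r w \<longleftrightarrow> v \<bullet> E 1 w = 1 \<and> v \<bullet> E 2 w = 0 \<and> v \<bullet> E 3 w = 0 \<and> v \<bullet> \<xi> w = al w" for w v
    by (simp add: M_def r_def vec_eq_iff forall_4 matrix_vector_mult_def inner_vec_def mult.commute)
  have det: "det (M w) \<noteq> 0" if "w \<in> V" for w
  proof -
    have "transpose (M w) = (\<chi> i j. if j = 1 then E 1 w $ i else if j = 2 then E 2 w $ i else if j = 3 then E 3 w $ i else \<xi> w $ i)"
      by (simp add: M_def transpose_def)
    then show ?thesis using independent_columns_solution(1)[OF E_indep4[OF that]] det_transpose[of "M w"] by simp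
  qed
  have "\<exists>v. M w *v v = r w" if "w \<in> V" for w using cramer[OF det[OF that]] by blast
  then have o: "om w \<bullet> E 1 w = 1 \<and> om w \<bullet> E 2 w = 0 \<and> om w \<bullet> E 3 w = 0 \<and> om w \<bullet> \<xi> w = al w" if "w \<in> V" for w
    unfolding om_def M using someI_ex[of "\<lambda>v. v \<bullet> E 1 w = 1 \<and> v \<bullet> E 2 w = 0 \<and> v \<bullet> E 3 w = 0 \<and> v \<bullet> \<xi> w = al w"] that by blast
  then show "w \<in> V \<Longrightarrow> om w \<bullet> E 1 w = 1" "w \<in> V \<Longrightarrow> om w \<bullet> E 2 w = 0" "w \<in> V \<Longrightarrow> om w \<bullet> E 3 w = 0"
    "w \<in> V \<Longrightarrow> om w \<bullet> \<xi> w = al w" by auto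
  show "smooth_on V om"
  proof (rule smooth_on_linear_solution[where M = M and b = r])
    show "smooth_on V (\<lambda>w. M w $ i $ j)" for i j
      using smooth_E[THEN smooth_on_vec_nth] smooth_xi[THEN smooth_on_vec_nth]
      by (cases "i = 1"; cases "i = 2"; cases "i = 3") (auto simp: M_def)
    show "smooth_on V (\<lambda>w. r w $ i)" for i
      using smooth_invariants(5) open_V by (cases "i = 1"; cases "i = 2"; cases "i = 3") (auto simp: r_def intro: smooth_on_const)
  qed (use det o M open_V in auto)
qed

lemma om_df: "w \<in> V \<Longrightarrow> om w \<bullet> fd f w x = th w x"
proof -
  assume w: "w \<in> V"
  have "om w \<bullet> fd f w x = h w x (e 1 w)"
    by (subst df_expand[OF w]) (simp add: sum_3 inner_add_right om_E[OF w])
  then show ?thesis using spd_sym[OF spd_h[OF w], of x "e 1 w"] by (simp add: th_def)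
qed

lemma om_zeta: "w \<in> V \<Longrightarrow> om w \<bullet> zeta w = 0" and om_W: "w \<in> V \<Longrightarrow> om w \<bullet> W w = nu w"
  by (simp_all add: zeta_def W_def nu_def inner_diff_right inner_add_right om_E)

text \<open>Obtained by differentiating the four defining equations. The derivatives of
  \<open>E 2\<close> and \<open>E 3\<close> are annihilated because the coefficients
  \<open>A 2 2 1 = A 3 3 1 = - al\<close> offset the value \<open>al\<close> on \<xi>.\<close>

lemma dom:
  assumes w: "w \<in> V"
  shows "fd om w x = (- (be w + 4 * l w) * th w x) *\<^sub>R om w"
proof (rule E_dual_eqI[OF w])
  have d: "om differentiable (at w)" using smooth_om w by (rule smooth_on_differentiable)
  note dd = invariants_differentiable[OF w]
  have c: "fd om w x \<bullet> X w = fd g w x - om w \<bullet> fd X w x"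
    if "\<And>q. q \<in> V \<Longrightarrow> om q \<bullet> X q = g q" "X differentiable (at w)" "g differentiable (at w)" for X g
  proof -
    have "fd (\<lambda>q. om q \<bullet> X q) w x = fd g w x" using fd_cong(1)[OF open_V w, of g "\<lambda>q. om q \<bullet> X q"] that by simp
    then show ?thesis using fd_inner[OF d that(2), of x] by simp
  qed
  have 2: "om w \<bullet> fd (E i) w x = 0" if "i \<noteq> 1" for i
  proof -
    have "om w \<bullet> fd (E i) w (e j w) = 0" for j
      using that exhaust_3[of i] exhaust_3[of j] unfolding dE[OF w] sum_3
      by (auto simp: A_values[OF w] axis_connection[OF w] inner_add_right om_E[OF w] al_def delta_def)
    then show ?thesis using fd_frame_expand[OF w dd(7), of i x] by (simp add: inner_add_right)
  qed
  show "fd om w x \<bullet> E i w = ((- (be w + 4 * l w) * th w x) *\<^sub>R om w) \<bullet> E i w" for i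
  proof (cases "i = 1")
    case True
    have "fd om w x \<bullet> E 1 w = - (om w \<bullet> fd (E 1) w x)" using c[of "E 1" "\<lambda>_. 1"] om_E dd by simp
    then show ?thesis
      using True om_E[OF w] unfolding dE1[OF w]
      by (simp add: inner_add_right inner_diff_right om_df[OF w] al_def algebra_simps)
  next
    case False
    then have z: "om q \<bullet> E i q = 0" if "q \<in> V" for q using om_E[OF that] exhaust_3[of i] by auto
    have "fd om w x \<bullet> E i w = 0" using c[of "E i" "\<lambda>_. 0"] z dd 2[OF False] by simp
    then show ?thesis using z[OF w] by simp
  qed
  show "fd om w x \<bullet> \<xi> w = ((- (be w + 4 * l w) * th w x) *\<^sub>R om w) \<bullet> \<xi> w"
    using c[of \<xi> al] om_E dd unfolding invariant_derivatives[OF w] dxi_axis[OF w]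
    by (simp add: inner_diff_right om_df[OF w] om_E[OF w] algebra_simps)
qed

lemma continuous_th: "continuous_on V (\<lambda>w. th w x)"
  using smooth_on_continuous smooth_invariants(7) by blast

lemma continuous_invariants: "continuous_on V l" "continuous_on V be"
  using smooth_on_continuous smooth_invariants by blast+

lemma om_proportional:
  assumes "w0 \<in> V" "w \<in> V"
  obtains c where "c > 0" "om w = c *\<^sub>R om w0"
  by (rule linear_ode_proportional[OF convex_V open_V assms smooth_on_differentiable[OF smooth_om] dom])
    (auto intro!: continuous_intros continuous_th continuous_invariants that)

lemma W_proportional:
  assumes "w0 \<in> V" "w \<in> V"
  obtains c where "c > 0" "W w = c *\<^sub>R W w0"
  by (rule linear_ode_proportional[OF convex_V open_V assms smooth_on_differentiable[OF smooth_W] dW])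
    (auto intro!: continuous_intros continuous_th continuous_invariants that)

lemma nu_nonzero:
  assumes "w0 \<in> V" "w \<in> V" "nu w0 \<noteq> 0"
  shows "nu w \<noteq> 0"
proof -
  obtain c c' where "c > 0" "om w = c *\<^sub>R om w0" "c' > 0" "W w = c' *\<^sub>R W w0"
    using om_proportional[OF assms(1,2)] W_proportional[OF assms(1,2)] by metis
  then show ?thesis using om_W[OF assms(1)] om_W[OF assms(2)] assms(3) by auto
qed

text \<open>Along a leaf the derivative of \<open>zeta / nu\<close> cancels that of
  \<open>f\<close>; along \<open>e 1\<close> the remainder is a multiple of
  \<open>W\<close>.\<close>

lemma dCen:
  assumes w: "w \<in> V" and n: "nu w \<noteq> 0"
  shows "Cen differentiable (at w)" "fd Cen w x = (th w x / nu w) *\<^sub>R W w"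
proof -
  note d = invariants_differentiable[OF w]
  have dz: "zeta differentiable (at w)" by (rule smooth_on_differentiable[OF smooth_zeta w])
  have i: "((\<lambda>q. 1 / nu q) has_derivative (\<lambda>x. - (fd nu w x / (nu w * nu w)))) (at w)"
    using has_derivative_divide'[OF has_derivative_const fd_has[OF d(6)] n, of 1] by simp
  then have di: "(\<lambda>q. 1 / nu q) differentiable (at w)" "fd (\<lambda>q. 1 / nu q) w x = - (fd nu w x / (nu w * nu w))"
    by (auto simp: differentiable_def fd_eq)
  show "Cen differentiable (at w)" unfolding Cen_def[abs_def] using d di(1) dz by simp
  have "fd Cen w x = fd f w x + (fd (\<lambda>q. 1 / nu q) w x *\<^sub>R zeta w + (1 / nu w) *\<^sub>R fd zeta w x)"
    unfolding Cen_def[abs_def] using d di(1) dz by (simp add: fd_add fd_scaleR)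
  also have "\<dots> = th w x *\<^sub>R E 1 w + (th w x * be w / nu w) *\<^sub>R zeta w"
    unfolding di(2) invariant_derivatives[OF w] dzeta[OF w] al_def using n
    by (simp add: vec_eq_iff field_simps)
  also have "\<dots> = (th w x / nu w) *\<^sub>R W w"
    unfolding W_def zeta_def using n by (simp add: vec_eq_iff nu_def field_simps)
  finally show "fd Cen w x = (th w x / nu w) *\<^sub>R W w" .
qed

text \<open>All derivatives of the centre point along \<open>W\<close>, whose direction is constant;
  once \<open>W w0\<close> is projected away, the derivative vanishes.\<close>

lemma Cen_line:
  assumes w0: "w0 \<in> V" and w: "w \<in> V" and n: "nu w0 \<noteq> 0"
  obtains t where "Cen w = Cen w0 + t *\<^sub>R W w0"
proof -
  have nz: "nu q \<noteq> 0" if "q \<in> V" for q using nu_nonzero[OF w0 that n] .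
  define k where "k = om w0 \<bullet> W w0"
  have k: "k \<noteq> 0" using om_W[OF w0] n by (simp add: k_def)
  \<comment> \<open>The projection along \<open>W w0\<close> onto the kernel of
    \<open>om w0\<close>; it exists because \<open>k = nu w0\<close> is nonzero.\<close>
  define L where "L v = v - (om w0 \<bullet> v / k) *\<^sub>R W w0" for v
  have lL: "linear L" unfolding L_def by (rule linearI) (simp_all add: vec_eq_iff inner_add_right add_divide_distrib algebra_simps)
  have LW: "L (c *\<^sub>R W w0) = 0" for c unfolding L_def using k by (simp add: k_def)
  have "((\<lambda>q. L (Cen q)) has_derivative (\<lambda>x. 0)) (at q within V)" if q: "q \<in> V" for q
  proof -
    have d: "Cen differentiable (at q)" by (rule dCen[OF q nz[OF q]])
    obtain c where c: "W q = c *\<^sub>R W w0" using W_proportional[OF w0 q] by metis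
    have "fd (\<lambda>q. L (Cen q)) q x = 0" for x
      unfolding fd_linear_compose[OF lL d] dCen(2)[OF q nz[OF q]] c scaleR_scaleR LW ..
    moreover have "(\<lambda>q. L (Cen q)) differentiable (at q)"
      using differentiable_compose[OF _ d, of L] lL linear_imp_differentiable by blast
    ultimately have "((\<lambda>q. L (Cen q)) has_derivative (\<lambda>x. 0)) (at q)" using fd_has by (metis (no_types, lifting) ext)
    then show ?thesis by (rule has_derivative_at_withinI)
  qed
  from has_derivative_zero_unique[OF convex_V this w w0] have "L (Cen w) = L (Cen w0)" by blast
  then have "L (Cen w - Cen w0) = 0" by (simp add: linear_diff[OF lL])
  then have "Cen w = Cen w0 + (om w0 \<bullet> (Cen w - Cen w0) / k) *\<^sub>R W w0" by (simp add: L_def algebra_simps)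
  then show ?thesis by (rule that)
qed

end

section \<open>Independence of the chart\<close>

locale chart_change = H1: hypersurface V1 f1 \<xi>1 + H2: hypersurface V2 f2 \<xi>2
  for V1 f1 \<xi>1 V2 f2 \<xi>2 +
  fixes T T' :: "(real^3) set" and \<tau> \<sigma> :: "real^3 \<Rightarrow> real^3"
  assumes T: "T \<subseteq> V1" "T' \<subseteq> V2" and smooth_tau: "smooth_on T \<tau>" and smooth_sigma: "smooth_on T' \<sigma>"
    and tau: "\<And>w. w \<in> T \<Longrightarrow> \<tau> w \<in> T'" "\<And>w. w \<in> T \<Longrightarrow> \<sigma> (\<tau> w) = w"
    and sigma: "\<And>w. w \<in> T' \<Longrightarrow> \<sigma> w \<in> T" "\<And>w. w \<in> T' \<Longrightarrow> \<tau> (\<sigma> w) = w"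
    and f12: "\<And>w. w \<in> T \<Longrightarrow> f1 w = f2 (\<tau> w)" and xi12: "\<And>w. w \<in> T \<Longrightarrow> \<xi>1 w = \<xi>2 (\<tau> w)"
begin

lemma open_T: "open T" and open_T': "open T'"
  using smooth_on_open smooth_tau smooth_sigma by blast+

lemma inverse_derivatives:
  assumes w: "w \<in> T"
  shows "fd \<sigma> (\<tau> w) (fd \<tau> w x) = x" "fd \<tau> w (fd \<sigma> (\<tau> w) y) = y"
proof -
  have d: "\<tau> differentiable (at w)" "\<sigma> differentiable (at (\<tau> w))" "\<tau> differentiable (at (\<sigma> (\<tau> w)))"
    using smooth_on_differentiable smooth_tau smooth_sigma w tau by auto
  have "fd (\<lambda>q. \<sigma> (\<tau> q)) w x = fd (\<lambda>q. q) w x"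
    using tau(2) by (subst fd_cong(1)[OF open_T w, of "\<lambda>q. q" "\<lambda>q. \<sigma> (\<tau> q)"]) auto
  then show "fd \<sigma> (\<tau> w) (fd \<tau> w x) = x" using fd_compose[OF d(1,2)] by simp
  have "fd (\<lambda>q. \<tau> (\<sigma> q)) (\<tau> w) y = fd (\<lambda>q. q) (\<tau> w) y"
    using sigma(2) by (subst fd_cong(1)[OF open_T' tau(1)[OF w], of "\<lambda>q. q" "\<lambda>q. \<tau> (\<sigma> q)"]) auto
  then show "fd \<tau> w (fd \<sigma> (\<tau> w) y) = y" using fd_compose[OF d(2,3)] tau(2)[OF w] by simp
qed

lemma linear_dtau: "w \<in> T \<Longrightarrow> linear (fd \<tau> w)" and linear_dsigma: "w \<in> T' \<Longrightarrow> linear (fd \<sigma> w)"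
  using smooth_on_linear_fd smooth_tau smooth_sigma by blast+

lemma fd_pullback:
  assumes w: "w \<in> T" and eq: "\<And>q. q \<in> T \<Longrightarrow> u1 q = u2 (\<tau> q)" and d: "u2 differentiable (at (\<tau> w))"
  shows "fd u1 w x = fd u2 (\<tau> w) (fd \<tau> w x)"
proof -
  have dt: "\<tau> differentiable (at w)" by (rule smooth_on_differentiable[OF smooth_tau w])
  have "(\<lambda>q. u2 (\<tau> q)) differentiable (at w)" using differentiable_chain_at[OF dt d] by (simp add: o_def)
  then have "fd u1 w = fd (\<lambda>q. u2 (\<tau> q)) w"
    using fd_cong(1)[OF open_T w, of "\<lambda>q. u2 (\<tau> q)" u1] eq by simp
  then show ?thesis using fd_compose[OF dt d] by simp
qed

lemma df_pullback: "w \<in> T \<Longrightarrow> fd f1 w x = fd f2 (\<tau> w) (fd \<tau> w x)"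
  by (rule fd_pullback) (use f12 smooth_on_differentiable[OF H2.smooth_f] tau(1) T in blast)+

lemma dxi_pullback: "w \<in> T \<Longrightarrow> fd \<xi>1 w x = fd \<xi>2 (\<tau> w) (fd \<tau> w x)"
  by (rule fd_pullback) (use xi12 smooth_on_differentiable[OF H2.smooth_xi] tau(1) T in blast)+

text \<open>A constant field of one chart becomes the variable field \<open>Y\<close> in the other.
  This changes only the tangential part of the Gauss formula, not the coefficient of \<xi>.\<close>

lemma h_pullback:
  assumes w: "w \<in> T"
  shows "H1.h w x y = H2.h (\<tau> w) (fd \<tau> w x) (fd \<tau> w y)"
proof -
  define Y where "Y q = fd \<tau> (\<sigma> q) y" for q
  have sY: "smooth_on T' Y" unfolding Y_def
    by (rule smooth_on_compose[OF smooth_sigma smooth_on_fd_const[OF smooth_tau]]) (use sigma in auto)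
  have sf: "smooth_on T' f2" by (rule smooth_on_subset[OF H2.smooth_f open_T' T(2)])
  have "smooth_on T' (\<lambda>q. fd f2 q (Y q))" by (rule smooth_on_fd[OF sf sY])
  then have "fd (\<lambda>q. fd f1 q y) w x = fd (\<lambda>q. fd f2 q (Y q)) (\<tau> w) (fd \<tau> w x)"
    using tau w by (intro fd_pullback[OF w]) (auto simp: Y_def df_pullback intro: smooth_on_differentiable)
  also have "\<dots> = fd f2 (\<tau> w) (H2.conn Y (\<tau> w) (fd \<tau> w x)) + H2.h (\<tau> w) (fd \<tau> w x) (Y (\<tau> w)) *\<^sub>R \<xi>2 (\<tau> w)"
    by (rule H2.Gauss_formula(1)[OF sY T(2) tau(1)[OF w]])
  also have "\<dots> = fd f1 w (fd \<sigma> (\<tau> w) (H2.conn Y (\<tau> w) (fd \<tau> w x))) + H2.h (\<tau> w) (fd \<tau> w x) (fd \<tau> w y) *\<^sub>R \<xi>1 w"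
    using w by (simp add: df_pullback inverse_derivatives xi12 Y_def tau(2))
  finally show ?thesis using H1.Gauss_constant_unique(2) w T(1) by blast
qed

lemma S_pullback:
  assumes w: "w \<in> T"
  shows "fd \<tau> w (H1.S w x) = H2.S (\<tau> w) (fd \<tau> w x)"
proof -
  have t: "\<tau> w \<in> V2" "w \<in> V1" using w tau(1) T by auto
  have "fd \<xi>1 w x = - fd f1 w (fd \<sigma> (\<tau> w) (H2.S (\<tau> w) (fd \<tau> w x)))"
    using H2.Weingarten[OF t(1)] w by (simp add: dxi_pullback df_pullback inverse_derivatives)
  then have "H1.S w x = fd \<sigma> (\<tau> w) (H2.S (\<tau> w) (fd \<tau> w x))" by (rule H1.Weingarten_unique[OF t(2)])
  then show ?thesis by (simp add: inverse_derivatives[OF w])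
qed

text \<open>Once an orthonormal frame is transported, the vectors \<open>E j\<close> and hence the
  coefficients \<open>A\<close> and \<open>C\<close> agree in both charts; \<open>K_eq\<close> then
  compares the tensors without any transformation rule for Christoffel symbols.\<close>

lemma K_pullback:
  assumes w: "w \<in> T"
  shows "fd \<tau> w (H1.K w x y) = H2.K (\<tau> w) (fd \<tau> w x) (fd \<tau> w y)"
proof -
  have t: "\<tau> w \<in> T'" using w tau(1) by auto
  interpret R1: hypersurface T f1 \<xi>1 using H1.hypersurface_subset[OF open_T T(1)] .
  interpret R2: hypersurface T' f2 \<xi>2 using H2.hypersurface_subset[OF open_T' T(2)] .
  obtain b2 where "framed_hypersurface T' f2 \<xi>2 b2" by (rule R2.framed_exists)
  then interpret F2: framed_hypersurface T' f2 \<xi>2 b2 .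
  define b1 where "b1 i q = fd \<sigma> (\<tau> q) (b2 i (\<tau> q))" for i q
  have tb: "fd \<tau> q (b1 i q) = b2 i (\<tau> q)" if "q \<in> T" for i q
    using that by (simp add: b1_def inverse_derivatives)
  have "smooth_on T (b1 i)" for i
    unfolding b1_def
    by (rule smooth_on_compose[OF smooth_tau smooth_on_fd[OF smooth_sigma F2.smooth_e]]) (use tau in auto)
  moreover have "onb (R1.h q) (\<lambda>i. b1 i q)" if "q \<in> T" for q
    using F2.onb_e[OF tau(1)[OF that]] that by (simp add: onb_def h_pullback tb)
  ultimately interpret F1: framed_hypersurface T f1 \<xi>1 b1
    by unfold_locales
  have E: "F1.E j q = F2.E j (\<tau> q)" if "q \<in> T" for j q
    using that by (simp add: F1.E_def F2.E_def df_pullback tb)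
  have A: "F1.A i j k w = F2.A i j k (\<tau> w)" for i j k
  proof (rule F1.A_unique[OF w])
    have "fd (F1.E j) w (b1 i w) = fd (F2.E j) (\<tau> w) (fd \<tau> w (b1 i w))"
      by (rule fd_pullback[OF w E smooth_on_differentiable[OF F2.smooth_E t]])
    then show "fd (F1.E j) w (b1 i w) = (\<Sum>k\<in>UNIV. F2.A i j k (\<tau> w) *\<^sub>R F1.E k w) + delta i j *\<^sub>R \<xi>1 w"
      using F2.dE[OF t] w by (simp add: tb E xi12)
  qed
  have C: "F1.C i j k w = F2.C i j k (\<tau> w)" for i j k by (simp add: F1.C_def F2.C_def A)
  have l: "linear (fd \<tau> w)" by (rule linear_dtau[OF w])
  show ?thesis
    unfolding F1.K_eq[OF w] F2.K_eq[OF t] using w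
    by (simp add: linear_sum[OF l] linear_scale[OF l] tb C h_pullback)
qed

text \<open>Symmetries are conjugated by the derivative of the chart change, and conjugation keeps
  the determinant whatever the orientation of the chart change.\<close>

lemma is_axis_pushforward:
  assumes w: "w \<in> T" and ax: "is_axis f1 \<xi>1 w v"
  shows "is_axis f2 \<xi>2 (\<tau> w) (fd \<tau> w v)"
proof -
  note lt = linear_dtau[OF w] and ls = linear_dsigma[OF tau(1)[OF w]]
  note inv = inverse_derivatives[OF w]
  have "R (fd \<tau> w v) = fd \<tau> w v" if R: "R \<in> symmetry_group f2 \<xi>2 (\<tau> w)" for R
  proof -
    have lR: "linear R" "det (matrix R) > 0" using R by (auto simp: symmetry_group_def)
    define Q where "Q = fd \<sigma> (\<tau> w) \<circ> (R \<circ> fd \<tau> w)"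
    have lQ: "linear Q" unfolding Q_def by (intro linear_compose lt ls lR)
    have "matrix Q = matrix (fd \<sigma> (\<tau> w)) ** (matrix R ** matrix (fd \<tau> w))"
      unfolding Q_def by (simp add: matrix_compose lt ls lR linear_compose)
    then have "det (matrix Q) = det (matrix R) * (det (matrix (fd \<sigma> (\<tau> w))) * det (matrix (fd \<tau> w)))"
      by (simp add: det_mul)
    also have "det (matrix (fd \<sigma> (\<tau> w))) * det (matrix (fd \<tau> w)) = 1"
    proof -
      have "fd \<sigma> (\<tau> w) \<circ> fd \<tau> w = (\<lambda>x. x)" by (simp add: fun_eq_iff inv)
      then have "matrix (fd \<sigma> (\<tau> w)) ** matrix (fd \<tau> w) = matrix (\<lambda>x. x)" using matrix_compose[OF lt ls] by simp
      also have "matrix (\<lambda>x. x :: real^3) = mat 1" by (simp add: matrix_def mat_def vec_eq_iff axis_def)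
      finally show ?thesis by (metis det_mul det_I)
    qed
    finally have "det (matrix Q) > 0" using lR by simp
    moreover have tQ: "fd \<tau> w (Q x) = R (fd \<tau> w x)" for x by (simp add: Q_def inv)
    moreover have inj: "x = y" if "fd \<tau> w x = fd \<tau> w y" for x y using that inv(1) by metis
    ultimately have "Q \<in> symmetry_group f1 \<xi>1 w"
      using R lQ unfolding symmetry_group_def
      by (auto simp: h_pullback[OF w] intro!: inj simp: K_pullback[OF w] S_pullback[OF w])
    then have "Q v = v" using ax by (simp add: is_axis_def)
    then show ?thesis using tQ[of v] by simp
  qed
  then show ?thesis using ax unfolding is_axis_def by (simp add: h_pullback[OF w] K_pullback[OF w])
qed

end

text \<open>The two frames share only their first vector. Still \<open>l\<close>, \<open>be\<close>
  and \<open>b\<close> are common to both: by \<open>dE1\<close> and \<open>dxi_axis\<close> they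
  are coefficients of nonzero vectors in the derivatives of \<open>E 1\<close> and \<xi>.\<close>

lemma adapted_data_eq:
  assumes cc: "chart_change V1 f1 \<xi>1 V2 f2 \<xi>2 T T' \<tau> \<sigma>"
    and D1: "adapted_hypersurface V1 f1 \<xi>1 e1" and D2: "adapted_hypersurface V2 f2 \<xi>2 e2"
    and ax: "\<And>w. w \<in> T \<Longrightarrow> e2 1 (\<tau> w) = fd \<tau> w (e1 1 w)" and w: "w \<in> T"
  shows "adapted_hypersurface.om f1 \<xi>1 e1 w = adapted_hypersurface.om f2 \<xi>2 e2 (\<tau> w)"
    "adapted_hypersurface.W f1 \<xi>1 e1 w = adapted_hypersurface.W f2 \<xi>2 e2 (\<tau> w)"
    "adapted_hypersurface.nu f1 \<xi>1 e1 w = adapted_hypersurface.nu f2 \<xi>2 e2 (\<tau> w)"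
    "adapted_hypersurface.Cen f1 \<xi>1 e1 w = adapted_hypersurface.Cen f2 \<xi>2 e2 (\<tau> w)"
proof -
  interpret chart_change V1 f1 \<xi>1 V2 f2 \<xi>2 T T' \<tau> \<sigma> by (rule cc)
  interpret D1: adapted_hypersurface V1 f1 \<xi>1 e1 by (rule D1)
  interpret D2: adapted_hypersurface V2 f2 \<xi>2 e2 by (rule D2)
  have v: "w \<in> V1" "\<tau> w \<in> V2" using w T tau(1) by auto
  have E: "D1.E 1 q = D2.E 1 (\<tau> q)" if "q \<in> T" for q
    using that by (simp add: D1.E_def D2.E_def df_pullback ax)
  have th: "D1.th w x = D2.th (\<tau> w) (fd \<tau> w x)" for x
    unfolding D1.th_def D2.th_def ax[OF w] by (rule h_pullback[OF w])
  have dE: "fd (D1.E 1) w x = fd (D2.E 1) (\<tau> w) (fd \<tau> w x)" for x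
    by (rule fd_pullback[OF w E smooth_on_differentiable[OF D2.smooth_E v(2)]])
  have E0: "D1.E k w \<noteq> 0" for k
  proof
    assume "D1.E k w = 0"
    then have "(\<Sum>i\<in>UNIV. delta k i *\<^sub>R D1.E i w) + 0 *\<^sub>R \<xi>1 w = 0" by simp
    from D1.E_xi_independent(1)[OF v(1) this, of k] show False by simp
  qed
  have "fd (D1.E 1) w (e1 1 w) = (2 * D1.l w) *\<^sub>R D1.E 1 w + \<xi>1 w"
    unfolding D1.dE1[OF v(1)] by (simp add: v D1.E_def)
  moreover have "fd (D2.E 1) (\<tau> w) (fd \<tau> w (e1 1 w)) = (2 * D2.l (\<tau> w)) *\<^sub>R D1.E 1 w + \<xi>1 w"
    unfolding D2.dE1[OF v(2)] ax[OF w, symmetric] by (simp add: v D2.E_def E[OF w] xi12[OF w])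
  ultimately have l: "D1.l w = D2.l (\<tau> w)" using dE E0 by simp
  have df2: "fd f2 (\<tau> w) (fd \<tau> w (e1 2 w)) = D1.E 2 w" by (simp add: D1.E_def df_pullback[OF w])
  have "fd (D1.E 1) w (e1 2 w) = D1.be w *\<^sub>R D1.E 2 w"
    unfolding D1.dE1[OF v(1)] by (simp add: v D1.E_def)
  moreover have "fd (D2.E 1) (\<tau> w) (fd \<tau> w (e1 2 w)) = D2.be (\<tau> w) *\<^sub>R D1.E 2 w"
    unfolding D2.dE1[OF v(2)] th[symmetric] df2 by (simp add: v)
  ultimately have be: "D1.be w = D2.be (\<tau> w)" using dE E0 by simp
  have "fd \<xi>1 w (e1 2 w) = - D1.b w *\<^sub>R D1.E 2 w"
    unfolding D1.dxi_axis[OF v(1)] by (simp add: v D1.E_def)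
  moreover have "fd \<xi>2 (\<tau> w) (fd \<tau> w (e1 2 w)) = - D2.b (\<tau> w) *\<^sub>R D1.E 2 w"
    unfolding D2.dxi_axis[OF v(2)] th[symmetric] df2 by (simp add: v)
  ultimately have b: "D1.b w = D2.b (\<tau> w)" using dxi_pullback[OF w, of "e1 2 w"] E0 by simp
  have al: "D1.al w = D2.al (\<tau> w)" by (simp add: D1.al_def D2.al_def l be)
  show nu: "D1.nu w = D2.nu (\<tau> w)" by (simp add: D1.nu_def D2.nu_def b be al)
  show "D1.W w = D2.W (\<tau> w)" by (simp add: D1.W_def D2.W_def b be E[OF w] xi12[OF w])
  show "D1.Cen w = D2.Cen (\<tau> w)" by (simp add: D1.Cen_def D2.Cen_def D1.zeta_def D2.zeta_def nu al E[OF w] xi12[OF w] f12[OF w])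
  show "D1.om w = D2.om (\<tau> w)"
  proof (rule D1.E_dual_eqI[OF v(1)])
    show "D1.om w \<bullet> D1.E i w = D2.om (\<tau> w) \<bullet> D1.E i w" for i
      unfolding D1.E_def using D1.om_df[OF v(1)] D2.om_df[OF v(2)] by (simp add: df_pullback[OF w] th[symmetric])
    show "D1.om w \<bullet> \<xi>1 w = D2.om (\<tau> w) \<bullet> \<xi>1 w"
      using D1.om_E(4)[OF v(1)] D2.om_E(4)[OF v(2)] al xi12[OF w] by simp
  qed
qed

section \<open>Globalization\<close>

locale symmetric_manifold =
  fixes \<A> :: "'m::{t2_space, second_countable_topology} chart set"
    and F \<xi> :: "'m \<Rightarrow> real^4" and G :: symmetry_type
  assumes conn: "connected (UNIV :: 'm set)" and atlas: "smooth_atlas \<A>"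
    and pos: "positive_definite_affine_hypersurface \<A> F \<xi>" and sym: "pointwise_symmetry \<A> F \<xi> G"
begin

abbreviation "Fx U x \<equiv> F \<circ> inv_into U x"
abbreviation "Xx U x \<equiv> \<xi> \<circ> inv_into U x"

lemma chartD:
  assumes "(U, x) \<in> \<A>"
  shows "open U" "open (x ` U)" "homeomorphism U (x ` U) x (inv_into U x)" "inj_on x U"
    "symmetric_hypersurface (x ` U) (Fx U x) (Xx U x) G"
proof -
  have c: "is_chart U x" using atlas assms by (auto simp: smooth_atlas_def)
  then show "open U" "open (x ` U)" "homeomorphism U (x ` U) x (inv_into U x)" by (auto simp: is_chart_def)
  then show "inj_on x U" by (metis homeomorphism_apply1 inj_on_inverseI)
  show "symmetric_hypersurface (x ` U) (Fx U x) (Xx U x) G"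
  proof
    show "blaschke_hypersurface (x ` U) (Fx U x) (Xx U x)"
      using pos assms by (auto simp: positive_definite_affine_hypersurface_def)
    show "positive_definite (affine_metric (Fx U x) (Xx U x) w)" if "w \<in> x ` U" for w
      using pos assms that unfolding positive_definite_affine_hypersurface_def by blast
    show "\<exists>e. orthonormal (affine_metric (Fx U x) (Xx U x) w) e \<and>
         symmetry_group (Fx U x) (Xx U x) w = {R. \<exists>\<theta>\<in>rotation_angles G. rotation_about_e1 e \<theta> R}" if "w \<in> x ` U" for w
      using sym assms that unfolding pointwise_symmetry_def by blast
  qed
qed

text \<open>Requiring \<open>e 1\<close> to be \<open>sym_axis\<close> makes overlapping frames
  comparable. The last clause keeps the vanishing of \<mu> for the quadrics.\<close>

definition frame_chart :: "'m set \<Rightarrow> ('m \<Rightarrow> real^3) \<Rightarrow> (real^3) set \<Rightarrow> (3 \<Rightarrow> real^3 \<Rightarrow> real^3) \<Rightarrow> bool" where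
  "frame_chart U x V e \<longleftrightarrow> (U, x) \<in> \<A> \<and> V \<subseteq> x ` U \<and> adapted_hypersurface V (Fx U x) (Xx U x) e \<and>
     (\<forall>w\<in>V. e 1 w = sym_axis (Fx U x) (Xx U x) w) \<and>
     (G = SO2 \<longrightarrow> (\<forall>w\<in>V. framed_hypersurface.C (Fx U x) (Xx U x) e 2 2 2 w = 0 \<and>
        framed_hypersurface.C (Fx U x) (Xx U x) e 2 2 3 w = 0))"

lemma frame_chart_exists:
  obtains U x V e where "frame_chart U x V e" "p \<in> U" "x p \<in> V"
proof -
  have "p \<in> (\<Union>(U, x)\<in>\<A>. U)" using atlas by (simp add: smooth_atlas_def)
  then obtain U x where Ux: "(U, x) \<in> \<A>" "p \<in> U" by blast
  interpret H: symmetric_hypersurface "x ` U" "Fx U x" "Xx U x" G by (rule chartD(5)[OF Ux(1)])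
  have xp: "x p \<in> x ` U" using Ux(2) by simp
  obtain r e where r: "r > 0" "ball (x p) r \<subseteq> x ` U" and fr: "framed_hypersurface (ball (x p) r) (Fx U x) (Xx U x) e"
    and e1: "\<And>w. w \<in> ball (x p) r \<Longrightarrow> e 1 w = H.ax w"
    by (rule H.axis_frame[OF xp]) (rule that; assumption)
  interpret B: framed_hypersurface "ball (x p) r" "Fx U x" "Xx U x" e by (rule fr)
  have ad: "\<exists>l m n a b. B.adapted w (\<lambda>i. e i w) l m n a b \<and> l > 0 \<and> (G = SO2 \<longrightarrow> m = 0 \<and> n = 0)"
    if w: "w \<in> ball (x p) r" for w
  proof -
    have wU: "w \<in> x ` U" using w r(2) by auto
    interpret P: cubic_data "B.h w" "B.K w" "B.S w" by (rule H.cubic[OF wU])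
    obtain e' l m n a b where A: "P.adapted e' l m n a b" "l > 0" "G = SO2 \<Longrightarrow> m = 0 \<and> n = 0" "e' 1 = H.ax w"
      by (rule H.adapted_at_axis[OF wU]) (rule that; assumption)
    have "e 1 w = e' 1" using e1[OF w] A(4) by simp
    from P.adapted_change[OF A(1) B.onb_e[OF w] this] obtain m' n' where
      "P.adapted (\<lambda>i. e i w) l m' n' a b" "m = 0 \<Longrightarrow> n = 0 \<Longrightarrow> m' = 0 \<and> n' = 0" by metis
    then show ?thesis using A(2,3) by blast
  qed
  interpret B: adapted_hypersurface "ball (x p) r" "Fx U x" "Xx U x" e
    by unfold_locales (use ad in blast, simp)
  have "B.C 2 2 2 w = 0 \<and> B.C 2 2 3 w = 0" if so: "G = SO2" and w: "w \<in> ball (x p) r" for w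
  proof -
    have wU: "w \<in> x ` U" using w r(2) by auto
    interpret P: cubic_data "B.h w" "B.K w" "B.S w" by (rule H.cubic[OF wU])
    obtain l a b where "P.adapted (\<lambda>i. e i w) l 0 0 a b" using ad[OF w] so by blast
    from P.adaptedD(5)[OF this] show ?thesis
      unfolding B.h_K_e[OF w, symmetric] by (simp add: spd_simps[OF B.spd_h[OF w]] B.h_e[OF w])
  qed
  then have "frame_chart U x (ball (x p) r) e"
    unfolding frame_chart_def using Ux(1) r(2) e1 B.adapted_hypersurface_axioms by blast
  then show ?thesis using that Ux(2) r(1) by simp
qed

text \<open>A relation instead of functions on the manifold: no frame has to be chosen at each
  point, and \<open>data_unique\<close> shows that the values are determined.\<close>

definition data_at :: "'m \<Rightarrow> real^4 \<Rightarrow> real^4 \<Rightarrow> real \<Rightarrow> real^4 \<Rightarrow> bool" where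
  "data_at p \<omega> W \<nu> c \<longleftrightarrow> (\<exists>U x V e. frame_chart U x V e \<and> p \<in> U \<and> x p \<in> V \<and>
     \<omega> = adapted_hypersurface.om (Fx U x) (Xx U x) e (x p) \<and>
     W = adapted_hypersurface.W (Fx U x) (Xx U x) e (x p) \<and>
     \<nu> = adapted_hypersurface.nu (Fx U x) (Xx U x) e (x p) \<and>
     c = adapted_hypersurface.Cen (Fx U x) (Xx U x) e (x p))"

lemma data_unique:
  assumes 1: "data_at p \<omega> W \<nu> c" and 2: "data_at p \<omega>' W' \<nu>' c'"
  shows "\<omega> = \<omega>'" "W = W'" "\<nu> = \<nu>'" "c = c'"
proof -
  obtain U x V e where a: "frame_chart U x V e" "p \<in> U" "x p \<in> V"
    "\<omega> = adapted_hypersurface.om (Fx U x) (Xx U x) e (x p)" "W = adapted_hypersurface.W (Fx U x) (Xx U x) e (x p)"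
    "\<nu> = adapted_hypersurface.nu (Fx U x) (Xx U x) e (x p)" "c = adapted_hypersurface.Cen (Fx U x) (Xx U x) e (x p)"
    using 1 unfolding data_at_def by blast
  obtain U' x' V' e' where b: "frame_chart U' x' V' e'" "p \<in> U'" "x' p \<in> V'"
    "\<omega>' = adapted_hypersurface.om (Fx U' x') (Xx U' x') e' (x' p)" "W' = adapted_hypersurface.W (Fx U' x') (Xx U' x') e' (x' p)"
    "\<nu>' = adapted_hypersurface.nu (Fx U' x') (Xx U' x') e' (x' p)" "c' = adapted_hypersurface.Cen (Fx U' x') (Xx U' x') e' (x' p)"
    using 2 unfolding data_at_def by blast
  have A: "(U, x) \<in> \<A>" "V \<subseteq> x ` U" "adapted_hypersurface V (Fx U x) (Xx U x) e"
    "\<And>w. w \<in> V \<Longrightarrow> e 1 w = sym_axis (Fx U x) (Xx U x) w" using a(1) by (auto simp: frame_chart_def)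
  have B: "(U', x') \<in> \<A>" "V' \<subseteq> x' ` U'" "adapted_hypersurface V' (Fx U' x') (Xx U' x') e'"
    "\<And>w. w \<in> V' \<Longrightarrow> e' 1 w = sym_axis (Fx U' x') (Xx U' x') w" using b(1) by (auto simp: frame_chart_def)
  interpret H: symmetric_hypersurface "x ` U" "Fx U x" "Xx U x" G by (rule chartD(5)[OF A(1)])
  interpret H': symmetric_hypersurface "x' ` U'" "Fx U' x'" "Xx U' x'" G by (rule chartD(5)[OF B(1)])
  interpret D: adapted_hypersurface V "Fx U x" "Xx U x" e by (rule A(3))
  interpret D': adapted_hypersurface V' "Fx U' x'" "Xx U' x'" e' by (rule B(3))
  define \<tau> where "\<tau> = x' \<circ> inv_into U x"
  define \<sigma> where "\<sigma> = x \<circ> inv_into U' x'"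
  have st: "smooth_on (x ` (U \<inter> U')) \<tau>" "smooth_on (x' ` (U' \<inter> U)) \<sigma>"
    using atlas A(1) B(1) unfolding smooth_atlas_def \<tau>_def \<sigma>_def by blast+
  \<comment> \<open>The overlap as seen in the first chart, cut down to the points covered by both
    frames.\<close>
  define T where "T = {w \<in> x ` (U \<inter> U') \<inter> V. \<tau> w \<in> V'}"
  define T' where "T' = {w \<in> x' ` (U' \<inter> U) \<inter> V'. \<sigma> w \<in> V}"
  note inj = chartD(4)[OF A(1)] chartD(4)[OF B(1)]
  have ti: "\<tau> (x q) = x' q" if "q \<in> U" for q using that inj by (simp add: \<tau>_def)
  have si: "\<sigma> (x' q) = x q" if "q \<in> U'" for q using that inj by (simp add: \<sigma>_def)
  have oT: "open T"
  proof -
    have s: "smooth_on (x ` (U \<inter> U') \<inter> V) \<tau>"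
      by (rule smooth_on_subset[OF st(1)]) (use smooth_on_open[OF st(1)] D.open_V in auto)
    show ?thesis using continuous_open_preimage[OF smooth_on_continuous[OF s] smooth_on_open[OF s] D'.open_V]
      by (simp add: T_def vimage_def Int_def)
  qed
  have oT': "open T'"
  proof -
    have s: "smooth_on (x' ` (U' \<inter> U) \<inter> V') \<sigma>"
      by (rule smooth_on_subset[OF st(2)]) (use smooth_on_open[OF st(2)] D'.open_V in auto)
    show ?thesis using continuous_open_preimage[OF smooth_on_continuous[OF s] smooth_on_open[OF s] D.open_V]
      by (simp add: T'_def vimage_def Int_def)
  qed
  \<comment> \<open>Two versions are needed: the whole charts, where the symmetry axes are compared,
    and the smaller domains, where the frames live.\<close>
  have cc0: "chart_change (x ` U) (Fx U x) (Xx U x) (x' ` U') (Fx U' x') (Xx U' x') T T' \<tau> \<sigma>"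
    and cc: "chart_change V (Fx U x) (Xx U x) V' (Fx U' x') (Xx U' x') T T' \<tau> \<sigma>"
  proof -
    have "smooth_on T \<tau>" "smooth_on T' \<sigma>"
      using smooth_on_subset[OF st(1) oT] smooth_on_subset[OF st(2) oT'] by (auto simp: T_def T'_def)
    moreover have "\<tau> w \<in> T'" "\<sigma> (\<tau> w) = w" "Fx U x w = Fx U' x' (\<tau> w)" "Xx U x w = Xx U' x' (\<tau> w)" if w: "w \<in> T" for w
    proof -
      obtain q where q: "q \<in> U" "q \<in> U'" "w = x q" using w by (auto simp: T_def)
      show "\<tau> w \<in> T'" "\<sigma> (\<tau> w) = w" using w q by (auto simp: ti si T_def T'_def)
      show "Fx U x w = Fx U' x' (\<tau> w)" "Xx U x w = Xx U' x' (\<tau> w)" using q inj by (simp_all add: ti)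
    qed
    moreover have "\<sigma> w \<in> T" "\<tau> (\<sigma> w) = w" if w: "w \<in> T'" for w
    proof -
      obtain q where q: "q \<in> U" "q \<in> U'" "w = x' q" using w by (auto simp: T'_def)
      show "\<sigma> w \<in> T" "\<tau> (\<sigma> w) = w" using w q by (auto simp: ti si T_def T'_def)
    qed
    moreover have "T \<subseteq> x ` U" "T' \<subseteq> x' ` U'" "T \<subseteq> V" "T' \<subseteq> V'" by (auto simp: T_def T'_def)
    ultimately show "chart_change (x ` U) (Fx U x) (Xx U x) (x' ` U') (Fx U' x') (Xx U' x') T T' \<tau> \<sigma>"
      "chart_change V (Fx U x) (Xx U x) V' (Fx U' x') (Xx U' x') T T' \<tau> \<sigma>"
      by unfold_locales auto
  qed
  have ax: "e' 1 (\<tau> w) = fd \<tau> w (e 1 w)" if w: "w \<in> T" for w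
  proof -
    have wV: "w \<in> V" "\<tau> w \<in> V'" using w by (auto simp: T_def)
    have "is_axis (Fx U x) (Xx U x) w (e 1 w)" using A(4)[OF wV(1)] H.is_axis_ax wV A(2) by auto
    from chart_change.is_axis_pushforward[OF cc0 w this] show ?thesis
      using H'.is_axis_unique B(4)[OF wV(2)] B(2) wV(2) by fastforce
  qed
  have xp: "x p \<in> T" using a b by (auto simp: T_def ti)
  have "\<tau> (x p) = x' p" using ti a(2) .
  then show "\<omega> = \<omega>'" "W = W'" "\<nu> = \<nu>'" "c = c'"
    using adapted_data_eq[OF cc A(3) B(3) ax xp] a(4-7) b(4-7) by simp_all
qed

lemma frame_chart_data:
  assumes "frame_chart U x V e" "q \<in> U" "x q \<in> V"
  shows "data_at q (adapted_hypersurface.om (Fx U x) (Xx U x) e (x q)) (adapted_hypersurface.W (Fx U x) (Xx U x) e (x q))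
     (adapted_hypersurface.nu (Fx U x) (Xx U x) e (x q)) (adapted_hypersurface.Cen (Fx U x) (Xx U x) e (x q))"
  unfolding data_at_def using assms by blast

lemma data_exists: "\<exists>\<omega> W \<nu> c. data_at p \<omega> W \<nu> c"
  by (rule frame_chart_exists[of p]) (use frame_chart_data in blast)

text \<open>The relation \<open>R\<close> of the proof is symmetric and transitive because \<open>\<nu> = \<omega> \<bullet> W\<close>.\<close>

lemma data_global:
  assumes p0: "data_at p0 \<omega>0 W0 \<nu>0 c0" and n0: "\<nu>0 \<noteq> 0" and q: "data_at q \<omega> W \<nu> c"
  shows "\<exists>k>0. \<omega> = k *\<^sub>R \<omega>0" "\<exists>k>0. W = k *\<^sub>R W0" "\<exists>t. c = c0 + t *\<^sub>R W0"
proof -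
  \<comment> \<open>Where \<nu> vanishes the centre is a default value, as \<open>1 / 0 = 0\<close>.
    So the clause on the centre is guarded, and the clause on the zeros of \<nu> carries the guard
    along chains of points.\<close>
  define R where "R p q \<longleftrightarrow> (\<forall>\<omega> W \<nu> c \<omega>' W' \<nu>' c'. data_at p \<omega> W \<nu> c \<longrightarrow> data_at q \<omega>' W' \<nu>' c' \<longrightarrow>
     (\<exists>k>0. \<omega>' = k *\<^sub>R \<omega>) \<and> (\<exists>k>0. W' = k *\<^sub>R W) \<and> (\<nu> = 0 \<longleftrightarrow> \<nu>' = 0) \<and> (\<nu> \<noteq> 0 \<longrightarrow> (\<exists>t. c' = c + t *\<^sub>R W)))" for p q
  have "R p0 q"
  proof (rule connected_equivalence_relation[OF conn, of p0 q R])
    show "R y x" if "R x y" for x y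
      unfolding R_def
    proof (intro allI impI)
      fix \<omega> W \<nu> c \<omega>' W' \<nu>' c' assume "data_at y \<omega> W \<nu> c" "data_at x \<omega>' W' \<nu>' c'"
      then obtain k k' where *: "k > 0" "\<omega> = k *\<^sub>R \<omega>'" "k' > 0" "W = k' *\<^sub>R W'" "\<nu>' = 0 \<longleftrightarrow> \<nu> = 0"
        "\<nu>' \<noteq> 0 \<longrightarrow> (\<exists>t. c = c' + t *\<^sub>R W')"
        using \<open>R x y\<close> unfolding R_def by blast
      have "\<exists>t. c' = c + t *\<^sub>R W" if "c = c' + t *\<^sub>R W'" for t
        using that *(3,4) by (intro exI[of _ "- t / k'"]) simp
      moreover have "\<omega>' = (1 / k) *\<^sub>R \<omega>" "W' = (1 / k') *\<^sub>R W" using * by auto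
      ultimately show "(\<exists>k>0. \<omega>' = k *\<^sub>R \<omega>) \<and> (\<exists>k>0. W' = k *\<^sub>R W) \<and> (\<nu> = 0 \<longleftrightarrow> \<nu>' = 0) \<and> (\<nu> \<noteq> 0 \<longrightarrow> (\<exists>t. c' = c + t *\<^sub>R W))"
        using *(1,3,5,6) by (metis zero_less_divide_1_iff)
    qed
    show "R x z" if xy: "R x y" and yz: "R y z" for x y z
      unfolding R_def
    proof (intro allI impI)
      fix \<omega> W \<nu> c \<omega>' W' \<nu>' c' assume d: "data_at x \<omega> W \<nu> c" "data_at z \<omega>' W' \<nu>' c'"
      obtain \<omega>1 W1 \<nu>1 c1 where d1: "data_at y \<omega>1 W1 \<nu>1 c1" using data_exists by blast
      obtain k k' where *: "k > 0" "\<omega>1 = k *\<^sub>R \<omega>" "k' > 0" "W1 = k' *\<^sub>R W" "\<nu> = 0 \<longleftrightarrow> \<nu>1 = 0"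
        "\<nu> \<noteq> 0 \<longrightarrow> (\<exists>t. c1 = c + t *\<^sub>R W)" using xy d(1) d1 unfolding R_def by blast
      obtain j j' where **: "j > 0" "\<omega>' = j *\<^sub>R \<omega>1" "j' > 0" "W' = j' *\<^sub>R W1" "\<nu>1 = 0 \<longleftrightarrow> \<nu>' = 0"
        "\<nu>1 \<noteq> 0 \<longrightarrow> (\<exists>t. c' = c1 + t *\<^sub>R W1)" using yz d(2) d1 unfolding R_def by blast
      have "\<exists>t. c' = c + t *\<^sub>R W" if nn: "\<nu> \<noteq> 0"
      proof -
        obtain t s where "c1 = c + t *\<^sub>R W" "c' = c1 + s *\<^sub>R W1" using nn *(5,6) **(6) by blast
        then have "c' = c + (t + s * k') *\<^sub>R W" using *(4) by (simp add: scaleR_add_left)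
        then show ?thesis by blast
      qed
      moreover have "j * k > 0" "j' * k' > 0" "\<omega>' = (j * k) *\<^sub>R \<omega>" "W' = (j' * k') *\<^sub>R W" using * ** by simp_all
      ultimately show "(\<exists>k>0. \<omega>' = k *\<^sub>R \<omega>) \<and> (\<exists>k>0. W' = k *\<^sub>R W) \<and> (\<nu> = 0 \<longleftrightarrow> \<nu>' = 0) \<and> (\<nu> \<noteq> 0 \<longrightarrow> (\<exists>t. c' = c + t *\<^sub>R W))"
        using *(5) **(5) by blast
    qed
    show "\<exists>T. openin (top_of_set UNIV) T \<and> a \<in> T \<and> (\<forall>x\<in>T. R a x)" for a
    proof -
      obtain U x V e where fc: "frame_chart U x V e" "a \<in> U" "x a \<in> V" by (rule frame_chart_exists)
      then have Ux: "(U, x) \<in> \<A>" by (simp add: frame_chart_def)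
      interpret D: adapted_hypersurface V "Fx U x" "Xx U x" e using fc by (simp add: frame_chart_def)
      have "continuous_on U x" using chartD(3)[OF Ux] by (simp add: homeomorphism_def)
      then have "open (U \<inter> x -` V)" using continuous_open_preimage[OF _ chartD(1)[OF Ux] D.open_V] by blast
      moreover have "R a q" if q: "q \<in> U \<inter> x -` V" for q
        unfolding R_def
      proof (intro allI impI)
        fix \<omega> W \<nu> c \<omega>' W' \<nu>' c' assume d: "data_at a \<omega> W \<nu> c" "data_at q \<omega>' W' \<nu>' c'"
        have xq: "q \<in> U" "x q \<in> V" using q by auto
        note u = data_unique[OF d(1) frame_chart_data[OF fc]] data_unique[OF d(2) frame_chart_data[OF fc(1) xq]]
        obtain k where k: "k > 0" "D.om (x q) = k *\<^sub>R D.om (x a)" by (rule D.om_proportional[OF fc(3) xq(2)])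
        obtain k' where k': "k' > 0" "D.W (x q) = k' *\<^sub>R D.W (x a)" by (rule D.W_proportional[OF fc(3) xq(2)])
        have "D.nu (x a) = 0 \<longleftrightarrow> D.nu (x q) = 0"
          using D.nu_nonzero fc(3) xq(2) by blast
        moreover have "\<exists>t. D.Cen (x q) = D.Cen (x a) + t *\<^sub>R D.W (x a)" if "D.nu (x a) \<noteq> 0"
          using D.Cen_line[OF fc(3) xq(2) that] by metis
        ultimately show "(\<exists>k>0. \<omega>' = k *\<^sub>R \<omega>) \<and> (\<exists>k>0. W' = k *\<^sub>R W) \<and> (\<nu> = 0 \<longleftrightarrow> \<nu>' = 0) \<and> (\<nu> \<noteq> 0 \<longrightarrow> (\<exists>t. c' = c + t *\<^sub>R W))"
          unfolding u using k k' by blast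
      qed
      ultimately show ?thesis using fc(2,3) by (intro exI[of _ "U \<inter> x -` V"]) auto
    qed
  qed auto
  then show "\<exists>k>0. \<omega> = k *\<^sub>R \<omega>0" "\<exists>k>0. W = k *\<^sub>R W0" "\<exists>t. c = c0 + t *\<^sub>R W0"
    using p0 n0 q unfolding R_def by blast+
qed

text \<open>The hypothesis comes with an arbitrary adapted frame. By \<open>axis_unique\<close> its
  first vector is the symmetry axis, and with \<open>\<eta> = be + l\<close> the given function is
  \<open>nu\<close>.\<close>

lemma nu_nonzero_frame:
  assumes nz: "nu_not_identically_zero \<A> F \<xi> G"
  obtains U x V e p where "frame_chart U x V e" "p \<in> U" "x p \<in> V" "adapted_hypersurface.nu (Fx U x) (Xx U x) e (x p) \<noteq> 0"
proof -
  obtain U x V e lam \<mu> a b w where Ux: "(U, x) \<in> \<A>" and VU: "V \<subseteq> x ` U"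
    and af: "adapted_frame G V (Fx U x) (Xx U x) e lam \<mu> a b" and w: "w \<in> V"
    and nz: "b w + (eta_function (Fx U x) (Xx U x) e w)\<^sup>2 - (lam w)\<^sup>2 \<noteq> 0"
    using nz unfolding nu_not_identically_zero_def by blast
  interpret H: symmetric_hypersurface "x ` U" "Fx U x" "Xx U x" G by (rule chartD(5)[OF Ux])
  have se: "smooth_on V (e i)" for i using af by (simp add: adapted_frame_def)
  obtain r where r: "r > 0" "ball w r \<subseteq> V" using smooth_on_open[OF se[of 1]] w openE by blast
  let ?B = "ball w r"
  have BU: "?B \<subseteq> x ` U" using r VU by auto
  interpret B: hypersurface ?B "Fx U x" "Xx U x" by (rule H.hypersurface_subset[OF open_ball BU])
  have ad: "B.adapted q (\<lambda>i. e i q) (lam q) (\<mu> q) 0 (a q) (b q)" and lp: "lam q > 0" and so: "G = SO2 \<Longrightarrow> \<mu> q = 0" if q: "q \<in> ?B" for q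
  proof -
    interpret P: cubic_data "B.h q" "B.K q" "B.S q" by (rule B.cubic[OF q])
    have qV: "q \<in> V" using q r by auto
    note * = af[unfolded adapted_frame_def Let_def, THEN conjunct2, rule_format, OF qV]
    have "onb (B.h q) (\<lambda>i. e i q)" using * orthonormal_iff_onb[OF B.spd_h[OF q]] by simp
    then show "P.adapted (\<lambda>i. e i q) (lam q) (\<mu> q) 0 (a q) (b q)"
      unfolding P.adapted_def using * by (simp add: has_matrix_def forall_3 sum_3)
    show "lam q > 0" using * by simp
    show "\<mu> q = 0" if "G = SO2" using * that by simp
  qed
  interpret B: framed_hypersurface ?B "Fx U x" "Xx U x" e
  proof
    show "smooth_on ?B (e i)" for i using smooth_on_subset[OF se open_ball r(2)] .
    show "onb (B.h q) (\<lambda>i. e i q)" if "q \<in> ?B" for q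
      using cubic_data.adaptedD(1)[OF B.cubic[OF that] ad[OF that]] .
  qed
  interpret B: adapted_hypersurface ?B "Fx U x" "Xx U x" e
    by unfold_locales (use ad lp in blast, simp)
  have C: "B.C 2 2 2 q = \<mu> q" "B.C 2 2 3 q = 0" "B.l q = lam q" "B.b q = b q" "B.C 2 1 2 q = - lam q" if q: "q \<in> ?B" for q
  proof -
    interpret P: cubic_data "B.h q" "B.K q" "B.S q" by (rule B.cubic[OF q])
    note D = P.adaptedD[OF ad[OF q]]
    show "B.C 2 2 2 q = \<mu> q" "B.C 2 2 3 q = 0" "B.l q = lam q" "B.b q = b q" "B.C 2 1 2 q = - lam q"
      unfolding B.l_def B.b_def B.Sm_def B.h_K_e[OF q, symmetric] P.K_sym[of "e 2 q" "e 1 q"] D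
      by (simp_all add: spd_simps[OF B.spd_h[OF q]] B.h_e[OF q])
  qed
  have ax: "e 1 q = H.ax q" if q: "q \<in> ?B" for q
  proof -
    interpret P: cubic_data "B.h q" "B.K q" "B.S q" by (rule B.cubic[OF q])
    have "is_axis (Fx U x) (Xx U x) q (H.ax q)" using H.is_axis_ax q BU by auto
    then show ?thesis using B.symmetry_group_eq[OF q] unfolding is_axis_def
      by (intro P.axis_unique[OF ad[OF q] lp[OF q], symmetric]) auto
  qed
  have fc: "frame_chart U x ?B e"
    unfolding frame_chart_def using Ux BU B.adapted_hypersurface_axioms ax so C by auto
  have wB: "w \<in> ?B" using r by simp
  have "eta_function (Fx U x) (Xx U x) e w = B.be w + B.l w"
  proof -
    \<comment> \<open>The Levi-Civita connection is the induced one minus \<open>K\<close>, and the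
      \<open>K\<close> term has component \<open>C 2 1 2 = - l\<close>.\<close>
    have "levi_civita B.h (e 1) w (e 2 w) = B.conn (e 1) w (e 2 w) - B.K w (e 2 w) (e 1 w)"
      unfolding B.Gauss_formula(2)[OF B.smooth_e order_refl wB] difference_tensor_def levi_civita_def by simp
    then show ?thesis
      unfolding eta_function_def
      by (simp add: spd_simps[OF B.spd_h[OF wB]] B.h_K_e[OF wB] B.A_def[symmetric] C[OF wB] B.be_def)
  qed
  then have "B.nu w \<noteq> 0" using nz C[OF wB] unfolding B.nu_def B.al_def
    by (simp add: power2_eq_square algebra_simps)
  moreover obtain p where "p \<in> U" "x p = w" using VU w by auto
  ultimately show ?thesis using that[OF fc, of p] wB by simp
qed

end

section \<open>The leaves are affine spheres\<close>

text \<open>The factors of \<open>\<real>\<^sup>4 = \<real> \<times> \<real>\<^sup>3\<close> that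
  carry \<open>\<gamma>\<^sub>1\<close> and \<open>\<gamma>\<^sub>2 \<phi>\<close> in the
  model.\<close>

definition tl4 :: "real^4 \<Rightarrow> real^3" where "tl4 y = vector [y $ 2, y $ 3, y $ 4]"
definition cons4 :: "real \<Rightarrow> real^3 \<Rightarrow> real^4" where "cons4 t z = vector [t, z $ 1, z $ 2, z $ 3]"

lemma vector4_nth [simp]: "(vector [a, b, c, d] :: real^4) $ 1 = a" "(vector [a, b, c, d] :: real^4) $ 2 = b"
  "(vector [a, b, c, d] :: real^4) $ 3 = c" "(vector [a, b, c, d] :: real^4) $ 4 = d"
  unfolding vector_def by simp_all

lemma vector4_nth_row [simp]: "(vector [a, b, c, d] :: real^4^4) $ 1 = a" "(vector [a, b, c, d] :: real^4^4) $ 2 = b"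
  "(vector [a, b, c, d] :: real^4^4) $ 3 = c" "(vector [a, b, c, d] :: real^4^4) $ 4 = d"
  unfolding vector_def by simp_all

lemma matrix_inv_mult:
  assumes "invertible A"
  shows "A ** matrix_inv A = mat 1" "matrix_inv A ** A = mat 1"
  using someI_ex[OF assms[unfolded invertible_def]] unfolding matrix_inv_def by auto

lemma linear_tl4: "linear tl4"
  by (rule linearI) (simp_all add: tl4_def vec_eq_iff forall_3)

lemma cons4_tl4 [simp]: "cons4 (y $ 1) (tl4 y) = y" "tl4 (cons4 t z) = z" "cons4 t z $ 1 = t"
  by (simp_all add: cons4_def tl4_def vec_eq_iff forall_3 forall_4)

lemma det_4: "det (A :: real^4^4) =
   A$1$1 * (A$2$2 * A$3$3 * A$4$4 + A$2$3 * A$3$4 * A$4$2 + A$2$4 * A$3$2 * A$4$3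
      - A$2$2 * A$3$4 * A$4$3 - A$2$3 * A$3$2 * A$4$4 - A$2$4 * A$3$3 * A$4$2)
 - A$1$2 * (A$2$1 * A$3$3 * A$4$4 + A$2$3 * A$3$4 * A$4$1 + A$2$4 * A$3$1 * A$4$3
      - A$2$1 * A$3$4 * A$4$3 - A$2$3 * A$3$1 * A$4$4 - A$2$4 * A$3$3 * A$4$1)
 + A$1$3 * (A$2$1 * A$3$2 * A$4$4 + A$2$2 * A$3$4 * A$4$1 + A$2$4 * A$3$1 * A$4$2
      - A$2$1 * A$3$4 * A$4$2 - A$2$2 * A$3$1 * A$4$4 - A$2$4 * A$3$2 * A$4$1)
 - A$1$4 * (A$2$1 * A$3$2 * A$4$3 + A$2$2 * A$3$3 * A$4$1 + A$2$3 * A$3$1 * A$4$2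
      - A$2$1 * A$3$3 * A$4$2 - A$2$2 * A$3$1 * A$4$3 - A$2$3 * A$3$2 * A$4$1)"
proof -
  have f1: "finite {2::4, 3, 4}" "1 \<notin> {2::4, 3, 4}" by auto
  have f2: "finite {3::4, 4}" "2 \<notin> {3::4, 4}" by auto
  have f3: "finite {4::4}" "3 \<notin> {4::4}" by auto
  show ?thesis
    unfolding det_def UNIV_4
    unfolding sum_over_permutations_insert[OF f1]
    unfolding sum_over_permutations_insert[OF f2]
    unfolding sum_over_permutations_insert[OF f3]
    unfolding permutes_sing
    by (simp add: sign_swap_id permutation_swap_id permutation_compose sign_compose sign_id swap_id_eq algebra_simps)
qed

lemma det_first_row_axis:
  "det (vector [axis 1 1, a, b, c] :: real^4^4) = det (vector [tl4 a, tl4 b, tl4 c] :: real^3^3)"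
  by (simp add: det_4 det_3 tl4_def axis_def vector_3)

lemma det_rows_mult:
  "det (vector [L *v a, L *v b, L *v c, L *v d] :: real^4^4) = det L * det (vector [a, b, c, d] :: real^4^4)"
proof -
  have "(vector [L *v a, L *v b, L *v c, L *v d] :: real^4^4) = vector [a, b, c, d] ** transpose L"
    by (simp add: vec_eq_iff forall_4 matrix_matrix_mult_def matrix_vector_mult_def transpose_def mult.commute)
  then show ?thesis by (simp add: det_mul)
qed

text \<open>The row operations of the volume computation on a leaf: passing from \<open>E 1\<close>
  to \<open>W\<close>, from \<xi> to \<open>zeta\<close>, and rescaling the two leaf
  vectors.\<close>

lemma det4_operations:
  "det (vector [x *\<^sub>R a + y *\<^sub>R d, b, c, d] :: real^4^4) = x * det (vector [a, b, c, d] :: real^4^4)"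
  "det (vector [a, b, c, d - x *\<^sub>R a] :: real^4^4) = det (vector [a, b, c, d] :: real^4^4)"
  "det (vector [a, s *\<^sub>R b, s *\<^sub>R c, d] :: real^4^4) = s\<^sup>2 * det (vector [a, b, c, d] :: real^4^4)"
  by (simp_all add: det_4 power2_eq_square algebra_simps)

lemma det3_scale:
  "det (vector [p *\<^sub>R a, p *\<^sub>R b, q *\<^sub>R c] :: real^3^3) = p\<^sup>2 * q * det (vector [a, b, c] :: real^3^3)"
  by (simp add: det_3 vector_3 power2_eq_square algebra_simps)

text \<open>The constants \<open>\<omega>0\<close>, \<open>W0\<close>, \<open>c0\<close> serve the
  whole manifold. The last two assumptions say that the columns of \<open>L\<close> are
  \<open>W0\<close> and three vectors in the kernel of \<open>\<omega>0\<close>.\<close>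

locale warped_chart = adapted_hypersurface +
  fixes \<omega>0 W0 c0 :: "real^4" and L :: "real^4^4"
  assumes om0: "\<And>w. w \<in> V \<Longrightarrow> \<exists>k>0. om w = k *\<^sub>R \<omega>0" and W0: "\<And>w. w \<in> V \<Longrightarrow> \<exists>k>0. W w = k *\<^sub>R W0"
    and Cen0: "\<And>w. w \<in> V \<Longrightarrow> \<exists>t. Cen w = c0 + t *\<^sub>R W0"
    and nz: "\<omega>0 \<bullet> W0 \<noteq> 0" and invertible_L: "invertible L" and L_axis: "L *v axis 1 1 = W0"
    and L_om: "\<And>y. \<omega>0 \<bullet> (L *v y) = y $ 1 * (\<omega>0 \<bullet> W0)"
begin

text \<open>The projection along \<open>W0\<close> onto the kernel of \<open>\<omega>0\<close>,
  identified with \<open>real^3\<close>. It sees each leaf faithfully and forgets the motion of the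
  centre.\<close>

definition Lam :: "real^4 \<Rightarrow> real^3" where "Lam v = tl4 (matrix_inv L *v v)"

lemma L_inverse [simp]: "L *v (matrix_inv L *v v) = v" "matrix_inv L *v (L *v v) = v"
  using matrix_inv_mult[OF invertible_L] by (simp_all add: matrix_vector_mul_assoc)

lemma linear_Lam: "linear Lam"
  using linear_compose[OF matrix_vector_mul_linear linear_tl4] by (simp add: Lam_def[abs_def] o_def)

lemmas Lam_simps = linear_add[OF linear_Lam] linear_diff[OF linear_Lam] linear_scale[OF linear_Lam] linear_neg[OF linear_Lam]

lemma inv_L_1: "(matrix_inv L *v v) $ 1 = (\<omega>0 \<bullet> v) / (\<omega>0 \<bullet> W0)"
  using L_om[of "matrix_inv L *v v"] nz by (simp add: field_simps)

lemma Lam_expand: "L *v cons4 ((\<omega>0 \<bullet> v) / (\<omega>0 \<bullet> W0)) (Lam v) = v"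
  unfolding Lam_def inv_L_1[symmetric] by simp

lemma Lam_W0: "Lam W0 = 0"
proof -
  have "matrix_inv L *v W0 = axis 1 1" using L_inverse(2)[of "axis 1 1"] by (simp add: L_axis)
  then show ?thesis by (simp add: Lam_def tl4_def axis_def vec_eq_iff forall_3 vector_3)
qed

lemma Lam_zeroI: "\<omega>0 \<bullet> v = 0 \<Longrightarrow> Lam v = 0 \<Longrightarrow> v = 0"
  using Lam_expand[of v] by (metis cons4_tl4(1) linear_0 linear_tl4 matrix_vector_mult_0_right div_0 zero_index)

lemma om0_df: "w \<in> V \<Longrightarrow> th w x = 0 \<Longrightarrow> \<omega>0 \<bullet> fd f w x = 0"
  using om0[of w] om_df[of w x] by auto

lemma om0_zeta: "w \<in> V \<Longrightarrow> \<omega>0 \<bullet> zeta w = 0"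
  using om0[of w] om_zeta[of w] by auto

lemma nu_sign: "w \<in> V \<Longrightarrow> nu w * (\<omega>0 \<bullet> W0) > 0"
proof -
  assume w: "w \<in> V"
  obtain k k' where "k > 0" "om w = k *\<^sub>R \<omega>0" "k' > 0" "W w = k' *\<^sub>R W0" using om0[OF w] W0[OF w] by auto
  then have "nu w = k * k' * (\<omega>0 \<bullet> W0)" using om_W[OF w] by (simp add: mult_ac)
  then have "nu w * (\<omega>0 \<bullet> W0) = k * k' * ((\<omega>0 \<bullet> W0) * (\<omega>0 \<bullet> W0))" by simp
  moreover have "(\<omega>0 \<bullet> W0) * (\<omega>0 \<bullet> W0) > 0" using nz by (auto simp: zero_less_mult_iff)
  ultimately show ?thesis using \<open>k > 0\<close> \<open>k' > 0\<close> by (metis mult_pos_pos)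
qed

lemma nu_nz: "w \<in> V \<Longrightarrow> nu w \<noteq> 0"
  using nu_sign[of w] by auto

text \<open>\<open>tt\<close> is the height over \<open>c0\<close> measured along \<open>W0\<close>,
  \<open>Y\<close> the position relative to the line of centres, and \<open>rr\<close> the rate of
  change of \<open>tt\<close> along the axis.\<close>

definition tt :: "real^3 \<Rightarrow> real" where "tt w = \<omega>0 \<bullet> (f w - c0) / (\<omega>0 \<bullet> W0)"
definition Y :: "real^3 \<Rightarrow> real^3" where "Y w = Lam (f w - c0)"
definition rr :: "real^3 \<Rightarrow> real" where "rr w = (\<omega>0 \<bullet> E 1 w) / (\<omega>0 \<bullet> W0)"

lemma f_expand: "f w = L *v cons4 (tt w) (Y w) + c0"
  using Lam_expand[of "f w - c0"] by (simp add: tt_def Y_def)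

lemma smooth_tt: "smooth_on V tt" and smooth_Y: "smooth_on V Y" and smooth_rr: "smooth_on V rr"
proof -
  show "smooth_on V tt" unfolding tt_def
    by (intro smooth_on_divide smooth_on_inner smooth_on_diff smooth_on_const open_V smooth_f) (rule nz)
  show "smooth_on V Y" unfolding Y_def
    by (rule smooth_on_linear_compose[OF _ linear_Lam]) (intro smooth_on_diff smooth_on_const open_V smooth_f)
  show "smooth_on V rr" unfolding rr_def
    by (intro smooth_on_divide smooth_on_inner smooth_on_const open_V smooth_E) (rule nz)
qed

text \<open>The centre differs from \<open>c0\<close> by a multiple of \<open>W0\<close>, which
  \<open>Lam\<close> kills.\<close>

lemma Y_zeta:
  assumes w: "w \<in> V"
  shows "Lam (zeta w) = - nu w *\<^sub>R Y w"
proof -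
  obtain t where t: "Cen w = c0 + t *\<^sub>R W0" using Cen0[OF w] by blast
  then have "f w - c0 = t *\<^sub>R W0 - (1 / nu w) *\<^sub>R zeta w" unfolding Cen_def by (simp add: algebra_simps)
  then have "Y w = - (1 / nu w) *\<^sub>R Lam (zeta w)" unfolding Y_def by (simp add: Lam_simps Lam_W0)
  then show ?thesis using nu_nz[OF w] by simp
qed

lemma Lam_W: "w \<in> V \<Longrightarrow> Lam (W w) = 0"
  using W0[of w] by (auto simp: Lam_simps Lam_W0)

lemma W_eq: "nu w *\<^sub>R E 1 w + be w *\<^sub>R zeta w = W w"
  by (simp add: W_def zeta_def nu_def vec_eq_iff algebra_simps)

text \<open>\<open>W\<close> is a combination of \<open>E 1\<close> and \<open>zeta\<close> and is
  killed by \<open>Lam\<close>, so the image of \<open>E 1\<close> is radial. This is the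
  infinitesimal form of the homotheties between leaves.\<close>

lemma Lam_E1:
  assumes w: "w \<in> V"
  shows "Lam (E 1 w) = be w *\<^sub>R Y w"
proof -
  have "nu w *\<^sub>R Lam (E 1 w) + be w *\<^sub>R Lam (zeta w) = 0"
    using Lam_W[OF w] unfolding W_eq[symmetric] by (simp add: Lam_simps)
  then have "nu w *\<^sub>R (Lam (E 1 w) - be w *\<^sub>R Y w) = 0"
    unfolding Y_zeta[OF w] by (simp add: vec_eq_iff algebra_simps)
  then show ?thesis using nu_nz[OF w] by simp
qed

lemma dY: "w \<in> V \<Longrightarrow> fd Y w x = Lam (fd f w x)"
  unfolding Y_def[abs_def]
  by (subst fd_linear_compose[OF linear_Lam]) (auto simp: fd_diff invariants_differentiable)

lemma df_th: "w \<in> V \<Longrightarrow> \<omega>0 \<bullet> fd f w x = th w x * (\<omega>0 \<bullet> E 1 w)"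
proof -
  assume w: "w \<in> V"
  obtain k where "k > 0" "om w = k *\<^sub>R \<omega>0" using om0[OF w] by blast
  then have *: "k * (\<omega>0 \<bullet> fd f w x) = th w x" "k * (\<omega>0 \<bullet> E 1 w) = 1"
    using om_df[OF w, of x] om_E(1)[OF w] by simp_all
  have "th w x * (\<omega>0 \<bullet> E 1 w) = (k * (\<omega>0 \<bullet> E 1 w)) * (\<omega>0 \<bullet> fd f w x)"
    unfolding *(1)[symmetric] by (simp only: mult_ac)
  then show ?thesis unfolding *(2) by simp
qed

lemma dtt: "w \<in> V \<Longrightarrow> fd tt w x = th w x * rr w"
proof -
  assume w: "w \<in> V"
  have "fd tt w x = \<omega>0 \<bullet> fd f w x / (\<omega>0 \<bullet> W0)"
  proof -
    have l: "linear (\<lambda>v. \<omega>0 \<bullet> v / (\<omega>0 \<bullet> W0))" by (rule linearI) (simp_all add: inner_add_right add_divide_distrib)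
    show ?thesis unfolding tt_def[abs_def]
      by (subst fd_linear_compose[OF l]) (auto simp: fd_diff invariants_differentiable[OF w])
  qed
  then show ?thesis by (simp add: df_th[OF w] rr_def)
qed

lemma rr_nz: "w \<in> V \<Longrightarrow> rr w \<noteq> 0"
  using om0[of w] om_E(1)[of w] nz by (auto simp: rr_def)

text \<open>Leaf vectors and \<open>zeta\<close> lie in the kernel of \<open>\<omega>0\<close>,
  where \<open>Lam\<close> is injective, and \<open>zeta\<close> has a component along
  \<xi>.\<close>

lemma leaf_independent:
  assumes w: "w \<in> V" and z: "Lam (r *\<^sub>R fd f w x + s *\<^sub>R zeta w) = 0" "th w x = 0"
  shows "r *\<^sub>R x = 0" "s = 0"
proof -
  have "r *\<^sub>R fd f w x + s *\<^sub>R zeta w = 0"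
    by (rule Lam_zeroI[OF _ z(1)]) (simp add: inner_add_right om0_df[OF w z(2)] om0_zeta[OF w])
  then have "fd f w (r *\<^sub>R x - (s * al w) *\<^sub>R e 1 w) + s *\<^sub>R \<xi> w = 0"
    by (simp add: linear_diff[OF linear_df[OF w]] linear_scale[OF linear_df[OF w]] zeta_def E_def algebra_simps)
  from df_xi_independent[OF w this] show "r *\<^sub>R x = 0" "s = 0" by auto
qed

text \<open>The derivative of \<open>om\<close> vanishes along a leaf, so second derivatives of leaf
  fields stay in the kernel of \<open>om\<close>, which is spanned by the leaf directions and
  \<open>zeta\<close>. Relative to \<open>zeta\<close> the leaf inherits the restriction of
  \<open>h\<close>.\<close>

lemma second_derivative_leaf:
  assumes U: "smooth_on U X" "U \<subseteq> V" "w \<in> U" and X: "\<And>q. q \<in> U \<Longrightarrow> th q (X q) = 0" and x: "th w x = 0"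
  obtains z where "th w z = 0" "fd (\<lambda>q. fd f q (X q)) w x = fd f w z + h w x (X w) *\<^sub>R zeta w"
proof -
  have w: "w \<in> V" using U by auto
  have sf: "smooth_on U f" "smooth_on U om"
    using smooth_on_subset[OF _ smooth_on_open[OF U(1)] U(2)] smooth_f smooth_om by auto
  let ?Z = "\<lambda>q. fd f q (X q)"
  have sZ: "smooth_on U ?Z" by (rule smooth_on_fd[OF sf(1) U(1)])
  have "fd (\<lambda>q. om q \<bullet> ?Z q) w x = fd (\<lambda>q. 0::real) w x"
    using U(2) X om_df by (subst fd_cong(1)[OF smooth_on_open[OF U(1)] U(3), of "\<lambda>q. 0"]) auto
  then have "fd om w x \<bullet> ?Z w + om w \<bullet> fd ?Z w x = 0"
    using fd_inner[OF smooth_on_differentiable[OF sf(2) U(3)] smooth_on_differentiable[OF sZ U(3)], of x] by simp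
  then have 0: "om w \<bullet> fd ?Z w x = 0" unfolding dom[OF w] by (simp add: x)
  define z where "z = conn X w x + (h w x (X w) * al w) *\<^sub>R e 1 w"
  have Z: "fd ?Z w x = fd f w (conn X w x) + h w x (X w) *\<^sub>R \<xi> w" by (rule Gauss_formula(1)[OF U])
  have "fd ?Z w x = fd f w z + h w x (X w) *\<^sub>R zeta w"
    unfolding Z z_def zeta_def by (simp add: linear_add[OF linear_df[OF w]] linear_scale[OF linear_df[OF w]] E_def algebra_simps)
  moreover from 0 this have "th w z = 0" by (simp add: inner_add_right om_df[OF w] om_zeta[OF w])
  ultimately show ?thesis by (rule that[rotated])
qed

text \<open>Row operations replace \<xi> by \<open>zeta\<close> and \<open>nu\<close> times
  \<open>E 1\<close> by \<open>W\<close>. Since \<open>W\<close> is \<open>k\<close> times the first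
  column of \<open>L\<close>, a first row \<open>axis 1 1\<close> splits off and leaves a volume in
  \<open>real^3\<close>.\<close>

lemma det_leaf:
  assumes w: "w \<in> V" and k: "W w = k *\<^sub>R W0"
  shows "nu w * det (vector [E 1 w, x1, x2, \<xi> w] :: real^4^4) =
     k * det L * det (vector [Lam x1, Lam x2, Lam (zeta w)] :: real^3^3)"
proof -
  have "nu w * det (vector [E 1 w, x1, x2, \<xi> w] :: real^4^4) = nu w * det (vector [E 1 w, x1, x2, zeta w] :: real^4^4)"
    unfolding zeta_def det4_operations(2) ..
  also have "\<dots> = det (vector [W w, x1, x2, zeta w] :: real^4^4)"
    unfolding W_eq[symmetric] det4_operations(1) ..
  also have "\<dots> = k * det (vector [W0, x1, x2, zeta w] :: real^4^4)"
    unfolding k using det4_operations(1)[of k W0 0] by simp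
  also have "det (vector [W0, x1, x2, zeta w] :: real^4^4) = det L * det (vector [Lam x1, Lam x2, Lam (zeta w)] :: real^3^3)"
    using det_rows_mult[of L "axis 1 1" "matrix_inv L *v x1" "matrix_inv L *v x2" "matrix_inv L *v zeta w"]
    by (simp add: L_axis det_first_row_axis Lam_def)
  finally show ?thesis by simp
qed

end

section \<open>One leaf as a proper affine sphere\<close>

locale warped_leaf = warped_chart +
  fixes N :: "(real^2) set" and \<gamma> :: "real^2 \<Rightarrow> real^3" and U :: "(real^3) set"
    and X :: "real^2 \<Rightarrow> real^3 \<Rightarrow> real^3" and k0 :: real
  assumes convex_N: "convex N" and N_ne: "N \<noteq> {}" and smooth_gamma: "smooth_on N \<gamma>" and gamma_U: "\<gamma> ` N \<subseteq> U" and U_V: "U \<subseteq> V"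
    and leaf: "\<And>n x. n \<in> N \<Longrightarrow> th (\<gamma> n) (fd \<gamma> n x) = 0"
    and inj_dgamma: "\<And>n. n \<in> N \<Longrightarrow> inj (fd \<gamma> n)"
    and leaf_full: "\<And>n z. n \<in> N \<Longrightarrow> th (\<gamma> n) z = 0 \<Longrightarrow> \<exists>x. z = fd \<gamma> n x"
    and X: "\<And>y. smooth_on U (X y)" "\<And>y q. q \<in> U \<Longrightarrow> th q (X y q) = 0" "\<And>y n. n \<in> N \<Longrightarrow> X y (\<gamma> n) = fd \<gamma> n y"
    and k0: "k0 \<noteq> 0"
begin

definition \<phi> :: "real^2 \<Rightarrow> real^3" where "\<phi> n = (1 / k0) *\<^sub>R Y (\<gamma> n)"

lemma open_N: "open N" using smooth_gamma by (rule smooth_on_open)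

lemma gamma_V: "n \<in> N \<Longrightarrow> \<gamma> n \<in> V" and gamma_U': "n \<in> N \<Longrightarrow> \<gamma> n \<in> U" using gamma_U U_V by auto

lemma leaf_constant:
  fixes u :: "real^3 \<Rightarrow> 'b::euclidean_space"
  assumes u: "smooth_on V u" and z: "\<And>w x. w \<in> V \<Longrightarrow> th w x = 0 \<Longrightarrow> fd u w x = 0" and n: "n \<in> N" "n' \<in> N"
  shows "u (\<gamma> n) = u (\<gamma> n')"
proof (rule has_derivative_zero_unique[OF convex_N _ n, of "\<lambda>n. u (\<gamma> n)"])
  fix n assume n: "n \<in> N"
  have d: "\<gamma> differentiable (at n)" "u differentiable (at (\<gamma> n))"
    using smooth_on_differentiable[OF smooth_gamma n] smooth_on_differentiable[OF u gamma_V[OF n]] by auto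
  have "fd (\<lambda>n. u (\<gamma> n)) n = (\<lambda>x. 0)"
    using fd_compose[OF d] z[OF gamma_V[OF n] leaf[OF n]] by auto
  moreover have "(\<lambda>n. u (\<gamma> n)) differentiable (at n)" using differentiable_chain_at[OF d] by (simp add: o_def)
  ultimately have "((\<lambda>n. u (\<gamma> n)) has_derivative (\<lambda>x. 0)) (at n)" using fd_has by metis
  then show "((\<lambda>n. u (\<gamma> n)) has_derivative (\<lambda>x. 0)) (at n within N)" by (rule has_derivative_at_withinI)
qed

lemma smooth_phi: "smooth_on N \<phi>"
  unfolding \<phi>_def using smooth_on_compose[OF smooth_gamma smooth_Y] gamma_V
  by (intro smooth_on_scaleR smooth_on_const open_N) auto

lemma dphi:
  assumes n: "n \<in> N"
  shows "fd \<phi> n x = (1 / k0) *\<^sub>R Lam (fd f (\<gamma> n) (fd \<gamma> n x))"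
proof -
  have d: "\<gamma> differentiable (at n)" "Y differentiable (at (\<gamma> n))"
    using smooth_on_differentiable[OF smooth_gamma n] smooth_on_differentiable[OF smooth_Y gamma_V[OF n]] by auto
  have d': "(\<lambda>n. Y (\<gamma> n)) differentiable (at n)" using differentiable_chain_at[OF d] by (simp add: o_def)
  have "fd \<phi> n x = (1 / k0) *\<^sub>R fd (\<lambda>n. Y (\<gamma> n)) n x"
    unfolding \<phi>_def[abs_def] using d' by (simp add: fd_scaleR)
  then show ?thesis using fd_compose[OF d, of x] dY[OF gamma_V[OF n]] by simp
qed

lemma linear_dphi: "n \<in> N \<Longrightarrow> linear (fd \<phi> n)" using smooth_on_linear_fd[OF smooth_phi] .

lemma phi_zeta: "n \<in> N \<Longrightarrow> \<phi> n = - (1 / (nu (\<gamma> n) * k0)) *\<^sub>R Lam (zeta (\<gamma> n))"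
  using Y_zeta[OF gamma_V] nu_nz[OF gamma_V] by (simp add: \<phi>_def)

lemma phi_transversal:
  assumes n: "n \<in> N" and eq: "fd \<phi> n x + r *\<^sub>R \<phi> n = 0"
  shows "x = 0" "r = 0"
proof -
  note v = gamma_V[OF n]
  have "Lam (1 *\<^sub>R fd f (\<gamma> n) (fd \<gamma> n x) + (- r / nu (\<gamma> n)) *\<^sub>R zeta (\<gamma> n)) = k0 *\<^sub>R (fd \<phi> n x + r *\<^sub>R \<phi> n)"
    unfolding dphi[OF n] phi_zeta[OF n] using k0 by (simp add: Lam_simps vec_eq_iff field_simps)
  also have "\<dots> = 0" using eq by simp
  finally have z: "1 *\<^sub>R fd \<gamma> n x = 0" "- r / nu (\<gamma> n) = 0" using leaf_independent[OF v _ leaf[OF n]] by blast+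
  show "r = 0" using z(2) nu_nz[OF v] by simp
  have "fd \<gamma> n x = fd \<gamma> n 0" using z(1) linear_0[OF smooth_on_linear_fd[OF smooth_gamma n]] by simp
  then show "x = 0" using inj_dgamma[OF n] by (simp add: inj_eq)
qed

lemma phi_unique:
  assumes n: "n \<in> N" and eq: "fd \<phi> n x + r *\<^sub>R \<phi> n = fd \<phi> n x' + r' *\<^sub>R \<phi> n"
  shows "x = x'" "r = r'"
proof -
  have "fd \<phi> n (x - x') + (r - r') *\<^sub>R \<phi> n = 0"
    using eq by (simp add: linear_diff[OF linear_dphi[OF n]] algebra_simps)
  from phi_transversal[OF n this] show "x = x'" "r = r'" by auto
qed

text \<open>This is \<open>second_derivative_leaf\<close> under \<open>Lam\<close>, where
  \<open>zeta\<close> becomes \<open>- nu * k0\<close> times \<phi>. The coefficient of \<phi> makes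
  the metric of the leaf a constant multiple of \<open>h\<close>.\<close>

lemma second_derivative_phi:
  assumes n: "n \<in> N"
  obtains z where "fd (\<lambda>n. fd \<phi> n y) n x = fd \<phi> n z + (- nu (\<gamma> n) * h (\<gamma> n) (fd \<gamma> n x) (fd \<gamma> n y)) *\<^sub>R \<phi> n"
proof -
  note v = gamma_V[OF n] and u = gamma_U'[OF n]
  \<comment> \<open>\<open>X y\<close> extends the coordinate field of the leaf to an open set of
    the chart, where it can be differentiated.\<close>
  let ?Z = "\<lambda>q. fd f q (X y q)"
  obtain z where z: "th (\<gamma> n) z = 0"
    "fd ?Z (\<gamma> n) (fd \<gamma> n x) = fd f (\<gamma> n) z + h (\<gamma> n) (fd \<gamma> n x) (X y (\<gamma> n)) *\<^sub>R zeta (\<gamma> n)"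
    by (rule second_derivative_leaf[OF X(1) U_V u X(2) leaf[OF n]]) (assumption | rule that)+
  obtain z' where z': "z = fd \<gamma> n z'" using leaf_full[OF n z(1)] by blast
  have sZ: "smooth_on U ?Z"
    using smooth_on_subset[OF smooth_f smooth_on_open[OF X(1)] U_V] X(1) by (rule smooth_on_fd)
  have d: "\<gamma> differentiable (at n)" "?Z differentiable (at (\<gamma> n))"
    using smooth_on_differentiable[OF smooth_gamma n] smooth_on_differentiable[OF sZ u] by auto
  have l: "linear (\<lambda>v. (1 / k0) *\<^sub>R Lam v)" by (rule linearI) (simp_all add: Lam_simps scaleR_add_right)
  have d': "(\<lambda>n. ?Z (\<gamma> n)) differentiable (at n)" using differentiable_chain_at[OF d] by (simp add: o_def)
  have "fd (\<lambda>n. fd \<phi> n y) n x = fd (\<lambda>n. (1 / k0) *\<^sub>R Lam (?Z (\<gamma> n))) n x"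
  proof -
    have "(\<lambda>n. (1 / k0) *\<^sub>R Lam (?Z (\<gamma> n))) differentiable (at n)"
      using differentiable_chain_at[OF d' linear_imp_differentiable[OF l]] by (simp add: o_def)
    from fd_cong(1)[OF open_N n _ this, of "\<lambda>n. fd \<phi> n y"] show ?thesis by (simp add: dphi X(3))
  qed
  also have "\<dots> = (1 / k0) *\<^sub>R Lam (fd ?Z (\<gamma> n) (fd \<gamma> n x))"
    unfolding fd_linear_compose[OF l d'] fd_compose[OF d] ..
  also have "\<dots> = fd \<phi> n z' + (- nu (\<gamma> n) * h (\<gamma> n) (fd \<gamma> n x) (fd \<gamma> n y)) *\<^sub>R \<phi> n"
    unfolding z(2) z' dphi[OF n] phi_zeta[OF n] X(3)[OF n] using nu_nz[OF v] by (simp add: Lam_simps scaleR_add_right)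
  finally show ?thesis by (rule that)
qed

definition n1 :: "real^2" where "n1 = (SOME n. n \<in> N)"
definition \<nu>1 :: real where "\<nu>1 = nu (\<gamma> n1)"
text \<open>The factor between \<open>W\<close> and \<open>W0\<close>, unique as \<open>W0\<close>
  is nonzero, and the same on the whole leaf because \<open>W\<close> is constant there.\<close>

definition k1 :: real where "k1 = (SOME k. k > 0 \<and> W (\<gamma> n1) = k *\<^sub>R W0)"

text \<open>The normalization of the volume by the affine normal forces \<open>c\<^sup>2\<close>.\<close>

definition c :: real where "c = sgn (\<omega>0 \<bullet> W0) * sqrt (\<bar>k0\<bar> ^ 3 * \<bar>\<nu>1\<bar> * k1 * \<bar>det L\<bar>)"

lemma n1: "n1 \<in> N" unfolding n1_def using N_ne some_in_eq by blast

lemma nu_leaf: "n \<in> N \<Longrightarrow> nu (\<gamma> n) = \<nu>1"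
  unfolding \<nu>1_def by (rule leaf_constant[OF smooth_invariants(6) _ _ n1]) (simp_all add: invariant_derivatives)

lemma k1: "k1 > 0" "n \<in> N \<Longrightarrow> W (\<gamma> n) = k1 *\<^sub>R W0"
proof -
  have *: "k1 > 0 \<and> W (\<gamma> n1) = k1 *\<^sub>R W0"
    unfolding k1_def by (rule someI_ex) (rule W0[OF gamma_V[OF n1]])
  then show "k1 > 0" by blast
  assume n: "n \<in> N"
  have "W (\<gamma> n) = W (\<gamma> n1)" by (rule leaf_constant[OF smooth_W _ n n1]) (simp add: dW)
  then show "W (\<gamma> n) = k1 *\<^sub>R W0" using * by simp
qed

text \<open>\<open>c\<close> is given the sign of \<open>\<omega>0 \<bullet> W0\<close>, which is
  that of \<open>nu\<close>; the quotient is then positive and so is the metric of \<phi>.\<close>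

lemma c_sign: "c * (\<omega>0 \<bullet> W0) > 0" "\<nu>1 / c > 0" "c\<^sup>2 = \<bar>k0\<bar> ^ 3 * \<bar>\<nu>1\<bar> * k1 * \<bar>det L\<bar>"
proof -
  have nu1: "\<nu>1 * (\<omega>0 \<bullet> W0) > 0" using nu_sign[OF gamma_V[OF n1]] by (simp add: \<nu>1_def)
  then have "\<nu>1 \<noteq> 0" by auto
  moreover have "det L \<noteq> 0" using invertible_L by (simp add: invertible_det_nz)
  ultimately have p: "\<bar>k0\<bar> ^ 3 * \<bar>\<nu>1\<bar> * k1 * \<bar>det L\<bar> > 0" using k0 k1(1) by simp
  then show "c\<^sup>2 = \<bar>k0\<bar> ^ 3 * \<bar>\<nu>1\<bar> * k1 * \<bar>det L\<bar>"
    unfolding c_def power_mult_distrib using nz by (simp add: sgn_if power2_eq_square)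
  show c: "c * (\<omega>0 \<bullet> W0) > 0" unfolding c_def using p nz by (auto simp: sgn_if zero_less_mult_iff mult_less_0_iff)
  show "\<nu>1 / c > 0" using nu1 c by (auto simp: zero_less_mult_iff zero_less_divide_iff)
qed

lemma metric_phi:
  assumes n: "n \<in> N"
  shows "affine_metric \<phi> (\<lambda>y. (- c) *\<^sub>R \<phi> y) n x y = (\<nu>1 / c) * h (\<gamma> n) (fd \<gamma> n x) (fd \<gamma> n y)"
proof -
  have c: "c \<noteq> 0" using c_sign(1) by auto
  obtain z where z: "fd (\<lambda>n. fd \<phi> n y) n x = fd \<phi> n z + (- nu (\<gamma> n) * h (\<gamma> n) (fd \<gamma> n x) (fd \<gamma> n y)) *\<^sub>R \<phi> n"
    by (rule second_derivative_phi[OF n])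
  have "(\<exists>z'. fd (\<lambda>n. fd \<phi> n y) n x = fd \<phi> n z' + r *\<^sub>R ((- c) *\<^sub>R \<phi> n)) \<longleftrightarrow>
      r = (\<nu>1 / c) * h (\<gamma> n) (fd \<gamma> n x) (fd \<gamma> n y)" (is "?l \<longleftrightarrow> ?r") for r
  proof
    assume ?l
    then obtain z' where "fd \<phi> n z + (- nu (\<gamma> n) * h (\<gamma> n) (fd \<gamma> n x) (fd \<gamma> n y)) *\<^sub>R \<phi> n = fd \<phi> n z' + (r * - c) *\<^sub>R \<phi> n"
      unfolding z by auto
    from phi_unique(2)[OF n this] show ?r using c nu_leaf[OF n] by (simp add: field_simps)
  next
    assume ?r
    then show ?l unfolding z by (intro exI[of _ z]) (use c nu_leaf[OF n] in simp)
  qed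
  then show ?thesis unfolding affine_metric_def flat_derivative_def by simp
qed

lemma posdef_phi:
  assumes n: "n \<in> N"
  shows "positive_definite (affine_metric \<phi> (\<lambda>y. (- c) *\<^sub>R \<phi> y) n)"
  unfolding positive_definite_def metric_phi[OF n]
proof (intro allI impI)
  fix x :: "real^2" assume "x \<noteq> 0"
  then have "fd \<gamma> n x \<noteq> 0"
    using inj_dgamma[OF n] linear_injective_0[OF smooth_on_linear_fd[OF smooth_gamma n]] by blast
  then show "\<nu>1 / c * h (\<gamma> n) (fd \<gamma> n x) (fd \<gamma> n x) > 0"
    using spd_pos[OF spd_h[OF gamma_V[OF n]]] c_sign(2) by (intro mult_pos_pos) auto
qed

text \<open>An orthonormal frame of the leaf, rescaled by \<open>s\<close> and completed by
  \<open>e 1\<close>, is orthonormal for \<open>h\<close>; the unit volume of the hypersurface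
  passes to the leaf through \<open>det_leaf\<close>.\<close>

lemma blaschke_phi: "blaschke_surface N \<phi> (\<lambda>y. (- c) *\<^sub>R \<phi> y)"
proof -
  have c: "c \<noteq> 0" using c_sign(1) by auto
  have dx: "fd (\<lambda>y. (- c) *\<^sub>R \<phi> y) n x = fd \<phi> n ((- c) *\<^sub>R x)" if n: "n \<in> N" for n x
    using smooth_on_differentiable[OF smooth_phi n] linear_scale[OF linear_dphi[OF n]]
    by (simp add: fd_scaleR linear_neg[OF linear_dphi[OF n]] fd_minus)
  have "equiaffine_hypersurface N \<phi> (\<lambda>y. (- c) *\<^sub>R \<phi> y)"
    unfolding equiaffine_hypersurface_def
  proof (intro conjI ballI allI impI)
    show "smooth_on N \<phi>" by (rule smooth_phi)
    show "smooth_on N (\<lambda>y. (- c) *\<^sub>R \<phi> y)" by (intro smooth_on_scaleR smooth_on_const open_N smooth_phi)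
    fix n assume n: "n \<in> N"
    show "inj (fd \<phi> n)"
      using linear_injective_0[OF linear_dphi[OF n]] phi_transversal(1)[OF n, of _ 0] by auto
    show "(- c) *\<^sub>R \<phi> n \<notin> range (fd \<phi> n)"
    proof
      assume "(- c) *\<^sub>R \<phi> n \<in> range (fd \<phi> n)"
      then obtain x where "(- c) *\<^sub>R \<phi> n = fd \<phi> n x" by blast
      then have "fd \<phi> n x + c *\<^sub>R \<phi> n = 0" by (metis add.left_inverse scaleR_minus_left)
      from phi_transversal(2)[OF n this] show False using c by simp
    qed
    show "range (fd (\<lambda>y. (- c) *\<^sub>R \<phi> y) n) \<subseteq> range (fd \<phi> n)" using dx[OF n] by auto
    fix x :: "real^2" assume "x \<noteq> 0"
    then show "\<exists>y. affine_metric \<phi> (\<lambda>y. (- c) *\<^sub>R \<phi> y) n x y \<noteq> 0"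
      using posdef_phi[OF n] unfolding positive_definite_def by (metis less_irrefl)
  qed
  moreover have "\<bar>det (vector [fd \<phi> n (X 1), fd \<phi> n (X 2), (- c) *\<^sub>R \<phi> n] :: real^3^3)\<bar> = 1"
    if n: "n \<in> N" and o: "orthonormal (affine_metric \<phi> (\<lambda>y. (- c) *\<^sub>R \<phi> y) n) X" for n and X :: "2 \<Rightarrow> real^2"
  proof -
    note v = gamma_V[OF n]
    note g = spd_h[OF v]
    \<comment> \<open>The metrics of \<phi> and of the hypersurface differ by the factor
      \<open>\<nu>1 / c\<close>, so lengths differ by its root.\<close>
    define s where "s = sqrt (\<nu>1 / c)"
    have s2: "s * s = \<nu>1 / c"
      unfolding s_def power2_eq_square[symmetric] using c_sign(2) by (intro real_sqrt_pow2 less_imp_le)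
    define Z where "Z i = fd \<gamma> n (X i)" for i
    \<comment> \<open>\<open>orthonormal\<close> provides absolute values only; positive
      definiteness removes them.\<close>
    have oZ: "\<nu>1 / c * h (\<gamma> n) (Z i) (Z i) = 1" "i \<noteq> j \<Longrightarrow> h (\<gamma> n) (Z i) (Z j) = 0" for i j
    proof -
      have "\<bar>\<nu>1 / c * h (\<gamma> n) (Z i) (Z j)\<bar> = (if i = j then 1 else 0)" for i j
        using o unfolding orthonormal_def metric_phi[OF n] Z_def by blast
      from this[of i i] this[of i j] have *: "\<bar>\<nu>1 / c * h (\<gamma> n) (Z i) (Z i)\<bar> = 1"
        "i \<noteq> j \<Longrightarrow> h (\<gamma> n) (Z i) (Z j) = 0" using c_sign(2) by auto
      have "h (\<gamma> n) (Z i) (Z i) \<ge> 0"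
        using spd_pos[OF g, of "Z i"] spd_simps(9)[OF g, of 0] by (cases "Z i = 0") auto
      then have "\<nu>1 / c * h (\<gamma> n) (Z i) (Z i) \<ge> 0" using c_sign(2) by (intro mult_nonneg_nonneg) auto
      then show "\<nu>1 / c * h (\<gamma> n) (Z i) (Z i) = 1" "i \<noteq> j \<Longrightarrow> h (\<gamma> n) (Z i) (Z j) = 0"
        using * by linarith+
    qed
    have thZ: "h (\<gamma> n) (e 1 (\<gamma> n)) (Z i) = 0" for i using leaf[OF n] by (simp add: Z_def th_def)
    define q where "q i = (if i = 1 then e 1 (\<gamma> n) else if i = 2 then s *\<^sub>R Z 1 else s *\<^sub>R Z 2)" for i :: 3
    interpret P: cubic_data "h (\<gamma> n)" "K (\<gamma> n)" "S (\<gamma> n)" by (rule cubic[OF v])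
    have oz: "s * (s * h (\<gamma> n) (Z i) (Z i)) = 1" for i unfolding mult.assoc[symmetric] s2 by (rule oZ(1))
    have "onb (h (\<gamma> n)) q" unfolding q_def[abs_def]
      by (rule P.onbI3) (simp_all add: spd_simps[OF g] h_e[OF v] thZ oZ(2) oz)
    then have "orthonormal (h (\<gamma> n)) q" using orthonormal_iff_onb[OF g] by simp
    then have "\<bar>det (vector [fd f (\<gamma> n) (q 1), fd f (\<gamma> n) (q 2), fd f (\<gamma> n) (q 3), \<xi> (\<gamma> n)] :: real^4^4)\<bar> = 1"
      using blaschke v unfolding blaschke_hypersurface_def by blast
    then have sdet: "\<bar>s\<^sup>2 * det (vector [E 1 (\<gamma> n), fd f (\<gamma> n) (Z 1), fd f (\<gamma> n) (Z 2), \<xi> (\<gamma> n)] :: real^4^4)\<bar> = 1"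
      by (simp add: q_def linear_scale[OF linear_df[OF v]] det4_operations(3) E_def)
    then have d4: "\<nu>1 / c * \<bar>det (vector [E 1 (\<gamma> n), fd f (\<gamma> n) (Z 1), fd f (\<gamma> n) (Z 2), \<xi> (\<gamma> n)] :: real^4^4)\<bar> = 1"
    proof -
      have "\<bar>s\<^sup>2\<bar> = \<nu>1 / c" unfolding power2_eq_square s2 using c_sign(2) by (rule abs_of_pos)
      then show ?thesis using sdet by (simp only: abs_mult)
    qed
    define D where "D = det (vector [Lam (fd f (\<gamma> n) (Z 1)), Lam (fd f (\<gamma> n) (Z 2)), Lam (zeta (\<gamma> n))] :: real^3^3)"
    have "\<nu>1 * det (vector [E 1 (\<gamma> n), fd f (\<gamma> n) (Z 1), fd f (\<gamma> n) (Z 2), \<xi> (\<gamma> n)] :: real^4^4) = k1 * det L * D"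
      unfolding D_def nu_leaf[OF n, symmetric] by (rule det_leaf[OF v k1(2)[OF n]])
    from arg_cong[OF this, of abs] have "\<bar>\<nu>1\<bar> * \<bar>det (vector [E 1 (\<gamma> n), fd f (\<gamma> n) (Z 1), fd f (\<gamma> n) (Z 2), \<xi> (\<gamma> n)] :: real^4^4)\<bar> = k1 * \<bar>det L\<bar> * \<bar>D\<bar>"
      by (simp only: abs_mult abs_of_pos[OF k1(1)])
    moreover have nuc: "\<bar>\<nu>1\<bar> = \<bar>c\<bar> * (\<nu>1 / c)" using c_sign(2) c by (auto simp: zero_less_divide_iff abs_if)
    ultimately have "\<bar>c\<bar> * (\<nu>1 / c * \<bar>det (vector [E 1 (\<gamma> n), fd f (\<gamma> n) (Z 1), fd f (\<gamma> n) (Z 2), \<xi> (\<gamma> n)] :: real^4^4)\<bar>) = k1 * \<bar>det L\<bar> * \<bar>D\<bar>"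
      by (simp only: mult.assoc)
    then have D: "\<bar>c\<bar> = k1 * \<bar>det L\<bar> * \<bar>D\<bar>" unfolding d4 by simp
    have "det (vector [fd \<phi> n (X 1), fd \<phi> n (X 2), (- c) *\<^sub>R \<phi> n] :: real^3^3) = (1 / k0)\<^sup>2 * (c / (\<nu>1 * k0)) * D"
      unfolding dphi[OF n] phi_zeta[OF n] nu_leaf[OF n] D_def Z_def
      using det3_scale[of "1 / k0" _ _ "c / (\<nu>1 * k0)"] by simp
    then have "\<bar>det (vector [fd \<phi> n (X 1), fd \<phi> n (X 2), (- c) *\<^sub>R \<phi> n] :: real^3^3)\<bar> = \<bar>c\<bar> * \<bar>D\<bar> / (\<bar>\<nu>1\<bar> * \<bar>k0\<bar> ^ 3)"
      by (simp add: abs_mult power2_eq_square power3_eq_cube)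
    also have "\<dots> = 1"
    proof -
      \<comment> \<open>Multiplying \<open>D\<close> by the absolute value of \<open>c\<close>
        brings in the prescribed value of \<open>c\<^sup>2\<close>.\<close>
      have "\<bar>c\<bar> * (k1 * \<bar>det L\<bar> * \<bar>D\<bar>) = \<bar>k0\<bar> ^ 3 * \<bar>\<nu>1\<bar> * k1 * \<bar>det L\<bar>"
        unfolding D[symmetric] using c_sign(3) by (simp add: power2_eq_square)
      moreover have "det L \<noteq> 0" using invertible_L by (simp add: invertible_det_nz)
      ultimately have "\<bar>c\<bar> * \<bar>D\<bar> = \<bar>\<nu>1\<bar> * \<bar>k0\<bar> ^ 3" using k1(1) by (simp add: field_simps)
      then show ?thesis using k0 c_sign(2) by auto
    qed
    finally show ?thesis .
  qed
  ultimately show ?thesis unfolding blaschke_surface_def by blast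
qed

lemma affine_sphere:
  "\<omega>0 \<bullet> W0 > 0 \<Longrightarrow> elliptic_affine_sphere N \<phi>"
  "\<omega>0 \<bullet> W0 < 0 \<Longrightarrow> hyperbolic_affine_sphere N \<phi>"
  using blaschke_phi posdef_phi c_sign(1) unfolding elliptic_affine_sphere_def hyperbolic_affine_sphere_def
  by (auto simp: zero_less_mult_iff intro!: exI[of _ c])

end

section \<open>Quadrics\<close>

context adapted_hypersurface
begin

text \<open>With vanishing cubic part, \<open>E 2\<close>, \<open>E 3\<close> and
  \<open>zeta\<close> satisfy a closed linear system along the leaf: a rotation by \<open>s\<close>
  in the leaf plane and an exchange with \<open>zeta\<close>. Systems of this shape preserve a
  quadratic tensor.\<close>

lemma leaf_frame_derivatives:
  assumes w: "w \<in> V" and C0: "C 2 2 2 w = 0" "C 2 2 3 w = 0" and x: "th w x = 0"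
  obtains s where "fd (E 2) w x = h w x (e 2 w) *\<^sub>R zeta w + s *\<^sub>R E 3 w" "fd (E 3) w x = h w x (e 3 w) *\<^sub>R zeta w - s *\<^sub>R E 2 w"
    "fd zeta w x = - nu w *\<^sub>R (h w x (e 2 w) *\<^sub>R E 2 w + h w x (e 3 w) *\<^sub>R E 3 w)"
proof -
  have x1: "h w x (e 1 w) = 0" using x spd_sym[OF spd_h[OF w]] by (simp add: th_def)
  note d = invariants_differentiable(7)[OF w]
  have "fd (E 2) w x = h w x (e 2 w) *\<^sub>R zeta w + (h w x (e 2 w) * A 2 2 3 w + h w x (e 3 w) * A 3 2 3 w) *\<^sub>R E 3 w"
    unfolding fd_frame_expand[OF w d, of 2 x] dE[OF w] sum_3 A_values[OF w] axis_connection[OF w] x1 C0 zeta_def al_def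
    by (simp add: algebra_simps)
  moreover have "fd (E 3) w x = h w x (e 3 w) *\<^sub>R zeta w - (h w x (e 2 w) * A 2 2 3 w + h w x (e 3 w) * A 3 2 3 w) *\<^sub>R E 2 w"
    unfolding fd_frame_expand[OF w d, of 3 x] dE[OF w] sum_3 A_values[OF w] axis_connection[OF w] x1 C0 zeta_def al_def
    by (simp add: algebra_simps)
  moreover have "fd zeta w x = - nu w *\<^sub>R (h w x (e 2 w) *\<^sub>R E 2 w + h w x (e 3 w) *\<^sub>R E 3 w)"
    unfolding dzeta[OF w] x using df_expand[OF w, of x] by (simp add: sum_3 x1)
  ultimately show ?thesis by (rule that)
qed

end

text \<open>With \<open>D = diag (1, 1, 1 / \<nu>)\<close> the hypothesis reads
  \<open>Z D Z\<^sup>t = Z0 D Z0\<^sup>t\<close>, so \<open>Q = Z0\<^sup>-\<^sup>1 Z\<close>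
  satisfies \<open>Q D Q\<^sup>t = D\<close>. Then \<open>Q\<^sup>t\<close> preserves the inverse of
  \<open>D\<close> in the same way, and the last diagonal entry of that relation is the quadric
  equation for the third column of \<open>Q\<close>.\<close>

lemma congruent_diagonal_column:
  fixes Z Z0 :: "real^3^3"
  assumes inv: "invertible Z0" and n: "\<nu> \<noteq> 0"
    and eq: "\<And>p r. Z$p$1 * Z$r$1 + Z$p$2 * Z$r$2 + Z$p$3 * Z$r$3 / \<nu> = Z0$p$1 * Z0$r$1 + Z0$p$2 * Z0$r$2 + Z0$p$3 * Z0$r$3 / \<nu>"
  obtains u where "Z *v axis 3 1 = Z0 *v u" "(u$1)\<^sup>2 + (u$2)\<^sup>2 + \<nu> * (u$3)\<^sup>2 = \<nu>"
proof -
  define D :: "real^3^3" where "D = (\<chi> i j. if i = j then (if i = 3 then 1 / \<nu> else 1) else 0)"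
  define D' :: "real^3^3" where "D' = (\<chi> i j. if i = j then (if i = 3 then \<nu> else 1) else 0)"
  have DD: "D ** D' = mat 1" "D' ** D = mat 1"
    using n by (auto simp: D_def D'_def matrix_matrix_mult_def mat_def vec_eq_iff forall_3 sum_3)
  have "Z ** D ** transpose Z = Z0 ** D ** transpose Z0"
    using eq by (simp add: vec_eq_iff matrix_matrix_mult_def transpose_def D_def sum_3)
  moreover define Zi where "Zi = matrix_inv Z0"
  have Zi: "Zi ** Z0 = mat 1" "Z0 ** Zi = mat 1" using matrix_inv_mult[OF inv] by (auto simp: Zi_def)
  define Q where "Q = Zi ** Z"
  have ZQ: "Z = Z0 ** Q" unfolding Q_def matrix_mul_assoc Zi by simp
  ultimately have "Z0 ** (Q ** D ** transpose Q) ** transpose Z0 = Z0 ** D ** transpose Z0"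
    by (simp add: matrix_transpose_mul matrix_mul_assoc)
  moreover have cancel: "Zi ** (Z0 ** X ** transpose Z0) ** transpose Zi = X" for X
  proof -
    have "Zi ** (Z0 ** X ** transpose Z0) ** transpose Zi = (Zi ** Z0) ** X ** (transpose Z0 ** transpose Zi)"
      by (simp only: matrix_mul_assoc)
    also have "transpose Z0 ** transpose Zi = transpose (Zi ** Z0)" by (rule matrix_transpose_mul[symmetric])
    finally show ?thesis by (simp add: Zi transpose_mat)
  qed
  ultimately have QD: "Q ** D ** transpose Q = D" by metis
  have "Q ** (D ** transpose Q ** D') = (Q ** D ** transpose Q) ** D'" by (simp only: matrix_mul_assoc)
  also have "\<dots> = mat 1" unfolding QD by (rule DD)
  finally have "Q ** (D ** transpose Q ** D') = mat 1" .
  \<comment> \<open>A right inverse of a square matrix is a left inverse; this moves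
    \<open>Q\<close> to the other side.\<close>
  then have "(D ** transpose Q ** D') ** Q = mat 1" by (simp add: matrix_left_right_inverse)
  then have "((D ** transpose Q ** D') ** Q) $ 3 $ 3 = 1" by (simp add: mat_def)
  then have q: "(Q$1$3)\<^sup>2 + (Q$2$3)\<^sup>2 + \<nu> * (Q$3$3)\<^sup>2 = \<nu>"
    using n by (simp add: matrix_matrix_mult_def D_def D'_def transpose_def sum_3 power2_eq_square field_simps)
  have "Z *v axis 3 1 = Z0 *v (Q *v axis 3 1)" unfolding ZQ by (simp add: matrix_vector_mul_assoc)
  moreover have "(Q *v axis 3 1) $ i = Q $ i $ 3" for i by (simp add: matrix_vector_mult_def axis_def sum_3)
  ultimately show ?thesis using that[of "Q *v axis 3 1"] q by simp
qed

context warped_leaf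
begin

lemma quadric:
  assumes C0: "\<And>w. w \<in> V \<Longrightarrow> C 2 2 2 w = 0 \<and> C 2 2 3 w = 0"
  shows "\<omega>0 \<bullet> W0 > 0 \<Longrightarrow> \<exists>Q. is_ellipsoid Q \<and> \<phi> ` N \<subseteq> Q" "\<omega>0 \<bullet> W0 < 0 \<Longrightarrow> \<exists>Q. is_hyperboloid Q \<and> \<phi> ` N \<subseteq> Q"
proof -
  define Z :: "real^3 \<Rightarrow> real^3^3" where "Z w = (\<chi> p i. (if i = 1 then Lam (E 2 w) else if i = 2 then Lam (E 3 w) else Lam (zeta w)) $ p)" for w
  have Zs: "Z w $ p $ 1 = Lam (E 2 w) $ p" "Z w $ p $ 2 = Lam (E 3 w) $ p" "Z w $ p $ 3 = Lam (zeta w) $ p" for w p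
    by (simp_all add: Z_def)
  define Q where "Q p r w = Z w$p$1 * Z w$r$1 + Z w$p$2 * Z w$r$2 + Z w$p$3 * Z w$r$3 / nu w" for p r w
  have sL: "smooth_on V (\<lambda>w. Lam (u w) $ p)" if "smooth_on V u" for u p
    by (intro smooth_on_vec_nth smooth_on_linear_compose[OF that linear_Lam])
  have sQ: "smooth_on V (Q p r)" for p r
    unfolding Q_def Zs by (intro smooth_on_add smooth_on_mult smooth_on_divide sL smooth_E smooth_zeta smooth_invariants nu_nz)
  have dQ: "fd (Q p r) w x = 0" if w: "w \<in> V" and x: "th w x = 0" for p r w x
  proof -
    obtain s where s: "fd (E 2) w x = h w x (e 2 w) *\<^sub>R zeta w + s *\<^sub>R E 3 w" "fd (E 3) w x = h w x (e 3 w) *\<^sub>R zeta w - s *\<^sub>R E 2 w"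
      "fd zeta w x = - nu w *\<^sub>R (h w x (e 2 w) *\<^sub>R E 2 w + h w x (e 3 w) *\<^sub>R E 3 w)"
      using leaf_frame_derivatives[OF w _ _ x] C0[OF w] by blast
    have dL: "(\<lambda>w. Lam (u w) $ p) differentiable (at w)" "fd (\<lambda>w. Lam (u w) $ p) w x = Lam (fd u w x) $ p" if "smooth_on V u" for u p
    proof -
      show "(\<lambda>w. Lam (u w) $ p) differentiable (at w)" by (rule smooth_on_differentiable[OF sL[OF that] w])
      have "linear (\<lambda>v. Lam v $ p)" by (rule linearI) (simp_all add: Lam_simps)
      from fd_linear_compose[OF this smooth_on_differentiable[OF that w]]
      show "fd (\<lambda>w. Lam (u w) $ p) w x = Lam (fd u w x) $ p" .
    qed
    note d = dL[OF smooth_E] dL[OF smooth_zeta]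
    define iv where "iv q = 1 / nu q" for q
    have dn: "iv differentiable (at w)" "fd iv w x = 0"
    proof -
      have i: "((\<lambda>q. 1 / nu q) has_derivative (\<lambda>x. - (fd nu w x / (nu w * nu w)))) (at w)"
        using has_derivative_divide'[OF has_derivative_const fd_has[OF invariants_differentiable(6)[OF w]] nu_nz[OF w], of 1] by simp
      then show "iv differentiable (at w)" "fd iv w x = 0"
        unfolding iv_def[abs_def] by (auto simp: differentiable_def fd_eq invariant_derivatives[OF w] x)
    qed
    have "Q p r = (\<lambda>w. Lam (E 2 w)$p * Lam (E 2 w)$r + Lam (E 3 w)$p * Lam (E 3 w)$r + Lam (zeta w)$p * Lam (zeta w)$r * iv w)"
      by (simp add: Q_def[abs_def] Zs iv_def)
    then have "fd (Q p r) w x = Lam (fd (E 2) w x)$p * Lam (E 2 w)$r + Lam (E 2 w)$p * Lam (fd (E 2) w x)$r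
       + (Lam (fd (E 3) w x)$p * Lam (E 3 w)$r + Lam (E 3 w)$p * Lam (fd (E 3) w x)$r)
       + (Lam (fd zeta w x)$p * Lam (zeta w)$r + Lam (zeta w)$p * Lam (fd zeta w x)$r) * iv w"
      using d dn by (simp add: fd_add fd_mult)
    also have "\<dots> = 0"
      unfolding s iv_def using nu_nz[OF w] by (simp add: Lam_simps field_simps)
    finally show ?thesis .
  qed
  have Qc: "Q p r (\<gamma> n) = Q p r (\<gamma> n1)" if "n \<in> N" for p r n
    by (rule leaf_constant[OF sQ dQ that n1])
  have nu1: "\<nu>1 \<noteq> 0" using nu_nz[OF gamma_V[OF n1]] by (simp add: \<nu>1_def)
  have inv: "invertible (Z (\<gamma> n1))"
  proof -
    note v = gamma_V[OF n1]
    have "u = 0" if u: "Z (\<gamma> n1) *v u = 0" for u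
    proof -
      have thx: "th (\<gamma> n1) (u$1 *\<^sub>R e 2 (\<gamma> n1) + u$2 *\<^sub>R e 3 (\<gamma> n1)) = 0"
        using h_e[OF v] by (simp add: th_def spd_simps[OF spd_h[OF v]])
      have "Lam (1 *\<^sub>R fd f (\<gamma> n1) (u$1 *\<^sub>R e 2 (\<gamma> n1) + u$2 *\<^sub>R e 3 (\<gamma> n1)) + u$3 *\<^sub>R zeta (\<gamma> n1)) = Z (\<gamma> n1) *v u"
        by (simp add: vec_eq_iff matrix_vector_mult_def sum_3 Zs Lam_simps E_def linear_add[OF linear_df[OF v]] linear_scale[OF linear_df[OF v]] mult.commute)
      then have z: "1 *\<^sub>R (u$1 *\<^sub>R e 2 (\<gamma> n1) + u$2 *\<^sub>R e 3 (\<gamma> n1)) = 0" "u$3 = 0"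
        using leaf_independent[OF v _ thx] u by metis+
      from arg_cong[OF z(1), of "\<lambda>x. h (\<gamma> n1) x (e 2 (\<gamma> n1))"] arg_cong[OF z(1), of "\<lambda>x. h (\<gamma> n1) x (e 3 (\<gamma> n1))"]
      show "u = 0" using z(2) h_e[OF v] by (simp add: vec_eq_iff forall_3 spd_simps[OF spd_h[OF v]])
    qed
    then show ?thesis by (simp add: invertible_left_inverse matrix_left_invertible_ker)
  qed
  define r where "r = sqrt \<bar>\<nu>1\<bar>"
  have r: "r > 0" "r\<^sup>2 = \<bar>\<nu>1\<bar>" using nu1 by (simp_all add: r_def)
  \<comment> \<open>Rescaling the first two coordinates by \<open>r\<close> turns
    \<open>u1^2 + u2^2 + \<nu>1 u3^2 = \<nu>1\<close> into the unit sphere or the two-sheeted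
    hyperboloid, according to the sign of \<open>\<nu>1\<close>. The factor in \<open>B\<close> is
    the one of \<open>phi_zeta\<close>.\<close>
  define R :: "real^3^3" where "R = (\<chi> i j. if i = j then (if i = 3 then 1 else r) else 0)"
  define B where "B = (- 1 / (\<nu>1 * k0)) *\<^sub>R (Z (\<gamma> n1) ** R)"
  have "det R = r * r" by (simp add: R_def det_3)
  then have "invertible R" using r(1) by (simp add: invertible_det_nz)
  then have "invertible (Z (\<gamma> n1) ** R)" using inv by (simp add: invertible_mult)
  then have iB: "invertible B"
    unfolding B_def using nu1 k0 by (intro scalar_invertible) auto
  have pt: "\<exists>s. \<phi> n = B *v s + 0 \<and> \<bar>\<nu>1\<bar> * ((s$1)\<^sup>2 + (s$2)\<^sup>2) + \<nu>1 * (s$3)\<^sup>2 = \<nu>1" if n: "n \<in> N" for n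
  proof -
    have "Q p q (\<gamma> n) = Q p q (\<gamma> n1)" for p q by (rule Qc[OF n])
    then obtain u where u: "Z (\<gamma> n) *v axis 3 1 = Z (\<gamma> n1) *v u" "(u$1)\<^sup>2 + (u$2)\<^sup>2 + \<nu>1 * (u$3)\<^sup>2 = \<nu>1"
      using congruent_diagonal_column[OF inv nu1, of "Z (\<gamma> n)"] unfolding Q_def nu_leaf[OF n] nu_leaf[OF n1] by metis
    define s :: "real^3" where "s = vector [u$1 / r, u$2 / r, u$3]"
    have "R *v s = u" using r(1) by (simp add: s_def R_def vec_eq_iff forall_3 matrix_vector_mult_def sum_3 vector_3)
    moreover have "Lam (zeta (\<gamma> n)) = Z (\<gamma> n) *v axis 3 1"
      by (simp add: vec_eq_iff matrix_vector_mult_def axis_def sum_3 Zs)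
    moreover have "B *v s = (- 1 / (\<nu>1 * k0)) *\<^sub>R (Z (\<gamma> n1) *v (R *v s))"
      unfolding B_def matrix_vector_mul_assoc by (rule scaleR_matrix_vector_assoc[symmetric])
    ultimately have "\<phi> n = B *v s"
      unfolding phi_zeta[OF n] nu_leaf[OF n] using u(1) by simp
    moreover have "\<bar>\<nu>1\<bar> * ((s$1)\<^sup>2 + (s$2)\<^sup>2) = (u$1)\<^sup>2 + (u$2)\<^sup>2"
      unfolding r(2)[symmetric] using r(1) by (simp add: s_def vector_3 power_divide distrib_left)
    moreover have "s $ 3 = u $ 3" by (simp add: s_def vector_3)
    ultimately show ?thesis using u(2) by (intro exI[of _ s]) simp
  qed
  have sg: "\<nu>1 * (\<omega>0 \<bullet> W0) > 0" using nu_sign[OF gamma_V[OF n1]] by (simp add: \<nu>1_def)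
  show "\<exists>Q. is_ellipsoid Q \<and> \<phi> ` N \<subseteq> Q" if "\<omega>0 \<bullet> W0 > 0"
  proof -
    have p: "\<nu>1 > 0" using sg that by (simp add: zero_less_mult_iff)
    have "\<phi> n \<in> (\<lambda>x. B *v x + 0) ` sphere 0 1" if n: "n \<in> N" for n
    proof -
      obtain s where s: "\<phi> n = B *v s + 0" "\<bar>\<nu>1\<bar> * ((s$1)\<^sup>2 + (s$2)\<^sup>2) + \<nu>1 * (s$3)\<^sup>2 = \<nu>1" using pt[OF n] by blast
      then have "\<nu>1 * ((s$1)\<^sup>2 + (s$2)\<^sup>2 + (s$3)\<^sup>2) = \<nu>1 * 1" using p by (simp add: distrib_left)
      then have "(s$1)\<^sup>2 + (s$2)\<^sup>2 + (s$3)\<^sup>2 = 1" using p by (simp only: mult_cancel_left) simp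
      then have "norm s = 1" by (simp add: norm_vec_def L2_set_def sum_3)
      then show ?thesis using s(1) by auto
    qed
    then show ?thesis unfolding is_ellipsoid_def using iB by blast
  qed
  show "\<exists>Q. is_hyperboloid Q \<and> \<phi> ` N \<subseteq> Q" if "\<omega>0 \<bullet> W0 < 0"
  proof -
    have p: "\<nu>1 < 0" using sg that by (simp add: zero_less_mult_iff)
    have "\<phi> n \<in> (\<lambda>x. B *v x + 0) ` {x. (x $ 1)\<^sup>2 + (x $ 2)\<^sup>2 - (x $ 3)\<^sup>2 = - 1}" if n: "n \<in> N" for n
    proof -
      obtain s where s: "\<phi> n = B *v s + 0" "\<bar>\<nu>1\<bar> * ((s$1)\<^sup>2 + (s$2)\<^sup>2) + \<nu>1 * (s$3)\<^sup>2 = \<nu>1" using pt[OF n] by blast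
      then have "\<nu>1 * ((s$1)\<^sup>2 + (s$2)\<^sup>2 - (s$3)\<^sup>2) = \<nu>1 * - 1" using p by (simp add: algebra_simps)
      then have "(s$1)\<^sup>2 + (s$2)\<^sup>2 - (s$3)\<^sup>2 = - 1" using p by (simp only: mult_cancel_left) simp
      then show ?thesis using s(1) by auto
    qed
    then show ?thesis unfolding is_hyperboloid_def using iB by blast
  qed
qed

end

section \<open>Coordinates adapted to the leaves\<close>

lemma fd_divide:
  fixes u v :: "'a::euclidean_space \<Rightarrow> real"
  assumes "u differentiable (at w)" "v differentiable (at w)" "v w \<noteq> 0"
  shows "fd (\<lambda>q. u q / v q) w x = (fd u w x * v w - u w * fd v w x) / (v w * v w)"
  by (subst fd_eq[OF has_derivative_divide'[OF fd_has fd_has]]) (use assms in auto)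

lemma fd_vec_nth: "u differentiable (at w) \<Longrightarrow> fd (\<lambda>q. u q $ m :: real) w x = fd u w x $ m"
  by (rule fd_linear_compose) (auto intro: linearI)

text \<open>The model lives on \<open>real \<times> real^2\<close>, the charts and the inverse
  function theorem on \<open>real^3\<close>.\<close>

definition cl :: "real \<times> (real^2) \<Rightarrow> real^3" where "cl p = vector [fst p, snd p $ 1, snd p $ 2]"
definition cl_inv :: "real^3 \<Rightarrow> real \<times> (real^2)" where "cl_inv z = (z $ 1, vector [z $ 2, z $ 3])"

lemma cl_simps [simp]: "cl p $ 1 = fst p" "cl p $ 2 = snd p $ 1" "cl p $ 3 = snd p $ 2" "cl_inv (cl p) = p" "cl (cl_inv z) = z"
  by (simp_all add: cl_def cl_inv_def vector_3 vector_2 prod_eq_iff vec_eq_iff forall_2 forall_3)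

lemma linear_cl: "linear cl" and linear_cl_inv: "linear cl_inv"
  by (auto intro!: linearI simp: cl_def cl_inv_def vec_eq_iff forall_2 forall_3 vector_2 vector_3 prod_eq_iff)

lemma fd_linear_pair:
  "fd (\<lambda>n. cl (t, n)) n x = cl (0, x)" "(\<lambda>n. cl (t, n)) differentiable (at n)"
  "fd (\<lambda>t. cl (t, n)) t s = cl (s, 0)" "(\<lambda>t. cl (t, n)) differentiable (at t)"
proof -
  have 1: "((\<lambda>n. (t, n)) has_derivative (\<lambda>x. (0, x))) (at n)" by (auto intro!: derivative_eq_intros)
  have 2: "((\<lambda>t. (t, n)) has_derivative (\<lambda>x. (x, 0))) (at t)" by (auto intro!: derivative_eq_intros)
  have "((\<lambda>n. cl (t, n)) has_derivative (\<lambda>x. cl (0, x))) (at n)" "((\<lambda>t. cl (t, n)) has_derivative (\<lambda>s. cl (s, 0))) (at t)"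
    using has_derivative_compose[OF 1 linear_imp_has_derivative[OF linear_cl]]
      has_derivative_compose[OF 2 linear_imp_has_derivative[OF linear_cl]] by auto
  then show "fd (\<lambda>n. cl (t, n)) n x = cl (0, x)" "(\<lambda>n. cl (t, n)) differentiable (at n)"
    "fd (\<lambda>t. cl (t, n)) t s = cl (s, 0)" "(\<lambda>t. cl (t, n)) differentiable (at t)"
    by (auto simp: fd_eq differentiable_def)
qed

context warped_chart
begin

text \<open>The height and two projective coordinates of \<open>Y\<close>. Homotheties leave the
  ratios alone, so the axis becomes the first coordinate direction.\<close>

definition Phi :: "3 \<Rightarrow> 3 \<Rightarrow> 3 \<Rightarrow> real^3 \<Rightarrow> real^3" where
  "Phi i j k w = (\<chi> m. if m = 1 then tt w else if m = 2 then Y w $ i / Y w $ k else Y w $ j / Y w $ k)"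

definition dom_Y :: "3 \<Rightarrow> (real^3) set" where "dom_Y k = {w \<in> V. Y w $ k \<noteq> 0}"

lemma Phi_nth: "Phi i j k w $ 1 = tt w" "Phi i j k w $ 2 = Y w $ i / Y w $ k" "Phi i j k w $ 3 = Y w $ j / Y w $ k"
  by (simp_all add: Phi_def)

lemma open_dom: "open (dom_Y k)"
  using continuous_open_preimage[OF smooth_on_continuous[OF smooth_on_vec_nth[OF smooth_Y]] open_V, of "- {0}" k]
  by (simp add: dom_Y_def vimage_def Int_def open_Compl)

lemma dom_V: "w \<in> dom_Y k \<Longrightarrow> w \<in> V" "w \<in> dom_Y k \<Longrightarrow> Y w $ k \<noteq> 0"
  by (auto simp: dom_Y_def)

lemma smooth_Phi: "smooth_on (dom_Y k) (Phi i j k)"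
proof -
  have s: "smooth_on (dom_Y k) tt" "smooth_on (dom_Y k) (\<lambda>w. Y w $ m)" for m
    using smooth_on_subset[OF _ open_dom] smooth_tt smooth_on_vec_nth[OF smooth_Y] dom_V(1) by blast+
  show ?thesis unfolding Phi_def
  proof (rule smooth_on_vec_lambda[OF open_dom])
    have d: "smooth_on (dom_Y k) (\<lambda>w. Y w $ m / Y w $ k)" for m
      by (intro smooth_on_divide s) (rule dom_V)
    show "smooth_on (dom_Y k) (\<lambda>w. if m = 1 then tt w else if m = 2 then Y w $ i / Y w $ k else Y w $ j / Y w $ k)" for m :: 3
      using s(1) d by (cases "m = 1"; cases "m = 2") auto
  qed
qed

lemma dPhi:
  assumes w: "w \<in> dom_Y k"
  shows "fd (Phi i j k) w x $ 1 = th w x * rr w"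
    "fd (Phi i j k) w x $ 2 = (fd Y w x $ i * Y w $ k - Y w $ i * fd Y w x $ k) / (Y w $ k * Y w $ k)"
    "fd (Phi i j k) w x $ 3 = (fd Y w x $ j * Y w $ k - Y w $ j * fd Y w x $ k) / (Y w $ k * Y w $ k)"
proof -
  note v = dom_V[OF w]
  have d: "Phi i j k differentiable (at w)" by (rule smooth_on_differentiable[OF smooth_Phi w])
  have dY: "Y differentiable (at w)" by (rule smooth_on_differentiable[OF smooth_Y v(1)])
  then have dYm: "(\<lambda>q. Y q $ m) differentiable (at w)" for m
    using smooth_on_differentiable[OF smooth_on_vec_nth[OF smooth_Y] v(1)] by blast
  show "fd (Phi i j k) w x $ 1 = th w x * rr w"
    using fd_vec_nth[OF d, of 1 x] dtt[OF v(1), of x] by (simp add: Phi_nth)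
  show "fd (Phi i j k) w x $ 2 = (fd Y w x $ i * Y w $ k - Y w $ i * fd Y w x $ k) / (Y w $ k * Y w $ k)"
    "fd (Phi i j k) w x $ 3 = (fd Y w x $ j * Y w $ k - Y w $ j * fd Y w x $ k) / (Y w $ k * Y w $ k)"
    using fd_vec_nth[OF d, of 2 x] fd_vec_nth[OF d, of 3 x]
    by (simp_all add: Phi_nth fd_divide[OF dYm dYm v(2)] fd_vec_nth[OF dY])
qed

lemma distinct3: "i \<noteq> j \<Longrightarrow> j \<noteq> k \<Longrightarrow> i \<noteq> k \<Longrightarrow> m = i \<or> m = j \<or> m = (k :: 3)"
  using exhaust_3[of i] exhaust_3[of j] exhaust_3[of k] exhaust_3[of m] by auto

text \<open>A kernel vector is tangent to the leaf and moves \<open>Y\<close> radially; but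
  \<open>Y\<close> is a nonzero multiple of the image of \<open>zeta\<close>, which is transversal
  to the leaf.\<close>

lemma dPhi_inj:
  assumes ijk: "i \<noteq> j" "j \<noteq> k" "i \<noteq> k" and w: "w \<in> dom_Y k" and z: "fd (Phi i j k) w x = 0"
  shows "x = 0"
proof -
  note v = dom_V[OF w]
  have th0: "th w x = 0" using dPhi(1)[OF w, of i j x] z rr_nz[OF v(1)] by simp
  have "fd Y w x $ m * Y w $ k = Y w $ m * fd Y w x $ k" for m
    using dPhi(2,3)[OF w, of i j x] z v(2) distinct3[OF ijk, of m] by auto
  then have "Y w $ k *\<^sub>R Lam (fd f w x) = fd Y w x $ k *\<^sub>R Y w"
    unfolding dY[OF v(1), symmetric] by (simp add: vec_eq_iff mult.commute)
  then have "Lam (Y w $ k *\<^sub>R fd f w x + (fd Y w x $ k / nu w) *\<^sub>R zeta w) = 0"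
    using nu_nz[OF v(1)] by (simp add: Lam_simps Y_zeta[OF v(1)])
  from leaf_independent(1)[OF v(1) this th0] show "x = 0" using v(2) by simp
qed

lemma dPhi_e1: "w \<in> dom_Y k \<Longrightarrow> fd (Phi i j k) w (e 1 w) = rr w *\<^sub>R axis 1 1"
proof -
  assume w: "w \<in> dom_Y k"
  note v = dom_V[OF w]
  have "fd Y w (e 1 w) = be w *\<^sub>R Y w" using dY[OF v(1)] Lam_E1[OF v(1)] by (simp add: E_def)
  then have "fd Y w (e 1 w) $ m = be w * Y w $ m" for m by simp
  then show ?thesis using dPhi[OF w, of i j "e 1 w"] v by (simp add: vec_eq_iff forall_3 axis_def)
qed

lemma Y_nonzero: "w \<in> V \<Longrightarrow> Y w \<noteq> 0"
proof
  assume w: "w \<in> V" and "Y w = 0"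
  then have "Lam (0 *\<^sub>R fd f w 0 + 1 *\<^sub>R zeta w) = 0" by (simp add: Y_zeta)
  moreover have "th w 0 = 0" using spd_simps(10)[OF spd_h[OF w]] by (simp add: th_def)
  ultimately show False using leaf_independent(2)[OF w] by fastforce
qed

end

locale warped_coords = warped_chart +
  fixes i j k :: 3 and g :: "real^3 \<Rightarrow> real^3" and U0 D :: "(real^3) set" and I :: "real set" and N :: "(real^2) set"
    and t0 :: real and n0 :: "real^2"
  assumes ijk: "i \<noteq> j" "j \<noteq> k" "i \<noteq> k"
    and U0: "open U0" "U0 \<subseteq> dom_Y k" and D: "open D" and hom: "homeomorphism U0 D (Phi i j k) g" and smooth_g: "smooth_on D g"
    and box: "cl ` (I \<times> N) \<subseteq> D" and I: "open I" "convex I" "t0 \<in> I" and N: "open N" "convex N" "n0 \<in> N"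
begin

abbreviation "\<Phi> \<equiv> Phi i j k"

lemma g_D: "z \<in> D \<Longrightarrow> g z \<in> U0" "z \<in> D \<Longrightarrow> g z \<in> dom_Y k" "z \<in> D \<Longrightarrow> g z \<in> V" "z \<in> D \<Longrightarrow> \<Phi> (g z) = z"
  and Phi_U0: "w \<in> U0 \<Longrightarrow> \<Phi> w \<in> D" "w \<in> U0 \<Longrightarrow> g (\<Phi> w) = w"
  using hom U0 dom_V(1) unfolding homeomorphism_def by auto

lemma fd_Phi_g:
  assumes z: "z \<in> D"
  shows "fd \<Phi> (g z) (fd g z x) = x" "fd g z (fd \<Phi> (g z) y) = y"
proof -
  have d: "g differentiable (at z)" "\<Phi> differentiable (at (g z))"
    using smooth_on_differentiable[OF smooth_g z] smooth_on_differentiable[OF smooth_Phi g_D(2)[OF z]] by auto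
  have "fd (\<lambda>z. \<Phi> (g z)) z x = fd (\<lambda>z. z) z x" for x
    using g_D(4) by (subst fd_cong(1)[OF D z, of "\<lambda>z. z" "\<lambda>z. \<Phi> (g z)"]) auto
  then show 1: "fd \<Phi> (g z) (fd g z x) = x" for x using fd_compose[OF d] by simp
  have l: "linear (fd \<Phi> (g z))" by (rule smooth_on_linear_fd[OF smooth_Phi g_D(2)[OF z]])
  have "fd \<Phi> (g z) (fd g z (fd \<Phi> (g z) y) - y) = 0" by (simp add: linear_diff[OF l] 1)
  then show "fd g z (fd \<Phi> (g z) y) = y" using dPhi_inj[OF ijk g_D(2)[OF z]] by fastforce
qed

lemma th_g: "z \<in> D \<Longrightarrow> x $ 1 = 0 \<Longrightarrow> th (g z) (fd g z x) = 0"
  using dPhi(1)[OF g_D(2), of z i j "fd g z x"] fd_Phi_g(1)[of z x] rr_nz[OF g_D(3)] by auto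

lemma linear_dg: "z \<in> D \<Longrightarrow> linear (fd g z)" by (rule smooth_on_linear_fd[OF smooth_g])

lemma fd_g_axis: "z \<in> D \<Longrightarrow> fd g z (axis 1 1) = (1 / rr (g z)) *\<^sub>R e 1 (g z)"
proof -
  assume z: "z \<in> D"
  have "e 1 (g z) = fd g z (rr (g z) *\<^sub>R axis 1 1)"
    using fd_Phi_g(2)[OF z, of "e 1 (g z)"] dPhi_e1[OF g_D(2)[OF z]] by simp
  also have "\<dots> = rr (g z) *\<^sub>R fd g z (axis 1 1)" by (rule linear_scale[OF linear_dg[OF z]])
  finally show ?thesis using rr_nz[OF g_D(3)[OF z]] by simp
qed

text \<open>\<open>Gz\<close> measures the scale of the leaves, and \<rho> is its logarithmic
  derivative in \<open>t\<close>, as \<open>dGz\<close> shows.\<close>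

definition Gz :: "real^3 \<Rightarrow> real" where "Gz z = Y (g z) $ k"
definition \<rho> :: "real^3 \<Rightarrow> real" where "\<rho> w = be w / rr w"

lemma Gz_nz: "z \<in> D \<Longrightarrow> Gz z \<noteq> 0" using dom_V(2)[OF g_D(2)] by (simp add: Gz_def)

lemma Y_g: "z \<in> D \<Longrightarrow> Y (g z) $ k = Gz z" "z \<in> D \<Longrightarrow> Y (g z) $ i = z $ 2 * Gz z" "z \<in> D \<Longrightarrow> Y (g z) $ j = z $ 3 * Gz z"
proof -
  assume z: "z \<in> D"
  show "Y (g z) $ k = Gz z" by (simp add: Gz_def)
  show "Y (g z) $ i = z $ 2 * Gz z" "Y (g z) $ j = z $ 3 * Gz z"
    using arg_cong[OF g_D(4)[OF z], of "\<lambda>v. v $ 2"] arg_cong[OF g_D(4)[OF z], of "\<lambda>v. v $ 3"] Gz_nz[OF z]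
    unfolding Phi_nth Gz_def by (simp_all add: field_simps)
qed

text \<open>With both ratios fixed, \<open>Y\<close> is determined by its \<open>k\<close>-th
  coordinate.\<close>

lemma Y_proportional:
  assumes z: "z \<in> D" "z' \<in> D" "z $ 2 = z' $ 2" "z $ 3 = z' $ 3"
  shows "Y (g z) = (Gz z / Gz z') *\<^sub>R Y (g z')"
proof (rule vec_eq_iff[THEN iffD2, rule_format])
  fix m
  show "Y (g z) $ m = ((Gz z / Gz z') *\<^sub>R Y (g z')) $ m"
    using distinct3[OF ijk, of m] Y_g[OF z(1)] Y_g[OF z(2)] Gz_nz[OF z(2)] z(3,4) by auto
qed

lemma dGz:
  assumes z: "z \<in> D"
  shows "Gz differentiable (at z)" "fd Gz z (axis 1 1) = \<rho> (g z) * Gz z"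
proof -
  have d: "g differentiable (at z)" "(\<lambda>w. Y w $ k) differentiable (at (g z))" "Y differentiable (at (g z))"
    using smooth_on_differentiable[OF smooth_g z] smooth_on_differentiable[OF smooth_on_vec_nth[OF smooth_Y] g_D(3)[OF z]]
      smooth_on_differentiable[OF smooth_Y g_D(3)[OF z]] by auto
  show "Gz differentiable (at z)" unfolding Gz_def[abs_def]
    using differentiable_chain_at[OF d(1,2)] by (simp add: o_def)
  have lY: "linear (fd Y (g z))" by (rule smooth_on_linear_fd[OF smooth_Y g_D(3)[OF z]])
  have "fd Gz z (axis 1 1) = fd Y (g z) ((1 / rr (g z)) *\<^sub>R e 1 (g z)) $ k"
    unfolding Gz_def[abs_def] fd_compose[OF d(1,2)] fd_vec_nth[OF d(3)] fd_g_axis[OF z] ..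
  also have "fd Y (g z) ((1 / rr (g z)) *\<^sub>R e 1 (g z)) = (1 / rr (g z)) *\<^sub>R (be (g z) *\<^sub>R Y (g z))"
    unfolding linear_scale[OF lY] using dY[OF g_D(3)[OF z]] Lam_E1[OF g_D(3)[OF z]] by (simp add: E_def)
  finally show "fd Gz z (axis 1 1) = \<rho> (g z) * Gz z" by (simp add: \<rho>_def Gz_def[abs_def])
qed

lemma smooth_rho: "smooth_on V \<rho>"
  unfolding \<rho>_def by (intro smooth_on_divide smooth_invariants smooth_rr rr_nz)

text \<open>Both \<open>be\<close> and \<open>rr\<close> are constant on leaves: there the
  derivative of \<open>E 1\<close> is \<open>be\<close> times a leaf vector, which
  \<open>\<omega>0\<close> kills.\<close>

lemma drho: "w \<in> V \<Longrightarrow> th w x = 0 \<Longrightarrow> fd \<rho> w x = 0"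
proof -
  assume w: "w \<in> V" and x: "th w x = 0"
  have drr: "rr differentiable (at w)" by (rule smooth_on_differentiable[OF smooth_rr w])
  have l: "linear (\<lambda>v. \<omega>0 \<bullet> v / (\<omega>0 \<bullet> W0))" by (rule linearI) (simp_all add: inner_add_right add_divide_distrib)
  have "fd rr w x = \<omega>0 \<bullet> fd (E 1) w x / (\<omega>0 \<bullet> W0)"
    unfolding rr_def[abs_def] by (rule fd_linear_compose[OF l invariants_differentiable(7)[OF w]])
  also have "\<dots> = 0" unfolding dE1[OF w] x by (simp add: om0_df[OF w x])
  finally show ?thesis
    unfolding \<rho>_def[abs_def] by (simp add: fd_divide[OF invariants_differentiable(4)[OF w] drr rr_nz[OF w]] invariant_derivatives[OF w] x)
qed

lemma clD: "t \<in> I \<Longrightarrow> n \<in> N \<Longrightarrow> cl (t, n) \<in> D" using box by auto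

lemma gamma_derivative:
  assumes t: "t \<in> I" and n: "n \<in> N"
  shows "(\<lambda>n. g (cl (t, n))) differentiable (at n)" "fd (\<lambda>n. g (cl (t, n))) n x = fd g (cl (t, n)) (cl (0, x))"
proof -
  have d: "g differentiable (at (cl (t, n)))" by (rule smooth_on_differentiable[OF smooth_g clD[OF t n]])
  show "(\<lambda>n. g (cl (t, n))) differentiable (at n)" using differentiable_chain_at[OF fd_linear_pair(2) d] by (simp add: o_def)
  show "fd (\<lambda>n. g (cl (t, n))) n x = fd g (cl (t, n)) (cl (0, x))"
    using fd_compose[OF fd_linear_pair(2) d] by (simp add: fd_linear_pair)
qed

lemma rho_leaf:
  assumes t: "t \<in> I" and n: "n \<in> N" "n' \<in> N"
  shows "\<rho> (g (cl (t, n))) = \<rho> (g (cl (t, n')))"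
proof (rule has_derivative_zero_unique[OF N(2) _ n, of "\<lambda>n. \<rho> (g (cl (t, n)))"])
  fix n assume n: "n \<in> N"
  note z = clD[OF t n]
  have d: "\<rho> differentiable (at (g (cl (t, n))))" by (rule smooth_on_differentiable[OF smooth_rho g_D(3)[OF z]])
  have 0: "fd (\<lambda>n. \<rho> (g (cl (t, n)))) n = (\<lambda>x. 0)"
    using fd_compose[OF gamma_derivative(1)[OF t n] d] drho[OF g_D(3)[OF z] th_g[OF z]] gamma_derivative(2)[OF t n] by auto
  have "(\<lambda>n. \<rho> (g (cl (t, n)))) differentiable (at n)"
    using differentiable_chain_at[OF gamma_derivative(1)[OF t n] d] by (simp add: o_def)
  from fd_has[OF this, unfolded 0]
  show "((\<lambda>n. \<rho> (g (cl (t, n)))) has_derivative (\<lambda>x. 0)) (at n within N)" by (rule has_derivative_at_withinI)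
qed

text \<open>As \<open>\<partial>\<^sub>t log G\<close> depends on \<open>t\<close> only, \<open>G\<close> is a product.\<close>

lemma Gz_product:
  assumes t: "t \<in> I" and n: "n \<in> N"
  shows "Gz (cl (t, n)) = Gz (cl (t, n0)) * (Gz (cl (t0, n)) / Gz (cl (t0, n0)))"
proof -
  have dG: "(\<lambda>t. Gz (cl (t, n))) differentiable (at t)" "fd (\<lambda>t. Gz (cl (t, n))) t s = s * (\<rho> (g (cl (t, n0))) * Gz (cl (t, n)))"
    if t: "t \<in> I" and n: "n \<in> N" for t n s
  proof -
    note z = clD[OF t n]
    show "(\<lambda>t. Gz (cl (t, n))) differentiable (at t)" using differentiable_chain_at[OF fd_linear_pair(4) dGz(1)[OF z]] by (simp add: o_def)
    have "cl (s, 0 :: real^2) = s *\<^sub>R axis 1 1" by (simp add: vec_eq_iff forall_3 axis_def)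
    then have "fd (\<lambda>t. Gz (cl (t, n))) t s = s * fd Gz (cl (t, n)) (axis 1 1)"
      using fd_compose[OF fd_linear_pair(4) dGz(1)[OF z]] linear_scale[OF linear_frechet_derivative[OF dGz(1)[OF z]]]
      by (simp add: fd_linear_pair)
    then show "fd (\<lambda>t. Gz (cl (t, n))) t s = s * (\<rho> (g (cl (t, n0))) * Gz (cl (t, n)))"
      unfolding dGz(2)[OF z] using rho_leaf[OF t n N(3)] by simp
  qed
  have "Gz (cl (t, n)) / Gz (cl (t, n0)) = Gz (cl (t0, n)) / Gz (cl (t0, n0))"
  proof (rule has_derivative_zero_unique[OF I(2) _ t I(3), of "\<lambda>t. Gz (cl (t, n)) / Gz (cl (t, n0))"])
    fix t assume t: "t \<in> I"
    note d = dG(1)[OF t n] dG(1)[OF t N(3)] Gz_nz[OF clD[OF t N(3)]]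
    have z: "fd (\<lambda>t. Gz (cl (t, n)) / Gz (cl (t, n0))) t = (\<lambda>s. 0)"
      using fd_divide[OF d] dG(2)[OF t n] dG(2)[OF t N(3)] by (auto simp: fun_eq_iff)
    have "(\<lambda>t. Gz (cl (t, n)) / Gz (cl (t, n0))) differentiable (at t)"
      using has_derivative_divide'[OF fd_has[OF d(1)] fd_has[OF d(2)] d(3)] by (auto simp: differentiable_def)
    from fd_has[OF this, unfolded z]
    show "((\<lambda>t. Gz (cl (t, n)) / Gz (cl (t, n0))) has_derivative (\<lambda>s. 0)) (at t within I)" by (rule has_derivative_at_withinI)
  qed
  then show ?thesis using Gz_nz[OF clD[OF t N(3)]] by (simp add: field_simps)
qed

text \<open>Extends the coordinate fields of the leaf \<open>t = t0\<close> to fields tangent to all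
  nearby leaves, as \<open>warped_leaf\<close> requires.\<close>

definition X :: "real^2 \<Rightarrow> real^3 \<Rightarrow> real^3" where "X y q = fd g (\<Phi> q) (cl (0, y))"

text \<open>The scale is \<open>Gz\<close> at the base point, so that \<open>\<gamma>2 t0\<close>
  times \<phi> gives back \<open>Y\<close> on the leaf \<open>t = t0\<close>.\<close>

sublocale leaf: warped_leaf V f \<xi> e \<omega>0 W0 c0 L N "\<lambda>n. g (cl (t0, n))" U0 X "Gz (cl (t0, n0))"
proof
  show "convex N" "N \<noteq> {}" using N by auto
  show "U0 \<subseteq> V" using U0(2) dom_V(1) by auto
  have lc: "linear (\<lambda>n. cl (0, n))" by (rule linearI) (simp_all add: vec_eq_iff forall_3)
  have "smooth_on N (\<lambda>n. cl (t0, 0) + cl (0, n))"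
    by (intro smooth_on_add smooth_on_const N smooth_on_linear lc)
  moreover have "cl (t0, 0) + cl (0, n) = cl (t0, n)" for n
    by (simp add: vec_eq_iff forall_3)
  ultimately have "smooth_on N (\<lambda>n. cl (t0, n))" by simp
  then show "smooth_on N (\<lambda>n. g (cl (t0, n)))"
    by (rule smooth_on_compose[OF _ smooth_g]) (use clD[OF I(3)] in auto)
  show "(\<lambda>n. g (cl (t0, n))) ` N \<subseteq> U0" using g_D(1) clD[OF I(3)] by auto
  show "Gz (cl (t0, n0)) \<noteq> 0" by (rule Gz_nz[OF clD[OF I(3) N(3)]])
  show "smooth_on U0 (X y)" for y
    unfolding X_def
    by (rule smooth_on_compose[OF smooth_on_subset[OF smooth_Phi U0] smooth_on_fd_const[OF smooth_g]]) (use Phi_U0 in auto)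
  show "th q (X y q) = 0" if "q \<in> U0" for y q
    using th_g[OF Phi_U0(1)[OF that], of "cl (0, y)"] Phi_U0(2)[OF that] by (simp add: X_def)
  fix n assume n: "n \<in> N"
  note z = clD[OF I(3) n] and dg = gamma_derivative(2)[OF I(3) n]
  show "th (g (cl (t0, n))) (fd (\<lambda>n. g (cl (t0, n))) n x) = 0" for x
    unfolding dg by (rule th_g[OF z]) simp
  show "inj (fd (\<lambda>n. g (cl (t0, n))) n)"
  proof (rule injI)
    fix x y assume "fd (\<lambda>n. g (cl (t0, n))) n x = fd (\<lambda>n. g (cl (t0, n))) n y"
    then have "cl (0, x) = cl (0, y)" unfolding dg using fd_Phi_g(1)[OF z] by metis
    from arg_cong[OF this, of cl_inv] show "x = y" by simp
  qed
  show "\<exists>x. v = fd (\<lambda>n. g (cl (t0, n))) n x" if "th (g (cl (t0, n))) v = 0" for v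
  proof -
    have "fd \<Phi> (g (cl (t0, n))) v $ 1 = 0" using dPhi(1)[OF g_D(2)[OF z]] that by simp
    then have "fd \<Phi> (g (cl (t0, n))) v = cl (0, snd (cl_inv (fd \<Phi> (g (cl (t0, n))) v)))"
      using cl_simps(5)[of "fd \<Phi> (g (cl (t0, n))) v"] by (metis cl_inv_def prod.collapse fst_conv)
    then have "v = fd (\<lambda>n. g (cl (t0, n))) n (snd (cl_inv (fd \<Phi> (g (cl (t0, n))) v)))"
      unfolding dg using fd_Phi_g(2)[OF z, of v] by metis
    then show ?thesis by blast
  qed
  show "X y (g (cl (t0, n))) = fd (\<lambda>n. g (cl (t0, n))) n y" for y
    unfolding dg X_def g_D(4)[OF z] ..
qed

definition \<gamma>2 :: "real \<Rightarrow> real" where "\<gamma>2 t = Gz (cl (t, n0))"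

lemma smooth_gamma2: "smooth_on I \<gamma>2"
proof -
  have lc: "linear (\<lambda>t. cl (t, 0))" by (rule linearI) (simp_all add: vec_eq_iff forall_3)
  have "smooth_on I (\<lambda>t. cl (t, 0) + cl (0, n0))"
    by (intro smooth_on_add smooth_on_const I smooth_on_linear lc)
  moreover have "cl (t, 0) + cl (0, n0) = cl (t, n0)" for t by (simp add: vec_eq_iff forall_3)
  ultimately have "smooth_on I (\<lambda>t. cl (t, n0))" by simp
  then have "smooth_on I (\<lambda>t. g (cl (t, n0)))"
    by (rule smooth_on_compose[OF _ smooth_g]) (use clD[OF _ N(3)] in auto)
  then have "smooth_on I (\<lambda>t. Y (g (cl (t, n0))))"
    by (rule smooth_on_compose[OF _ smooth_Y]) (use clD[OF _ N(3)] g_D(3) in auto)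
  then show ?thesis unfolding \<gamma>2_def Gz_def by (rule smooth_on_vec_nth)
qed

lemma f_product:
  assumes t: "t \<in> I" and n: "n \<in> N"
  shows "f (g (cl (t, n))) = L *v cons4 t (\<gamma>2 t *\<^sub>R leaf.\<phi> n) + c0"
proof -
  note z = clD[OF t n] and z0 = clD[OF I(3) n]
  have "tt (g (cl (t, n))) = t" using arg_cong[OF g_D(4)[OF z], of "\<lambda>v. v $ 1"] by (simp add: Phi_nth)
  moreover have "Y (g (cl (t, n))) = \<gamma>2 t *\<^sub>R leaf.\<phi> n"
    using Y_proportional[OF z z0] Gz_product[OF t n] Gz_nz[OF z0]
    by (simp add: leaf.\<phi>_def \<gamma>2_def)
  ultimately show ?thesis using f_expand[of "g (cl (t, n))"] by simp
qed

end

text \<open>\<open>Y\<close> never vanishes, so near each point some coordinate can serve as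
  denominator.\<close>

lemma (in warped_chart) coordinates_exist:
  assumes w: "w \<in> V"
  obtains i j k g U0 D I N t0 n0 where "warped_coords V f \<xi> e \<omega>0 W0 c0 L i j k g U0 D I N t0 n0" "w = g (cl (t0, n0))"
    "is_interval I" "connected N"
proof -
  have "\<exists>m. Y w $ m \<noteq> 0" using Y_nonzero[OF w] by (simp add: vec_eq_iff)
  then have "\<exists>i j k :: 3. i \<noteq> j \<and> j \<noteq> k \<and> i \<noteq> k \<and> Y w $ k \<noteq> 0"
  proof (elim exE)
    fix m assume m: "Y w $ m \<noteq> 0"
    from exhaust_3[of m] m show ?thesis
      by (elim disjE) ((rule exI[of _ 2], rule exI[of _ 3], rule exI[of _ 1], simp),
        (rule exI[of _ 1], rule exI[of _ 3], rule exI[of _ 2], simp),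
        (rule exI[of _ 1], rule exI[of _ 2], rule exI[of _ 3], simp))
  qed
  then obtain i j k :: 3 where ijk: "i \<noteq> j" "j \<noteq> k" "i \<noteq> k" "Y w $ k \<noteq> 0" by blast
  have wd: "w \<in> dom_Y k" using w ijk by (simp add: dom_Y_def)
  have "inj (fd (Phi i j k) w)"
    using linear_injective_0[OF smooth_on_linear_fd[OF smooth_Phi wd]] dPhi_inj[OF ijk(1-3) wd] by blast
  from smooth_inverse_function[OF smooth_Phi wd this]
  obtain U0 D g where g: "open U0" "U0 \<subseteq> dom_Y k" "w \<in> U0" "open D" "homeomorphism U0 D (Phi i j k) g" "smooth_on D g"
    by metis
  have wD: "Phi i j k w \<in> D" and gw: "g (Phi i j k w) = w" using g(3,5) by (auto simp: homeomorphism_def)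
  define p0 where "p0 = cl_inv (Phi i j k w)"
  have cp: "cl p0 = Phi i j k w" by (simp add: p0_def)
  have "continuous_on UNIV cl" using linear_cl linear_continuous_on by (simp add: linear_conv_bounded_linear)
  then have "open (cl -` D)" using open_vimage[OF g(4)] by blast
  then obtain A B where AB: "open A" "open B" "p0 \<in> A \<times> B" "A \<times> B \<subseteq> cl -` D"
    by (rule open_prod_elim[of _ p0]) (use wD cp in auto)
  then obtain r s where rs: "r > 0" "ball (fst p0) r \<subseteq> A" "s > 0" "ball (snd p0) s \<subseteq> B"
    by (metis mem_Times_iff openE)
  have "warped_coords V f \<xi> e \<omega>0 W0 c0 L i j k g U0 D (ball (fst p0) r) (ball (snd p0) s) (fst p0) (snd p0)"
  proof unfold_locales
    have "ball (fst p0) r \<times> ball (snd p0) s \<subseteq> A \<times> B" using rs by (intro Sigma_mono) auto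
    then show "cl ` (ball (fst p0) r \<times> ball (snd p0) s) \<subseteq> D" using AB(4) by blast
  qed (use ijk g rs in auto)
  moreover have "w = g (cl (fst p0, snd p0))" by (simp add: cp gw)
  moreover have "is_interval (ball (fst p0) r)" by (simp add: is_interval_ball_real)
  moreover have "connected (ball (snd p0) s)" by (simp add: convex_connected)
  ultimately show ?thesis by (rule that)
qed

text \<open>The columns are \<open>W\<close>, \<open>E 2\<close>, \<open>E 3\<close>,
  \<open>zeta\<close>: the last three span the kernel of \<open>om\<close>, and \<open>W\<close>
  lies outside because \<open>nu\<close> is nonzero.\<close>

lemma (in adapted_hypersurface) splitting_matrix:
  assumes w: "w \<in> V" and n: "nu w \<noteq> 0"
  obtains M :: "real^4^4" where "invertible M" "M *v axis 1 1 = W w" "\<And>y. om w \<bullet> (M *v y) = y $ 1 * (om w \<bullet> W w)"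
proof -
  have ind: "indep4 (W w) (E 2 w) (E 3 w) (zeta w)"
    unfolding indep4_def
  proof (intro allI impI)
    fix x y z t assume 0: "x *\<^sub>R W w + y *\<^sub>R E 2 w + z *\<^sub>R E 3 w + t *\<^sub>R zeta w = 0"
    from arg_cong[OF 0, of "\<lambda>v. om w \<bullet> v"] have x: "x = 0"
      using n by (simp add: inner_add_right om_E[OF w] om_zeta[OF w] om_W[OF w])
    have "(- t * al w) *\<^sub>R E 1 w + y *\<^sub>R E 2 w + z *\<^sub>R E 3 w + t *\<^sub>R \<xi> w = 0"
      using 0 x by (simp add: zeta_def algebra_simps)
    then have "- t * al w = 0 \<and> y = 0 \<and> z = 0 \<and> t = 0" using E_indep4[OF w] unfolding indep4_def by blast
    then show "x = 0 \<and> y = 0 \<and> z = 0 \<and> t = 0" using x by simp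
  qed
  define M :: "real^4^4" where "M = (\<chi> i j. if j = 1 then W w $ i else if j = 2 then E 2 w $ i else if j = 3 then E 3 w $ i else zeta w $ i)"
  have Mv: "M *v u = (u $ 1) *\<^sub>R W w + (u $ 2) *\<^sub>R E 2 w + (u $ 3) *\<^sub>R E 3 w + (u $ 4) *\<^sub>R zeta w" for u
    unfolding M_def by (rule independent_columns_solution(2)[OF ind])
  have "invertible M" unfolding invertible_det_nz M_def by (rule independent_columns_solution(1)[OF ind])
  moreover have "M *v axis 1 1 = W w" by (simp add: Mv axis_def)
  moreover have "om w \<bullet> (M *v y) = y $ 1 * (om w \<bullet> W w)" for y
    by (simp add: Mv inner_add_right om_E[OF w] om_zeta[OF w])
  ultimately show ?thesis by (rule that)
qed

section \<open>Assembly of the local models on the manifold\<close>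

context symmetric_manifold
begin

text \<open>The inverse of \<open>\<Psi>\<close> is \<open>cl_inv \<circ> \<Phi> \<circ> x\<close>.
  Read in another chart, both maps are composed of smooth maps and a transition map of the
  atlas.\<close>

lemma local_diffeomorphism:
  assumes Ux: "(U, x) \<in> \<A>" and VU: "V \<subseteq> x ` U"
    and wc: "warped_coords V (Fx U x) (Xx U x) e \<omega>0 W0 c0 L i j k g U0 D I N t0 n0"
  defines "\<Psi> \<equiv> \<lambda>p. inv_into U x (g (cl p))"
  shows "diffeomorphism_onto \<A> (I \<times> N) \<Psi> (\<Psi> ` (I \<times> N))"
proof -
  interpret wc: warped_coords V "Fx U x" "Xx U x" e \<omega>0 W0 c0 L i j k g U0 D I N t0 n0 by (rule wc)
  note ch = chartD[OF Ux]
  let ?W = "I \<times> N"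
  have oW: "open ?W" using wc.I wc.N by (simp add: open_Times)
  have gU: "g (cl p) \<in> x ` U" if "p \<in> ?W" for p
    using wc.clD[of "fst p" "snd p"] that wc.g_D(3) VU by auto
  have xPsi: "x (\<Psi> p) = g (cl p)" and PsiU: "\<Psi> p \<in> U" if "p \<in> ?W" for p
    using gU[OF that] by (auto simp: \<Psi>_def f_inv_into_f inv_into_into)
  have clinvPhi: "cl_inv (wc.\<Phi> (x (\<Psi> p))) = p" if "p \<in> ?W" for p
    using xPsi[OF that] wc.g_D(4)[OF wc.clD[of "fst p" "snd p"]] that by auto
  \<comment> \<open>The image of the box in the chart, written as a preimage so that it is visibly
    open.\<close>
  define B where "B = {w \<in> U0. cl_inv (wc.\<Phi> w) \<in> ?W}"
  have oB: "open B"
  proof -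
    have "smooth_on U0 (\<lambda>w. cl_inv (wc.\<Phi> w))"
      by (rule smooth_on_linear_compose[OF smooth_on_subset[OF wc.smooth_Phi wc.U0] linear_cl_inv])
    from continuous_open_preimage[OF smooth_on_continuous[OF this] wc.U0(1) oW] show ?thesis
      by (simp add: B_def vimage_def Int_def)
  qed
  have B_eq: "g (cl p) \<in> B" if "p \<in> ?W" for p
  proof -
    have "cl p \<in> D" using wc.clD[of "fst p" "snd p"] that by auto
    then show ?thesis using wc.g_D(1,4) that by (simp add: B_def)
  qed
  have B_img: "w = g (cl (cl_inv (wc.\<Phi> w)))" if "w \<in> B" for w
    using that wc.Phi_U0(2) by (simp add: B_def)
  have BU: "B \<subseteq> x ` U" unfolding B_def using wc.U0(2) wc.dom_V(1) VU by blast
  have img: "\<Psi> ` ?W = U \<inter> x -` B"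
  proof
    show "\<Psi> ` ?W \<subseteq> U \<inter> x -` B" using PsiU xPsi B_eq by auto
    show "U \<inter> x -` B \<subseteq> \<Psi> ` ?W"
    proof
      fix m assume m: "m \<in> U \<inter> x -` B"
      then have xm: "g (cl (cl_inv (wc.\<Phi> (x m)))) = x m" and W: "cl_inv (wc.\<Phi> (x m)) \<in> ?W"
        using B_img[of "x m"] by (auto simp: B_def)
      have "m = \<Psi> (cl_inv (wc.\<Phi> (x m)))" unfolding \<Psi>_def xm using m ch(4) by simp
      then show "m \<in> \<Psi> ` ?W" using W by (rule image_eqI)
    qed
  qed
  have oU: "open (\<Psi> ` ?W)"
    unfolding img using continuous_open_preimage[OF _ ch(1) oB] ch(3) by (auto simp: homeomorphism_def)
  have bij: "bij_betw \<Psi> ?W (\<Psi> ` ?W)"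
    by (intro inj_on_imp_bij_betw inj_on_inverseI[of _ "\<lambda>m. cl_inv (wc.\<Phi> (x m))"] clinvPhi)
  have inv: "inv_into ?W \<Psi> m = cl_inv (wc.\<Phi> (x m))" if m: "m \<in> \<Psi> ` ?W" for m
  proof -
    from m obtain p where p: "m = \<Psi> p" "p \<in> ?W" by (rule imageE)
    show ?thesis
      unfolding p(1) inv_into_f_f[OF bij_betw_imp_inj_on[OF bij] p(2)] clinvPhi[OF p(2)] by (rule refl)
  qed
  have "smooth_on (?W \<inter> \<Psi> -` V') (x' \<circ> \<Psi>)" "smooth_on (x' ` (\<Psi> ` ?W \<inter> V')) (inv_into ?W \<Psi> \<circ> inv_into V' x')"
    if V': "(V', x') \<in> \<A>" for V' x'
  proof -
    note ch' = chartD[OF V']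
    have tr: "smooth_on (x ` (U \<inter> V')) (x' \<circ> inv_into U x)" "smooth_on (x' ` (V' \<inter> U)) (x \<circ> inv_into V' x')"
      using atlas Ux V' unfolding smooth_atlas_def by blast+
    have sg: "smooth_on ?W (\<lambda>p. g (cl p))"
      by (rule smooth_on_compose[OF smooth_on_linear[OF oW linear_cl] wc.smooth_g]) (use wc.box in auto)
    have eq: "?W \<inter> \<Psi> -` V' = ?W \<inter> (\<lambda>p. g (cl p)) -` (x ` (U \<inter> V'))"
    proof -
      have "\<Psi> p \<in> V' \<longleftrightarrow> g (cl p) \<in> x ` (U \<inter> V')" if p: "p \<in> ?W" for p
      proof
        assume "\<Psi> p \<in> V'"
        then show "g (cl p) \<in> x ` (U \<inter> V')" using PsiU[OF p] xPsi[OF p] by (metis IntI image_eqI)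
      next
        assume "g (cl p) \<in> x ` (U \<inter> V')"
        then show "\<Psi> p \<in> V'" using ch(4) by (auto simp: \<Psi>_def)
      qed
      then show ?thesis by auto
    qed
    have oe: "open (?W \<inter> \<Psi> -` V')"
      unfolding eq by (rule continuous_open_preimage[OF smooth_on_continuous[OF sg] oW smooth_on_open[OF tr(1)]])
    have "smooth_on (?W \<inter> \<Psi> -` V') (\<lambda>p. (x' \<circ> inv_into U x) (g (cl p)))"
      by (rule smooth_on_compose[OF smooth_on_subset[OF sg oe] tr(1)]) (auto simp: eq)
    then show "smooth_on (?W \<inter> \<Psi> -` V') (x' \<circ> \<Psi>)" by (simp add: \<Psi>_def o_def)
    let ?T = "x' ` (\<Psi> ` ?W \<inter> V')"
    have T_eq: "?T = x' ` (V' \<inter> U) \<inter> (x \<circ> inv_into V' x') -` B"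
    proof -
      have iff: "x' m \<in> ?T \<longleftrightarrow> (x \<circ> inv_into V' x') (x' m) \<in> B" if m: "m \<in> V' \<inter> U" for m
      proof -
        have "x' m \<in> ?T \<longleftrightarrow> m \<in> \<Psi> ` ?W"
        proof
          assume "x' m \<in> ?T"
          then obtain m' where "x' m = x' m'" "m' \<in> \<Psi> ` ?W" "m' \<in> V'" by blast
          then show "m \<in> \<Psi> ` ?W" using ch'(4) m by (metis IntD1 inj_onD)
        qed (use m in auto)
        then show ?thesis using m ch'(4) by (simp add: img)
      qed
      have sub: "?T \<subseteq> x' ` (V' \<inter> U)" unfolding img by auto
      show ?thesis
      proof (rule set_eqI)
        fix w
        show "w \<in> ?T \<longleftrightarrow> w \<in> x' ` (V' \<inter> U) \<inter> (x \<circ> inv_into V' x') -` B"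
        proof (cases "w \<in> x' ` (V' \<inter> U)")
          case True
          then obtain m where m: "w = x' m" "m \<in> V' \<inter> U" by (rule imageE)
          show ?thesis using True unfolding m(1) iff[OF m(2)] by (simp only: Int_iff vimage_eq simp_thms)
        qed (use sub in blast)
      qed
    qed
    have oT: "open ?T" unfolding T_eq
      by (rule continuous_open_preimage[OF smooth_on_continuous[OF tr(2)] smooth_on_open[OF tr(2)] oB])
    have TU: "?T \<subseteq> x' ` (V' \<inter> U)" unfolding T_eq by auto
    have "smooth_on ?T (\<lambda>w. wc.\<Phi> ((x \<circ> inv_into V' x') w))"
      by (rule smooth_on_compose[OF smooth_on_subset[OF tr(2) oT TU] smooth_on_subset[OF wc.smooth_Phi wc.U0]])
        (auto simp: T_eq B_def)
    then have "smooth_on ?T (\<lambda>w. cl_inv (wc.\<Phi> ((x \<circ> inv_into V' x') w)))"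
      by (rule smooth_on_linear_compose[OF _ linear_cl_inv])
    moreover have "cl_inv (wc.\<Phi> ((x \<circ> inv_into V' x') w)) = (inv_into ?W \<Psi> \<circ> inv_into V' x') w" if w: "w \<in> ?T" for w
    proof -
      obtain m where m: "w = x' m" "m \<in> \<Psi> ` ?W" "m \<in> V'" using w by blast
      then have "inv_into V' x' w = m" using ch'(4) by simp
      then show ?thesis using inv[OF m(2)] by simp
    qed
    ultimately show "smooth_on ?T (inv_into ?W \<Psi> \<circ> inv_into V' x')" using smooth_on_cong by (metis (no_types, lifting))
  qed
  then show ?thesis unfolding diffeomorphism_onto_def using oW oU bij by auto
qed

lemma locally_warped_everywhere:
  assumes d0: "data_at p0 \<omega>0 W0 \<nu>0 c0" and n0: "\<nu>0 \<noteq> 0" and om_W: "\<omega>0 \<bullet> W0 = \<nu>0"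
    and M: "invertible M" "M *v axis 1 1 = W0" "\<And>y. \<omega>0 \<bullet> (M *v y) = y $ 1 * (\<omega>0 \<bullet> W0)"
  shows "\<nu>0 > 0 \<Longrightarrow> locally_warped \<A> F M c0 (\<lambda>N \<phi>. elliptic_affine_sphere N \<phi> \<and>
       (G = SO2 \<longrightarrow> (\<exists>Q. is_ellipsoid Q \<and> \<phi> ` N \<subseteq> Q))) p"
    and "\<nu>0 < 0 \<Longrightarrow> locally_warped \<A> F M c0 (\<lambda>N \<phi>. hyperbolic_affine_sphere N \<phi> \<and>
       (G = SO2 \<longrightarrow> (\<exists>Q. is_hyperboloid Q \<and> \<phi> ` N \<subseteq> Q))) p"
proof -
  obtain U x V e where fc: "frame_chart U x V e" "p \<in> U" "x p \<in> V" by (rule frame_chart_exists)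
  then have Ux: "(U, x) \<in> \<A>" and VU: "V \<subseteq> x ` U" and ad: "adapted_hypersurface V (Fx U x) (Xx U x) e"
    by (simp_all add: frame_chart_def)
  interpret A: adapted_hypersurface V "Fx U x" "Xx U x" e by (rule ad)
  interpret A: warped_chart V "Fx U x" "Xx U x" e \<omega>0 W0 c0 M
  proof
    fix w assume w: "w \<in> V"
    then obtain q where q: "q \<in> U" "x q = w" using VU by auto
    have "data_at q (A.om w) (A.W w) (A.nu w) (A.Cen w)"
      using frame_chart_data[OF fc(1) q(1)] w q(2) by simp
    from data_global[OF d0 n0 this]
    show "\<exists>k>0. A.om w = k *\<^sub>R \<omega>0" "\<exists>k>0. A.W w = k *\<^sub>R W0" "\<exists>t. A.Cen w = c0 + t *\<^sub>R W0" by blast+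
  qed (use n0 om_W M in auto)
  obtain i j k g U0 D I N t0 n0 where wc: "warped_coords V (Fx U x) (Xx U x) e \<omega>0 W0 c0 M i j k g U0 D I N t0 n0"
    and xp: "x p = g (cl (t0, n0))" and IN: "is_interval I" "connected N"
    by (rule A.coordinates_exist[OF fc(3)]) (rule that; assumption)
  interpret wc: warped_coords V "Fx U x" "Xx U x" e \<omega>0 W0 c0 M i j k g U0 D I N t0 n0 by (rule wc)
  define \<Psi> where "\<Psi> q = inv_into U x (g (cl q))" for q
  have diff: "diffeomorphism_onto \<A> (I \<times> N) \<Psi> (\<Psi> ` (I \<times> N))"
    using local_diffeomorphism[OF Ux VU wc] by (simp add: \<Psi>_def[abs_def])
  have "\<Psi> (t0, n0) = p" using chartD(4)[OF Ux] fc(2) by (simp add: \<Psi>_def xp[symmetric])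
  then have p: "p \<in> \<Psi> ` (I \<times> N)" using wc.I(3) wc.N(3) by (metis SigmaI image_eqI)
  have F: "F (\<Psi> (t, y)) = M *v vector [t, wc.\<gamma>2 t * wc.leaf.\<phi> y $ 1, wc.\<gamma>2 t * wc.leaf.\<phi> y $ 2, wc.\<gamma>2 t * wc.leaf.\<phi> y $ 3] + c0"
    if "t \<in> I" "y \<in> N" for t y
    using wc.f_product[OF that] by (simp add: \<Psi>_def cons4_def)
  have lw: "locally_warped \<A> F M c0 P p" if "P N wc.leaf.\<phi>" for P
    unfolding locally_warped_def
    \<comment> \<open>The height serves as curve parameter, so the first component of the curve is
      the identity.\<close>
    by (intro exI[of _ I] exI[of _ N] exI[of _ "\<Psi> ` (I \<times> N)"] exI[of _ \<Psi>] exI[of _ "\<lambda>t. t"] exI[of _ wc.\<gamma>2]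
        exI[of _ wc.leaf.\<phi>] conjI ballI p wc.I(1) IN wc.N(1) diff smooth_on_ident wc.smooth_gamma2 that F)
  have C0: "A.C 2 2 2 w = 0 \<and> A.C 2 2 3 w = 0" if "G = SO2" "w \<in> V" for w
    using fc(1) that unfolding frame_chart_def by blast
  show "\<nu>0 > 0 \<Longrightarrow> locally_warped \<A> F M c0 (\<lambda>N \<phi>. elliptic_affine_sphere N \<phi> \<and>
       (G = SO2 \<longrightarrow> (\<exists>Q. is_ellipsoid Q \<and> \<phi> ` N \<subseteq> Q))) p"
    by (rule lw) (use wc.leaf.affine_sphere(1) wc.leaf.quadric(1) C0 om_W in auto)
  show "\<nu>0 < 0 \<Longrightarrow> locally_warped \<A> F M c0 (\<lambda>N \<phi>. hyperbolic_affine_sphere N \<phi> \<and>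
       (G = SO2 \<longrightarrow> (\<exists>Q. is_hyperboloid Q \<and> \<phi> ` N \<subseteq> Q))) p"
    by (rule lw) (use wc.leaf.affine_sphere(2) wc.leaf.quadric(2) C0 om_W in auto)
qed

end

theorem theorem4p1:
  fixes \<A> :: "'m::{t2_space, second_countable_topology} chart set"
    and F \<xi> :: "'m \<Rightarrow> real^4"
    and G :: symmetry_type
  assumes "connected (UNIV :: 'm set)"
    and "smooth_atlas \<A>"
    and "positive_definite_affine_hypersurface \<A> F \<xi>"
    and "pointwise_symmetry \<A> F \<xi> G"
    and "nu_not_identically_zero \<A> F \<xi> G"
  shows "\<exists>(L :: real^4^4) d. invertible L \<and>
    ((\<forall>p. locally_warped \<A> F L d
        (\<lambda>N \<phi>. elliptic_affine_sphere N \<phi> \<and>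
               (G = SO2 \<longrightarrow> (\<exists>Q. is_ellipsoid Q \<and> \<phi> ` N \<subseteq> Q))) p) \<or>
     (\<forall>p. locally_warped \<A> F L d
        (\<lambda>N \<phi>. hyperbolic_affine_sphere N \<phi> \<and>
               (G = SO2 \<longrightarrow> (\<exists>Q. is_hyperboloid Q \<and> \<phi> ` N \<subseteq> Q))) p))"
proof -
  interpret symmetric_manifold \<A> F \<xi> G using assms by unfold_locales
  obtain U x V e p0 where fc: "frame_chart U x V e" "p0 \<in> U" "x p0 \<in> V"
    and nz: "adapted_hypersurface.nu (Fx U x) (Xx U x) e (x p0) \<noteq> 0"
    by (rule nu_nonzero_frame[OF assms(5)])
  interpret A: adapted_hypersurface V "Fx U x" "Xx U x" e using fc by (simp add: frame_chart_def)
  note d0 = frame_chart_data[OF fc] and oW = A.om_W[OF fc(3)]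
  obtain M :: "real^4^4" where M: "invertible M" "M *v axis 1 1 = A.W (x p0)"
    "\<And>y. A.om (x p0) \<bullet> (M *v y) = y $ 1 * (A.om (x p0) \<bullet> A.W (x p0))"
    by (rule A.splitting_matrix[OF fc(3) nz]) (rule that; assumption)
  \<comment> \<open>The matrix, the translation and the sign of \<nu> all come from the single point
    \<open>p0\<close>, so one of the two alternatives holds for all \<open>p\<close> at
    once.\<close>
  show ?thesis
    using locally_warped_everywhere[OF d0 nz oW M] M(1) nz by (meson linorder_neqE_linordered_idom)
qed

end
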